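(* Let $\rho_0\in L^\infty(\mathbb{T}^d)$ have zero average, satisfy $\|\rho_0\|_{L^\infty(\mathbb{T}^d)}=1$, and depend only on one space variable. Let $T>0$. Suppose that $\rho\in L^\infty((0,T)\times\mathbb{T}^d)$ and $v\in L^\infty(0,T;L^2(\mathbb{T}^d;\mathbb{R}^d))$ with $$\|v\|_{L^\infty(0,T;L^2(\mathbb{T}^d;\mathbb{R}^d))}\leq\sqrt{E},\qquad \|\rho\|_{L^\infty((0,T)\times\mathbb{T}^d)}\leq 1$$ solve the system $$\partial_t\rho+\mathrm{div}(\rho v)=0,\quad \mathrm{div}\,v=0\quad\text{on }(0,T)\times\mathbb{T}^d,\qquad \rho(0,\cdot)=\rho_0$$ in the sense of distributions. Suppose further that $\|\rho(t,\cdot)\|_{H^{-1}(\mathbb{T}^d)}\to0$ as $t\to T$. Then $$T\ \geq\ E^{-\frac12}\,H_{max}\,\sqrt2\,S(\alpha(r_0)),$$ where $H_{max}:=L^{\frac{d+2}{2}}/\sqrt{48}$, $r_0:=\|\rho_0\|_{H^{-1}(\mathbb{T}^d)}/H_{max}\in[0,1]$, $S(\alpha):=\frac12\left(\arcsin(\alpha)+\alpha\sqrt{1-\alpha^2}\right)$ and $\alpha(r):=\left(1-\sqrt{1-r^2}\right)^{\frac12}$.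
   Context: Fix $d\geq2$, $L>0$, $E>0$. $\mathbb{T}^d=(\mathbb{R}/L\mathbb{Z})^d$ is the flat torus with side length $L$. For $f\in L^2(\mathbb{T}^d)$ with zero average, $\|f\|_{H^{-1}(\mathbb{T}^d)}:=\|\nabla\varphi\|_{L^2(\mathbb{T}^d)}$ where $\Delta\varphi=f$. Solving the system in the sense of distributions means: for all $\psi\in\mathcal{C}^\infty_c([0,T)\times\mathbb{T}^d)$, $$\int_0^T\int_{\mathbb{T}^d}\rho\,\partial_t\psi+\rho\, v\cdot\nabla\psi\,dx\,dt+\int_{\mathbb{T}^d}\rho_0\,\psi(0,\cdot)\,dx=0,$$ and $\int_0^T\int_{\mathbb{T}^d}v\cdot\nabla\psi\,dx\,dt=0$ for all $\psi\in\mathcal{C}^\infty([0,T]\times\mathbb{T}^d)$. Convention: $\rho$ is taken in its representative in $\mathcal{C}^0([0,T);L^2_w(\mathbb{T}^d))$ (continuous in time with values in $L^2$ with the weak topology), so that $\|\rho(t,\cdot)\|_{H^{-1}(\mathbb{T}^d)}$ is well-defined for every $t\in[0,T)$ and continuous in $t$. *)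

theory Defs
  imports "HOL-Analysis.Analysis" "HOL-Probability.Essential_Supremum"
begin

section \<open>The torus\<close>

text \<open>
  The torus of side length \<open>L\<close> is identified with its fundamental domain \<open>[0,L)^d\<close>, where
  \<open>d = CARD('n)\<close>.  Elements of its Lebesgue spaces are functions considered on this cube only
  (values outside are never inspected); smooth functions on the torus are smooth \<open>L\<close>-periodic
  functions on \<open>\<real>^d\<close>.
\<close>

definition cube :: "real \<Rightarrow> (real^'n) set" where
  "cube L = {x. \<forall>i. 0 \<le> x $ i \<and> x $ i < L}"

definition torus :: "real \<Rightarrow> (real^'n) measure" where
  "torus L = lebesgue_on (cube L)"

definition time_torus :: "real \<Rightarrow> real \<Rightarrow> (real \<times> (real^'n)) measure" where
  "time_torus T L = lebesgue_on ({0<..<T} \<times> cube L)"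

definition torus_periodic :: "real \<Rightarrow> (real^'n \<Rightarrow> 'b) \<Rightarrow> bool" where
  "torus_periodic L f \<longleftrightarrow> (\<forall>x i. f (x + axis i L) = f x)"


section \<open>Lebesgue spaces\<close>

definition L2 :: "'a measure \<Rightarrow> ('a \<Rightarrow> 'b::euclidean_space) set" where
  "L2 M = {f. f \<in> borel_measurable M \<and> integrable M (\<lambda>x. (norm (f x))\<^sup>2)}"

definition L2_norm :: "'a measure \<Rightarrow> ('a \<Rightarrow> 'b::euclidean_space) \<Rightarrow> real" where
  "L2_norm M f = sqrt (LINT x|M. (norm (f x))\<^sup>2)"

definition Linf_norm :: "'a measure \<Rightarrow> ('a \<Rightarrow> 'b::euclidean_space) \<Rightarrow> ennreal" where
  "Linf_norm M f = esssup M (\<lambda>x. ennreal (norm (f x)))"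

definition Linf :: "'a measure \<Rightarrow> ('a \<Rightarrow> 'b::euclidean_space) set" where
  "Linf M = {f. f \<in> borel_measurable M \<and> Linf_norm M f < \<infinity>}"

text \<open>
  The norm of \<open>L\<^sup>\<infinity>(0,T; L\<^sup>2)\<close>.  Outside the space \<open>LinfL2\<close> its value carries no information,
  since \<open>L2_norm\<close> is meaningful only on \<open>L2\<close>.
\<close>

definition LinfL2_norm ::
    "real \<Rightarrow> real \<Rightarrow> (real \<Rightarrow> real^'n \<Rightarrow> 'b::euclidean_space) \<Rightarrow> ennreal" where
  "LinfL2_norm T L v = esssup (lebesgue_on {0<..<T}) (\<lambda>t. ennreal (L2_norm (torus L) (v t)))"

definition LinfL2 ::
    "real \<Rightarrow> real \<Rightarrow> (real \<Rightarrow> real^'n \<Rightarrow> 'b::euclidean_space) set" where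
  "LinfL2 T L = {v. (\<lambda>(t, x). v t x) \<in> borel_measurable (time_torus T L)
      \<and> (AE t in lebesgue_on {0<..<T}. v t \<in> L2 (torus L))
      \<and> LinfL2_norm T L v < \<infinity>}"

text \<open>\<open>C\<^sup>0([0,T); L\<^sup>2\<^sub>w)\<close>: at every single time the slice is in \<open>L\<^sup>2\<close>, weakly continuously in time.\<close>

definition weakly_continuous_L2 :: "real \<Rightarrow> real \<Rightarrow> (real \<Rightarrow> real^'n \<Rightarrow> real) set" where
  "weakly_continuous_L2 T L = {\<rho>. (\<forall>t\<in>{0..<T}. \<rho> t \<in> L2 (torus L))
      \<and> (\<forall>g\<in>L2 (torus L). continuous_on {0..<T} (\<lambda>t. LINT x|torus L. \<rho> t x * g x))}"


section \<open>Smooth functions and differential operators\<close>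

primrec C_k :: "nat \<Rightarrow> ('a::real_normed_vector \<Rightarrow> 'b::real_normed_vector) \<Rightarrow> bool" where
  "C_k 0 f \<longleftrightarrow> continuous_on UNIV f"
| "C_k (Suc k) f \<longleftrightarrow> (\<forall>x. f differentiable (at x))
      \<and> (\<forall>h. C_k k (\<lambda>x. frechet_derivative f (at x) h))"

definition C_infinity :: "('a::real_normed_vector \<Rightarrow> 'b::real_normed_vector) \<Rightarrow> bool" where
  "C_infinity f \<longleftrightarrow> (\<forall>k. C_k k f)"

definition partial :: "'n \<Rightarrow> (real^'n \<Rightarrow> real) \<Rightarrow> real^'n \<Rightarrow> real" where
  "partial i f x = frechet_derivative f (at x) (axis i 1)"

definition grad :: "(real^'n \<Rightarrow> real) \<Rightarrow> real^'n \<Rightarrow> real^'n" where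
  "grad f x = (\<chi> i. partial i f x)"

definition laplacian :: "(real^'n \<Rightarrow> real) \<Rightarrow> real^'n \<Rightarrow> real" where
  "laplacian f x = (\<Sum>i\<in>UNIV. partial i (partial i f) x)"

definition torus_smooth :: "real \<Rightarrow> (real^'n \<Rightarrow> real) set" where
  "torus_smooth L = {\<psi>. C_infinity \<psi> \<and> torus_periodic L \<psi>}"

text \<open>
  Smooth functions on \<open>[0,T] \<times> \<T>^d\<close> are the restrictions of smooth functions on
  \<open>\<real> \<times> \<T>^d\<close>; only the restriction is used.  The test functions with compact support in
  \<open>[0,T) \<times> \<T>^d\<close> vanish near \<open>t = T\<close>, but not necessarily at \<open>t = 0\<close>.
\<close>

definition time_smooth :: "real \<Rightarrow> (real \<Rightarrow> real^'n \<Rightarrow> real) set" where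
  "time_smooth L = {\<psi>. C_infinity (\<lambda>(t, x). \<psi> t x) \<and> (\<forall>t. torus_periodic L (\<psi> t))}"

definition time_smooth_compact :: "real \<Rightarrow> real \<Rightarrow> (real \<Rightarrow> real^'n \<Rightarrow> real) set" where
  "time_smooth_compact T L = {\<psi>\<in>time_smooth L. \<exists>\<tau><T. \<forall>t\<in>{\<tau>..<T}. \<forall>x. \<psi> t x = 0}"


section \<open>The negative Sobolev norm\<close>

text \<open>Both relations are in the sense of distributions on the torus.\<close>

definition weak_gradient :: "real \<Rightarrow> (real^'n \<Rightarrow> real) \<Rightarrow> (real^'n \<Rightarrow> real^'n) \<Rightarrow> bool" where
  "weak_gradient L \<phi> G \<longleftrightarrow> (\<forall>\<psi>\<in>torus_smooth L. \<forall>i.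
      (LINT x|torus L. \<phi> x * partial i \<psi> x) = - (LINT x|torus L. G x $ i * \<psi> x))"

definition weak_laplacian :: "real \<Rightarrow> (real^'n \<Rightarrow> real) \<Rightarrow> (real^'n \<Rightarrow> real) \<Rightarrow> bool" where
  "weak_laplacian L \<phi> f \<longleftrightarrow> (\<forall>\<psi>\<in>torus_smooth L.
      (LINT x|torus L. \<phi> x * laplacian \<psi> x) = (LINT x|torus L. f x * \<psi> x))"

text \<open>
  Meaningful for \<open>f \<in> L\<^sup>2\<close> with zero average: then the solution \<open>\<phi>\<close> of \<open>\<Delta>\<phi> = f\<close> exists and is
  unique up to an additive constant, so that the norm of its gradient is determined.
\<close>

definition Hm1_norm :: "real \<Rightarrow> (real^'n \<Rightarrow> real) \<Rightarrow> real" where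
  "Hm1_norm L f = (THE r. \<exists>\<phi> G. \<phi> \<in> L2 (torus L) \<and> G \<in> L2 (torus L)
      \<and> weak_laplacian L \<phi> f \<and> weak_gradient L \<phi> G \<and> r = L2_norm (torus L) G)"


section \<open>The transport system\<close>

definition solves_continuity ::
    "real \<Rightarrow> real \<Rightarrow> (real^'n \<Rightarrow> real) \<Rightarrow> (real \<Rightarrow> real^'n \<Rightarrow> real) \<Rightarrow> (real \<Rightarrow> real^'n \<Rightarrow> real^'n) \<Rightarrow> bool"
  where
  "solves_continuity T L \<rho>0 \<rho> v \<longleftrightarrow> (\<forall>\<psi>\<in>time_smooth_compact T L.
      (LINT t|lebesgue_on {0<..<T}. LINT x|torus L.
          \<rho> t x * deriv (\<lambda>s. \<psi> s x) t + \<rho> t x * (v t x \<bullet> grad (\<psi> t) x))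
      + (LINT x|torus L. \<rho>0 x * \<psi> 0 x) = 0)"

definition solves_div_free :: "real \<Rightarrow> real \<Rightarrow> (real \<Rightarrow> real^'n \<Rightarrow> real^'n) \<Rightarrow> bool" where
  "solves_div_free T L v \<longleftrightarrow> (\<forall>\<psi>\<in>time_smooth L.
      (LINT t|lebesgue_on {0<..<T}. LINT x|torus L. v t x \<bullet> grad (\<psi> t) x) = 0)"

definition depends_on_one_variable :: "real \<Rightarrow> (real^'n \<Rightarrow> real) \<Rightarrow> bool" where
  "depends_on_one_variable L f \<longleftrightarrow> (\<exists>i g. AE x in torus L. f x = g (x $ i))"


section \<open>Constants\<close>

definition H_max :: "real \<Rightarrow> nat \<Rightarrow> real" where
  "H_max L d = L powr ((real d + 2) / 2) / sqrt 48"

definition S_fun :: "real \<Rightarrow> real" where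
  "S_fun a = (arcsin a + a * sqrt (1 - a\<^sup>2)) / 2"

definition alpha_fun :: "real \<Rightarrow> real" where
  "alpha_fun r = sqrt (1 - sqrt (1 - r\<^sup>2))"

end

theory Submission
  imports Defs
begin

text \<open>
  Let \<open>i\<close> be the variable on which \<open>\<rho>0\<close> depends.  Averaging the density over the other variables gives
  at every time a one-dimensional profile \<open>m\<close> with \<open>\<bar>m\<bar> <= 1\<close> and mean zero (\<open>marginal_exists\<close>).  Let
  \<open>w\<close> be its primitive of mean zero and let the energy be \<open>A(t) = \<integral> w(x\<^sub>i)\<^sup>2\<close>, the square of the
  \<open>H\<^sup>-\<^sup>1\<close> norm of the averaged density.  Averaging does not increase that norm
  (\<open>Hm1_norm_ge_marginal\<close>), and \<open>\<rho>0\<close> is its own average (\<open>Hm1_norm_one_variable\<close>).  Hence \<open>A\<close> starts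
  at \<open>\<parallel>\<rho>0\<parallel>\<^sup>2\<close>, tends to zero as \<open>t\<close> tends to \<open>T\<close>, and it suffices to bound the rate at which it falls.

  Testing the transport equation with functions of \<open>x\<^sub>i\<close> gives formally \<open>A' = - 2 \<integral> \<rho> v\<^sub>i w(x\<^sub>i)\<close>.  Since \<open>v\<close> is
  divergence free, \<open>v\<^sub>i\<close> is orthogonal to every function of \<open>x\<^sub>i\<close> of mean zero, in particular to
  \<open>m w = (w\<^sup>2)' / 2\<close>.  So \<open>\<rho>\<close> may be replaced by \<open>\<rho> - m\<close>, whose conditional variance is at most
  \<open>1 - m\<^sup>2\<close>, and the Cauchy-Schwarz inequality gives \<open>\<bar>A'\<bar> <= 2 \<surd>E \<surd>(A - \<integral> w\<^sup>2 m\<^sup>2)\<close> (\<open>energy_rate\<close>,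
  \<open>transported_defect\<close>).

  The heart of the matter is one-dimensional: if \<open>w\<close> has mean zero on a period \<open>L\<close> and \<open>\<bar>w'\<bar> <= 1\<close>, then
  \<open>z \<integral> w\<^sup>2 - (1 - z) \<integral> w\<^sup>2 w'\<^sup>2 <= z\<^sup>2 L\<^sup>3 / 48\<close> for all \<open>z\<close> in \<open>[0,1]\<close> (\<open>transport_inequality\<close>).
  Writing \<open>A = M z (2 - z)\<close> with \<open>M = H_max\<^sup>2\<close>, the choice of this \<open>z\<close> bounds \<open>A - \<integral> w\<^sup>2 m\<^sup>2\<close> by
  \<open>2 M z (1 - z)\<close>, and \<open>\<surd>2 S(\<surd>z)\<close> is exactly the function of \<open>A\<close> whose rate of change is then at most
  \<open>\<surd>E / H_max\<close> (\<open>travel_time\<close>).  As it has to fall to zero, the bound on \<open>T\<close> follows.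

  The one-dimensional inequality is proved by calibration.  Between two zeros \<open>w\<close> consists of lobes, and
  each lobe is cut into two halves of equal mass.  A half lobe is compared with the extremal profile
  \<open>lobe\<close> at the point with the same mass fraction; a solution of a Hamilton-Jacobi inequality
  (\<open>hamilton_jacobi\<close>) provides a function whose derivative dominates the integrand (\<open>half_lobe\<close>).  What
  remains is an optimisation over the masses (\<open>lobe_optimum\<close>).

  The equations are only known in the weak sense.  Trigonometric polynomials, dense in the sense of
  bounded almost everywhere convergence (\<open>trig_dense\<close>), serve as test functions in space; explicit
  cutoffs \<open>exp(- c / (\<tau> - t))\<close> serve as test functions in time.
\<close>

section \<open>The extremal profile and its calibration\<close>

text \<open>Two one-sided derivatives with the same value give a derivative; used where the profiles below
  change their formula.\<close>

lemma deriv_glue: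
  fixes f g h :: "real => real"
  assumes "(f has_real_derivative D) (at a)" "(g has_real_derivative D) (at a)" "h a = f a" "h a = g a"
    and "\<And>x. x <= a ==> h x = f x" "\<And>x. a < x ==> h x = g x"
  shows "(h has_real_derivative D) (at a)"
proof -
  have h: "f x = h x" if "x \<in> {..a}" for x using assms(5)[of x] that by simp
  have k: "g x = h x" if "x \<in> {a..}" for x using assms(4) assms(6)[of x] that by (cases "x = a") simp_all
  have 1: "(h has_real_derivative D) (at a within {..a})"
    by (rule has_field_derivative_transform_within[OF has_field_derivative_at_within[OF assms(1)] zero_less_one])
      (simp_all add: h)
  have 2: "(h has_real_derivative D) (at a within {a..})"
    by (rule has_field_derivative_transform_within[OF has_field_derivative_at_within[OF assms(2)] zero_less_one])
      (simp_all add: k)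
  have U: "{..a} \<union> {a..} = (UNIV::real set)" by auto
  have "(h has_real_derivative D) (at a within {..a} \<union> {a..})"
    using 1 2 unfolding has_field_derivative_iff Lim_within_Un by blast
  then show ?thesis unfolding U .
qed

lemma pos_part_power_deriv:
  assumes "n \<ge> 2"
  shows "((\<lambda>y::real. (max 0 y) ^ n) has_real_derivative real n * (max 0 y) ^ (n - 1)) (at y)"
proof -
  have p: "((\<lambda>y::real. y ^ n) has_real_derivative real n * y ^ (n - 1)) (at y)" for y
    using DERIV_pow[of n y UNIV] by simp
  have n: "n \<noteq> 0" "n - 1 \<noteq> 0" using assms by linarith+
  consider "y = 0" | "y > 0" | "y < 0" by linarith
  then show ?thesis
  proof cases
    case 1
    have p0: "((\<lambda>y::real. y ^ n) has_real_derivative 0) (at 0)"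
      using p[of 0] n by (simp add: power_0_left)
    have "((\<lambda>y::real. (max 0 y) ^ n) has_real_derivative 0) (at 0)"
      by (rule deriv_glue[OF DERIV_const[of 0] p0]) (use n in \<open>simp_all add: max_def\<close>)
    then show ?thesis using 1 n by (simp add: power_0_left)
  next
    case 2
    have "((\<lambda>y::real. (max 0 y) ^ n) has_real_derivative real n * y ^ (n - 1)) (at y)"
      by (rule has_field_derivative_transform_within_open[OF p, of "{0<..}"]) (use 2 in simp_all)
    then show ?thesis using 2 by simp
  next
    case 3
    have "((\<lambda>y::real. (max 0 y) ^ n) has_real_derivative 0) (at y)"
      by (rule has_field_derivative_transform_within_open[OF DERIV_const[of 0], of "{..<0}"])
        (use 3 n in \<open>simp_all add: max_def\<close>)
    moreover have "max 0 y = 0" using 3 by simp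
    ultimately show ?thesis using n by (simp add: power_0_left)
  qed
qed

text \<open>The integrand of the inequality on the positive part of \<open>u\<close>, lowered by the constant
  \<open>z\<^sup>2 m\<^sup>2\<close>. The constant pays for the length of the set \<open>{u > 0}\<close>,
  which is thereby removed from the constraints.\<close>

definition lobe_integrand :: "real => real => (real => real) => (real => real) => real => real" where
  "lobe_integrand z m u u' x = (if 0 < u x then z * (u x)\<^sup>2 - (1 - z) * (u x)\<^sup>2 * (u' x)\<^sup>2 - z\<^sup>2 * m\<^sup>2 else 0)"

lemma lobe_integrand_integrable:
  assumes cu: "continuous_on {c..d} u" and cu': "continuous_on {c..d} u'"
  shows "lobe_integrand z m u u' integrable_on {c..d}"
proof -
  define F where "F = (\<lambda>x. z * (u x)\<^sup>2 - (1 - z) * (u x)\<^sup>2 * (u' x)\<^sup>2 - z\<^sup>2 * m\<^sup>2)"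
  have "openin (top_of_set {c..d}) ({c..d} \<inter> u -` {0<..})"
    by (rule continuous_openin_preimage_gen[OF cu open_greaterThan])
  then have meas: "{c..d} \<inter> u -` {0<..} \<in> sets lebesgue" by (rule lebesgue_openin) simp
  have "F absolutely_integrable_on {c..d}"
    unfolding F_def by (intro absolutely_integrable_continuous_real continuous_intros cu cu')
  then have "F absolutely_integrable_on ({c..d} \<inter> u -` {0<..})"
    by (rule set_integrable_subset) (use meas in auto)
  then have "F integrable_on ({c..d} \<inter> u -` {0<..})" by (rule set_lebesgue_integral_eq_integral)
  then have "(\<lambda>x. if x \<in> u -` {0<..} then F x else 0) integrable_on {c..d}"
    unfolding integrable_restrict_Int by (simp add: Int_commute)
  then show ?thesis by (rule integrable_eq) (simp add: lobe_integrand_def F_def)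
qed

text \<open>The extremal half lobe of unit size as a function of the parameter \<open>y\<close> in
  \<open>[0,1]\<close>: a straight line up to height \<open>z\<close>, then an arc of an ellipse.\<close>

definition lobe :: "real => real => real" where
  "lobe z y = (if y <= z then y else sqrt (z - z / (1 - z) * (1 - y)\<^sup>2))"

text \<open>The mass coordinate of the extremal profile, in the normalisation in which a half lobe of scale
  \<open>m\<close> has mass \<open>m\<^sup>2 lobe_mass z 1\<close>.\<close>

definition lobe_mass :: "real => real => real" where
  "lobe_mass z y = integral {0..y} (lobe z)"

text \<open>The calibrating slope field along the extremal profile; its derivative \<open>(2/3) z\<^sup>2 /
  lobe\<^sup>3\<close> is the same on both pieces.\<close>

definition lobe_slope :: "real => real => real" where
  "lobe_slope z y = (if y <= z then (2 * z - 1 - z\<^sup>2 / y\<^sup>2) / 3 else - (2/3) * z * (1 - y) / lobe z y)"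

context
  fixes z :: real
  assumes z: "0 < z" "z <= 1"
begin

lemma lobe_radicand:
  assumes "z < y" "y <= 1"
  shows "z\<^sup>2 < z - z / (1 - z) * (1 - y)\<^sup>2"
proof -
  have z1: "z < 1" using assms z by linarith
  have "(1 - y)\<^sup>2 < (1 - z)\<^sup>2" using assms by (intro power_strict_mono) auto
  then have "z / (1 - z) * (1 - y)\<^sup>2 < z / (1 - z) * (1 - z)\<^sup>2"
    using z z1 by (intro mult_strict_left_mono) auto
  also have "\<dots> = z * (1 - z)" using z1 by (simp add: power2_eq_square)
  finally show ?thesis by (simp add: power2_eq_square algebra_simps)
qed

lemma lobe_pos: "0 < y ==> y <= 1 ==> 0 < lobe z y"
  using order_le_less_trans[OF zero_le_power2[of z] lobe_radicand[of y]] unfolding lobe_def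
  by (cases "y <= z") simp_all

lemma lobe_sq: "z < y ==> y <= 1 ==> (lobe z y)\<^sup>2 = z - z / (1 - z) * (1 - y)\<^sup>2"
  using order_le_less_trans[OF zero_le_power2[of z] lobe_radicand[of y]] unfolding lobe_def
  by simp

lemma lobe_continuous: "continuous_on {0..1} (lobe z)"
proof (cases "z = 1")
  case True
  then show ?thesis
    by (intro continuous_on_eq[OF continuous_on_id]) (auto simp: lobe_def)
next
  case False
  then have z1: "z < 1" using z by simp
  have "z / (1 - z) * (1 - z)\<^sup>2 = z * (1 - z)" using z1 by (simp add: power2_eq_square)
  then have "z - z / (1 - z) * (1 - z)\<^sup>2 = z\<^sup>2" by (simp add: power2_eq_square algebra_simps)
  then have join: "sqrt (z - z / (1 - z) * (1 - z)\<^sup>2) = z" using z by simp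
  have "continuous_on ({0..z} \<union> {z..1}) (\<lambda>y. if y <= z then y else sqrt (z - z / (1 - z) * (1 - y)\<^sup>2))"
  proof (rule continuous_on_cases)
    show "\<forall>x. x \<in> {0..z} \<and> \<not> x <= z \<or> x \<in> {z..1} \<and> x <= z \<longrightarrow> x = sqrt (z - z / (1 - z) * (1 - x)\<^sup>2)"
    proof (intro allI impI)
      fix x assume "x \<in> {0..z} \<and> \<not> x <= z \<or> x \<in> {z..1} \<and> x <= z"
      then have "x = z" by auto
      then show "x = sqrt (z - z / (1 - z) * (1 - x)\<^sup>2)" using join by simp
    qed
  qed (use z1 in \<open>auto intro!: continuous_intros\<close>)
  moreover have "{0..z} \<union> {z..1} = {0..1}" using z by auto
  ultimately show ?thesis unfolding lobe_def by simp
qed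

lemma lobe_mass_deriv:
  assumes "0 < y" "y < 1"
  shows "(lobe_mass z has_real_derivative lobe z y) (at y)"
proof -
  have "((\<lambda>y. integral {0..y} (lobe z)) has_real_derivative lobe z y) (at y within {0..1})"
    by (rule integral_has_real_derivative[OF lobe_continuous]) (use assms in auto)
  then show ?thesis unfolding lobe_mass_def using assms by (simp add: at_within_Icc_at)
qed

lemma lobe_mass_continuous: "continuous_on {0..1} (lobe_mass z)"
  unfolding lobe_mass_def
  by (rule indefinite_integral_continuous_1[OF integrable_continuous_real[OF lobe_continuous]])

lemma lobe_mass_0 [simp]: "lobe_mass z 0 = 0" by (simp add: lobe_mass_def)

lemma lobe_mass_less: "0 <= x ==> x < y ==> y <= 1 ==> lobe_mass z x < lobe_mass z y"
proof (rule DERIV_pos_imp_increasing_open[of x y])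
  assume a: "0 <= x" "x < y" "y <= 1"
  show "\<exists>l. (lobe_mass z has_real_derivative l) (at t) \<and> 0 < l" if "x < t" "t < y" for t
    using lobe_mass_deriv[of t] lobe_pos[of t] a that by auto
  show "continuous_on {x..y} (lobe_mass z)"
    by (rule continuous_on_subset[OF lobe_mass_continuous]) (use a in auto)
qed

lemma lobe_mass_le: "0 <= x ==> x <= y ==> y <= 1 ==> lobe_mass z x <= lobe_mass z y"
  using lobe_mass_less[of x y] by (cases "x = y") auto

text \<open>On the straight piece the mass is explicit. This controls the singularity of
  \<open>lobe_slope\<close> at zero.\<close>

lemma lobe_mass_start:
  assumes "0 <= y" "y <= z"
  shows "lobe_mass z y = y\<^sup>2 / 2"
proof -
  have "((\<lambda>x. x) has_integral y\<^sup>2 / 2 - 0\<^sup>2 / 2) {0..y}"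
    by (rule fundamental_theorem_of_calculus)
      (use assms in \<open>auto intro!: derivative_eq_intros simp: has_real_derivative_iff_has_vector_derivative[symmetric]\<close>)
  then have "(lobe z has_integral y\<^sup>2 / 2) {0..y}"
    by (rule has_integral_eq_rhs[OF has_integral_eq[rotated]]) (use assms in \<open>auto simp: lobe_def\<close>)
  then show ?thesis unfolding lobe_mass_def by (rule integral_unique)
qed

lemma lobe_slope_deriv:
  assumes "0 < y" "y < 1"
  shows "(lobe_slope z has_real_derivative (2/3) * z\<^sup>2 / (lobe z y) ^ 3) (at y)"
proof -
  define f where "f = (\<lambda>y. (2 * z - 1 - z\<^sup>2 / y\<^sup>2) / 3)"
  define r where "r = (\<lambda>y. z - z / (1 - z) * (1 - y)\<^sup>2)"
  define g where "g = (\<lambda>y. - (2/3) * z * (1 - y) / sqrt (r y))"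
  have f: "(f has_real_derivative (2/3) * z\<^sup>2 / y ^ 3) (at y)"
    unfolding f_def
    by (rule DERIV_cong[OF DERIV_cdivide[OF DERIV_diff[OF DERIV_const DERIV_divide[OF DERIV_const DERIV_pow]]]])
      (use assms in \<open>simp_all add: field_simps power2_eq_square power3_eq_cube\<close>)
  have g: "(g has_real_derivative (2/3) * z\<^sup>2 / (sqrt (r y)) ^ 3) (at y)" if "z <= y"
  proof -
    have z1: "z < 1" using that assms by simp
    have rp: "0 < r y"
    proof (cases "z = y")
      case True
      have "z / (1 - z) * (1 - z)\<^sup>2 = z * (1 - z)" using z1 by (simp add: power2_eq_square)
      then have "r y = z\<^sup>2" unfolding r_def True[symmetric] by (simp add: power2_eq_square algebra_simps)
      then show ?thesis using z by simp
    next
      case False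
      then show ?thesis
        using that assms lobe_radicand[of y] zero_le_power2[of z] unfolding r_def by linarith
    qed
    have key: "r y + z / (1 - z) * (1 - y)\<^sup>2 = z" by (simp add: r_def)
    have dr: "(r has_real_derivative 2 * (z / (1 - z) * (1 - y))) (at y)"
      unfolding r_def
      by (rule DERIV_cong[OF DERIV_diff[OF DERIV_const DERIV_cmult[OF DERIV_power[OF DERIV_diff[OF DERIV_const DERIV_ident]]]]])
        (simp add: algebra_simps diff_divide_distrib)
    have sq: "sqrt (r y) * sqrt (r y) = r y" using rp by simp
    have s0: "sqrt (r y) > 0" using rp by simp
    have "((\<lambda>y. sqrt (r y)) has_real_derivative (z / (1 - z) * (1 - y)) / sqrt (r y)) (at y)"
    proof (rule DERIV_cong[OF DERIV_chain2[OF DERIV_real_sqrt[OF rp] dr]])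
      have "inverse q / 2 * (2 * a) = a / q" for q a :: real by (simp add: field_simps)
      then show "inverse (sqrt (r y)) / 2 * (2 * (z / (1 - z) * (1 - y))) = z / (1 - z) * (1 - y) / sqrt (r y)" .
    qed
    then have G: "(g has_real_derivative ((2/3) * z * sqrt (r y) - (- ((2/3) * z) * (1 - y)) * ((z / (1 - z) * (1 - y)) / sqrt (r y)))
           / (sqrt (r y) * sqrt (r y))) (at y)"
      unfolding g_def
      by (rule DERIV_cong[OF DERIV_divide[OF DERIV_cmult[OF DERIV_diff[OF DERIV_const DERIV_ident]]]])
        (use s0 in simp_all)
    have "(c * q - (- c * d) * (a / q)) / (q * q) = c * (q * q + a * d) / q ^ 3" if "q > 0" for c q a d :: real
      using that by (simp add: field_simps power3_eq_cube)
    note N = this[OF s0, of "(2/3) * z" "1 - y" "z / (1 - z) * (1 - y)"]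
    have K: "sqrt (r y) * sqrt (r y) + z / (1 - z) * (1 - y) * (1 - y) = z"
      unfolding sq using key by (simp add: power2_eq_square mult.assoc)
    show ?thesis using G unfolding N K by (simp add: power2_eq_square mult.assoc)
  qed
  have e: "lobe_slope z y = (if y <= z then f y else g y)" for y
    by (simp add: lobe_slope_def f_def g_def r_def lobe_def)
  consider "y < z" | "y = z" | "y > z" by linarith
  then show ?thesis
  proof cases
    case 1
    show ?thesis
      by (rule has_field_derivative_transform_within_open[of f _ _ "{..<z}"])
        (use 1 f in \<open>auto simp: e lobe_def\<close>)
  next
    case 2
    then have z1: "z < 1" using assms by simp
    have "z / (1 - z) * (1 - z)\<^sup>2 = z * (1 - z)" using z1 by (simp add: power2_eq_square)
    then have "r y = z\<^sup>2" unfolding r_def 2 by (simp add: power2_eq_square algebra_simps)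
    then have rz: "sqrt (r y) = y" using 2 z by simp
    have fg: "f y = g y"
    proof -
      have "g y = - (2/3) * z * (1 - y) / y" unfolding g_def rz ..
      also have "\<dots> = f y" using 2 z by (simp add: f_def field_simps)
      finally show ?thesis ..
    qed
    have "(lobe_slope z has_real_derivative (2/3) * z\<^sup>2 / y ^ 3) (at y)"
      by (rule deriv_glue[OF f g[unfolded rz]]) (use 2 fg in \<open>auto simp: e\<close>)
    then show ?thesis using 2 by (simp add: lobe_def)
  next
    case 3
    then have l: "lobe z y = sqrt (r y)" by (simp add: lobe_def r_def)
    show ?thesis unfolding l
      by (rule has_field_derivative_transform_within_open[of g _ _ "{z<..}"])
        (use 3 g in \<open>auto simp: e\<close>)
  qed
qed

lemma lobe_slope_1 [simp]: "lobe_slope z 1 = 0"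
  using z by (auto simp: lobe_slope_def)

lemma lobe_slope_continuous: "continuous_on {0<..1} (lobe_slope z)"
proof (cases "z = 1")
  case True
  have "continuous_on {0<..1} (\<lambda>y. (2 * z - 1 - z\<^sup>2 / y\<^sup>2) / 3)"
    by (auto intro!: continuous_intros)
  then show ?thesis
    by (rule continuous_on_eq) (use True in \<open>auto simp: lobe_slope_def\<close>)
next
  case False
  then have z1: "z < 1" using z by simp
  have 1: "continuous_on {z/2..1} (\<lambda>y. - (2/3) * z * (1 - y) / lobe z y)"
    by (intro continuous_intros continuous_on_subset[OF lobe_continuous])
      (use z in \<open>force dest!: lobe_pos[rotated]\<close>)+
  have "isCont (lobe_slope z) y" if "0 < y" "y < 1" for y
    using lobe_slope_deriv[OF that] by (rule DERIV_isCont)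
  moreover have "continuous (at 1 within {0<..1}) (lobe_slope z)"
  proof -
    have "continuous (at 1 within {z/2..1}) (\<lambda>y. - (2/3) * z * (1 - y) / lobe z y)"
      using 1 z by (auto simp: continuous_on_eq_continuous_within)
    then have "continuous (at 1 within {z/2..1}) (lobe_slope z)"
      by (rule continuous_transform_within[where \<delta> = "1 - z"])
        (use z z1 in \<open>auto simp: lobe_slope_def dist_real_def\<close>)
    moreover have "at (1::real) within {z/2..1} = at 1 within {0<..1}"
      by (rule at_within_nhd[of _ "{z/2<..}"]) (use z z1 in auto)
    ultimately show ?thesis by (simp add: continuous_within)
  qed
  ultimately show ?thesis
    by (auto simp: continuous_on_eq_continuous_within le_less continuous_at_imp_continuous_within)
qed

text \<open>On the straight piece the difference of the two sides factorises with the root \<open>t =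
  1\<close>; on the elliptic piece it is the square \<open>(1 - z) (t - p)\<^sup>2\<close>, where
  \<open>p\<close> is the slope of the extremal profile. So equality holds for the slope of the profile, and
  the restriction \<open>t <= 1\<close> matters only on the straight piece.\<close>

lemma hamilton_jacobi:
  assumes y: "0 < y" "y < 1" and "t <= 1"
  shows "z - (1 - z) * t\<^sup>2 - 3 * lobe_slope z y * t <= z\<^sup>2 / (lobe z y)\<^sup>2"
proof (cases "y <= z")
  case True
  define c where "c = z\<^sup>2 / y\<^sup>2"
  have c1: "c \<ge> 1" unfolding c_def using True y by (simp add: divide_simps power_mono)
  have "0 <= (1 - t) * (c - z - (1 - z) * t)"
  proof (rule mult_nonneg_nonneg)
    have "(1 - z) * t <= 1 - z" using assms z mult_left_mono[of t 1 "1 - z"] by simp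
    then show "0 <= c - z - (1 - z) * t" using c1 by linarith
  qed (use assms in auto)
  then have "z - (1 - z) * t\<^sup>2 - (2 * z - 1 - c) * t <= c"
    by (simp add: algebra_simps power2_eq_square)
  moreover have "3 * lobe_slope z y = 2 * z - 1 - c" using True by (simp add: lobe_slope_def c_def)
  ultimately show ?thesis using True by (simp add: lobe_def c_def)
next
  case False
  then have z1: "z < 1" using y by simp
  define W where "W = lobe z y"
  have W: "W > 0" using lobe_pos y by (simp add: W_def)
  have W2: "W\<^sup>2 = z - z / (1 - z) * (1 - y)\<^sup>2" using lobe_sq False y by (simp add: W_def)
  define p where "p = z / (1 - z) * (1 - y) / W"
  have zp: "(1 - z) * p = z * (1 - y) / W" using z1 by (simp add: p_def)
  have pW: "p * W = z / (1 - z) * (1 - y)" using W by (simp add: p_def)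
  have sl: "3 * lobe_slope z y = - 2 * ((1 - z) * p)"
    unfolding zp using False by (simp add: lobe_slope_def W_def)
  have eq: "z + (1 - z) * p\<^sup>2 = z\<^sup>2 / W\<^sup>2"
  proof -
    have "(z + (1 - z) * p\<^sup>2) * W\<^sup>2 = z * W\<^sup>2 + (1 - z) * (z / (1 - z))\<^sup>2 * (1 - y)\<^sup>2"
      unfolding power_mult_distrib[symmetric] mult.assoc pW[symmetric] by (simp add: algebra_simps power_mult_distrib)
    also have "(1 - z) * (z / (1 - z))\<^sup>2 = z * (z / (1 - z))"
      using z1 by (simp add: power2_eq_square)
    finally have "(z + (1 - z) * p\<^sup>2) * W\<^sup>2 = z\<^sup>2"
      unfolding W2 by (simp add: algebra_simps power2_eq_square)
    then show ?thesis using W by (simp add: field_simps)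
  qed
  have "z - (1 - z) * t\<^sup>2 - 3 * lobe_slope z y * t = z\<^sup>2 / W\<^sup>2 - (1 - z) * (t - p)\<^sup>2"
    unfolding sl eq[symmetric] by (simp add: algebra_simps power2_eq_square)
  moreover have "0 <= (1 - z) * (t - p)\<^sup>2" using z by simp
  ultimately show ?thesis unfolding W_def[symmetric] by linarith
qed

text \<open>Calibration. Let \<open>Y x\<close> be the parameter at which the extremal profile has the same
  mass fraction as \<open>u\<close> at \<open>x\<close>. The function \<open>\<Phi> = - (2/3) z\<^sup>2
  m\<^sup>3 Y + lobe_slope(Y) u\<^sub>+\<^sup>3\<close> has a derivative above the integrand: the
  Hamilton-Jacobi inequality removes \<open>u'\<close>, and the remaining inequality \<open>w\<^sup>2 - 1
  <= (2/3) (w\<^sup>4 - w)\<close> compares \<open>u\<close> with the profile through their ratio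
  \<open>w\<close>. The bound is the increment of \<open>\<Phi>\<close>, since \<open>Y\<close> runs from 0 to
  1 and \<open>lobe_slope\<close> vanishes at 1.\<close>

lemma half_lobe:
  fixes u u' :: "real => real"
  assumes m: "m > 0" and X: "0 <= X"
    and cu: "continuous_on {0..X} u" and cu': "continuous_on {0..X} u'"
    and du: "\<And>x. 0 < x ==> x < X ==> (u has_real_derivative u' x) (at x)"
    and u1: "\<And>x. 0 < x ==> x < X ==> u' x <= 1"
    and u0: "u 0 = 0"
    and mass: "integral {0..X} (\<lambda>x. max 0 (u x)) = m\<^sup>2 * lobe_mass z 1"
  shows "integral {0..X} (lobe_integrand z m u u') <= - (2/3) * z\<^sup>2 * m ^ 3"
proof -
  define p where "p = (\<lambda>x. max 0 (u x))"
  define k where "k = lobe_integrand z m u u'"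
  note k_def = k_def lobe_integrand_def
  define \<sigma> where "\<sigma> = (\<lambda>x. integral {0..x} p)"
  define Q where "Q = lobe_mass z 1"
  have Q: "0 < Q" using lobe_mass_less[of 0 1] by (simp add: Q_def)
  have m2Q: "0 < m\<^sup>2 * Q" using m Q by simp
  have cp: "continuous_on {0..X} p" unfolding p_def by (intro continuous_intros cu)
  have p0: "p x \<ge> 0" for x by (simp add: p_def)
  have c\<sigma>: "continuous_on {0..X} \<sigma>"
    unfolding \<sigma>_def by (rule indefinite_integral_continuous_1[OF integrable_continuous_real[OF cp]])
  have d\<sigma>: "(\<sigma> has_real_derivative p x) (at x)" if "0 < x" "x < X" for x
  proof -
    have "(\<sigma> has_real_derivative p x) (at x within {0..X})"
      unfolding \<sigma>_def by (rule integral_has_real_derivative[OF cp]) (use that in auto)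
    then show ?thesis using that by (simp add: at_within_Icc_at)
  qed
  have mono: "\<sigma> x <= \<sigma> y" if "0 <= x" "x <= y" "y <= X" for x y
  proof -
    have "integral {0..x} p <= integral {0..y} p"
      by (rule integral_subset_le)
        (use that p0 in \<open>auto intro!: integrable_continuous_real continuous_on_subset[OF cp]\<close>)
    then show ?thesis by (simp add: \<sigma>_def)
  qed
  have flat: "p t = 0" if "0 <= x" "x < y" "y <= X" "\<sigma> x = \<sigma> y" "t \<in> {x..y}" for x y t
  proof -
    have "integral {0..x} p + integral {x..y} p = integral {0..y} p"
      by (rule Henstock_Kurzweil_Integration.integral_combine)
        (use that in \<open>auto intro!: integrable_continuous_real continuous_on_subset[OF cp]\<close>)
    then have "integral {x..y} p = 0" using that by (simp add: \<sigma>_def)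
    moreover have "p integrable_on {x..y}"
      by (rule integrable_continuous_real) (use that in \<open>auto intro!: continuous_on_subset[OF cp]\<close>)
    ultimately have "(p has_integral 0) (cbox x y)" by (simp add: has_integral_integral)
    then show ?thesis
      by (rule has_integral_0_cbox_imp_0[rotated 2])
        (use that p0 in \<open>auto intro!: continuous_on_subset[OF cp]\<close>)
  qed
  have \<sigma>0: "\<sigma> 0 = 0" by (simp add: \<sigma>_def)
  have \<sigma>X: "\<sigma> X = m\<^sup>2 * Q" using mass by (simp add: \<sigma>_def p_def Q_def)
  \<comment> \<open>the last point before any mass, and the first point with the full mass\<close>
  define a where "a = Sup {x\<in>{0..X}. \<sigma> x = 0}"
  define b where "b = Inf {x\<in>{0..X}. \<sigma> x = m\<^sup>2 * Q}"
  have cl: "closed {x\<in>{0..X}. \<sigma> x = c}" for c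
    by (rule continuous_closed_preimage_constant[OF c\<sigma>]) simp
  have "a \<in> {x\<in>{0..X}. \<sigma> x = 0}"
    unfolding a_def by (rule closed_contains_Sup[OF _ _ cl]) (use X \<sigma>0 in \<open>auto intro!: bdd_aboveI[of _ X]\<close>)
  then have a: "0 <= a" "a <= X" "\<sigma> a = 0" by auto
  have "b \<in> {x\<in>{0..X}. \<sigma> x = m\<^sup>2 * Q}"
    unfolding b_def by (rule closed_contains_Inf[OF _ _ cl]) (use X \<sigma>X in \<open>auto intro!: bdd_belowI[of _ 0]\<close>)
  then have b: "0 <= b" "b <= X" "\<sigma> b = m\<^sup>2 * Q" by auto
  have ab: "a < b"
    using mono[of b a] a b m2Q by (cases "a < b") auto
  have pos: "0 < \<sigma> x" if "a < x" "x <= X" for x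
  proof (rule ccontr)
    assume "\<not> 0 < \<sigma> x"
    then have "\<sigma> x = 0" using mono[of 0 x] a that \<sigma>0 by simp
    then have "x <= a" unfolding a_def
      by (intro cSup_upper) (use that a in \<open>auto intro!: bdd_aboveI[of _ X]\<close>)
    then show False using that by simp
  qed
  have less: "\<sigma> x < m\<^sup>2 * Q" if "x < b" "0 <= x" for x
  proof (rule ccontr)
    assume "\<not> \<sigma> x < m\<^sup>2 * Q"
    then have "\<sigma> x = m\<^sup>2 * Q" using mono[of x b] b that by simp
    then have "b <= x" unfolding b_def
      by (intro cInf_lower) (use that b in \<open>auto intro!: bdd_belowI[of _ 0]\<close>)
    then show False using that by simp
  qed
  have pa: "p t = 0" if "0 <= t" "t <= a" for t
  proof (cases "a = 0")
    case True then show ?thesis using that u0 by (simp add: p_def)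
  next
    case False then show ?thesis using flat[of 0 a t] a \<sigma>0 that by simp
  qed
  have pb: "p t = 0" if "b < t" "t <= X" for t
    using flat[of b X t] b \<sigma>X that by simp
  have k0: "k t = 0" if "p t = 0" for t using that by (simp add: k_def p_def max_def split: if_splits)
  \<comment> \<open>the position in the profile with the same fraction of the mass\<close>
  have "\<exists>y. 0 <= y \<and> y <= 1 \<and> m\<^sup>2 * lobe_mass z y = \<sigma> x" if "x \<in> {a..b}" for x
  proof -
    have "\<exists>y\<ge>0. y <= 1 \<and> lobe_mass z y = \<sigma> x / m\<^sup>2"
      by (rule IVT'[OF _ _ _ lobe_mass_continuous])
        (use mono[of a x] mono[of x b] that a b m in \<open>auto simp: Q_def field_simps\<close>)
    then show ?thesis using m by (auto simp: field_simps)
  qed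
  then obtain Y where Y: "\<And>x. x \<in> {a..b} ==> 0 <= Y x \<and> Y x <= 1 \<and> m\<^sup>2 * lobe_mass z (Y x) = \<sigma> x"
    by metis
  have inj: "y = y'" if "lobe_mass z y = lobe_mass z y'" "0 <= y" "y <= 1" "0 <= y'" "y' <= 1" for y y'
    using lobe_mass_less[of y y'] lobe_mass_less[of y' y] that by (cases y y' rule: linorder_cases) auto
  obtain g where g: "\<And>y. y \<in> {0..1} ==> g (lobe_mass z y) = y" and cg: "continuous_on (lobe_mass z ` {0..1}) g"
  proof
    show "the_inv_into {0..1} (lobe_mass z) (lobe_mass z y) = y" if "y \<in> {0..1}" for y
      by (rule the_inv_into_f_f) (use inj that in \<open>auto simp: inj_on_def\<close>)
    show "continuous_on (lobe_mass z ` {0..1}) (the_inv_into {0..1} (lobe_mass z))"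
      by (rule continuous_on_inv_into[OF lobe_mass_continuous]) (use inj in \<open>auto simp: inj_on_def\<close>)
  qed
  have img: "lobe_mass z ` {0..1} = {0..Q}"
  proof
    show "lobe_mass z ` {0..1} \<subseteq> {0..Q}"
    proof
      fix s assume "s \<in> lobe_mass z ` {0..1}"
      then obtain y where "s = lobe_mass z y" "0 <= y" "y <= 1" by auto
      then show "s \<in> {0..Q}"
        using lobe_mass_le[of 0 y] lobe_mass_le[of y 1] by (simp add: Q_def)
    qed
    show "{0..Q} \<subseteq> lobe_mass z ` {0..1}"
    proof
      fix s assume "s \<in> {0..Q}"
      then have "\<exists>y\<ge>0. y <= 1 \<and> lobe_mass z y = s"
        by (intro IVT'[OF _ _ _ lobe_mass_continuous]) (auto simp: Q_def)
      then show "s \<in> lobe_mass z ` {0..1}" by auto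
    qed
  qed
  have Yg: "Y x = g (\<sigma> x / m\<^sup>2)" if "x \<in> {a..b}" for x
  proof -
    have "\<sigma> x / m\<^sup>2 = lobe_mass z (Y x)" using Y[OF that] m by (simp add: field_simps)
    then show ?thesis using Y[OF that] g[of "Y x"] by simp
  qed
  have cY: "continuous_on {a..b} Y"
  proof -
    have "continuous_on {a..b} (\<lambda>x. g (\<sigma> x / m\<^sup>2))"
    proof (rule continuous_on_compose2[OF cg])
      show "continuous_on {a..b} (\<lambda>x. \<sigma> x / m\<^sup>2)"
        using m a b by (intro continuous_intros continuous_on_subset[OF c\<sigma>]) auto
      show "(\<lambda>x. \<sigma> x / m\<^sup>2) ` {a..b} \<subseteq> lobe_mass z ` {0..1}"
        unfolding img using mono[of a] mono[of _ b] a b m by (fastforce simp: field_simps)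
    qed
    then show ?thesis by (rule continuous_on_eq) (simp add: Yg)
  qed
  have Yint: "0 < Y x \<and> Y x < 1" if "a < x" "x < b" for x
  proof -
    have "Y x \<noteq> 0" "Y x \<noteq> 1"
      using Y[of x] pos[of x] less[of x] that a b by (auto simp: Q_def)
    then show ?thesis using Y[of x] that by auto
  qed
  have dY: "(Y has_real_derivative p x / (m\<^sup>2 * lobe z (Y x))) (at x)" if x: "a < x" "x < b" for x
  proof -
    have yx: "0 < Y x" "Y x < 1" using Yint x by auto
    have W: "lobe z (Y x) > 0" using lobe_pos yx by simp
    have sx: "\<sigma> x / m\<^sup>2 = lobe_mass z (Y x)" using Y[of x] x m by (auto simp: field_simps)
    have "DERIV g (lobe_mass z (Y x)) :> inverse (lobe z (Y x))"
    proof (rule DERIV_inverse_function[where f = "lobe_mass z" and a = 0 and b = Q])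
      show "DERIV (lobe_mass z) (g (lobe_mass z (Y x))) :> lobe z (Y x)"
        using g[of "Y x"] yx lobe_mass_deriv by auto
      show "0 < lobe_mass z (Y x)" "lobe_mass z (Y x) < Q"
        using lobe_mass_less[of 0 "Y x"] lobe_mass_less[of "Y x" 1] yx by (auto simp: Q_def)
      show "lobe_mass z (g s) = s" if "0 < s" "s < Q" for s
      proof -
        have "s \<in> lobe_mass z ` {0..1}" using that by (auto simp: img)
        then show ?thesis using g by auto
      qed
      then show "isCont g (lobe_mass z (Y x))"
        using cg \<open>0 < lobe_mass z (Y x)\<close> \<open>lobe_mass z (Y x) < Q\<close>
        by (intro continuous_on_interior[of "{0..Q}"]) (auto simp: img)
    qed (use W in auto)
    then have "DERIV g (\<sigma> x / m\<^sup>2) :> inverse (lobe z (Y x))" by (simp add: sx)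
    moreover have "((\<lambda>x. \<sigma> x / m\<^sup>2) has_real_derivative p x / m\<^sup>2) (at x)"
      by (intro DERIV_cdivide d\<sigma>) (use x a b in auto)
    ultimately have "((\<lambda>x. g (\<sigma> x / m\<^sup>2)) has_real_derivative inverse (lobe z (Y x)) * (p x / m\<^sup>2)) (at x)"
      by (rule DERIV_chain2)
    then have "(Y has_real_derivative inverse (lobe z (Y x)) * (p x / m\<^sup>2)) (at x)"
      by (rule has_field_derivative_transform_within_open[of _ _ _ "{a<..<b}"]) (use x Yg in auto)
    then show ?thesis by (simp add: field_simps)
  qed
  define \<Phi> where "\<Phi> = (\<lambda>x. - (2/3) * z\<^sup>2 * m ^ 3 * Y x + lobe_slope z (Y x) * p x ^ 3)"
  define D where "D = (\<lambda>x. - (2/3) * z\<^sup>2 * m ^ 3 * (p x / (m\<^sup>2 * lobe z (Y x)))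
      + ((2/3) * z\<^sup>2 / (lobe z (Y x)) ^ 3 * (p x / (m\<^sup>2 * lobe z (Y x))) * p x ^ 3
          + 3 * (p x)\<^sup>2 * u' x * lobe_slope z (Y x)))"
  have d\<Phi>: "(\<Phi> has_real_derivative D x) (at x)" if x: "a < x" "x < b" for x
  proof -
    have x': "0 < x" "x < X" using x a b by auto
    have d1: "((\<lambda>x. p x ^ 3) has_real_derivative 3 * (p x)\<^sup>2 * u' x) (at x)"
      unfolding p_def using DERIV_chain2[OF pos_part_power_deriv[of 3 "u x"] du[OF x']] by simp
    have d2: "((\<lambda>x. lobe_slope z (Y x)) has_real_derivative
        (2/3) * z\<^sup>2 / (lobe z (Y x)) ^ 3 * (p x / (m\<^sup>2 * lobe z (Y x)))) (at x)"
      by (rule DERIV_chain2[OF lobe_slope_deriv dY]) (use Yint[OF x] x in auto)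
    show ?thesis unfolding \<Phi>_def D_def
      by (rule DERIV_add[OF DERIV_cmult[OF dY[OF x]] DERIV_mult[OF d2 d1]])
  qed
  have le: "k x <= D x" if x: "a < x" "x < b" for x
  proof (cases "0 < u x")
    case False
    then show ?thesis by (simp add: k_def D_def p_def)
  next
    case True
      \<comment> \<open>\<open>w\<close> is the ratio of \<open>u\<close> to the scaled profile at the same mass fraction\<close>
    define W where "W = lobe z (Y x)"
    define w where "w = u x / (m * W)"
    have W: "W > 0" using lobe_pos Yint[OF x] by (simp add: W_def)
    have px: "p x = u x" using True by (simp add: p_def)
    have ux: "u x = w * m * W" using W m by (simp add: w_def)
    have "z - (1 - z) * (u' x)\<^sup>2 - 3 * lobe_slope z (Y x) * u' x <= z\<^sup>2 / W\<^sup>2"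
      unfolding W_def by (rule hamilton_jacobi) (use Yint[OF x] u1[of x] x a b in auto)
    then have "(u x)\<^sup>2 * (z - (1 - z) * (u' x)\<^sup>2 - 3 * lobe_slope z (Y x) * u' x) <= (u x)\<^sup>2 * (z\<^sup>2 / W\<^sup>2)"
      by (rule mult_left_mono) simp
    also have "(u x)\<^sup>2 * (z\<^sup>2 / W\<^sup>2) = z\<^sup>2 * m\<^sup>2 * w\<^sup>2"
      using W by (simp add: ux power_mult_distrib)
    finally have 1: "k x <= z\<^sup>2 * m\<^sup>2 * (w\<^sup>2 - 1) + 3 * lobe_slope z (Y x) * u' x * (u x)\<^sup>2"
      using True by (simp add: k_def algebra_simps)
    have 2: "D x = z\<^sup>2 * m\<^sup>2 * ((2/3) * (w ^ 4 - w)) + 3 * lobe_slope z (Y x) * u' x * (u x)\<^sup>2"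
      unfolding D_def px W_def[symmetric] using W m
      by (simp add: ux field_simps power2_eq_square power3_eq_cube power4_eq_xxxx)
    have "0 <= (w - 1)\<^sup>2 * (2 * (w + 1)\<^sup>2 + 1) / 3" by simp
    also have "\<dots> = (2/3) * (w ^ 4 - w) - (w\<^sup>2 - 1)"
      by (simp add: field_simps power2_eq_square power4_eq_xxxx)
    finally have "w\<^sup>2 - 1 <= (2/3) * (w ^ 4 - w)" by simp
    then have "z\<^sup>2 * m\<^sup>2 * (w\<^sup>2 - 1) <= z\<^sup>2 * m\<^sup>2 * ((2/3) * (w ^ 4 - w))"
      by (rule mult_left_mono) simp
    then show ?thesis using 1 2 by linarith
  qed
  \<comment> \<open>with slope at most one the mass is at least that of a triangle\<close>
  have psq: "(p x)\<^sup>2 / 2 <= \<sigma> x" if "0 <= x" "x <= X" for x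
  proof -
    have "\<sigma> 0 - (p 0)\<^sup>2 / 2 <= \<sigma> x - (p x)\<^sup>2 / 2"
    proof (rule DERIV_nonneg_imp_increasing_open[OF that(1)])
      fix t assume t: "0 < t" "t < x"
      then have t': "t < X" using that by simp
      have "((\<lambda>x. (p x)\<^sup>2) has_real_derivative 2 * p t * u' t) (at t)"
        unfolding p_def using DERIV_chain2[OF pos_part_power_deriv[of 2 "u t"] du[OF t(1) t']] by simp
      then have "((\<lambda>x. \<sigma> x - (p x)\<^sup>2 / 2) has_real_derivative p t - 2 * p t * u' t / 2) (at t)"
        by (intro DERIV_diff DERIV_cdivide d\<sigma> t t')
      moreover have "0 <= p t * (1 - u' t)" using p0[of t] u1[OF t(1) t'] by (intro mult_nonneg_nonneg) auto
      ultimately show "\<exists>y. ((\<lambda>x. \<sigma> x - (p x)\<^sup>2 / 2) has_real_derivative y) (at t) \<and> 0 <= y"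
        by (intro exI conjI) (auto simp: algebra_simps)
    qed (use that in \<open>auto intro!: continuous_intros continuous_on_subset[OF cp] continuous_on_subset[OF c\<sigma>]\<close>)
    then show ?thesis using \<sigma>0 u0 by (simp add: p_def)
  qed
  have Ya: "Y a = 0" using Y[of a] a ab m inj[of "Y a" 0] by auto
  have Yb: "Y b = 1" using Y[of b] b ab m inj[of "Y b" 1] by (auto simp: Q_def)
  have c\<Phi>: "continuous_on {a..b} \<Phi>"
  proof -
    have "continuous_on {a<..b} \<Phi>"
    proof -
      have "continuous_on {a<..b} (\<lambda>x. lobe_slope z (Y x))"
      proof (rule continuous_on_compose2[OF lobe_slope_continuous continuous_on_subset[OF cY]])
        show "Y ` {a<..b} \<subseteq> {0<..1}"
          using Yint Yb by (force simp: le_less)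
      qed auto
      then show ?thesis unfolding \<Phi>_def
        using a b by (intro continuous_intros continuous_on_subset[OF cY] continuous_on_subset[OF cp]) auto
    qed
    then have in1: "continuous (at x within {a..b}) \<Phi>" if "x \<in> {a<..b}" for x
    proof -
      have "at x within {a<..b} = at x within {a..b}"
        by (rule at_within_nhd[of _ "{a<..}"]) (use that in auto)
      then show ?thesis using \<open>continuous_on {a<..b} \<Phi>\<close> that
        by (metis continuous_on_eq_continuous_within continuous_within)
    qed
    have "continuous (at a within {a..b}) \<Phi>"
    proof -
      have Yl: "(Y \<longlongrightarrow> 0) (at a within {a..b})"
        using bspec[OF cY[unfolded continuous_on_def], of a] ab by (simp add: Ya)
      have ev: "\<forall>\<^sub>F x in at a within {a..b}. Y x < z"
        using order_tendstoD(2)[OF Yl] z by simp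
      have "((\<lambda>x. lobe_slope z (Y x) * p x ^ 3) \<longlongrightarrow> 0) (at a within {a..b})"
      proof (rule Lim_null_comparison)
        show "\<forall>\<^sub>F x in at a within {a..b}. norm (lobe_slope z (Y x) * p x ^ 3) <= m ^ 3 * ((Y x) ^ 3 + Y x)"
          unfolding eventually_at_filter
        proof (rule eventually_mono[OF ev[unfolded eventually_at_filter]], intro impI)
          fix x assume "x \<noteq> a \<longrightarrow> x \<in> {a..b} \<longrightarrow> Y x < z" and x: "x \<noteq> a" "x \<in> {a..b}"
          then have yz: "Y x < z" by blast
          have y: "0 < Y x" using Yint[of x] Yb x by (cases "x = b") auto
          have "\<sigma> x = m\<^sup>2 * ((Y x)\<^sup>2 / 2)"
            using Y[of x] lobe_mass_start[of "Y x"] x y yz by auto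
          then have "(p x)\<^sup>2 <= (m * Y x)\<^sup>2" using psq[of x] x a b by (simp add: power_mult_distrib)
          then have pm: "p x <= m * Y x" by (rule power2_le_imp_le) (use m y in simp)
          have "\<bar>2 * z - 1 - z\<^sup>2 / (Y x)\<^sup>2\<bar> <= 1 + 1 / (Y x)\<^sup>2"
          proof -
            have "z\<^sup>2 / (Y x)\<^sup>2 <= 1 / (Y x)\<^sup>2" using z by (intro divide_right_mono) (auto simp: power_le_one)
            moreover have "0 <= z\<^sup>2 / (Y x)\<^sup>2" by simp
            ultimately show ?thesis using z by linarith
          qed
          then have "\<bar>lobe_slope z (Y x)\<bar> <= 1 + 1 / (Y x)\<^sup>2"
            using yz by (simp add: lobe_slope_def)
          then have "\<bar>lobe_slope z (Y x)\<bar> * p x ^ 3 <= (1 + 1 / (Y x)\<^sup>2) * (m * Y x) ^ 3"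
            by (intro mult_mono power_mono pm) (use p0[of x] in auto)
          also have "\<dots> = m ^ 3 * ((Y x) ^ 3 + Y x)"
            using y by (simp add: field_simps power2_eq_square power3_eq_cube)
          finally show "norm (lobe_slope z (Y x) * p x ^ 3) <= m ^ 3 * ((Y x) ^ 3 + Y x)"
            using p0[of x] by (simp add: abs_mult)
        qed
        have "((\<lambda>x. m ^ 3 * ((Y x) ^ 3 + Y x)) \<longlongrightarrow> m ^ 3 * (0 ^ 3 + 0)) (at a within {a..b})"
          by (intro tendsto_intros Yl)
        then show "((\<lambda>x. m ^ 3 * ((Y x) ^ 3 + Y x)) \<longlongrightarrow> 0) (at a within {a..b})" by simp
      qed
      then have "(\<Phi> \<longlongrightarrow> - (2/3) * z\<^sup>2 * m ^ 3 * 0 + 0) (at a within {a..b})"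
        unfolding \<Phi>_def by (intro tendsto_intros Yl)
      moreover have "\<Phi> a = 0" using pa[of a] a by (simp add: \<Phi>_def Ya)
      ultimately show ?thesis by (simp add: continuous_within)
    qed
    with in1 show ?thesis
      by (auto simp: continuous_on_eq_continuous_within le_less)
  qed
  have "(D has_integral \<Phi> b - \<Phi> a) {a..b}"
    by (rule fundamental_theorem_of_calculus_interior)
      (use ab c\<Phi> d\<Phi> in \<open>auto simp: has_real_derivative_iff_has_vector_derivative[symmetric]\<close>)
  then have D: "(D has_integral \<Phi> b - \<Phi> a) {a<..<b}" by (simp add: has_integral_Icc_iff_Ioo)
  have kint: "k integrable_on {c..d}" if "{c..d} \<subseteq> {0..X}" for c d
    unfolding k_def(1) by (intro lobe_integrand_integrable continuous_on_subset[OF cu that] continuous_on_subset[OF cu' that])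
  have "(k has_integral integral {a..b} k) {a<..<b}"
    using integrable_integral[OF kint[of a b]] a b by (simp add: has_integral_Icc_iff_Ioo)
  then have "integral {a..b} k <= \<Phi> b - \<Phi> a" using has_integral_le[OF _ D] le by auto
  also have "\<Phi> b - \<Phi> a = - (2/3) * z\<^sup>2 * m ^ 3"
    using pa[of a] a by (simp add: \<Phi>_def Ya Yb)
  finally have ab_le: "integral {a..b} k <= - (2/3) * z\<^sup>2 * m ^ 3" .
  have "integral {0..a} k = 0"
    by (rule integral_unique[OF has_integral_is_0]) (use pa k0 in auto)
  moreover have "integral {b..X} k = 0"
    by (rule integral_unique[OF has_integral_spike_finite[OF _ _ has_integral_0, of "{b}"]]) (use pb k0 in auto)
  moreover have "integral {0..a} k + integral {a..X} k = integral {0..X} k"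
    by (rule Henstock_Kurzweil_Integration.integral_combine[OF a(1,2) kint]) simp
  moreover have "integral {a..b} k + integral {b..X} k = integral {a..X} k"
    by (rule Henstock_Kurzweil_Integration.integral_combine[OF less_imp_le[OF ab] b(2) kint]) (use a in auto)
  ultimately have "integral {0..X} k <= - (2/3) * z\<^sup>2 * m ^ 3" using ab_le by linarith
  then show ?thesis by (simp add: k_def(1))
qed

end

section \<open>The one-dimensional inequality\<close>

lemma integral_reflect_interval:
  fixes f :: "real => real"
  shows "integral {0..c} (\<lambda>x. f (L - x)) = integral {L - c..L} f"
proof -
  have "integral {0..c} (\<lambda>x. f (L - x)) = integral {- c..- 0} (\<lambda>x. f (x + L))"
    using Henstock_Kurzweil_Integration.integral_reflect_real[of c 0 "\<lambda>x. f (L - x)"] by (simp add: add.commute)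
  also have "\<dots> = integral {L - c..L} f"
    using integral_shift_real_ivl[of "L - c" L L f] by simp
  finally show ?thesis .
qed

text \<open>The positive part is cut at the point where half of its mass is reached; the right half is
  reflected.\<close>

lemma lobe_bound:
  fixes w w' :: "real => real"
  assumes z: "0 < z" "z <= 1" and m: "0 <= m" and L: "0 < L"
    and cw: "continuous_on {0..L} w" and cw': "continuous_on {0..L} w'"
    and dw: "\<And>x. 0 < x ==> x < L ==> (w has_real_derivative w' x) (at x)"
    and w1: "\<And>x. 0 < x ==> x < L ==> \<bar>w' x\<bar> <= 1"
    and w0: "w 0 = 0" "w L = 0"
    and mass: "integral {0..L} (\<lambda>x. max 0 (w x)) = 2 * (m\<^sup>2 * lobe_mass z 1)"
  shows "integral {0..L} (lobe_integrand z m w w') <= - (4/3) * z\<^sup>2 * m ^ 3"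
proof -
  define k where "k = lobe_integrand z m w w'"
  define p where "p = (\<lambda>x. max 0 (w x))"
  have cp: "continuous_on {0..L} p" unfolding p_def by (intro continuous_intros cw)
  have kint: "k integrable_on {0..L}" unfolding k_def by (rule lobe_integrand_integrable[OF cw cw'])
  have "integral {0..L} k <= - (4/3) * z\<^sup>2 * m ^ 3"
  proof (cases "m = 0")
    case True
    then have "integral {0..L} p = 0" using mass by (simp add: p_def)
    moreover have "p integrable_on {0..L}" by (rule integrable_continuous_real[OF cp])
    ultimately have "(p has_integral 0) (cbox 0 L)" by (simp add: has_integral_integral)
    then have "p x = 0" if "x \<in> {0..L}" for x
      by (rule has_integral_0_cbox_imp_0[rotated 2]) (use cp that L in \<open>auto simp: p_def\<close>)
    then have "k x = 0" if "x \<in> {0..L}" for x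
      using that by (force simp: k_def lobe_integrand_def p_def max_def split: if_splits)
    then have "integral {0..L} k = 0" by (intro integral_unique[OF has_integral_is_0]) auto
    then show ?thesis using True by simp
  next
    case False
    then have m: "m > 0" using m by simp
    define Q where "Q = lobe_mass z 1"
    have Q: "0 < Q" using lobe_mass_less[OF z, of 0 1] lobe_mass_0[of z] z by (simp add: Q_def)
    have cs: "continuous_on {0..L} (\<lambda>x. integral {0..x} p)"
      by (rule indefinite_integral_continuous_1[OF integrable_continuous_real[OF cp]])
    have "\<exists>x\<ge>0. x <= L \<and> integral {0..x} p = m\<^sup>2 * Q"
      by (rule IVT'[OF _ _ _ cs]) (use mass L Q in \<open>auto simp: p_def Q_def\<close>)
    then obtain c where c: "0 <= c" "c <= L" "integral {0..c} p = m\<^sup>2 * Q" by auto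
    have "integral {0..c} p + integral {c..L} p = integral {0..L} p"
      by (rule Henstock_Kurzweil_Integration.integral_combine[OF c(1,2) integrable_continuous_real[OF cp]])
    then have c2: "integral {c..L} p = m\<^sup>2 * Q" using c mass by (simp add: p_def Q_def)
    have 1: "integral {0..c} k <= - (2/3) * z\<^sup>2 * m ^ 3"
      unfolding k_def
    proof (rule half_lobe[OF z m c(1)])
      show "continuous_on {0..c} w" "continuous_on {0..c} w'"
        using c by (auto intro: continuous_on_subset[OF cw] continuous_on_subset[OF cw'])
      show "(w has_real_derivative w' x) (at x)" if "0 < x" "x < c" for x
        using dw that c by simp
      show "w' x <= 1" if "0 < x" "x < c" for x using w1[of x] that c by auto
    qed (use w0 c in \<open>simp_all add: p_def Q_def\<close>)
    have "integral {0..L - c} (\<lambda>x. k (L - x)) <= - (2/3) * z\<^sup>2 * m ^ 3"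
    proof -
      have "integral {0..L - c} (lobe_integrand z m (\<lambda>x. w (L - x)) (\<lambda>x. - w' (L - x))) <= - (2/3) * z\<^sup>2 * m ^ 3"
      proof (rule half_lobe[OF z m])
        show "continuous_on {0..L - c} (\<lambda>x. w (L - x))"
          by (rule continuous_on_compose2[OF cw]) (use c in \<open>auto intro!: continuous_intros\<close>)
        show "continuous_on {0..L - c} (\<lambda>x. - w' (L - x))"
          by (intro continuous_intros continuous_on_compose2[OF cw']) (use c in auto)
        show "((\<lambda>x. w (L - x)) has_real_derivative - w' (L - x)) (at x)" if "0 < x" "x < L - c" for x
        proof -
          have "((\<lambda>x. L - x) has_real_derivative 0 - 1) (at x)"
            by (rule DERIV_diff[OF DERIV_const DERIV_ident])
          from DERIV_chain2[OF dw this] show ?thesis using that c by simp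
        qed
        show "- w' (L - x) <= 1" if "0 < x" "x < L - c" for x
          using w1[of "L - x"] that c by auto
        show "integral {0..L - c} (\<lambda>x. max 0 (w (L - x))) = m\<^sup>2 * lobe_mass z 1"
          using c2 integral_reflect_interval[of "L - c" p L] by (simp add: p_def Q_def)
      qed (use c w0 in auto)
      then show ?thesis by (simp only: k_def lobe_integrand_def[abs_def] power2_minus)
    qed
    then have 2: "integral {c..L} k <= - (2/3) * z\<^sup>2 * m ^ 3"
      using integral_reflect_interval[of "L - c" k L] by simp
    have "integral {0..c} k + integral {c..L} k = integral {0..L} k"
      by (rule Henstock_Kurzweil_Integration.integral_combine[OF c(1,2) kint])
    then show ?thesis using 1 2 by simp
  qed
  then show ?thesis unfolding k_def .
qed

text \<open>Applied to \<open>w\<close> and \<open>- w\<close>. The constants subtracted in the two integrands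
  are both at most \<open>z\<^sup>2 (max m n)\<^sup>2\<close>, which is added back on the whole interval.\<close>

lemma two_lobes_bound:
  fixes w w' :: "real => real"
  assumes z: "0 < z" "z <= 1" and m: "0 <= m" "0 <= n" and L: "0 < L"
    and cw: "continuous_on {0..L} w" and cw': "continuous_on {0..L} w'"
    and dw: "\<And>x. 0 < x ==> x < L ==> (w has_real_derivative w' x) (at x)"
    and w1: "\<And>x. 0 < x ==> x < L ==> \<bar>w' x\<bar> <= 1"
    and w0: "w 0 = 0" "w L = 0"
    and mass: "integral {0..L} (\<lambda>x. max 0 (w x)) = 2 * (m\<^sup>2 * lobe_mass z 1)"
        "integral {0..L} (\<lambda>x. max 0 (- w x)) = 2 * (n\<^sup>2 * lobe_mass z 1)"
  shows "z * integral {0..L} (\<lambda>x. (w x)\<^sup>2) - (1 - z) * integral {0..L} (\<lambda>x. (w x)\<^sup>2 * (w' x)\<^sup>2)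
     <= z\<^sup>2 * (max m n)\<^sup>2 * L - (4/3) * z\<^sup>2 * (m ^ 3 + n ^ 3)"
proof -
  define k where "k = lobe_integrand z m w w'"
  define l where "l = lobe_integrand z n (\<lambda>x. - w x) (\<lambda>x. - w' x)"
  have k: "k integrable_on {0..L}" "integral {0..L} k <= - (4/3) * z\<^sup>2 * m ^ 3"
    unfolding k_def by (rule lobe_integrand_integrable[OF cw cw'], rule lobe_bound[OF z m(1) L cw cw' dw w1 w0 mass(1)])
  have l: "l integrable_on {0..L}" "integral {0..L} l <= - (4/3) * z\<^sup>2 * n ^ 3"
    unfolding l_def
    using lobe_integrand_integrable[OF continuous_on_minus[OF cw] continuous_on_minus[OF cw']] lobe_bound[OF z m(2) L continuous_on_minus[OF cw] continuous_on_minus[OF cw'] DERIV_minus[OF dw] _ _ _ mass(2)] w1 w0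
    by simp_all
  define F where "F = (\<lambda>x. z * (w x)\<^sup>2 - (1 - z) * ((w x)\<^sup>2 * (w' x)\<^sup>2))"
  have "integral {0..L} F <= integral {0..L} (\<lambda>x. k x + l x + z\<^sup>2 * (max m n)\<^sup>2)"
  proof (rule integral_le)
    show "F integrable_on {0..L}" unfolding F_def
      by (intro integrable_continuous_real continuous_intros cw cw')
    show "(\<lambda>x. k x + l x + z\<^sup>2 * (max m n)\<^sup>2) integrable_on {0..L}"
      by (intro integrable_add k l integrable_const_ivl)
    have mn: "z\<^sup>2 * m\<^sup>2 <= z\<^sup>2 * (max m n)\<^sup>2" "z\<^sup>2 * n\<^sup>2 <= z\<^sup>2 * (max m n)\<^sup>2"
      using m by (auto intro!: mult_left_mono power_mono)
    show "F x <= k x + l x + z\<^sup>2 * (max m n)\<^sup>2" for x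
      using mn by (cases "w x" "0::real" rule: linorder_cases) (auto simp: F_def k_def l_def lobe_integrand_def)
  qed
  also have "integral {0..L} F = z * integral {0..L} (\<lambda>x. (w x)\<^sup>2) - (1 - z) * integral {0..L} (\<lambda>x. (w x)\<^sup>2 * (w' x)\<^sup>2)"
  proof -
    have "integral {0..L} F = integral {0..L} (\<lambda>x. z * (w x)\<^sup>2) - integral {0..L} (\<lambda>x. (1 - z) * ((w x)\<^sup>2 * (w' x)\<^sup>2))"
      unfolding F_def by (rule integral_diff) (intro integrable_continuous_real continuous_intros cw cw')+
    then show ?thesis by simp
  qed
  also have "integral {0..L} (\<lambda>x. k x + l x + z\<^sup>2 * (max m n)\<^sup>2) = integral {0..L} k + integral {0..L} l + z\<^sup>2 * (max m n)\<^sup>2 * L"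
  proof -
    have "integral {0..L} (\<lambda>x. k x + l x + z\<^sup>2 * (max m n)\<^sup>2)
        = integral {0..L} (\<lambda>x. k x + l x) + integral {0..L} (\<lambda>_. z\<^sup>2 * (max m n)\<^sup>2)"
      by (intro integral_add integrable_add k l integrable_const_ivl)
    also have "integral {0..L} (\<lambda>x. k x + l x) = integral {0..L} k + integral {0..L} l"
      by (intro integral_add k l)
    finally show ?thesis using L by simp
  qed
  finally have "z * integral {0..L} (\<lambda>x. (w x)\<^sup>2) - (1 - z) * integral {0..L} (\<lambda>x. (w x)\<^sup>2 * (w' x)\<^sup>2)
      <= integral {0..L} k + integral {0..L} l + z\<^sup>2 * (max m n)\<^sup>2 * L" .
  moreover have "(4/3) * z\<^sup>2 * (m ^ 3 + n ^ 3) = (4/3) * z\<^sup>2 * m ^ 3 + (4/3) * z\<^sup>2 * n ^ 3"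
    by (simp add: distrib_left)
  ultimately show ?thesis using k(2) l(2) by linarith
qed

lemma borel_measurable_lebesgue_onI:
  fixes f :: "'a::euclidean_space => 'b::topological_space"
  assumes "f \<in> borel_measurable borel"
  shows "f \<in> borel_measurable (lebesgue_on S)"
proof -
  have "f \<in> borel_measurable lborel" using assms by simp
  then have "f \<in> borel_measurable lebesgue" by (rule measurable_completion)
  then show ?thesis by (rule measurable_restrict_space1)
qed

lemma sq_mult_bound:
  fixes a b :: real
  assumes "\<bar>a\<bar> <= A" "\<bar>b\<bar> <= 1"
  shows "\<bar>a\<^sup>2 * b\<^sup>2\<bar> <= A\<^sup>2"
proof -
  have "a\<^sup>2 <= A\<^sup>2" "b\<^sup>2 <= 1" using power_mono[OF assms(1) abs_ge_zero, of 2] power_mono[OF assms(2) abs_ge_zero, of 2] by auto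
  then have "a\<^sup>2 * b\<^sup>2 <= A\<^sup>2 * 1" by (intro mult_mono) auto
  then show ?thesis by simp
qed

text \<open>Bounded Borel functions are the common ground on which the gauge integral and the Lebesgue
  integral agree below.\<close>

lemma bounded_borel_integrable:
  fixes f :: "real => real"
  assumes "f \<in> borel_measurable borel" "\<And>x. x \<in> {a..b} ==> \<bar>f x\<bar> <= C"
  shows "f absolutely_integrable_on {a..b}" "f integrable_on {a..b}"
proof -
  show "f absolutely_integrable_on {a..b}"
    by (rule measurable_bounded_by_integrable_imp_absolutely_integrable[where g = "\<lambda>_. C"])
      (use assms in \<open>auto intro: borel_measurable_lebesgue_onI\<close>)
  then show "f integrable_on {a..b}" by (rule set_lebesgue_integral_eq_integral)
qed

lemma bounded_convergence_interval:
  fixes f :: "nat => real => real"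
  assumes "\<And>n. f n \<in> borel_measurable borel" "g \<in> borel_measurable borel"
    and bd: "\<And>n x. x \<in> {a..b} ==> \<bar>f n x\<bar> <= C" and N: "negligible N"
    and lim: "\<And>x. x \<in> {a..b} - N ==> (\<lambda>n. f n x) \<longlonglongrightarrow> g x"
  shows "(\<lambda>n. integral {a..b} (f n)) \<longlonglongrightarrow> integral {a..b} g"
proof -
  define f' where "f' = (\<lambda>n x. if x \<in> N then 0 else f n x)"
  define g' where "g' = (\<lambda>x. if x \<in> N then 0 else g x)"
  have e: "integral {a..b} (f' n) = integral {a..b} (f n)" for n
    by (rule integral_spike[OF N]) (simp add: f'_def)
  have e2: "integral {a..b} g' = integral {a..b} g"
    by (rule integral_spike[OF N]) (simp add: g'_def)
  have "(\<lambda>n. integral {a..b} (f' n)) \<longlonglongrightarrow> integral {a..b} g'"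
  proof (rule dominated_convergence(2)[where h = "\<lambda>_. \<bar>C\<bar>"])
    show "f' n integrable_on {a..b}" for n
      by (rule integrable_spike[OF bounded_borel_integrable(2)[OF assms(1) bd] N]) (auto simp: f'_def)
    show "norm (f' n x) <= \<bar>C\<bar>" if "x \<in> {a..b}" for n x
      using bd[OF that, of n] by (auto simp: f'_def)
    show "(\<lambda>n. f' n x) \<longlonglongrightarrow> g' x" if "x \<in> {a..b}" for x
      using lim[of x] that by (auto simp: f'_def g'_def)
  qed auto
  then show ?thesis by (simp add: e e2)
qed

text \<open>The optimum \<open>m = L / 4\<close> is a double root of the difference; it is where the constant
  48 comes from.\<close>

lemma lobe_optimum:
  fixes m L :: real
  assumes "0 <= m" "0 < L"
  shows "m\<^sup>2 * L - (8/3) * m ^ 3 <= L ^ 3 / 48"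
proof -
  have "0 <= (L - 4 * m)\<^sup>2 * (L + 8 * m) / 48" using assms by simp
  also have "\<dots> = L ^ 3 / 48 - (m\<^sup>2 * L - (8/3) * m ^ 3)"
    by (simp add: field_simps power2_eq_square power3_eq_cube)
  finally show ?thesis by simp
qed

definition prim :: "(real => real) => real => real" where
  "prim g x = integral {0..x} g"

lemma prim_lipschitz:
  fixes g :: "real => real"
  assumes g: "g \<in> borel_measurable borel" "\<And>x. \<bar>g x\<bar> <= C"
  shows "\<bar>prim g x - prim g y\<bar> <= C * \<bar>x - y\<bar>"
proof -
  have C: "0 <= C" using g(2)[of 0] by (meson abs_ge_zero order_trans)
  have *: "\<bar>prim g y - prim g x\<bar> <= C * \<bar>y - x\<bar>" if "x <= y" for x y
  proof (cases "0 <= x")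
    case True
    have "integral {0..x} g + integral {x..y} g = integral {0..y} g"
      by (rule Henstock_Kurzweil_Integration.integral_combine[OF True that bounded_borel_integrable(2)[OF g(1,2)]])
    moreover have "norm (integral {x..y} g) <= integral {x..y} (\<lambda>_. C)"
      by (rule integral_norm_bound_integral[OF bounded_borel_integrable(2)[OF g(1,2)]]) (use g in auto)
    ultimately show ?thesis using that by (simp add: prim_def mult.commute abs_le_iff)
  next
    case False
    then have x: "prim g x = 0" by (simp add: prim_def)
    show ?thesis
    proof (cases "0 <= y")
      case True
      have "norm (integral {0..y} g) <= integral {0..y} (\<lambda>_. C)"
        by (rule integral_norm_bound_integral[OF bounded_borel_integrable(2)[OF g(1,2)]]) (use g in auto)
      also have "\<dots> = C * y" using True by simp
      also have "\<dots> <= C * \<bar>y - x\<bar>" using C False that by (intro mult_left_mono) auto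
      finally show ?thesis by (simp add: x) (simp add: prim_def)
    next
      case False
      then have "prim g y = 0" by (simp add: prim_def)
      then show ?thesis using x C by simp
    qed
  qed
  show ?thesis using *[of x y] *[of y x] by (cases "x <= y") (auto simp: abs_minus_commute)
qed

lemma prim_continuous:
  assumes g: "g \<in> borel_measurable borel" "\<And>x. \<bar>g x\<bar> <= C"
  shows "continuous_on S (prim g)"
proof (rule lipschitz_on_continuous_on[of "\<bar>C\<bar>"], rule lipschitz_onI)
  show "dist (prim g x) (prim g y) <= \<bar>C\<bar> * dist x y" for x y
    using prim_lipschitz[OF g, of x y] g(2)[of 0] by (simp add: dist_real_def)
qed auto

lemma prim_bound:
  assumes g: "g \<in> borel_measurable borel" "\<And>x. \<bar>g x\<bar> <= C" and "x \<in> {0..L}"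
  shows "\<bar>prim g x\<bar> <= C * L"
proof -
  have C: "0 <= C" using g(2)[of 0] by (meson abs_ge_zero order_trans)
  have "prim g 0 = 0" by (simp add: prim_def)
  then have "\<bar>prim g x\<bar> <= C * \<bar>x\<bar>" using prim_lipschitz[OF g, of x 0] by simp
  also have "\<dots> <= C * L" using assms C by (intro mult_left_mono) auto
  finally show ?thesis .
qed

lemma borel_prim [measurable]:
  assumes g: "g \<in> borel_measurable borel" "\<And>x. \<bar>g x\<bar> <= C"
  shows "prim g \<in> borel_measurable borel"
  by (rule borel_measurable_continuous_onI[OF prim_continuous[OF g]])

text \<open>Measurability gives continuous functions converging almost everywhere; clipping them preserves the
  limit and the bound.\<close>

lemma bounded_continuous_approximation:
  fixes g :: "'a::euclidean_space => real"
  assumes K: "K \<in> sets lebesgue" and g: "g \<in> borel_measurable (lebesgue_on K)" "\<And>x. \<bar>g x\<bar> <= C"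
  shows "\<exists>N c. negligible N \<and> (\<forall>n::nat. continuous_on UNIV (c n)) \<and> (\<forall>n x. \<bar>c n x\<bar> <= C) \<and> (\<forall>x\<in>K - N. (\<lambda>n. c n x) \<longlonglongrightarrow> g x)"
proof -
  have "g measurable_on K" using g(1) K by (subst measurable_on_iff_borel_measurable)
  then obtain N h where N: "negligible N" and ch: "\<And>n::nat. continuous_on UNIV (h n)"
    and h: "\<And>x. x \<notin> N ==> (\<lambda>n. h n x) \<longlonglongrightarrow> (if x \<in> K then g x else 0)"
    unfolding measurable_on_def by blast
  have C: "0 <= C" using g(2) by (meson abs_ge_zero order_trans)
  have "(\<lambda>n. max (- C) (min C (h n x))) \<longlonglongrightarrow> g x" if "x \<in> K - N" for x
  proof -
    have "(\<lambda>n. max (- C) (min C (h n x))) \<longlonglongrightarrow> max (- C) (min C (g x))"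
      using h[of x] that by (intro tendsto_intros) auto
    moreover have "max (- C) (min C (g x)) = g x" using g(2)[of x] by (auto simp: max_def min_def)
    ultimately show ?thesis by simp
  qed
  then show ?thesis using N C
    by (intro exI[of _ N] exI[of _ "\<lambda>n x. max (- C) (min C (h n x))"]) (auto intro!: continuous_intros ch)
qed

text \<open>The case in which \<open>w\<close> vanishes at the ends. The lobe estimates need a continuous
  derivative, so \<open>g\<close> is replaced by bounded continuous functions converging to it almost
  everywhere, corrected to have mean zero. As \<open>w\<close> has mean zero, the masses of its positive and
  negative part agree in the limit, and four half lobes of the same scale \<open>m\<close> contribute
  \<open>z\<^sup>2 (m\<^sup>2 L - (8/3) m\<^sup>3)\<close>.\<close>

lemma transport_inequality_pinned:
  fixes g :: "real => real"
  assumes z: "0 < z" "z <= 1" and L: "0 < L"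
    and g: "g \<in> borel_measurable borel" "\<And>x. \<bar>g x\<bar> <= 1"
    and g0: "integral {0..L} g = 0" and w0: "integral {0..L} (prim g) = 0"
  shows "z * integral {0..L} (\<lambda>x. (prim g x)\<^sup>2) - (1 - z) * integral {0..L} (\<lambda>x. (prim g x)\<^sup>2 * (g x)\<^sup>2)
     <= L ^ 3 / 48 * z\<^sup>2"
proof -
  have "\<exists>N c. negligible N \<and> (\<forall>n::nat. continuous_on UNIV (c n)) \<and> (\<forall>n x. \<bar>c n x\<bar> <= 1) \<and> (\<forall>x\<in>{0..L} - N. (\<lambda>n. c n x) \<longlonglongrightarrow> g x)"
    by (rule bounded_continuous_approximation[OF _ borel_measurable_lebesgue_onI[OF g(1)] g(2)]) simp
  then obtain N c where N: "negligible N" and cU: "\<And>n::nat. continuous_on UNIV (c n)" and c1: "\<And>n x. \<bar>c n x\<bar> <= 1"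
    and climit: "\<And>x. x \<in> {0..L} - N ==> (\<lambda>n. c n x) \<longlonglongrightarrow> g x" by blast
  have cc: "continuous_on S (c n)" for n S by (rule continuous_on_subset[OF cU]) simp
  have cb: "c n \<in> borel_measurable borel" for n
    by (rule borel_measurable_continuous_onI[OF cc])
  define a where "a = (\<lambda>n. integral {0..L} (c n) / L)"
  have a0: "a \<longlonglongrightarrow> 0"
  proof -
    have "(\<lambda>n. integral {0..L} (c n)) \<longlonglongrightarrow> integral {0..L} g"
      by (rule bounded_convergence_interval[OF cb g(1) c1 N climit])
    from tendsto_divide[OF this tendsto_const[of L]] show ?thesis using L g0 by (simp add: a_def)
  qed
  define G where "G = (\<lambda>n x. (c n x - a n) / (1 + \<bar>a n\<bar>))"
  have cG: "continuous_on S (G n)" for n S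
    unfolding G_def by (intro continuous_intros cc) (auto simp: add_nonneg_eq_0_iff)
  have G1: "\<bar>G n x\<bar> <= 1" for n x
  proof -
    have "\<bar>c n x - a n\<bar> <= 1 + \<bar>a n\<bar>" using c1[of n x] by linarith
    then show ?thesis by (simp add: G_def abs_divide divide_le_eq)
  qed
  have Gb: "G n \<in> borel_measurable borel" for n
    by (rule borel_measurable_continuous_onI[OF cG])
  have Glim: "(\<lambda>n. G n x) \<longlonglongrightarrow> g x" if "x \<in> {0..L} - N" for x
  proof -
    have "(\<lambda>n. G n x) \<longlonglongrightarrow> (g x - 0) / (1 + \<bar>0\<bar>)"
      unfolding G_def by (intro tendsto_intros climit that a0) auto
    then show ?thesis by simp
  qed
  have GL: "integral {0..L} (G n) = 0" for n
  proof -
    have "integral {0..L} (\<lambda>x. c n x - a n) = integral {0..L} (c n) - L * a n"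
      using L by (subst integral_diff) (auto intro!: integrable_continuous_real cc)
    also have "\<dots> = 0" using L by (simp add: a_def)
    finally show ?thesis by (simp add: G_def)
  qed
  define w where "w = (\<lambda>n. prim (G n))"
  have wb: "w n \<in> borel_measurable borel" for n
    unfolding w_def by (rule borel_prim[OF Gb G1])
  have gb: "prim g \<in> borel_measurable borel" by (rule borel_prim[OF g])
  have w1: "\<bar>w n x\<bar> <= L" if "x \<in> {0..L}" for n x
    using prim_bound[OF Gb G1 that] by (simp add: w_def)
  have wlim: "(\<lambda>n. w n x) \<longlonglongrightarrow> prim g x" if "x \<in> {0..L}" for x
    unfolding w_def prim_def
    by (rule bounded_convergence_interval[OF Gb g(1) G1 N Glim]) (use that in auto)
  have W2: "(\<lambda>n. integral {0..L} (\<lambda>x. (w n x)\<^sup>2)) \<longlonglongrightarrow> integral {0..L} (\<lambda>x. (prim g x)\<^sup>2)"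
  proof (rule bounded_convergence_interval[where C = "L\<^sup>2" and N = "{}"])
    show "\<bar>(w n x)\<^sup>2\<bar> <= L\<^sup>2" if "x \<in> {0..L}" for n x
      using power_mono[OF w1[OF that, of n] abs_ge_zero, of 2] by simp
  qed (use wb gb wlim in \<open>auto intro!: tendsto_intros\<close>)
  have W3: "(\<lambda>n. integral {0..L} (\<lambda>x. (w n x)\<^sup>2 * (G n x)\<^sup>2)) \<longlonglongrightarrow> integral {0..L} (\<lambda>x. (prim g x)\<^sup>2 * (g x)\<^sup>2)"
  proof (rule bounded_convergence_interval[where C = "L\<^sup>2" and N = N])
    show "\<bar>(w n x)\<^sup>2 * (G n x)\<^sup>2\<bar> <= L\<^sup>2" if "x \<in> {0..L}" for n x
      by (rule sq_mult_bound[OF w1[OF that] G1])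
    show "(\<lambda>n. (w n x)\<^sup>2 * (G n x)\<^sup>2) \<longlonglongrightarrow> (prim g x)\<^sup>2 * (g x)\<^sup>2" if "x \<in> {0..L} - N" for x
      using wlim[of x] Glim[OF that] that by (auto intro!: tendsto_intros)
  qed (use wb gb Gb g N in \<open>auto\<close>)
  have P: "(\<lambda>n. integral {0..L} (\<lambda>x. max 0 (s * w n x))) \<longlonglongrightarrow> integral {0..L} (\<lambda>x. max 0 (s * prim g x))"
    if "\<bar>s\<bar> = 1" for s
  proof (rule bounded_convergence_interval[where C = L and N = "{}"])
    show "\<bar>max 0 (s * w n x)\<bar> <= L" if "x \<in> {0..L}" for n x
      using w1[OF that, of n] \<open>\<bar>s\<bar> = 1\<close> L abs_mult[of s "w n x"] by (auto simp: max_def)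
  qed (use wb gb wlim in \<open>auto intro!: tendsto_intros\<close>)
  define Q where "Q = lobe_mass z 1"
  have Q: "0 < Q" using lobe_mass_less[OF z, of 0 1] lobe_mass_0[of z] z by (simp add: Q_def)
  define m where "m = (\<lambda>n. sqrt (integral {0..L} (\<lambda>x. max 0 (1 * w n x)) / (2 * Q)))"
  define l where "l = (\<lambda>n. sqrt (integral {0..L} (\<lambda>x. max 0 (- 1 * w n x)) / (2 * Q)))"
  define M where "M = sqrt (integral {0..L} (\<lambda>x. max 0 (1 * prim g x)) / (2 * Q))"
  have same: "integral {0..L} (\<lambda>x. max 0 (- 1 * prim g x)) = integral {0..L} (\<lambda>x. max 0 (1 * prim g x))"
  proof -
    have i: "(\<lambda>x. max 0 (s * prim g x)) integrable_on {0..L}" for s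
      by (intro integrable_continuous_real continuous_intros prim_continuous[OF g])
    have "integral {0..L} (\<lambda>x. max 0 (1 * prim g x)) - integral {0..L} (\<lambda>x. max 0 (- 1 * prim g x))
        = integral {0..L} (\<lambda>x. max 0 (1 * prim g x) - max 0 (- 1 * prim g x))"
      by (rule integral_diff[symmetric]) (rule i)+
    also have "(\<lambda>x. max 0 (1 * prim g x) - max 0 (- 1 * prim g x)) = prim g" by (auto simp: max_def)
    finally show ?thesis using w0 by simp
  qed
  have ml: "m \<longlonglongrightarrow> M" "l \<longlonglongrightarrow> M"
  proof -
    show "m \<longlonglongrightarrow> M" unfolding m_def M_def
      by (intro tendsto_real_sqrt tendsto_divide P tendsto_const) (use Q in auto)
    show "l \<longlonglongrightarrow> M" unfolding l_def M_def same[symmetric]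
      by (intro tendsto_real_sqrt tendsto_divide P tendsto_const) (use Q in auto)
  qed
  have nn: "0 <= integral {0..L} (\<lambda>x. max 0 (s * w n x))" for s n
    by (rule Henstock_Kurzweil_Integration.integral_nonneg)
      (auto simp: w_def intro!: integrable_continuous_real continuous_intros prim_continuous[OF Gb G1])
  have M0: "0 <= M" unfolding M_def using Q
    by (auto intro!: divide_nonneg_pos Henstock_Kurzweil_Integration.integral_nonneg integrable_continuous_real continuous_intros prim_continuous[OF g])
  have le: "z * integral {0..L} (\<lambda>x. (w n x)\<^sup>2) - (1 - z) * integral {0..L} (\<lambda>x. (w n x)\<^sup>2 * (G n x)\<^sup>2)
      <= z\<^sup>2 * (max (m n) (l n))\<^sup>2 * L - (4/3) * z\<^sup>2 * (m n ^ 3 + l n ^ 3)" for n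
  proof (rule two_lobes_bound[OF z _ _ L])
    show "0 <= m n" "0 <= l n" using nn[of 1 n] nn[of "-1" n] Q by (simp_all add: m_def l_def)
    show "continuous_on {0..L} (w n)" unfolding w_def by (rule prim_continuous[OF Gb G1])
    show "(w n has_real_derivative G n x) (at x)" if "0 < x" "x < L" for x
    proof -
      have "(w n has_real_derivative G n x) (at x within {0..L})"
        unfolding w_def prim_def using that by (intro integral_has_real_derivative cG) auto
      then show ?thesis using that by (simp add: at_within_Icc_at)
    qed
    show "w n 0 = 0" "w n L = 0" using GL by (simp_all add: w_def prim_def)
    show "integral {0..L} (\<lambda>x. max 0 (w n x)) = 2 * ((m n)\<^sup>2 * lobe_mass z 1)"
      using nn[of 1 n] Q by (simp add: m_def Q_def)
    show "integral {0..L} (\<lambda>x. max 0 (- w n x)) = 2 * ((l n)\<^sup>2 * lobe_mass z 1)"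
      using nn[of "-1" n] Q by (simp add: l_def Q_def)
  qed (use cG G1 in auto)
  have "z * integral {0..L} (\<lambda>x. (prim g x)\<^sup>2) - (1 - z) * integral {0..L} (\<lambda>x. (prim g x)\<^sup>2 * (g x)\<^sup>2)
      <= z\<^sup>2 * (max M M)\<^sup>2 * L - (4/3) * z\<^sup>2 * (M ^ 3 + M ^ 3)"
    by (rule LIMSEQ_le[OF tendsto_diff[OF tendsto_mult[OF tendsto_const W2] tendsto_mult[OF tendsto_const W3]]
          tendsto_diff[OF tendsto_mult[OF tendsto_mult[OF tendsto_const tendsto_power[OF tendsto_max[OF ml]]] tendsto_const]
             tendsto_mult[OF tendsto_const tendsto_add[OF tendsto_power[OF ml(1)] tendsto_power[OF ml(2)]]]]])
      (use le in auto)
  also have "\<dots> = z\<^sup>2 * (M\<^sup>2 * L - (8/3) * M ^ 3)" by (simp add: algebra_simps)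
  also have "\<dots> <= z\<^sup>2 * (L ^ 3 / 48)" by (intro mult_left_mono lobe_optimum M0 L) simp
  finally show ?thesis by (simp add: mult.commute)
qed

text \<open>A function of mean zero has a zero on the period; rotating the circle moves that zero to the ends
  of the interval.\<close>

lemma transport_inequality:
  fixes g :: "real => real"
  assumes z: "0 <= z" "z <= 1" and L: "0 < L"
    and g: "g \<in> borel_measurable borel" "\<And>x. \<bar>g x\<bar> <= 1"
    and g0: "integral {0..L} g = 0" and w0: "integral {0..L} (\<lambda>x. c + prim g x) = 0"
  shows "z * integral {0..L} (\<lambda>x. (c + prim g x)\<^sup>2) - (1 - z) * integral {0..L} (\<lambda>x. (c + prim g x)\<^sup>2 * (g x)\<^sup>2)
     <= L ^ 3 / 48 * z\<^sup>2"
proof (cases "z = 0")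
  case True
  have "0 <= integral {0..L} (\<lambda>x. (c + prim g x)\<^sup>2 * (g x)\<^sup>2)"
    by (cases "(\<lambda>x. (c + prim g x)\<^sup>2 * (g x)\<^sup>2) integrable_on {0..L}") (auto intro: Henstock_Kurzweil_Integration.integral_nonneg simp: not_integrable_integral)
  then show ?thesis using True by simp
next
  case False
  then have z: "0 < z" "z <= 1" using z by auto
  define w where "w = (\<lambda>x. c + prim g x)"
  have cw: "continuous_on S w" for S unfolding w_def by (intro continuous_intros prim_continuous[OF g])
  have "\<exists>x\<in>{0..L}. w x = 0"
  proof (rule ccontr)
    assume no: "\<not> ?thesis"
    have con: "connected (w ` {0..L})" by (rule connected_continuous_image[OF cw]) simp
    have "(\<forall>x\<in>{0..L}. 0 < w x) \<or> (\<forall>x\<in>{0..L}. 0 < - w x)"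
    proof (rule ccontr)
      assume "\<not> ?thesis"
      then obtain x y where xy: "x \<in> {0..L}" "y \<in> {0..L}" "w x <= 0" "0 <= w y" by force
      then have "0 \<in> w ` {0..L}" using connectedD_interval[OF con, of "w x" "w y" 0] by blast
      then show False using no by auto
    qed
    moreover have False if "\<forall>x\<in>{0..L}. 0 < s * w x" for s
    proof -
      have "integral {0..L} (\<lambda>x. s * w x) = 0" using w0 by (simp add: w_def)
      moreover have "(\<lambda>x. s * w x) integrable_on {0..L}" by (intro integrable_continuous_real continuous_intros cw)
      ultimately have "((\<lambda>x. s * w x) has_integral 0) (cbox 0 L)" using integrable_integral[of "\<lambda>x. s * w x" "{0..L}"] by (simp only: cbox_interval)
      then have "s * w 0 = 0"
        by (rule has_integral_0_cbox_imp_0[rotated 2]) (use that L in \<open>auto intro!: continuous_intros cw less_imp_le\<close>)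
      then show False using that L by force
    qed
    from this[of 1] this[of "- 1"] show False using calculation by auto
  qed
  then obtain a where a: "0 <= a" "a <= L" "w a = 0" by auto
  \<comment> \<open>the rotation of the circle that moves the zero \<open>a\<close> to the origin\<close>
  define r where "r = (\<lambda>x. if x <= L - a then x + a else x + a - L)"
  have rot: "integral {0..L} (\<lambda>x. f (r x)) = integral {0..L} f" if f: "f integrable_on {0..L}" for f :: "real => real"
  proof -
    have fa: "f integrable_on {a..L}" "f integrable_on {0..a}"
      using a by (auto intro: integrable_on_subinterval[OF f])
    have 1: "((\<lambda>x. f (x + a)) has_integral integral {a..L} f) {0..L - a}"
      using has_integral_shift_real_ivl[OF integrable_integral[OF fa(1)], of a] by simp
    have 2: "((\<lambda>x. f (x + (a - L))) has_integral integral {0..a} f) {L - a..L}"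
      using has_integral_shift_real_ivl[OF integrable_integral[OF fa(2)], of "a - L"] by simp
    have r1: "((\<lambda>x. f (r x)) has_integral integral {a..L} f) {0..L - a}"
      by (rule has_integral_eq[OF _ 1]) (simp add: r_def)
    have r2: "((\<lambda>x. f (r x)) has_integral integral {0..a} f) {L - a..L}"
      by (rule has_integral_spike_finite[OF _ _ 2, of "{L - a}"]) (auto simp: r_def algebra_simps)
    have "((\<lambda>x. f (r x)) has_integral (integral {a..L} f + integral {0..a} f)) {0..L}"
      by (rule has_integral_combine[OF _ _ r1 r2]) (use a in auto)
    moreover have "integral {0..a} f + integral {a..L} f = integral {0..L} f"
      by (rule Henstock_Kurzweil_Integration.integral_combine[OF a(1,2) f])
    ultimately show ?thesis by (simp add: integral_unique add.commute)
  qed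
  define G where "G = (\<lambda>x. g (r x))"
  have rb: "r \<in> borel_measurable borel" unfolding r_def by measurable
  have Gb: "G \<in> borel_measurable borel" unfolding G_def by (rule measurable_compose[OF rb g(1)])
  have G1: "\<bar>G x\<bar> <= 1" for x by (simp add: G_def g)
  have gi: "g integrable_on {x..y}" for x y by (rule bounded_borel_integrable(2)[OF g])
  have Gi: "G integrable_on {x..y}" for x y by (rule bounded_borel_integrable(2)[OF Gb G1])
  have wd: "w y - w x = integral {x..y} g" if "0 <= x" "x <= y" for x y
    using Henstock_Kurzweil_Integration.integral_combine[OF that gi] by (simp add: w_def prim_def)
  have wL: "w L = w 0" using wd[of 0 L] L g0 by simp
  have P: "prim G x = w (r x)" if x: "x \<in> {0..L}" for x
  proof -
    have first: "prim G x = w (x + a)" if "0 <= x" "x <= L - a" for x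
    proof -
      have "prim G x = integral {0..x} (\<lambda>x. g (x + a))"
        unfolding prim_def G_def by (rule integral_cong) (use that in \<open>auto simp: r_def\<close>)
      also have "\<dots> = integral {a..x + a} g" using integral_shift_real_ivl[of a a "x + a" g] by simp
      also have "\<dots> = w (x + a)" using wd[of a "x + a"] a that by simp
      finally show ?thesis .
    qed
    show ?thesis
    proof (cases "x <= L - a")
      case True then show ?thesis using first[of x] x by (simp add: r_def)
    next
      case False
      have "prim G x = prim G (L - a) + integral {L - a..x} G"
        unfolding prim_def
        by (rule Henstock_Kurzweil_Integration.integral_combine[symmetric, OF _ _ Gi]) (use a False in auto)
      also have "prim G (L - a) = w L" using first[of "L - a"] a by simp
      also have "integral {L - a..x} G = integral {L - a..x} (\<lambda>x. g (x + (a - L)))"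
        by (rule integral_spike[of "{L - a}"]) (auto simp: G_def r_def algebra_simps)
      also have "\<dots> = integral {0..x + a - L} g"
        using integral_shift_real_ivl[of 0 "a - L" "x + a - L" g] by simp
      also have "\<dots> = w (x + a - L) - w 0" using wd[of 0 "x + a - L"] False by simp
      finally show ?thesis using wL False by (simp add: r_def)
    qed
  qed
  have i1: "(\<lambda>x. (w x)\<^sup>2) integrable_on {0..L}" by (intro integrable_continuous_real continuous_intros cw)
  have i2: "(\<lambda>x. (w x)\<^sup>2 * (g x)\<^sup>2) integrable_on {0..L}"
  proof -
    have "bounded (w ` {0..L})" by (rule compact_imp_bounded[OF compact_continuous_image[OF cw compact_Icc]])
    then obtain B where B: "\<And>x. x \<in> {0..L} ==> \<bar>w x\<bar> <= B"
      unfolding bounded_iff by force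
    show ?thesis
    proof (rule bounded_borel_integrable(2)[where C = "B\<^sup>2"])
      show "(\<lambda>x. (w x)\<^sup>2 * (g x)\<^sup>2) \<in> borel_measurable borel"
        using borel_measurable_continuous_onI[OF cw] g by measurable
      show "\<bar>(w x)\<^sup>2 * (g x)\<^sup>2\<bar> <= B\<^sup>2" if "x \<in> {0..L}" for x
        by (rule sq_mult_bound[OF B[OF that] g(2)])
    qed
  qed
  have "z * integral {0..L} (\<lambda>x. (prim G x)\<^sup>2) - (1 - z) * integral {0..L} (\<lambda>x. (prim G x)\<^sup>2 * (G x)\<^sup>2)
     <= L ^ 3 / 48 * z\<^sup>2"
  proof (rule transport_inequality_pinned[OF z L Gb G1])
    show "integral {0..L} G = 0" unfolding G_def by (simp add: rot[OF gi] g0)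
    have "integral {0..L} (prim G) = integral {0..L} (\<lambda>x. w (r x))"
      by (rule integral_cong) (simp add: P)
    also have "\<dots> = integral {0..L} w" by (rule rot) (intro integrable_continuous_real cw)
    also have "\<dots> = 0" using w0 by (simp add: w_def)
    finally show "integral {0..L} (prim G) = 0" .
  qed
  also have "integral {0..L} (\<lambda>x. (prim G x)\<^sup>2) = integral {0..L} (\<lambda>x. (w (r x))\<^sup>2)"
    by (rule integral_cong) (simp add: P)
  also have "\<dots> = integral {0..L} (\<lambda>x. (w x)\<^sup>2)" by (rule rot[OF i1])
  also have "integral {0..L} (\<lambda>x. (prim G x)\<^sup>2 * (G x)\<^sup>2) = integral {0..L} (\<lambda>x. (w (r x))\<^sup>2 * (g (r x))\<^sup>2)"
    by (rule integral_cong) (simp only: P, simp only: G_def)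
  also have "\<dots> = integral {0..L} (\<lambda>x. (w x)\<^sup>2 * (g x)\<^sup>2)" by (rule rot[OF i2])
  finally show ?thesis by (simp add: w_def)
qed

section \<open>Trigonometric polynomials and test functions\<close>

text \<open>Smoothness by coinduction: a class of functions closed under taking directional derivatives
  consists of smooth functions.\<close>

lemma C_infinity_coinduct:
  fixes f :: "'a::real_normed_vector => 'b::real_normed_vector"
  assumes "f \<in> F"
    and step: "\<And>f. f \<in> F ==> \<exists>f'. (\<forall>x. (f has_derivative f' x) (at x)) \<and> (\<forall>h. (\<lambda>x. f' x h) \<in> F)"
  shows "C_infinity f"
proof -
  have "\<forall>f\<in>F. C_k k f" for k
  proof (induction k)
    case 0
    show ?case
    proof
      fix f assume "f \<in> F"
      then obtain f' where "\<And>x. (f has_derivative f' x) (at x)" using step by blast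
      then have "\<forall>x\<in>UNIV. isCont f x" by (blast intro: has_derivative_continuous)
      then have "continuous_on UNIV f" by (rule continuous_at_imp_continuous_on)
      then show "C_k 0 f" by simp
    qed
  next
    case (Suc k)
    show ?case
    proof
      fix f assume "f \<in> F"
      then obtain f' where f': "\<And>x. (f has_derivative f' x) (at x)" "\<And>h. (\<lambda>x. f' x h) \<in> F"
        using step by blast
      have "frechet_derivative f (at x) = f' x" for x
        using frechet_derivative_at[OF f'(1)] by simp
      then show "C_k (Suc k) f" using f' Suc by (auto simp: differentiable_def)
    qed
  qed
  then show ?thesis using assms(1) by (simp add: C_infinity_def)
qed

text \<open>The frequencies of waves that are periodic with period \<open>L\<close> in every coordinate.\<close>

definition lattice :: "real => 'a::euclidean_space set" where
  "lattice L = {\<kappa>. \<forall>b\<in>Basis. \<exists>k::int. \<kappa> \<bullet> b = 2 * pi * k / L}"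

lemma lattice_0: "0 \<in> lattice L"
  by (auto simp: lattice_def intro!: exI[of _ 0])

lemma lattice_add: "a \<in> lattice L ==> b \<in> lattice L ==> a + b \<in> lattice L"
  unfolding lattice_def
proof (safe)
  fix c :: 'a assume c: "c \<in> Basis" and a: "\<forall>b\<in>Basis. \<exists>k::int. a \<bullet> b = 2 * pi * k / L"
    and b: "\<forall>c\<in>Basis. \<exists>k::int. b \<bullet> c = 2 * pi * k / L"
  obtain k l :: int where "a \<bullet> c = 2 * pi * k / L" "b \<bullet> c = 2 * pi * l / L" using a b c by blast
  then have "(a + b) \<bullet> c = 2 * pi * (k + l) / L" by (simp add: inner_add_left add_divide_distrib distrib_left)
  then show "\<exists>k::int. (a + b) \<bullet> c = 2 * pi * k / L" by (rule exI)
qed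

lemma lattice_minus: "a \<in> lattice L ==> - a \<in> lattice L"
  unfolding lattice_def
proof (safe)
  fix c :: 'a assume c: "c \<in> Basis" and a: "\<forall>b\<in>Basis. \<exists>k::int. a \<bullet> b = 2 * pi * k / L"
  obtain k :: int where "a \<bullet> c = 2 * pi * k / L" using a c by blast
  then have "(- a) \<bullet> c = 2 * pi * (- k) / L" by simp
  then show "\<exists>k::int. (- a) \<bullet> c = 2 * pi * k / L" by (rule exI)
qed

lemma lattice_diff: "a \<in> lattice L ==> b \<in> lattice L ==> a - b \<in> lattice L"
  using lattice_add[OF _ lattice_minus] by fastforce

inductive_set trig :: "real => ('a::euclidean_space => real) set" for L where
  trig_cos: "\<kappa> \<in> lattice L ==> (\<lambda>x. cos (\<kappa> \<bullet> x)) \<in> trig L"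
| trig_sin: "\<kappa> \<in> lattice L ==> (\<lambda>x. sin (\<kappa> \<bullet> x)) \<in> trig L"
| trig_add: "f \<in> trig L ==> g \<in> trig L ==> (\<lambda>x. f x + g x) \<in> trig L"
| trig_cmult: "f \<in> trig L ==> (\<lambda>x. c * f x) \<in> trig L"

lemma trig_const: "(\<lambda>x. c) \<in> trig L"
  using trig_cmult[OF trig_cos[OF lattice_0[of L]], of c] by simp

lemma trig_diff: "f \<in> trig L ==> g \<in> trig L ==> (\<lambda>x. f x - g x) \<in> trig L"
  using trig_add[OF _ trig_cmult[of g L "- 1"], of f] by simp

lemma trig_sum: "finite A ==> (\<And>a. a \<in> A ==> f a \<in> trig L) ==> (\<lambda>x. \<Sum>a\<in>A. f a x) \<in> trig L"
  by (induction rule: finite_induct) (auto intro: trig_const trig_add)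

lemma trig_mult_right:
  assumes g: "g \<in> trig L"
    and c: "\<And>\<kappa>. \<kappa> \<in> lattice L ==> (\<lambda>x. f x * cos (\<kappa> \<bullet> x)) \<in> trig L"
    and s: "\<And>\<kappa>. \<kappa> \<in> lattice L ==> (\<lambda>x. f x * sin (\<kappa> \<bullet> x)) \<in> trig L"
  shows "(\<lambda>x. f x * g x) \<in> trig L"
  using g
proof (induction)
  case (trig_add g h)
  then show ?case using trig.trig_add[OF trig_add.IH] by (simp add: distrib_left)
next
  case (trig_cmult g a)
  then show ?case using trig.trig_cmult[OF trig_cmult.IH, of a] by (simp add: mult.left_commute)
qed (use c s in auto)

lemma trig_mult:
  assumes f: "f \<in> trig L" and g: "g \<in> trig L"
  shows "(\<lambda>x. f x * g x) \<in> trig L"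
proof -
  have half: "(\<lambda>x. f x / 2) \<in> trig L" if "f \<in> trig L" for f :: "'a => real"
    using trig_cmult[OF that, of "1/2"] by simp
  have "(\<lambda>x. g x * f x) \<in> trig L"
  proof (rule trig_mult_right[OF f])
    fix \<kappa> :: 'a assume k: "\<kappa> \<in> lattice L"
    have "(\<lambda>x. cos (\<kappa> \<bullet> x) * g x) \<in> trig L"
    proof (rule trig_mult_right[OF g])
      fix \<mu> :: 'a assume m: "\<mu> \<in> lattice L"
      show "(\<lambda>x. cos (\<kappa> \<bullet> x) * cos (\<mu> \<bullet> x)) \<in> trig L"
        unfolding cos_times_cos inner_diff_left[symmetric] inner_add_left[symmetric]
        by (intro half trig_add trig_cos lattice_diff lattice_add k m)
      show "(\<lambda>x. cos (\<kappa> \<bullet> x) * sin (\<mu> \<bullet> x)) \<in> trig L"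
        unfolding cos_times_sin inner_diff_left[symmetric] inner_add_left[symmetric]
        by (intro half trig_diff trig_sin lattice_diff lattice_add k m)
    qed
    then show "(\<lambda>x. g x * cos (\<kappa> \<bullet> x)) \<in> trig L" by (simp add: mult.commute)
    have "(\<lambda>x. sin (\<kappa> \<bullet> x) * g x) \<in> trig L"
    proof (rule trig_mult_right[OF g])
      fix \<mu> :: 'a assume m: "\<mu> \<in> lattice L"
      show "(\<lambda>x. sin (\<kappa> \<bullet> x) * cos (\<mu> \<bullet> x)) \<in> trig L"
        unfolding sin_times_cos inner_diff_left[symmetric] inner_add_left[symmetric]
        by (intro half trig_add trig_sin lattice_diff lattice_add k m)
      show "(\<lambda>x. sin (\<kappa> \<bullet> x) * sin (\<mu> \<bullet> x)) \<in> trig L"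
        unfolding sin_times_sin inner_diff_left[symmetric] inner_add_left[symmetric]
        by (intro half trig_diff trig_cos lattice_diff lattice_add k m)
    qed
    then show "(\<lambda>x. g x * sin (\<kappa> \<bullet> x)) \<in> trig L" by (simp add: mult.commute)
  qed
  then show ?thesis by (simp add: mult.commute)
qed

lemma trig_periodic:
  assumes "f \<in> trig L" "b \<in> Basis" "L > 0"
  shows "f (x + L *\<^sub>R b) = f x"
  using assms(1)
proof (induction)
  case (trig_cos \<kappa>)
  obtain k :: int where "\<kappa> \<bullet> b = 2 * pi * k / L" using trig_cos assms(2) by (auto simp: lattice_def)
  then have "\<kappa> \<bullet> (x + L *\<^sub>R b) = \<kappa> \<bullet> x + 2 * pi * k" using assms(3) by (simp add: inner_add_right)
  then show ?case by (simp add: cos_add cos_int_2pin sin_int_2pin)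
next
  case (trig_sin \<kappa>)
  obtain k :: int where "\<kappa> \<bullet> b = 2 * pi * k / L" using trig_sin assms(2) by (auto simp: lattice_def)
  then have "\<kappa> \<bullet> (x + L *\<^sub>R b) = \<kappa> \<bullet> x + 2 * pi * k" using assms(3) by (simp add: inner_add_right)
  then show ?case by (simp add: sin_add cos_int_2pin sin_int_2pin)
qed auto

lemma trig_bounded:
  assumes "f \<in> trig L"
  shows "\<exists>C. \<forall>x. \<bar>f x\<bar> <= C"
  using assms
proof (induction)
  case (trig_add f g)
  then obtain C D where "\<And>x. \<bar>f x\<bar> <= C" "\<And>x. \<bar>g x\<bar> <= D" by blast
  then have "\<bar>f x + g x\<bar> <= C + D" for x by (meson abs_triangle_ineq add_mono order_trans)
  then show ?case by blast
next
  case (trig_cmult f c)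
  then obtain C where "\<And>x. \<bar>f x\<bar> <= C" by blast
  then have "\<bar>c * f x\<bar> <= \<bar>c\<bar> * C" for x by (simp add: abs_mult mult_left_mono)
  then show ?case by blast
qed (auto intro!: exI[of _ 1])

lemma trig_derivative:
  assumes "f \<in> trig L"
  shows "\<exists>f'. (\<forall>x. (f has_derivative f' x) (at x)) \<and> (\<forall>h. (\<lambda>x. f' x h) \<in> trig L)"
  using assms
proof (induction)
  case (trig_cos \<kappa>)
  show ?case
  proof (intro exI conjI allI)
    show "((\<lambda>x. cos (\<kappa> \<bullet> x)) has_derivative (\<lambda>h. - (\<kappa> \<bullet> h) * sin (\<kappa> \<bullet> x))) (at x)" for x
      by (auto intro!: derivative_eq_intros)
    show "(\<lambda>x. - (\<kappa> \<bullet> h) * sin (\<kappa> \<bullet> x)) \<in> trig L" for h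
      by (intro trig.trig_cmult trig.trig_sin trig_cos)
  qed
next
  case (trig_sin \<kappa>)
  show ?case
  proof (intro exI conjI allI)
    show "((\<lambda>x. sin (\<kappa> \<bullet> x)) has_derivative (\<lambda>h. (\<kappa> \<bullet> h) * cos (\<kappa> \<bullet> x))) (at x)" for x
      by (auto intro!: derivative_eq_intros)
    show "(\<lambda>x. (\<kappa> \<bullet> h) * cos (\<kappa> \<bullet> x)) \<in> trig L" for h
      by (intro trig.trig_cmult trig.trig_cos trig_sin)
  qed
next
  case (trig_add f g)
  then obtain f' g' where "\<And>x. (f has_derivative f' x) (at x)" "\<And>h. (\<lambda>x. f' x h) \<in> trig L"
    "\<And>x. (g has_derivative g' x) (at x)" "\<And>h. (\<lambda>x. g' x h) \<in> trig L" by blast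
  then show ?case
    by (intro exI[of _ "\<lambda>x h. f' x h + g' x h"]) (auto intro!: has_derivative_add trig.trig_add)
next
  case (trig_cmult f c)
  then obtain f' where "\<And>x. (f has_derivative f' x) (at x)" "\<And>h. (\<lambda>x. f' x h) \<in> trig L" by blast
  then show ?case
    by (intro exI[of _ "\<lambda>x h. c * f' x h"]) (auto intro!: has_derivative_mult_right trig.trig_cmult)
qed

lemma trig_C_infinity: "f \<in> trig L ==> C_infinity f"
  by (rule C_infinity_coinduct[where F = "trig L"]) (auto intro: trig_derivative)

lemma trig_continuous: "f \<in> trig L ==> continuous_on S f"
proof -
  assume "f \<in> trig L"
  then obtain f' where f': "\<forall>x. (f has_derivative f' x) (at x)" using trig_derivative[of f L] by auto
  have "\<forall>x\<in>S. isCont f x" using has_derivative_continuous[OF f'[rule_format]] by auto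
  then show ?thesis by (rule continuous_at_imp_continuous_on)
qed

lemma trig_borel: "f \<in> trig L ==> f \<in> borel_measurable borel"
  by (rule borel_measurable_continuous_onI[OF trig_continuous])

subsection \<open>Density\<close>

text \<open>A continuous function on a compact set that is constant on the fibres of \<open>Z\<close> factors
  continuously through \<open>Z\<close>, because \<open>Z\<close> is a closed map.\<close>

lemma continuous_factorization:
  fixes Z :: "'a::t2_space => 'b::t2_space" and u :: "'a => 'c::t2_space"
  assumes "compact K" "continuous_on K Z" "continuous_on K u"
    and inv: "\<And>x y. x \<in> K ==> y \<in> K ==> Z x = Z y ==> u x = u y"
  obtains h where "continuous_on (Z ` K) h" "\<And>x. x \<in> K ==> h (Z x) = u x"
proof -
  define h where "h = (\<lambda>s. u (SOME x. x \<in> K \<and> Z x = s))"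
  have h: "h (Z x) = u x" if "x \<in> K" for x
  proof -
    have "(SOME y. y \<in> K \<and> Z y = Z x) \<in> K \<and> Z (SOME y. y \<in> K \<and> Z y = Z x) = Z x"
      by (rule someI[of _ x]) (use that in auto)
    then show ?thesis unfolding h_def using inv that by blast
  qed
  have "continuous_on (Z ` K) h"
    unfolding continuous_on_closed_vimage[OF compact_imp_closed[OF compact_continuous_image[OF assms(2,1)]]]
  proof (intro allI impI)
    fix B :: "'c set" assume B: "closed B"
    have "compact (K \<inter> u -` B)"
      by (metis B assms(1,3) closed_vimage_Int compact_Int_closed compact_imp_closed
          continuous_on_closed_vimage inf.commute inf.left_idem)
    then have "compact (Z ` (K \<inter> u -` B))"
      by (rule compact_continuous_image[OF continuous_on_subset[OF assms(2)] , rotated]) auto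
    moreover have "h -` B \<inter> Z ` K = Z ` (K \<inter> u -` B)" using h by auto
    ultimately show "closed (h -` B \<inter> Z ` K)" by (simp add: compact_imp_closed)
  qed
  then show ?thesis using h that by blast
qed

definition box_corner :: "real => 'a::euclidean_space" where
  "box_corner L = (\<Sum>b\<in>Basis. L *\<^sub>R b)"

lemma box_corner_inner [simp]: "b \<in> Basis ==> box_corner L \<bullet> b = L"
  by (simp add: box_corner_def inner_sum_left inner_Basis if_distrib cong: if_cong)

text \<open>The map to a product of circles, which realises the torus as a compact subset of a vector space.\<close>

definition wind :: "real => 'a::euclidean_space => 'a \<times> 'a" where
  "wind L x = (\<Sum>b\<in>Basis. cos (2 * pi / L * (b \<bullet> x)) *\<^sub>R b, \<Sum>b\<in>Basis. sin (2 * pi / L * (b \<bullet> x)) *\<^sub>R b)"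

lemma wind_inner:
  assumes "b \<in> Basis"
  shows "fst (wind L x) \<bullet> b = cos (2 * pi / L * (b \<bullet> x))" "snd (wind L x) \<bullet> b = sin (2 * pi / L * (b \<bullet> x))"
  using assms by (simp_all add: wind_def inner_sum_left inner_Basis if_distrib cong: if_cong)

lemma wind_eq:
  fixes x y :: "'a::euclidean_space"
  assumes L: "0 < L" and x: "x \<in> cbox 0 (box_corner L)" and y: "y \<in> cbox 0 (box_corner L)"
    and e: "wind L x = wind L y" and xb: "x \<in> box 0 (box_corner L)"
  shows "x = y"
proof (rule euclidean_eqI)
  fix b :: 'a assume b: "b \<in> Basis"
  have xs: "0 < x \<bullet> b" "x \<bullet> b < L" using xb b by (auto simp: mem_box)
  have ys: "0 <= y \<bullet> b" "y \<bullet> b <= L" using y b by (auto simp: mem_box)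
  have "cos (2 * pi / L * (x \<bullet> b)) = cos (2 * pi / L * (y \<bullet> b))"
       "sin (2 * pi / L * (x \<bullet> b)) = sin (2 * pi / L * (y \<bullet> b))"
    using wind_inner[OF b, of L x] wind_inner[OF b, of L y] e by (simp_all add: inner_commute)
  then obtain n :: int where n: "2 * pi / L * (x \<bullet> b) = 2 * pi / L * (y \<bullet> b) + 2 * pi * n"
    using sin_cos_eq_iff by metis
  then have "2 * pi * (x \<bullet> b) = 2 * pi * (y \<bullet> b + L * n)"
    using L by (simp add: field_simps)
  then have xy: "x \<bullet> b = y \<bullet> b + L * n" by simp
  then have "L * n < L * 1" "L * (- 1) < L * n" using xs ys unfolding mult_1_right mult_minus_right by linarith+
  then have "real_of_int n < 1" "- 1 < real_of_int n" unfolding mult_less_cancel_left_pos[OF L] by simp_all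
  then have "n = 0" by linarith
  then show "x \<bullet> b = y \<bullet> b" using xy by simp
qed

lemma polynomial_wind_trig:
  fixes p :: "'a::euclidean_space \<times> 'a => real"
  assumes "real_polynomial_function p" and L: "0 < L"
  shows "(\<lambda>x. p (wind L x)) \<in> trig L"
  using assms(1)
proof (induction)
  case (linear f)
  then have lin: "linear f" by (rule bounded_linear.linear)
  have "f (wind L x) = (\<Sum>b\<in>Basis. f (b, 0) * cos (((2 * pi / L) *\<^sub>R b) \<bullet> x)) + (\<Sum>b\<in>Basis. f (0, b) * sin (((2 * pi / L) *\<^sub>R b) \<bullet> x))" for x
  proof -
    have "wind L x = (\<Sum>b\<in>Basis. cos (2 * pi / L * (b \<bullet> x)) *\<^sub>R (b, 0)) + (\<Sum>b\<in>Basis. sin (2 * pi / L * (b \<bullet> x)) *\<^sub>R (0, b))"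
      by (simp add: wind_def prod_eq_iff fst_sum snd_sum)
    then have "f (wind L x) = (\<Sum>b\<in>Basis. cos (2 * pi / L * (b \<bullet> x)) * f (b, 0)) + (\<Sum>b\<in>Basis. sin (2 * pi / L * (b \<bullet> x)) * f (0, b))"
      by (simp only: linear_add[OF lin] linear_sum[OF lin] linear_cmul[OF lin] real_scaleR_def)
    then show ?thesis by (simp add: mult.commute)
  qed
  moreover have "(2 * pi / L) *\<^sub>R b \<in> lattice L" if "b \<in> Basis" for b :: 'a
    unfolding lattice_def
  proof safe
    fix c :: 'a assume "c \<in> Basis"
    then have "((2 * pi / L) *\<^sub>R b) \<bullet> c = 2 * pi * (of_int (if b = c then 1 else 0)) / L"
      using that by (simp add: inner_Basis)
    then show "\<exists>k::int. ((2 * pi / L) *\<^sub>R b) \<bullet> c = 2 * pi * k / L" by (rule exI)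
  qed
  ultimately show ?case
    by (simp only:) (intro trig_add trig_sum trig_cmult trig_cos trig_sin finite_Basis; assumption)
next
  case (const c) then show ?case by (rule trig_const)
next
  case (add f g) then show ?case by (intro trig_add)
next
  case (mult f g) then show ?case by (intro trig_mult)
qed

text \<open>The approximants of \<open>g\<close> are continuous and are made to vanish on the boundary of the
  box, so they are functions on the torus. Through \<open>wind\<close> they are continuous functions on a
  compact set, where the Stone-Weierstrass theorem provides polynomials in the cosines and sines of the
  coordinates, that is, trigonometric polynomials.\<close>

theorem trig_dense:
  fixes g :: "'a::euclidean_space => real"
  assumes L: "0 < L" and g: "g \<in> borel_measurable (lebesgue_on (cbox 0 (box_corner L)))" and gC: "\<And>x. \<bar>g x\<bar> <= C"
  obtains q N where "negligible N" "\<And>n. q n \<in> trig L"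
    "\<And>n x. x \<in> cbox 0 (box_corner L) ==> \<bar>q n x\<bar> <= C + 1"
    "\<And>x. x \<in> cbox 0 (box_corner L) - N ==> (\<lambda>n. q n x) \<longlonglongrightarrow> g x"
proof -
  define K where "K = (cbox 0 (box_corner L) :: 'a set)"
  define B where "B = (box 0 (box_corner L) :: 'a set)"
  have "\<exists>N h. negligible N \<and> (\<forall>n::nat. continuous_on UNIV (h n)) \<and> (\<forall>n x. \<bar>h n x\<bar> <= C) \<and> (\<forall>x\<in>K - N. (\<lambda>n. h n x) \<longlonglongrightarrow> g x)"
    unfolding K_def by (rule bounded_continuous_approximation[OF _ g gC]) simp
  then obtain N h where N: "negligible N" and ch: "\<And>n::nat. continuous_on UNIV (h n)" and hC: "\<And>n x. \<bar>h n x\<bar> <= C"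
    and h: "\<And>x. x \<in> K - N ==> (\<lambda>n. h n x) \<longlonglongrightarrow> g x" by blast
  \<comment> \<open>a factor that vanishes on the boundary of the box and tends to one inside\<close>
  define d where "d = (\<lambda>n x. min 1 (real n * infdist x (- B)))"
  define u where "u = (\<lambda>n x. h n x * d n x)"
  have "0 \<notin> B" by (simp add: B_def mem_box)
  then have nB: "- B \<noteq> {}" by auto
  have d01: "0 <= d n x" "d n x <= 1" for n x by (auto simp: d_def infdist_nonneg)
  have cu: "continuous_on S (u n)" for n S
    unfolding u_def d_def by (intro continuous_intros continuous_on_subset[OF ch]) auto
  have uC: "\<bar>u n x\<bar> <= C" for n x
  proof -
    have "\<bar>h n x\<bar> * d n x <= C * 1" using hC d01[of n x] by (intro mult_mono) (auto intro: order_trans[OF abs_ge_zero hC])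
    then show ?thesis using d01[of n x] by (simp add: u_def abs_mult)
  qed
  have u0: "u n x = 0" if "x \<notin> B" for n x using that by (simp add: u_def d_def)
  have ulim: "(\<lambda>n. u n x) \<longlonglongrightarrow> g x" if "x \<in> B" "x \<notin> N" for x
  proof -
    have "closed (- B)" by (auto simp: B_def)
    then have pos: "0 < infdist x (- B)" using that nB by (simp add: infdist_pos_not_in_closed)
    obtain n0 where "1 < real n0 * infdist x (- B)" using reals_Archimedean3[OF pos] by blast
    then have "d n x = 1" if "n \<ge> n0" for n
      using mult_right_mono[of "real n0" "real n" "infdist x (- B)"] that pos unfolding d_def by linarith
    then have "\<forall>\<^sub>F n in sequentially. d n x = 1" by (auto simp: eventually_sequentially)
    then have dl: "(\<lambda>n. d n x) \<longlonglongrightarrow> 1" by (rule tendsto_eventually)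
    have "x \<in> K" using that box_subset_cbox by (auto simp: B_def K_def)
    then have "(\<lambda>n. u n x) \<longlonglongrightarrow> g x * 1"
      unfolding u_def using h[of x] that dl by (intro tendsto_intros) auto
    then show ?thesis by simp
  qed
  have cw: "continuous_on K (wind L)" unfolding wind_def by (intro continuous_intros)
  have "\<exists>q. q \<in> trig L \<and> (\<forall>x\<in>K. \<bar>u n x - q x\<bar> < 1 / (real n + 1))" for n
  proof -
    have inv: "u n x = u n y" if "x \<in> K" "y \<in> K" "wind L x = wind L y" for x y
    proof (cases "x \<in> B \<or> y \<in> B")
      case True
      then have "x = y" using wind_eq[OF L, of x y] wind_eq[OF L, of y x] that by (auto simp: K_def B_def)
      then show ?thesis by simp
    next
      case False then show ?thesis using u0 by simp
    qed
    have K: "compact K" by (simp add: K_def)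
    obtain H where H: "continuous_on (wind L ` K) H" "\<And>x. x \<in> K ==> H (wind L x) = u n x"
      using continuous_factorization[OF K cw cu inv] by metis
    obtain p where p: "real_polynomial_function p" "\<And>s. s \<in> wind L ` K ==> \<bar>H s - p s\<bar> < 1 / (real n + 1)"
      using Stone_Weierstrass_real_polynomial_function[OF compact_continuous_image[OF cw K] H(1), of "1 / (real n + 1)"] by auto
    show ?thesis
    proof (intro exI conjI ballI)
      show "(\<lambda>x. p (wind L x)) \<in> trig L" by (rule polynomial_wind_trig[OF p(1) L])
      show "\<bar>u n x - p (wind L x)\<bar> < 1 / (real n + 1)" if "x \<in> K" for x
        using p(2)[of "wind L x"] H(2)[OF that] that by simp
    qed
  qed
  then obtain q where q: "\<And>n. q n \<in> trig L" "\<And>n x. x \<in> K ==> \<bar>u n x - q n x\<bar> < 1 / (real n + 1)"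
    by metis
  show ?thesis
  proof
    show "negligible (N \<union> (K - B))"
      using N negligible_frontier_interval[of 0 "box_corner L :: 'a"] by (simp add: K_def B_def)
    show "q n \<in> trig L" for n by (rule q)
    show "\<bar>q n x\<bar> <= C + 1" if "x \<in> cbox 0 (box_corner L)" for n x
    proof -
      have "1 / (real n + 1) <= 1" by simp
      moreover have "\<bar>u n x - q n x\<bar> < 1 / (real n + 1)" using q(2)[of x n] that by (simp add: K_def)
      ultimately show ?thesis using uC[of n x] by linarith
    qed
    show "(\<lambda>n. q n x) \<longlonglongrightarrow> g x" if "x \<in> cbox 0 (box_corner L) - (N \<union> (K - B))" for x
    proof -
      have x: "x \<in> K" "x \<in> B" "x \<notin> N" using that by (auto simp: K_def)
      have "(\<lambda>n. u n x - q n x) \<longlonglongrightarrow> 0"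
      proof (rule Lim_null_comparison)
        show "\<forall>\<^sub>F n in sequentially. norm (u n x - q n x) <= 1 / (real n + 1)"
          using q(2)[OF x(1)] by (auto intro!: always_eventually less_imp_le)
        show "(\<lambda>n. 1 / (real n + 1)) \<longlonglongrightarrow> 0" using LIMSEQ_inverse_real_of_nat by (simp add: inverse_eq_divide add.commute)
      qed
      from tendsto_diff[OF ulim[OF x(2,3)] this] show ?thesis by simp
    qed
  qed
qed

subsection \<open>Cutoffs in time\<close>

text \<open>The powers \<open>k\<close> make the family closed under differentiation, which is what
  \<open>C_infinity_coinduct\<close> asks for. For small \<open>c\<close> and \<open>k = 0\<close> it
  approximates the indicator of \<open>{..<\<tau>}\<close>.\<close>

definition cutoff :: "real => real => nat => real => real" where
  "cutoff c \<tau> k t = (if t < \<tau> then exp (- c / (\<tau> - t)) / (\<tau> - t) ^ k else 0)"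

lemma power_div_fact_le_exp:
  fixes x :: real
  assumes "0 <= x"
  shows "x ^ n / fact n <= exp x"
proof -
  have "(\<Sum>k\<in>{n}. x ^ k /\<^sub>R fact k) <= (\<Sum>k. x ^ k /\<^sub>R fact k)"
    by (rule sum_le_suminf[OF summable_exp_generic]) (use assms in auto)
  then show ?thesis by (simp add: exp_def divide_inverse mult.commute)
qed

text \<open>Flatness at \<open>\<tau>\<close>: the exponential beats every power. The square on the right
  gives differentiability there, with derivative zero.\<close>

lemma cutoff_flat:
  assumes "0 < c"
  shows "\<bar>cutoff c \<tau> k t\<bar> <= fact (k + 2) / c ^ (k + 2) * (t - \<tau>)\<^sup>2"
proof (cases "t < \<tau>")
  case True
  define s where "s = \<tau> - t"
  have s: "0 < s" using True by (simp add: s_def)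
  define n where "n = k + 2"
  define F :: real where "F = fact n"
  have F: "0 < F" by (simp add: F_def)
  have "(c / s) ^ n / F <= exp (c / s)"
    unfolding F_def by (rule power_div_fact_le_exp) (use s assms in simp)
  then have "exp (- (c / s)) <= F * s ^ n / c ^ n"
    using s assms F by (simp add: exp_minus field_simps power_divide)
  then have "exp (- (c / s)) / s ^ k <= (F * s ^ n / c ^ n) / s ^ k"
    by (rule divide_right_mono) (use s in simp)
  also have "s ^ n = s ^ k * s\<^sup>2" by (simp add: n_def power_add power2_eq_square)
  also have "(F * (s ^ k * s\<^sup>2) / c ^ n) / s ^ k = F / c ^ n * s\<^sup>2" using s by simp
  finally have "exp (- (c / s)) / s ^ k <= F / c ^ n * s\<^sup>2" .
  moreover have "s\<^sup>2 = (t - \<tau>)\<^sup>2" by (simp add: s_def power2_commute)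
  moreover have "cutoff c \<tau> k t = exp (- (c / s)) / s ^ k" using True by (simp add: cutoff_def s_def)
  moreover have "0 <= exp (- (c / s)) / s ^ k" using s by simp
  ultimately show ?thesis unfolding F_def n_def by simp
next
  case False then show ?thesis using assms by (simp add: cutoff_def)
qed

lemma cutoff_deriv:
  assumes c: "0 < c"
  shows "(cutoff c \<tau> k has_real_derivative real k * cutoff c \<tau> (k + 1) t - c * cutoff c \<tau> (k + 2) t) (at t)"
proof -
  consider "t < \<tau>" | "t > \<tau>" | "t = \<tau>" by linarith
  then show ?thesis
  proof cases
    case 1
    define s where "s = \<tau> - t"
    have s: "0 < s" using 1 by (simp add: s_def)
    have ds: "((\<lambda>t. \<tau> - t) has_real_derivative - 1) (at t)"
      using DERIV_diff[OF DERIV_const[of \<tau>] DERIV_ident] by simp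
    have d1: "((\<lambda>t. exp (- c / (\<tau> - t))) has_real_derivative exp (- c / s) * (- c / s\<^sup>2)) (at t)"
      using DERIV_chain2[OF DERIV_exp DERIV_divide[OF DERIV_const[of "- c"] ds]] s
      by (simp add: s_def power2_eq_square)
    have d2: "((\<lambda>t. (\<tau> - t) ^ k) has_real_derivative - (real k * s ^ (k - 1))) (at t)"
      using DERIV_chain2[OF DERIV_pow ds, of k] by (simp add: s_def)
    have "((\<lambda>t. exp (- c / (\<tau> - t)) / (\<tau> - t) ^ k) has_real_derivative
       ((exp (- c / s) * (- c / s\<^sup>2)) * s ^ k - exp (- c / s) * (- (real k * s ^ (k - 1)))) / (s ^ k * s ^ k)) (at t)"
      using DERIV_divide[OF d1 d2] s by (simp add: s_def)
    moreover have "((exp (- c / s) * (- c / s\<^sup>2)) * s ^ k - exp (- c / s) * (- (real k * s ^ (k - 1)))) / (s ^ k * s ^ k)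
        = real k * (exp (- c / s) / s ^ (k + 1)) - c * (exp (- c / s) / s ^ (k + 2))"
      using s by (cases k) (simp_all add: field_simps power_add power2_eq_square)
    ultimately have "((\<lambda>t. exp (- c / (\<tau> - t)) / (\<tau> - t) ^ k) has_real_derivative
       real k * cutoff c \<tau> (k + 1) t - c * cutoff c \<tau> (k + 2) t) (at t)"
      using 1 by (simp add: cutoff_def s_def)
    then show ?thesis
      by (rule has_field_derivative_transform_within_open[of _ _ _ "{..<\<tau>}"]) (use 1 in \<open>auto simp: cutoff_def\<close>)
  next
    case 2
    have "((\<lambda>t. 0) has_real_derivative real k * cutoff c \<tau> (k + 1) t - c * cutoff c \<tau> (k + 2) t) (at t)"
      using 2 by (simp add: cutoff_def)
    then show ?thesis
      by (rule has_field_derivative_transform_within_open[of _ _ _ "{\<tau><..}"]) (use 2 in \<open>auto simp: cutoff_def\<close>)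
  next
    case 3
    define M where "M = fact (k + 2) / c ^ (k + 2)"
    have "((\<lambda>y. (cutoff c \<tau> k y - cutoff c \<tau> k \<tau>) / (y - \<tau>)) \<longlongrightarrow> 0) (at \<tau>)"
    proof (rule Lim_null_comparison)
      have "norm ((cutoff c \<tau> k y - cutoff c \<tau> k \<tau>) / (y - \<tau>)) <= M * \<bar>y - \<tau>\<bar>" if "y \<noteq> \<tau>" for y
      proof -
        have "\<bar>cutoff c \<tau> k y\<bar> <= M * (\<bar>y - \<tau>\<bar> * \<bar>y - \<tau>\<bar>)"
          using cutoff_flat[OF c, of \<tau> k y] unfolding M_def[symmetric] by (simp add: power2_eq_square)
        then have "\<bar>cutoff c \<tau> k y\<bar> / \<bar>y - \<tau>\<bar> <= M * \<bar>y - \<tau>\<bar>"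
          using that by (simp add: divide_le_eq mult.assoc)
        then show ?thesis by (simp add: cutoff_def[of c \<tau> k \<tau>] abs_divide)
      qed
      then show "\<forall>\<^sub>F y in at \<tau>. norm ((cutoff c \<tau> k y - cutoff c \<tau> k \<tau>) / (y - \<tau>)) <= M * \<bar>y - \<tau>\<bar>"
        by (auto simp: eventually_at_filter)
      have "((\<lambda>y. M * \<bar>y - \<tau>\<bar>) \<longlongrightarrow> M * \<bar>\<tau> - \<tau>\<bar>) (at \<tau>)" by (intro tendsto_intros)
      then show "((\<lambda>y. M * \<bar>y - \<tau>\<bar>) \<longlongrightarrow> 0) (at \<tau>)" by simp
    qed
    then show ?thesis using 3 by (simp add: has_field_derivative_iff cutoff_def[of _ _ _ \<tau>])
  qed
qed

inductive_set cutoff_trig :: "real => real => real => (real \<times> 'a::euclidean_space => real) set" for L c \<tau> where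
  cutoff_trig_base: "q \<in> trig L ==> (\<lambda>p. cutoff c \<tau> k (fst p) * q (snd p)) \<in> cutoff_trig L c \<tau>"
| cutoff_trig_add: "f \<in> cutoff_trig L c \<tau> ==> g \<in> cutoff_trig L c \<tau> ==> (\<lambda>p. f p + g p) \<in> cutoff_trig L c \<tau>"

lemma cutoff_trig_derivative:
  assumes "f \<in> cutoff_trig L c \<tau>" and c: "0 < c"
  shows "\<exists>f'. (\<forall>x. (f has_derivative f' x) (at x)) \<and> (\<forall>h. (\<lambda>x. f' x h) \<in> cutoff_trig L c \<tau>)"
  using assms(1)
proof (induction)
  case (cutoff_trig_base q k)
  obtain q' where q': "\<And>x. (q has_derivative q' x) (at x)" "\<And>h. (\<lambda>x. q' x h) \<in> trig L"
    using trig_derivative[OF cutoff_trig_base] by blast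
  define e where "e = (\<lambda>t. real k * cutoff c \<tau> (k + 1) t - c * cutoff c \<tau> (k + 2) t)"
  show ?case
  proof (intro exI conjI allI)
    fix p :: "real \<times> 'a"
    have d1: "((\<lambda>p::real \<times> 'a. cutoff c \<tau> k (fst p)) has_derivative (\<lambda>h. e (fst p) * fst h)) (at p)"
    proof -
      have "(cutoff c \<tau> k has_derivative (\<lambda>h. e (fst p) * h)) (at (fst p))"
        using cutoff_deriv[OF c, of \<tau> k "fst p"] by (simp add: has_field_derivative_def e_def)
      from has_derivative_compose[OF has_derivative_fst[OF has_derivative_ident] this]
      show ?thesis by simp
    qed
    have d2: "((\<lambda>p::real \<times> 'a. q (snd p)) has_derivative (\<lambda>h. q' (snd p) (snd h))) (at p)"
      by (rule has_derivative_compose[OF has_derivative_snd[OF has_derivative_ident] q'(1)])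
    show "((\<lambda>p. cutoff c \<tau> k (fst p) * q (snd p)) has_derivative
       (\<lambda>h. cutoff c \<tau> k (fst p) * q' (snd p) (snd h) + e (fst p) * fst h * q (snd p))) (at p)"
      by (rule has_derivative_mult[OF d1 d2])
  next
    fix h :: "real \<times> 'a"
    have "(\<lambda>p. cutoff c \<tau> k (fst p) * q' (snd p) (snd h) + (cutoff c \<tau> (k + 1) (fst p) * (real k * fst h * q (snd p))
        + cutoff c \<tau> (k + 2) (fst p) * (- c * fst h * q (snd p)))) \<in> cutoff_trig L c \<tau>"
      by (intro cutoff_trig.intros trig_cmult q' cutoff_trig_base)
    then show "(\<lambda>p. cutoff c \<tau> k (fst p) * q' (snd p) (snd h) + e (fst p) * fst h * q (snd p)) \<in> cutoff_trig L c \<tau>"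
      by (simp add: e_def algebra_simps)
  qed
next
  case (cutoff_trig_add f g)
  then obtain f' g' where "\<And>x. (f has_derivative f' x) (at x)" "\<And>h. (\<lambda>x. f' x h) \<in> cutoff_trig L c \<tau>"
    "\<And>x. (g has_derivative g' x) (at x)" "\<And>h. (\<lambda>x. g' x h) \<in> cutoff_trig L c \<tau>" by blast
  then show ?case
    by (intro exI[of _ "\<lambda>x h. f' x h + g' x h"]) (auto intro!: has_derivative_add cutoff_trig.cutoff_trig_add)
qed

lemma trig_basis_periodic: "f \<in> trig L ==> 0 < L ==> torus_periodic L (f :: real^'n => real)"
  unfolding torus_periodic_def
proof (intro allI)
  fix x :: "real^'n" and i :: 'n assume "f \<in> trig L" "0 < L"
  moreover have "axis i L = L *\<^sub>R axis i (1::real)" by (simp add: axis_def vec_eq_iff)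
  ultimately show "f (x + axis i L) = f x" using trig_periodic[of f L "axis i 1" x] by (simp add: axis_in_Basis_iff)
qed

lemma trig_torus_smooth: "f \<in> trig L ==> 0 < L ==> f \<in> torus_smooth L"
  by (simp add: torus_smooth_def trig_C_infinity trig_basis_periodic)

lemma cutoff_trig_time_smooth:
  fixes q :: "real^'n => real"
  assumes "q \<in> trig L" "0 < L" "0 < c"
  shows "(\<lambda>t x. cutoff c \<tau> k t * q x) \<in> time_smooth L"
proof -
  have "C_infinity (\<lambda>p::real \<times> (real^'n). cutoff c \<tau> k (fst p) * q (snd p))"
    by (rule C_infinity_coinduct[OF cutoff_trig_base[OF assms(1)] cutoff_trig_derivative[OF _ assms(3)]])
  then show ?thesis
    using trig_basis_periodic[OF assms(1,2)]
    by (auto simp: time_smooth_def torus_periodic_def case_prod_unfold)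
qed

lemma cutoff_trig_time_smooth_compact:
  fixes q :: "real^'n => real"
  assumes "q \<in> trig L" "0 < L" "0 < c" "\<tau> < T"
  shows "(\<lambda>t x. cutoff c \<tau> k t * q x) \<in> time_smooth_compact T L"
  using cutoff_trig_time_smooth[OF assms(1-3)] assms(4)
  by (auto simp: time_smooth_compact_def cutoff_def intro!: exI[of _ \<tau>])

section \<open>Integration over the torus\<close>

lemma axis_scale: "axis i h = h *\<^sub>R (axis i 1 :: real^'n)"
  by (simp add: axis_def vec_eq_iff)

lemma box_corner_nth [simp]: "(box_corner L :: real^'n) $ i = L"
  using box_corner_inner[of "axis i 1 :: real^'n" L] by (simp add: axis_in_Basis_iff inner_axis)

lemma cube_subset_cbox: "cube L \<subseteq> cbox 0 (box_corner L)"
  by (auto simp: cube_def mem_box_cart less_imp_le)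

lemma cube_borel [measurable]: "cube L \<in> sets borel"
proof -
  have "cube L = (\<Inter>i. {x::real^'a. 0 <= x $ i} \<inter> {x. x $ i < L})" by (auto simp: cube_def)
  also have "\<dots> \<in> sets borel"
    by (intro sets.countable_INT'' sets.Int) (auto intro!: borel_closed borel_open closed_Collect_le open_Collect_less continuous_intros)
  finally show ?thesis .
qed

lemma cube_lebesgue [simp]: "cube L \<in> sets lebesgue"
  by simp

lemma space_torus [simp]: "space (torus L) = cube L"
  by (simp add: torus_def)

lemma torus_measurableI: "f \<in> borel_measurable borel ==> f \<in> borel_measurable (torus L)"
  for f :: "real^'n => 'b::topological_space"
  unfolding torus_def by (rule borel_measurable_lebesgue_onI)

lemma coordinate_borel [measurable]: "(\<lambda>x::real^'n. x $ i) \<in> borel_measurable borel"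
  by (auto intro: borel_measurable_continuous_onI continuous_intros)

lemma emeasure_between_boxes:
  fixes l u :: "'a::euclidean_space"
  assumes "box l u \<subseteq> S" "S \<subseteq> cbox l u" "S \<in> sets borel" "\<And>b. b \<in> Basis ==> l \<bullet> b <= u \<bullet> b"
  shows "emeasure lborel S = (\<Prod>b\<in>Basis. (u - l) \<bullet> b)"
proof (rule antisym)
  have "emeasure lborel S <= emeasure lborel (cbox l u)" by (rule emeasure_mono) (use assms in auto)
  then show "emeasure lborel S <= (\<Prod>b\<in>Basis. (u - l) \<bullet> b)"
    using emeasure_lborel_cbox[OF assms(4)] by simp
  have "emeasure lborel (box l u) <= emeasure lborel S" by (rule emeasure_mono) (use assms in auto)
  then show "(\<Prod>b\<in>Basis. (u - l) \<bullet> b) <= emeasure lborel S"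
    using emeasure_lborel_box[OF assms(4)] by simp
qed

lemma emeasure_torus_borel:
  fixes A :: "(real^'n) set"
  assumes "A \<in> sets borel"
  shows "emeasure (torus L) (A \<inter> cube L) = emeasure lborel (A \<inter> cube L)"
proof -
  have "emeasure (torus L) (A \<inter> cube L) = emeasure lebesgue (A \<inter> cube L)"
    unfolding torus_def by (rule emeasure_restrict_space) auto
  then show ?thesis using assms by simp
qed

text \<open>Half-open slabs of the cube lie between an open and a closed box with the same volume. They
  determine the distribution of a coordinate.\<close>

lemma emeasure_slab:
  fixes i :: "'n::finite"
  assumes L: "0 < L"
  shows "emeasure lborel ({x::real^'n. a < x $ i} \<inter> cube L) = ennreal (L ^ (CARD('n) - 1) * max 0 (L - max a 0))"
proof (cases "a < L")
  case False
  have "{x::real^'n. a < x $ i} \<inter> cube L = {}"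
  proof safe
    fix x :: "real^'n" assume "a < x $ i" "x \<in> cube L"
    then have "a < L" unfolding cube_def by (blast intro: less_trans)
    then show "x \<in> {}" using False by simp
  qed
  then show ?thesis using False by simp
next
  case True
  define l :: "real^'n" where "l = (\<chi> j. if j = i then max a 0 else 0)"
  have "emeasure lborel ({x::real^'n. a < x $ i} \<inter> cube L) = (\<Prod>b\<in>Basis. (box_corner L - l) \<bullet> b)"
  proof (rule emeasure_between_boxes)
    show "box l (box_corner L) \<subseteq> {x. a < x $ i} \<inter> cube L"
    proof
      fix x assume x: "x \<in> box l (box_corner L)"
      then have lx: "l $ j < x $ j" "x $ j < L" for j by (auto simp: mem_box_cart)
      have a: "max a 0 < x $ i" using lx(1)[of i] by (simp add: l_def)
      moreover have "0 <= x $ j" for j using lx(1)[of j] a by (cases "j = i") (simp_all add: l_def)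
      moreover note lx(2)
      ultimately show "x \<in> {x. a < x $ i} \<inter> cube L" by (auto simp: cube_def)
    qed
    show "{x. a < x $ i} \<inter> cube L \<subseteq> cbox l (box_corner L)"
      by (auto simp: cube_def mem_box_cart l_def less_imp_le)
    show "{x. a < x $ i} \<inter> cube L \<in> sets borel"
      by (intro sets.Int cube_borel borel_open open_Collect_less continuous_intros)
    show "l \<bullet> b <= box_corner L \<bullet> b" if "b \<in> Basis" for b
      using that True L by (auto simp: Basis_vec_def inner_axis l_def)
  qed
  also have "(\<Prod>b\<in>Basis. (box_corner L - l) \<bullet> b) = (\<Prod>j\<in>UNIV. L - l $ j)"
  proof -
    have B: "(Basis :: (real^'n) set) = (\<lambda>j. axis j 1) ` UNIV" by (auto simp: Basis_vec_def)
    have inj: "inj (\<lambda>j::'n. axis j (1::real))" by (auto simp: inj_on_def axis_eq_axis)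
    have "(\<Prod>b\<in>Basis. v \<bullet> b) = (\<Prod>j\<in>UNIV. v $ j)" for v :: "real^'n"
      unfolding B prod.reindex[OF inj] by (simp add: inner_axis)
    then show ?thesis by simp
  qed
  also have "\<dots> = L ^ (CARD('n) - 1) * (L - max a 0)"
  proof -
    have "(\<Prod>j\<in>UNIV. L - l $ j) = (L - l $ i) * (\<Prod>j\<in>UNIV - {i}. L - l $ j)"
      by (rule prod.remove) auto
    also have "(\<Prod>j\<in>UNIV - {i}. L - l $ j) = (\<Prod>j\<in>UNIV - {i}. L)"
      by (rule prod.cong) (auto simp: l_def)
    finally show ?thesis by (simp add: l_def card_Diff_singleton)
  qed
  finally show ?thesis using True L by simp
qed

lemma emeasure_torus:
  assumes L: "0 < L"
  shows "emeasure (torus L) (cube L :: (real^'n) set) = ennreal (L ^ CARD('n))"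
proof -
  fix i :: 'n
  have "cube L = {x::real^'n. - 1 < x $ i} \<inter> cube L" by (auto simp: cube_def intro: less_le_trans[of "-1" 0])
  then have "emeasure (torus L) (cube L :: (real^'n) set) = emeasure lborel ({x::real^'n. - 1 < x $ i} \<inter> cube L)"
    using emeasure_torus_borel[of UNIV L] by simp
  also have "\<dots> = ennreal (L ^ (CARD('n) - 1) * L)" using emeasure_slab[OF L, of "- 1" i] L by simp
  also have "L ^ (CARD('n) - 1) * L = L ^ CARD('n)"
    using power_minus_mult[of "CARD('n)" L] by simp
  finally show ?thesis .
qed

lemma finite_measure_torus: "0 < L ==> finite_measure (torus L)"
  by (rule finite_measureI) (simp add: emeasure_torus)

lemma measure_torus: "0 < L ==> measure (torus L) (cube L :: (real^'n) set) = L ^ CARD('n)"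
  using emeasure_torus[of L] by (simp add: measure_def)

lemma AE_torusI:
  fixes N :: "(real^'n) set"
  assumes "negligible N" "\<And>x. x \<in> cube L ==> x \<notin> N ==> P x"
  shows "AE x in torus L. P x"
proof -
  have "AE x in lebesgue. x \<notin> N"
    using assms(1) by (simp add: AE_not_in negligible_iff_null_sets)
  then have "AE x in lebesgue. x \<in> cube L \<longrightarrow> P x" by eventually_elim (use assms in auto)
  then show ?thesis unfolding torus_def by (subst AE_restrict_space_iff) auto
qed

lemma torus_integrable_bounded:
  fixes f :: "real^'n => real"
  assumes "0 < L" "f \<in> borel_measurable (torus L)" "AE x in torus L. \<bar>f x\<bar> <= C"
  shows "integrable (torus L) f"
  using finite_measure.integrable_const_bound[OF finite_measure_torus[OF assms(1)] _ assms(2)] assms(3) by simp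

lemma distr_torus_coordinate:
  fixes i :: "'n::finite"
  assumes L: "0 < L"
  shows "distr (torus L) borel (\<lambda>x::real^'n. x $ i) = density lborel (\<lambda>s. ennreal (L ^ (CARD('n) - 1)) * indicator {0..<L} s)"
proof -
  note m = torus_measurableI[OF coordinate_borel]
  have e: "emeasure (distr (torus L) borel (\<lambda>x::real^'n. x $ i)) {a<..} = ennreal (L ^ (CARD('n) - 1) * max 0 (L - max a 0))" for a
  proof -
    have "emeasure (distr (torus L) borel (\<lambda>x::real^'n. x $ i)) {a<..} = emeasure (torus L) ({x::real^'n. a < x $ i} \<inter> cube L)"
      by (subst emeasure_distr[OF m]) (auto simp: vimage_def)
    also have "\<dots> = emeasure lborel ({x::real^'n. a < x $ i} \<inter> cube L)"
      by (rule emeasure_torus_borel) (auto intro!: borel_open open_Collect_less continuous_intros)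
    finally show ?thesis using emeasure_slab[OF L, of a i] by simp
  qed
  show ?thesis
  proof (rule measure_eqI_lessThan)
    show "emeasure (distr (torus L) borel (\<lambda>x::real^'n. x $ i)) {a<..} < \<infinity>" for a
      unfolding e by simp
    show "emeasure (distr (torus L) borel (\<lambda>x::real^'n. x $ i)) {a<..}
      = emeasure (density lborel (\<lambda>s. ennreal (L ^ (CARD('n) - 1)) * indicator {0..<L} s)) {a<..}" for a
    proof -
      have "emeasure (density lborel (\<lambda>s. ennreal (L ^ (CARD('n) - 1)) * indicator {0..<L} s)) {a<..}
          = (\<integral>\<^sup>+ s. ennreal (L ^ (CARD('n) - 1)) * indicator ({0..<L} \<inter> {a<..}) s \<partial>lborel)"
        by (subst emeasure_density) (auto simp: indicator_inter_arith mult.assoc)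
      also have "\<dots> = ennreal (L ^ (CARD('n) - 1)) * emeasure lborel ({0..<L} \<inter> {a<..})"
        by (subst nn_integral_cmult_indicator) auto
      also have "emeasure lborel ({0..<L} \<inter> {a<..}) = ennreal (max 0 (L - max a 0))"
      proof (cases "a < 0")
        case True
        then have "{0..<L} \<inter> {a<..} = {0..<L}" by auto
        then show ?thesis using True L by simp
      next
        case False
        then have "{0..<L} \<inter> {a<..} = {a<..<L}" by auto
        then show ?thesis using False by (cases "a <= L") auto
      qed
      also have "ennreal (L ^ (CARD('n) - 1)) * ennreal (max 0 (L - max a 0)) = ennreal (L ^ (CARD('n) - 1) * max 0 (L - max a 0))"
        using L by (simp add: ennreal_mult)
      finally show ?thesis unfolding e ..
    qed
  qed auto
qed

text \<open>Fubini for functions of one coordinate, through the distribution of that coordinate.\<close>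

lemma torus_integral_coordinate:
  fixes g :: "real => real" and i :: "'n::finite"
  assumes L: "0 < L" and g: "g \<in> borel_measurable borel" "\<And>s. s \<in> {0..L} ==> \<bar>g s\<bar> <= C"
  shows "(LINT x|torus L. g ((x::real^'n) $ i)) = L ^ (CARD('n) - 1) * integral {0..L} g"
proof -
  note m = torus_measurableI[OF coordinate_borel]
  have "(LINT x|torus L. g ((x::real^'n) $ i)) = (LINT s|distr (torus L) borel (\<lambda>x::real^'n. x $ i). g s)"
    by (rule integral_distr[symmetric, OF m g(1)])
  also have "\<dots> = (LINT s|lborel. (L ^ (CARD('n) - 1) * indicator {0..<L} s) *\<^sub>R g s)"
    unfolding distr_torus_coordinate[OF L]
    by (subst integral_density[symmetric]) (use g L in \<open>auto simp: ennreal_mult'' ennreal_indicator[symmetric] intro!: arg_cong2[where f = "integral\<^sup>L"] density_cong\<close>)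
  also have "\<dots> = (LINT s|lborel. L ^ (CARD('n) - 1) * (indicator {0..L} s *\<^sub>R g s))"
    by (rule integral_cong_AE)
      (use g AE_lborel_singleton[of L] in \<open>auto elim!: eventually_mono simp: indicator_def\<close>)
  also have "\<dots> = L ^ (CARD('n) - 1) * (LINT s|lborel. indicator {0..L} s *\<^sub>R g s)" by simp
  also have "(LINT s|lborel. indicator {0..L} s *\<^sub>R g s) = (LINT s:{0..L}|lebesgue. g s)"
    unfolding set_lebesgue_integral_def by (rule integral_completion[symmetric]) (use g in measurable)
  also have "\<dots> = integral {0..L} g"
    by (rule set_lebesgue_integral_eq_integral(2)[OF bounded_borel_integrable(1)[OF g]])
  finally show ?thesis .
qed

lemma AE_torus_coordinate:
  fixes i :: "'n::finite"
  assumes L: "0 < L" and N: "negligible N" and P: "\<And>s. s \<in> {0..<L} ==> s \<notin> N ==> P s"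
  shows "AE x in torus L. P ((x::real^'n) $ i)"
proof -
  note m = torus_measurableI[OF coordinate_borel]
  have "N \<in> null_sets lebesgue" using N by (simp add: negligible_iff_null_sets)
  then obtain N' where N': "N \<subseteq> N'" "N' \<in> null_sets lborel"
    unfolding null_sets_completion_iff2 by blast
  have "AE s in density lborel (\<lambda>s. ennreal (L ^ (CARD('n) - 1)) * indicator {0..<L} s). s \<notin> N'"
    by (subst AE_density) (use AE_not_in[OF N'(2)] in \<open>auto\<close>)
  then have "AE s in distr (torus L) borel (\<lambda>x::real^'n. x $ i). s \<notin> N'"
    unfolding distr_torus_coordinate[OF L] .
  then have "AE x in torus L. (x::real^'n) $ i \<notin> N'"
    by (rule AE_distrD[OF m])
  moreover have "AE x in torus L. x \<in> cube L" using AE_space[of "torus L"] by simp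
  ultimately show ?thesis
  proof eventually_elim
    case (elim x)
    then show ?case using P[of "x $ i"] N'(1) by (auto simp: cube_def)
  qed
qed

subsection \<open>Translations\<close>

text \<open>Translation by \<open>h\<close> in direction \<open>i\<close> as a bijection of the cube, with the
  part that leaves on one side entering on the other.\<close>

definition wrap :: "real => 'n => real => real^'n => real^'n" where
  "wrap L i h x = (if x $ i < L - h then x + axis i h else x + axis i (h - L))"

lemma wrap_borel [measurable]: "wrap L i h \<in> borel_measurable borel"
proof -
  have "{x::real^'a. x $ i < L - h} \<in> sets borel"
    by (intro borel_open open_Collect_less continuous_intros)
  then show ?thesis unfolding wrap_def
    by (intro measurable_If) (auto intro!: borel_measurable_continuous_onI continuous_intros)
qed

lemma nn_integral_translate:
  fixes f :: "'a::euclidean_space => ennreal"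
  assumes "f \<in> borel_measurable borel"
  shows "(\<integral>\<^sup>+ x. f (x + c) \<partial>lborel) = (\<integral>\<^sup>+ x. f x \<partial>lborel)"
proof -
  have "(\<integral>\<^sup>+ x. f x \<partial>lborel) = (\<integral>\<^sup>+ x. f x \<partial>distr lborel borel ((+) c))" by (simp add: lborel_distr_plus)
  also have "\<dots> = (\<integral>\<^sup>+ x. f (c + x) \<partial>lborel)" by (rule nn_integral_distr) (use assms in auto)
  finally show ?thesis by (simp add: add.commute)
qed

lemma nn_integral_wrap:
  fixes f :: "real^'n => ennreal"
  assumes [measurable]: "f \<in> borel_measurable borel" and h: "0 <= h" "h < L"
  shows "(\<integral>\<^sup>+ x. f (wrap L i h x) * indicator (cube L) x \<partial>lborel) = (\<integral>\<^sup>+ x. f x * indicator (cube L) x \<partial>lborel)"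
proof -
  define A where "A = {x::real^'n. x $ i < L - h} \<inter> cube L"
  define B where "B = {x::real^'n. L - h <= x $ i} \<inter> cube L"
  define A' where "A' = {x::real^'n. h <= x $ i} \<inter> cube L"
  define B' where "B' = {x::real^'n. x $ i < h} \<inter> cube L"
  have [measurable]: "A \<in> sets borel" "B \<in> sets borel" "A' \<in> sets borel" "B' \<in> sets borel"
    unfolding A_def B_def A'_def B'_def
    by (intro sets.Int cube_borel borel_open open_Collect_less borel_closed closed_Collect_le continuous_intros)+
  have split: "y \<in> cube L \<longleftrightarrow> (0 <= y $ i \<and> y $ i < L) \<and> (\<forall>j. j \<noteq> i \<longrightarrow> 0 <= y $ j \<and> y $ j < L)" for y :: "real^'n"
    unfolding cube_def by auto
  have comp: "(x + axis i t) $ i = x $ i + t" "j \<noteq> i ==> (x + axis i t) $ j = x $ j" for x :: "real^'n" and t j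
    by (simp_all add: axis_def)
  have A: "x \<in> A \<longleftrightarrow> x + axis i h \<in> A'" for x
    using h by (auto simp: A_def A'_def split comp simp del: vector_add_component)
  have B: "x \<in> B \<longleftrightarrow> x + axis i (h - L) \<in> B'" for x
    using h by (auto simp: B_def B'_def split comp simp del: vector_add_component)
  have "f (wrap L i h x) * indicator (cube L) x
      = f (x + axis i h) * indicator A' (x + axis i h) + f (x + axis i (h - L)) * indicator B' (x + axis i (h - L))" for x
    unfolding indicator_def A[symmetric] B[symmetric] by (auto simp: A_def B_def wrap_def)
  then have "(\<integral>\<^sup>+ x. f (wrap L i h x) * indicator (cube L) x \<partial>lborel)
      = (\<integral>\<^sup>+ x. f (x + axis i h) * indicator A' (x + axis i h) + f (x + axis i (h - L)) * indicator B' (x + axis i (h - L)) \<partial>lborel)"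
    by simp
  also have "\<dots> = (\<integral>\<^sup>+ x. f (x + axis i h) * indicator A' (x + axis i h) \<partial>lborel)
      + (\<integral>\<^sup>+ x. f (x + axis i (h - L)) * indicator B' (x + axis i (h - L)) \<partial>lborel)"
    by (rule nn_integral_add) measurable
  also have "(\<integral>\<^sup>+ x. f (x + axis i h) * indicator A' (x + axis i h) \<partial>lborel) = (\<integral>\<^sup>+ x. f x * indicator A' x \<partial>lborel)"
    by (rule nn_integral_translate[of "\<lambda>x. f x * indicator A' x"]) measurable
  also have "(\<integral>\<^sup>+ x. f (x + axis i (h - L)) * indicator B' (x + axis i (h - L)) \<partial>lborel) = (\<integral>\<^sup>+ x. f x * indicator B' x \<partial>lborel)"
    by (rule nn_integral_translate[of "\<lambda>x. f x * indicator B' x"]) measurable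
  also have "(\<integral>\<^sup>+ x. f x * indicator A' x \<partial>lborel) + (\<integral>\<^sup>+ x. f x * indicator B' x \<partial>lborel)
      = (\<integral>\<^sup>+ x. f x * indicator A' x + f x * indicator B' x \<partial>lborel)"
    by (rule nn_integral_add[symmetric]) measurable
  also have "\<dots> = (\<integral>\<^sup>+ x. f x * indicator (cube L) x \<partial>lborel)"
    by (rule nn_integral_cong) (auto simp: A'_def B'_def indicator_def)
  finally show ?thesis .
qed

text \<open>The Borel version of the measure on the torus. Fubini and image measures are applied to it, since
  the completed measure of a product is not the product of the completed measures.\<close>

definition btorus :: "real => (real^'n) measure" where
  "btorus L = density lborel (indicator (cube L))"

lemma sets_btorus [measurable_cong, simp]: "sets (btorus L) = sets borel" by (simp add: btorus_def)
lemma space_btorus [simp]: "space (btorus L) = UNIV" by (simp add: btorus_def)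

lemma torus_integral_borel:
  fixes f :: "real^'n => real"
  assumes [measurable]: "f \<in> borel_measurable borel"
  shows "(LINT x|torus L. f x) = (LINT x|btorus L. f x)" "integrable (torus L) f \<longleftrightarrow> integrable (btorus L) f"
proof -
  have d: "density lborel (indicator (cube L)) = density lborel (\<lambda>x. ennreal (indicator (cube L) x))"
    by (simp add: ennreal_indicator)
  have "(LINT x|torus L. f x) = (LINT x|lebesgue. indicator (cube L) x *\<^sub>R f x)"
    unfolding torus_def by (rule integral_restrict_space) simp
  also have "\<dots> = (LINT x|lborel. indicator (cube L) x *\<^sub>R f x)"
    by (rule integral_completion) simp
  also have "\<dots> = (LINT x|btorus L. f x)"
    unfolding btorus_def d by (rule integral_density[symmetric]) auto
  finally show "(LINT x|torus L. f x) = (LINT x|btorus L. f x)" .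
  have "integrable (torus L) f \<longleftrightarrow> integrable lebesgue (\<lambda>x. indicator (cube L) x *\<^sub>R f x)"
    unfolding torus_def by (rule integrable_restrict_space) simp
  also have "\<dots> \<longleftrightarrow> integrable lborel (\<lambda>x. indicator (cube L) x *\<^sub>R f x)"
    by (rule integrable_completion) simp
  also have "\<dots> \<longleftrightarrow> integrable (btorus L) f"
    unfolding btorus_def d by (rule integrable_density[symmetric]) auto
  finally show "integrable (torus L) f \<longleftrightarrow> integrable (btorus L) f" .
qed

lemma distr_wrap:
  assumes h: "0 <= h" "h < L"
  shows "distr (btorus L) borel (wrap L i h) = (btorus L :: (real^'n) measure)"
proof (rule measure_eqI)
  fix A assume "A \<in> sets (distr (btorus L) borel (wrap L i h :: real^'n => _))"
  then have [measurable]: "A \<in> sets borel" by simp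
  have "emeasure (distr (btorus L) borel (wrap L i h)) A = (\<integral>\<^sup>+ x. indicator A x \<partial>distr (btorus L) borel (wrap L i h))" by simp
  also have "\<dots> = (\<integral>\<^sup>+ x. indicator A (wrap L i h x) \<partial>btorus L)"
    by (rule nn_integral_distr) auto
  also have "\<dots> = (\<integral>\<^sup>+ x. indicator A (wrap L i h x) * indicator (cube L) x \<partial>lborel)"
    unfolding btorus_def by (subst nn_integral_density) (auto simp: mult.commute)
  also have "\<dots> = (\<integral>\<^sup>+ x. indicator A x * indicator (cube L) x \<partial>lborel)"
    by (rule nn_integral_wrap) (use h in auto)
  also have "\<dots> = (\<integral>\<^sup>+ x. indicator A x \<partial>btorus L)"
    unfolding btorus_def by (subst nn_integral_density) (auto simp: mult.commute)
  finally show "emeasure (distr (btorus L) borel (wrap L i h)) A = emeasure (btorus L) A" by simp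
qed simp

lemma torus_periodic_minus:
  assumes "torus_periodic L f"
  shows "f (x - axis i L) = f x"
  using assms[unfolded torus_periodic_def, rule_format, of "x - axis i L" i] by simp

lemma wrap_periodic:
  assumes "torus_periodic L f"
  shows "f (wrap L i h x) = f (x + axis i h)"
proof -
  have "axis i (h - L) = axis i h - axis i L" by (auto simp: axis_def vec_eq_iff)
  then have e: "x + axis i (h - L) = (x + axis i h) - axis i L" by simp
  show ?thesis unfolding wrap_def e using torus_periodic_minus[OF assms, of "x + axis i h" i] by simp
qed

lemma torus_integral_shift_axis:
  fixes f :: "real^'n => real"
  assumes f: "f \<in> borel_measurable borel" "torus_periodic L f" and h: "0 <= h" "h < L"
  shows "(LINT x|torus L. f (x + axis i h)) = (LINT x|torus L. f x)"
proof -
  have "(LINT x|torus L. f (x + axis i h)) = (LINT x|btorus L. f (x + axis i h))"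
    by (rule torus_integral_borel(1)) (use f in measurable)
  also have "\<dots> = (LINT x|btorus L. f (wrap L i h x))" by (simp add: wrap_periodic[OF f(2)])
  also have "\<dots> = (LINT x|distr (btorus L) borel (wrap L i h). f x)"
    by (rule integral_distr[symmetric]) (use f in auto)
  also have "\<dots> = (LINT x|torus L. f x)"
    by (simp add: distr_wrap[OF h] torus_integral_borel(1)[OF f(1)])
  finally show ?thesis .
qed

lemma torus_periodic_shift: "torus_periodic L f ==> torus_periodic L (\<lambda>x. f (x + c))"
  unfolding torus_periodic_def by (metis add.assoc add.commute)

lemma torus_integral_shift:
  fixes f :: "real^'n => real"
  assumes f: "f \<in> borel_measurable borel" "torus_periodic L f" and h: "h \<in> cube L"
  shows "(LINT x|torus L. f (x + h)) = (LINT x|torus L. f x)"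
proof -
  have "(LINT x|torus L. f (x + (\<Sum>j\<in>J. axis j (h $ j)))) = (LINT x|torus L. f x)" if "finite J" for J
    using that
  proof (induction J rule: finite_induct)
    case (insert j J)
    have "(LINT x|torus L. f (x + (\<Sum>j\<in>insert j J. axis j (h $ j))))
        = (LINT x|torus L. f ((x + axis j (h $ j)) + (\<Sum>j\<in>J. axis j (h $ j))))"
      using insert by (simp add: add.assoc)
    also have "\<dots> = (LINT x|torus L. f (x + (\<Sum>j\<in>J. axis j (h $ j))))"
      by (rule torus_integral_shift_axis[of "\<lambda>x. f (x + (\<Sum>j\<in>J. axis j (h $ j)))"])
        (use f h in \<open>auto simp: cube_def intro: torus_periodic_shift\<close>)
    finally show ?case using insert by simp
  qed simp
  moreover have "(\<Sum>j\<in>UNIV. axis j (h $ j)) = h"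
    by (simp add: vec_eq_iff axis_def if_distrib cong: if_cong)
  ultimately show ?thesis by (metis finite)
qed

section \<open>Smooth functions on the torus\<close>

lemma C_k_add: "C_k k f ==> C_k k g ==> C_k k (\<lambda>x. f x + g x)"
proof (induction k arbitrary: f g)
  case 0 then show ?case by (auto intro: continuous_on_add)
next
  case (Suc k)
  have "frechet_derivative (\<lambda>x. f x + g x) (at x) = (\<lambda>h. frechet_derivative f (at x) h + frechet_derivative g (at x) h)" for x
  proof -
    have "f differentiable (at x)" "g differentiable (at x)" using Suc.prems by auto
    from has_derivative_add[OF this[unfolded frechet_derivative_works]]
    show ?thesis using frechet_derivative_at by metis
  qed
  then show ?case using Suc by (auto intro: differentiable_add)
qed

lemma C_k_cmult: "C_k k f ==> C_k k (\<lambda>x. (c::real) * f x)"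
proof (induction k arbitrary: f)
  case 0 then show ?case by (auto intro: continuous_intros)
next
  case (Suc k)
  have "frechet_derivative (\<lambda>x. c * f x) (at x) = (\<lambda>h. c * frechet_derivative f (at x) h)" for x
  proof -
    have "f differentiable (at x)" using Suc.prems by auto
    from has_derivative_mult_right[OF this[unfolded frechet_derivative_works], of c]
    show ?thesis using frechet_derivative_at by metis
  qed
  then show ?case using Suc by (auto intro: differentiable_mult)
qed

lemma C_infinity_derivative: "C_infinity f ==> C_infinity (\<lambda>x. frechet_derivative f (at x) h)"
  unfolding C_infinity_def by (metis C_k.simps(2))

lemma C_infinity_differentiable: "C_infinity f ==> f differentiable (at x)"
  unfolding C_infinity_def by (metis C_k.simps(2))

lemma C_infinity_continuous: "C_infinity f ==> continuous_on S f"
  unfolding C_infinity_def by (metis C_k.simps(1) continuous_on_subset subset_UNIV)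

lemma torus_smooth_add: "f \<in> torus_smooth L ==> g \<in> torus_smooth L ==> (\<lambda>x. f x + g x) \<in> torus_smooth L"
  by (simp add: torus_smooth_def C_infinity_def torus_periodic_def C_k_add)

lemma torus_smooth_cmult: "f \<in> torus_smooth L ==> (\<lambda>x. c * f x) \<in> torus_smooth L"
  by (simp add: torus_smooth_def C_infinity_def torus_periodic_def C_k_cmult)

lemma torus_smooth_derivative:
  assumes "f \<in> torus_smooth L"
  shows "(f has_derivative frechet_derivative f (at x)) (at x)"
  using assms C_infinity_differentiable by (auto simp: torus_smooth_def frechet_derivative_works)

lemma torus_smooth_partial:
  assumes "f \<in> torus_smooth L"
  shows "partial i f \<in> torus_smooth L"
proof -
  have per: "f (x + axis j L) = f x" for x j using assms by (auto simp: torus_smooth_def torus_periodic_def)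
  have "frechet_derivative f (at (x + axis j L)) = frechet_derivative f (at x)" for x j
  proof -
    have "((\<lambda>y. f (y + axis j L)) has_derivative frechet_derivative f (at (x + axis j L))) (at x)"
      using has_derivative_compose[OF has_derivative_add_const[OF has_derivative_ident, of "axis j L"] torus_smooth_derivative[OF assms]]
      by simp
    then have "(f has_derivative frechet_derivative f (at (x + axis j L))) (at x)" by (simp add: per)
    then show ?thesis using frechet_derivative_at by metis
  qed
  then show ?thesis
    using C_infinity_derivative[of f] assms by (auto simp: torus_smooth_def torus_periodic_def partial_def[abs_def])
qed

lemma torus_smooth_continuous: "f \<in> torus_smooth L ==> continuous_on S f"
  by (simp add: torus_smooth_def C_infinity_continuous)

lemma torus_smooth_borel: "f \<in> torus_smooth L ==> f \<in> borel_measurable borel"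
  by (rule borel_measurable_continuous_onI[OF torus_smooth_continuous])

lemma partial_eq: "(f has_derivative f') (at x) ==> partial i f x = f' (axis i 1)"
  unfolding partial_def using frechet_derivative_at by metis

lemma partial_add:
  assumes "f \<in> torus_smooth L" "g \<in> torus_smooth L"
  shows "partial i (\<lambda>x. f x + g x) x = partial i f x + partial i g x"
  using partial_eq[OF has_derivative_add[OF torus_smooth_derivative[OF assms(1)] torus_smooth_derivative[OF assms(2)]]]
  by (simp add: partial_def)

lemma partial_cmult:
  assumes "f \<in> torus_smooth L"
  shows "partial i (\<lambda>x. c * f x) x = c * partial i f x"
  using partial_eq[OF has_derivative_mult_right[OF torus_smooth_derivative[OF assms]]] by (simp add: partial_def)

lemma continuous_bounded_on_cube:
  fixes f :: "real^'n => real"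
  assumes "continuous_on UNIV f"
  obtains C where "0 <= C" "\<And>x. x \<in> cbox 0 (box_corner M) ==> \<bar>f x\<bar> <= C"
proof -
  have "bounded (f ` cbox 0 (box_corner M))"
    by (intro compact_imp_bounded compact_continuous_image continuous_on_subset[OF assms]) auto
  then obtain C where "\<And>x. x \<in> cbox 0 (box_corner M) ==> \<bar>f x\<bar> <= C" unfolding bounded_iff by force
  then show ?thesis using that[of "\<bar>C\<bar>"] by force
qed

lemma torus_continuous_integrable:
  fixes f :: "real^'n => real"
  assumes "0 < L" "continuous_on UNIV f"
  shows "integrable (torus L) f"
proof -
  obtain C where "\<And>x. x \<in> cbox 0 (box_corner L) ==> \<bar>f x\<bar> <= C" using continuous_bounded_on_cube[OF assms(2)] by blast
  then have "AE x in torus L. \<bar>f x\<bar> <= C" using cube_subset_cbox by (intro AE_I2) auto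
  then show ?thesis
    by (intro torus_integrable_bounded assms torus_measurableI borel_measurable_continuous_onI)
qed

text \<open>Difference quotients of a periodic function have integral zero by translation invariance, and they
  converge boundedly to the derivative.\<close>

lemma torus_integral_partial_eq_0:
  fixes f :: "real^'n => real"
  assumes L: "0 < L" and per: "torus_periodic L f" and d: "\<And>x. (f has_derivative f' x) (at x)"
    and c: "continuous_on UNIV (\<lambda>x. f' x (axis i 1))"
  shows "(LINT x|torus L. f' x (axis i 1)) = 0"
proof -
  define p where "p = (\<lambda>x. f' x (axis i 1))"
  define h where "h = (\<lambda>n. L / (real n + 2))"
  have h: "0 < h n" "h n < L" for n
  proof -
    show "0 < h n" using L by (simp add: h_def)
    have "L * 1 < L * (real n + 2)" using L by (intro mult_strict_left_mono) auto
    then show "h n < L" by (simp add: h_def divide_less_eq)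
  qed
  have hn: "h n \<noteq> 0" for n using h(1)[of n] by simp
  have h0: "h \<longlonglongrightarrow> 0"
  proof -
    have "(\<lambda>n. L * inverse (real (Suc (Suc n)))) \<longlonglongrightarrow> L * 0"
      by (intro tendsto_mult tendsto_const LIMSEQ_Suc[OF LIMSEQ_inverse_real_of_nat])
    then show ?thesis by (simp add: h_def divide_inverse add.commute)
  qed
  have cf: "continuous_on UNIV f"
    using has_derivative_continuous[OF d] by (intro continuous_at_imp_continuous_on) auto
  have fb: "f \<in> borel_measurable borel" by (rule borel_measurable_continuous_onI[OF cf])
  obtain C where C: "0 <= C" "\<And>x. x \<in> cbox 0 (box_corner (2 * L)) ==> \<bar>p x\<bar> <= C"
    using continuous_bounded_on_cube[of p "2 * L"] c unfolding p_def by blast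
  have line: "((\<lambda>s. f (x + s *\<^sub>R axis i 1)) has_real_derivative p (x + s *\<^sub>R axis i 1)) (at s)" for x s
  proof -
    have "((\<lambda>s. x + s *\<^sub>R axis i 1) has_derivative (\<lambda>t. t *\<^sub>R axis i 1)) (at s)"
      by (auto intro!: derivative_eq_intros)
    from has_derivative_compose[OF this d[of "x + s *\<^sub>R axis i 1"]]
    have "((\<lambda>s. f (x + s *\<^sub>R axis i 1)) has_derivative (\<lambda>t. f' (x + s *\<^sub>R axis i 1) (t *\<^sub>R axis i 1))) (at s)" .
    moreover have "f' y (t *\<^sub>R axis i 1) = p y * t" for y t
      using linear_cmul[OF has_derivative_linear[OF d[of y]]] by (simp add: p_def)
    ultimately have "((\<lambda>s. f (x + s *\<^sub>R axis i 1)) has_derivative (\<lambda>t. p (x + s *\<^sub>R axis i 1) * t)) (at s)" by simp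
    then show ?thesis unfolding has_field_derivative_def .
  qed
  have a0: "axis i (0::real) = 0" by (simp add: axis_def vec_eq_iff)
  define q where "q = (\<lambda>n x. (f (x + axis i (h n)) - f x) / h n)"
  have q0: "(LINT x|torus L. q n x) = 0" for n
  proof -
    have "(LINT x|torus L. f (x + axis i (h n)) - f x) = (LINT x|torus L. f (x + axis i (h n))) - (LINT x|torus L. f x)"
      by (rule Bochner_Integration.integral_diff)
        (intro torus_continuous_integrable L cf continuous_on_compose2[OF cf] continuous_intros subset_UNIV)+
    also have "\<dots> = 0" using torus_integral_shift_axis[OF fb per] h[of n] by (simp add: less_imp_le)
    finally show ?thesis by (simp add: q_def)
  qed
  have "(\<lambda>n. LINT x|torus L. q n x) \<longlonglongrightarrow> (LINT x|torus L. p x)"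
  proof (rule integral_dominated_convergence[where w = "\<lambda>_. C"])
    show "p \<in> borel_measurable (torus L)"
      using c unfolding p_def by (intro torus_measurableI borel_measurable_continuous_onI)
    show "q n \<in> borel_measurable (torus L)" for n
      unfolding q_def using h[of n]
      by (intro torus_measurableI borel_measurable_continuous_onI continuous_intros cf continuous_on_compose2[OF cf]) auto
    show "integrable (torus L) (\<lambda>_. C)" by (intro torus_continuous_integrable L continuous_intros)
    show "AE x in torus L. (\<lambda>n. q n x) \<longlonglongrightarrow> p x"
    proof (rule AE_I2)
      fix x
      have "((\<lambda>s. (f (x + s *\<^sub>R axis i 1) - f x) / s) \<longlongrightarrow> p x) (at 0)"
        using line[of x 0] by (simp add: has_field_derivative_iff)
      moreover have "filterlim h (at 0) sequentially"
        unfolding filterlim_at by (simp add: h0 hn)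
      ultimately have "(\<lambda>n. (f (x + h n *\<^sub>R axis i 1) - f x) / h n) \<longlonglongrightarrow> p x"
        by (rule filterlim_compose)
      then show "(\<lambda>n. q n x) \<longlonglongrightarrow> p x" by (simp add: q_def axis_scale[symmetric])
    qed
    show "AE x in torus L. norm (q n x) <= C" for n
    proof (rule AE_I2)
      fix x :: "real^'n" assume "x \<in> space (torus L)"
      then have x: "x \<in> cube L" by simp
      obtain s where s: "0 < s" "s < h n" "f (x + h n *\<^sub>R axis i 1) - f (x + 0 *\<^sub>R axis i 1) = (h n - 0) * p (x + s *\<^sub>R axis i 1)"
        using MVT2[of 0 "h n" "\<lambda>s. f (x + s *\<^sub>R axis i 1)" "\<lambda>s. p (x + s *\<^sub>R axis i 1)"] line h[of n] by blast
      have "x + s *\<^sub>R axis i 1 \<in> cbox 0 (box_corner (2 * L))"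
      proof -
        have "0 <= (x + s *\<^sub>R axis i 1) $ j \<and> (x + s *\<^sub>R axis i 1) $ j <= 2 * L" for j
        proof -
          have "0 <= x $ j" "x $ j < L" using x by (auto simp: cube_def)
          then show ?thesis using s h[of n] by (auto simp: axis_def)
        qed
        then show ?thesis by (simp add: mem_box_cart)
      qed
      moreover have "q n x = p (x + s *\<^sub>R axis i 1)" using s hn[of n] by (simp add: q_def axis_scale[symmetric] a0)
      ultimately show "norm (q n x) <= C" using C by simp
    qed
  qed
  then show ?thesis unfolding q0 by (simp add: p_def LIMSEQ_const_iff)
qed

lemma torus_integration_by_parts:
  fixes f g :: "real^'n => real"
  assumes L: "0 < L" and f: "f \<in> torus_smooth L" and g: "g \<in> torus_smooth L"
  shows "(LINT x|torus L. f x * partial i g x) = - (LINT x|torus L. partial i f x * g x)"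
proof -
  have c: "continuous_on UNIV f" "continuous_on UNIV g" "continuous_on UNIV (partial i f)" "continuous_on UNIV (partial i g)"
    by (rule torus_smooth_continuous[OF f] torus_smooth_continuous[OF g] torus_smooth_continuous[OF torus_smooth_partial[OF f]]
        torus_smooth_continuous[OF torus_smooth_partial[OF g]])+
  have "(LINT x|torus L. f x * frechet_derivative g (at x) (axis i 1) + frechet_derivative f (at x) (axis i 1) * g x) = 0"
  proof (rule torus_integral_partial_eq_0[OF L])
    show "torus_periodic L (\<lambda>x. f x * g x)" using f g by (simp add: torus_smooth_def torus_periodic_def)
    show "((\<lambda>x. f x * g x) has_derivative (\<lambda>h. f x * frechet_derivative g (at x) h + frechet_derivative f (at x) h * g x)) (at x)" for x
      by (rule has_derivative_mult[OF torus_smooth_derivative[OF f] torus_smooth_derivative[OF g]])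
    show "continuous_on UNIV (\<lambda>x. f x * frechet_derivative g (at x) (axis i 1) + frechet_derivative f (at x) (axis i 1) * g x)"
      using c unfolding partial_def[abs_def] by (intro continuous_intros)
  qed
  then have "(LINT x|torus L. f x * partial i g x + partial i f x * g x) = 0" by (simp add: partial_def)
  moreover have "(LINT x|torus L. f x * partial i g x + partial i f x * g x)
      = (LINT x|torus L. f x * partial i g x) + (LINT x|torus L. partial i f x * g x)"
    by (rule Bochner_Integration.integral_add) (intro torus_continuous_integrable L continuous_intros c)+
  ultimately show ?thesis by simp
qed

subsection \<open>The Poincare inequality\<close>

text \<open>The Cauchy-Schwarz inequality along a segment, in the form that a variance is nonnegative.\<close>

lemma square_increment_le:
  fixes f :: "'a::euclidean_space => real"
  assumes d: "\<And>x. (f has_derivative f' x) (at x)" and c: "continuous_on UNIV (\<lambda>x. f' x h)"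
  shows "(f (x + h) - f x)\<^sup>2 <= integral {0..1} (\<lambda>s. (f' (x + s *\<^sub>R h) h)\<^sup>2)"
proof -
  define D where "D = f (x + h) - f x"
  define k where "k = (\<lambda>s. f' (x + s *\<^sub>R h) h)"
  have ck: "continuous_on {0..1} k" unfolding k_def
    by (intro continuous_on_compose2[OF c] continuous_intros) auto
  have "(k has_integral (f (x + 1 *\<^sub>R h) - f (x + 0 *\<^sub>R h))) {0..1}"
  proof (rule fundamental_theorem_of_calculus)
    fix s :: real
    have "((\<lambda>s. x + s *\<^sub>R h) has_derivative (\<lambda>t. t *\<^sub>R h)) (at s within {0..1})"
      by (auto intro!: derivative_eq_intros)
    from has_derivative_compose[OF this d[of "x + s *\<^sub>R h"]]
    have "((\<lambda>s. f (x + s *\<^sub>R h)) has_derivative (\<lambda>t. f' (x + s *\<^sub>R h) (t *\<^sub>R h))) (at s within {0..1})" .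
    moreover have "f' y (t *\<^sub>R h) = t *\<^sub>R f' y h" for y t
      using linear_cmul[OF has_derivative_linear[OF d[of y]]] by simp
    ultimately show "((\<lambda>s. f (x + s *\<^sub>R h)) has_vector_derivative k s) (at s within {0..1})"
      by (simp add: has_vector_derivative_def k_def)
  qed simp
  then have k: "(k has_integral D) {0..1}" by (simp add: D_def)
  have k2: "((\<lambda>s. (k s)\<^sup>2) has_integral integral {0..1} (\<lambda>s. (k s)\<^sup>2)) {0..1}"
    by (intro integrable_integral integrable_continuous_real continuous_intros ck)
  have "((\<lambda>s. (k s)\<^sup>2 - 2 * D * k s + D\<^sup>2) has_integral (integral {0..1} (\<lambda>s. (k s)\<^sup>2) - 2 * D * D + D\<^sup>2)) {0..1}"
    using has_integral_add[OF has_integral_diff[OF k2 has_integral_mult_right[OF k, of "2 * D"]] has_integral_const_real[of "D\<^sup>2" 0 1]]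
    by simp
  then have "0 <= integral {0..1} (\<lambda>s. (k s)\<^sup>2) - 2 * D * D + D\<^sup>2"
  proof (rule has_integral_nonneg)
    show "0 <= (k s)\<^sup>2 - 2 * D * k s + D\<^sup>2" for s
      using zero_le_power2[of "k s - D"] by (simp add: power2_eq_square algebra_simps)
  qed
  then have "D\<^sup>2 <= integral {0..1} (\<lambda>s. (k s)\<^sup>2)" by (simp add: power2_eq_square)
  then show ?thesis by (simp add: D_def k_def)
qed

lemma frechet_grad:
  fixes f :: "real^'n => real"
  assumes "f differentiable (at x)"
  shows "frechet_derivative f (at x) h = grad f x \<bullet> h"
proof -
  have lin: "linear (frechet_derivative f (at x))" using assms by (rule linear_frechet_derivative)
  have "h = (\<Sum>j\<in>UNIV. (h $ j) *\<^sub>R axis j 1)" by (simp add: vec_eq_iff axis_def if_distrib cong: if_cong)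
  then have "frechet_derivative f (at x) h = frechet_derivative f (at x) (\<Sum>j\<in>UNIV. (h $ j) *\<^sub>R axis j 1)"
    by (rule arg_cong)
  also have "\<dots> = (\<Sum>j\<in>UNIV. h $ j * frechet_derivative f (at x) (axis j 1))"
    by (simp only: linear_sum[OF lin] linear_cmul[OF lin] real_scaleR_def)
  finally have "frechet_derivative f (at x) h = (\<Sum>j\<in>UNIV. h $ j * frechet_derivative f (at x) (axis j 1))" .
  then show ?thesis by (simp add: grad_def partial_def inner_vec_def mult.commute)
qed

lemma grad_continuous: "f \<in> torus_smooth L ==> continuous_on S (grad f)"
  unfolding grad_def[abs_def]
  by (intro continuous_on_vec_lambda torus_smooth_continuous[OF torus_smooth_partial])

lemma finite_measure_btorus: "0 < L ==> finite_measure (btorus L :: (real^'n) measure)"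
proof (rule finite_measureI)
  assume L: "0 < L"
  have "emeasure (btorus L) (space (btorus L) :: (real^'n) set) = emeasure lborel (cube L :: (real^'n) set)"
    unfolding btorus_def by (simp add: emeasure_density)
  also have "\<dots> = ennreal (L ^ CARD('n))"
    using emeasure_torus_borel[of "UNIV :: (real^'n) set" L] emeasure_torus[OF L, where 'n = 'n] by simp
  finally show "emeasure (btorus L) (space (btorus L) :: (real^'n) set) \<noteq> \<infinity>" by simp
qed

lemma AE_btorus: "(\<And>x. x \<in> cube L ==> P x) ==> AE x in btorus L. P x"
  unfolding btorus_def by (subst AE_density) (auto simp: indicator_def)

lemma btorus_continuous_integrable:
  fixes f :: "real^'n => real"
  assumes "0 < L" "continuous_on UNIV f"
  shows "integrable (btorus L) f"
  using torus_continuous_integrable[OF assms] torus_integral_borel(2)[OF borel_measurable_continuous_onI[OF assms(2)]] by simp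

text \<open>The pointwise estimate is integrated over the torus; by Fubini and translation invariance every
  point of the segment contributes the same.\<close>

lemma square_increment_integral_le:
  fixes f :: "real^'n => real"
  assumes L: "0 < L" and f: "f \<in> torus_smooth L" and h: "h \<in> cube L"
  shows "(LINT x|torus L. (f (x + h) - f x)\<^sup>2) <= (norm h)\<^sup>2 * (LINT x|torus L. (norm (grad f x))\<^sup>2)"
proof -
  define k where "k = (\<lambda>x. (grad f x \<bullet> h)\<^sup>2)"
  have diff: "f differentiable (at x)" for x using f by (simp add: torus_smooth_def C_infinity_differentiable)
  have ck: "continuous_on S k" for S unfolding k_def by (intro continuous_intros grad_continuous[OF f])
  have kb: "k \<in> borel_measurable borel" by (rule borel_measurable_continuous_onI[OF ck])
  have cf: "continuous_on UNIV f" by (rule torus_smooth_continuous[OF f])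
  have perk: "torus_periodic L k"
    using torus_smooth_partial[OF f] unfolding k_def grad_def by (simp add: torus_periodic_def torus_smooth_def)
  have sh: "s *\<^sub>R h \<in> cube L" if "s \<in> {0..1}" for s
  proof -
    have "0 <= s * h $ j \<and> s * h $ j < L" for j
    proof -
      have hj: "0 <= h $ j" "h $ j < L" using h by (auto simp: cube_def)
      then have "s * h $ j <= 1 * h $ j" using that by (intro mult_right_mono) auto
      then show ?thesis using hj that by auto
    qed
    then show ?thesis by (simp add: cube_def)
  qed
  interpret B: finite_measure "btorus L :: (real^'n) measure" by (rule finite_measure_btorus[OF L])
  interpret P: pair_sigma_finite "btorus L :: (real^'n) measure" lborel ..
  have b2: "(\<lambda>p::(real^'n) \<times> real. k (fst p + snd p *\<^sub>R h)) \<in> borel_measurable (borel \<Otimes>\<^sub>M borel)"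
    unfolding borel_prod by (intro borel_measurable_continuous_onI continuous_on_compose2[OF ck[of UNIV]] continuous_intros) auto
  have "(\<integral>\<^sup>+ x. ennreal ((f (x + h) - f x)\<^sup>2) \<partial>btorus L) <= (\<integral>\<^sup>+ x. (\<integral>\<^sup>+ s. ennreal (k (x + s *\<^sub>R h)) * indicator {0..1} s \<partial>lborel) \<partial>btorus L)"
  proof (rule nn_integral_mono)
    fix x :: "real^'n"
    have "(f (x + h) - f x)\<^sup>2 <= integral {0..1} (\<lambda>s. (frechet_derivative f (at (x + s *\<^sub>R h)) h)\<^sup>2)"
    proof (rule square_increment_le[OF torus_smooth_derivative[OF f]])
      show "continuous_on UNIV (\<lambda>x. frechet_derivative f (at x) h)"
        unfolding frechet_grad[OF diff] by (intro continuous_intros grad_continuous[OF f])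
    qed
    also have "\<dots> = integral {0..1} (\<lambda>s. k (x + s *\<^sub>R h))" by (simp add: frechet_grad[OF diff] k_def)
    finally have "ennreal ((f (x + h) - f x)\<^sup>2) <= ennreal (integral {0..1} (\<lambda>s. k (x + s *\<^sub>R h)))" by (rule ennreal_leI)
    also have "\<dots> = (\<integral>\<^sup>+ s. ennreal (k (x + s *\<^sub>R h)) * indicator {0..1} s \<partial>lborel)"
    proof (rule nn_integral_has_integral_lebesgue'[symmetric])
      show "((\<lambda>s. k (x + s *\<^sub>R h)) has_integral integral {0..1} (\<lambda>s. k (x + s *\<^sub>R h))) {0..1}"
        by (intro integrable_integral integrable_continuous_real continuous_on_compose2[OF ck[of UNIV]] continuous_intros) auto
    qed (auto simp: k_def)
    finally show "ennreal ((f (x + h) - f x)\<^sup>2) <= (\<integral>\<^sup>+ s. ennreal (k (x + s *\<^sub>R h)) * indicator {0..1} s \<partial>lborel)" .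
  qed
  also have "\<dots> = (\<integral>\<^sup>+ s. (\<integral>\<^sup>+ x. ennreal (k (x + s *\<^sub>R h)) * indicator {0..1} s \<partial>btorus L) \<partial>lborel)"
    by (rule P.Fubini[symmetric, of "\<lambda>(x, s). ennreal (k (x + s *\<^sub>R h)) * indicator {0..1} s", simplified])
      (use b2 in \<open>auto simp: case_prod_unfold intro!: borel_measurable_times_ennreal\<close>)
  also have "\<dots> = (\<integral>\<^sup>+ s. ennreal (LINT x|torus L. k x) * indicator {0..1} (s::real) \<partial>lborel)"
  proof (rule nn_integral_cong)
    fix s :: real
    show "(\<integral>\<^sup>+ x. ennreal (k (x + s *\<^sub>R h)) * indicator {0..1} s \<partial>btorus L) = ennreal (LINT x|torus L. k x) * indicator {0..1} s"
    proof (cases "s \<in> {0..1}")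
      case True
      have cks: "continuous_on UNIV (\<lambda>x. k (x + s *\<^sub>R h))"
        by (intro continuous_on_compose2[OF ck[of UNIV]] continuous_intros) auto
      have "(\<integral>\<^sup>+ x. ennreal (k (x + s *\<^sub>R h)) \<partial>btorus L) = ennreal (LINT x|btorus L. k (x + s *\<^sub>R h))"
        by (rule nn_integral_eq_integral[OF btorus_continuous_integrable[OF L cks]]) (simp add: k_def)
      also have "(LINT x|btorus L. k (x + s *\<^sub>R h)) = (LINT x|torus L. k (x + s *\<^sub>R h))"
        by (rule torus_integral_borel(1)[symmetric, OF borel_measurable_continuous_onI[OF cks]])
      also have "\<dots> = (LINT x|torus L. k x)" by (rule torus_integral_shift[OF kb perk sh[OF True]])
      finally show ?thesis using True by simp
    qed simp
  qed
  also have "\<dots> = ennreal (LINT x|torus L. k x)" by (subst nn_integral_cmult_indicator) auto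
  finally have le: "(\<integral>\<^sup>+ x. ennreal ((f (x + h) - f x)\<^sup>2) \<partial>btorus L) <= ennreal (LINT x|torus L. k x)" .
  have cD: "continuous_on UNIV (\<lambda>x. (f (x + h) - f x)\<^sup>2)"
    by (intro continuous_intros cf continuous_on_compose2[OF cf]) auto
  have "(\<integral>\<^sup>+ x. ennreal ((f (x + h) - f x)\<^sup>2) \<partial>btorus L) = ennreal (LINT x|btorus L. (f (x + h) - f x)\<^sup>2)"
    by (rule nn_integral_eq_integral[OF btorus_continuous_integrable[OF L cD]]) simp
  also have "(LINT x|btorus L. (f (x + h) - f x)\<^sup>2) = (LINT x|torus L. (f (x + h) - f x)\<^sup>2)"
    by (rule torus_integral_borel(1)[symmetric, OF borel_measurable_continuous_onI[OF cD]])
  finally have "(LINT x|torus L. (f (x + h) - f x)\<^sup>2) <= (LINT x|torus L. k x)"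
    using le by (simp add: k_def)
  also have "\<dots> <= (LINT x|torus L. (norm h)\<^sup>2 * (norm (grad f x))\<^sup>2)"
  proof (rule integral_mono)
    show "k x <= (norm h)\<^sup>2 * (norm (grad f x))\<^sup>2" for x
    proof -
      have "\<bar>grad f x \<bullet> h\<bar>\<^sup>2 <= (norm (grad f x) * norm h)\<^sup>2"
        by (rule power_mono[OF Cauchy_Schwarz_ineq2]) simp
      then show ?thesis by (simp add: k_def power_mult_distrib mult.commute)
    qed
  qed (intro torus_continuous_integrable L ck continuous_intros grad_continuous[OF f])+
  finally show ?thesis by simp
qed

text \<open>The squared increment \<open>f (x + h) - f x\<close> is integrated over all \<open>x\<close> and
  all translations \<open>h\<close>. The mixed term \<open>f (x + h) f x\<close> integrates to zero because
  \<open>f\<close> has mean zero, so what is left is twice the square norm of \<open>f\<close>.\<close>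

lemma poincare:
  fixes f :: "real^'n => real"
  assumes L: "0 < L" and f: "f \<in> torus_smooth L" and mean: "(LINT x|torus L. f x) = 0"
  shows "(LINT x|torus L. (f x)\<^sup>2) <= real CARD('n) * L\<^sup>2 * (LINT x|torus L. (norm (grad f x))\<^sup>2)"
proof -
  define G where "G = (LINT x|torus L. (norm (grad f x))\<^sup>2)"
  define S where "S = (LINT x|torus L. (f x)\<^sup>2)"
  define V where "V = L ^ CARD('n)"
  have V: "0 < V" using L by (simp add: V_def)
  have cf: "continuous_on A f" for A by (rule torus_smooth_continuous[OF f])
  have fb: "f \<in> borel_measurable borel" by (rule torus_smooth_borel[OF f])
  have per: "torus_periodic L f" using f by (simp add: torus_smooth_def)
  have G0: "0 <= G" by (simp add: G_def)
  interpret B: finite_measure "btorus L :: (real^'n) measure" by (rule finite_measure_btorus[OF L])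
  interpret P: pair_sigma_finite "btorus L :: (real^'n) measure" "btorus L :: (real^'n) measure" ..
  obtain C where C: "0 <= C" "\<And>x. x \<in> cbox 0 (box_corner (2 * L)) ==> \<bar>f x\<bar> <= C"
    using continuous_bounded_on_cube[OF cf, of "2 * L"] by blast
  have const: "(LINT h|(btorus L :: (real^'n) measure). c) = c * V" for c :: real
    using torus_integral_borel(1)[of "\<lambda>_::real^'n. c" L] measure_torus[OF L, where 'n = 'n] by (auto simp: V_def)
  have int: "integrable (btorus L \<Otimes>\<^sub>M btorus L) (\<lambda>(h, x). f (x + h) * f x)"
  proof -
      have m: "(\<lambda>p::(real^'n) \<times> (real^'n). f (snd p + fst p) * f (snd p)) \<in> borel_measurable (borel \<Otimes>\<^sub>M borel)"
        unfolding borel_prod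
        by (intro borel_measurable_continuous_onI continuous_intros continuous_on_compose2[OF cf[of UNIV]]) auto
      interpret PP: finite_measure "btorus L \<Otimes>\<^sub>M btorus L :: ((real^'n) \<times> (real^'n)) measure"
        by (rule finite_measure_pair_measure) (rule B.finite_measure_axioms)+
      have "AE p in (btorus L \<Otimes>\<^sub>M btorus L :: ((real^'n) \<times> (real^'n)) measure). norm (f (snd p + fst p) * f (snd p)) <= C * C"
      proof (rule P.AE_pair_measure)
        show "AE h in btorus L. AE x in btorus L. norm (f (snd (h, x) + fst (h, x)) * f (snd (h, x))) <= C * C"
        proof (intro AE_btorus)
          fix h x :: "real^'n" assume hx: "h \<in> cube L" "x \<in> cube L"
          have "x \<in> cbox 0 (box_corner (2 * L))" "x + h \<in> cbox 0 (box_corner (2 * L))"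
            using hx L unfolding cube_def mem_box_cart by (auto intro: less_imp_le simp: add_nonneg_nonneg) (smt (verit))+
          then show "norm (f (snd (h, x) + fst (h, x)) * f (snd (h, x))) <= C * C"
            using C by (auto simp: abs_mult intro!: mult_mono)
        qed
        show "{p \<in> space (btorus L \<Otimes>\<^sub>M btorus L). norm (f (snd p + fst p) * f (snd p)) <= C * C} \<in> sets (btorus L \<Otimes>\<^sub>M btorus L)"
          using m by measurable
      qed
      then show ?thesis unfolding case_prod_unfold
        by (rule PP.integrable_const_bound) (use m in \<open>simp cong: measurable_cong_sets\<close>)
  qed
  have prod0: "(LINT h|btorus L. LINT x|btorus L. f (x + h) * f x) = 0"
  proof -
    have "(LINT h|btorus L. LINT x|btorus L. f (x + h) * f x) = (LINT x|btorus L. LINT h|btorus L. f (x + h) * f x)"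
      by (rule P.Fubini_integral[OF int, symmetric])
    also have "\<dots> = (LINT x|(btorus L :: (real^'n) measure). 0)"
    proof (rule integral_cong_AE)
      show "AE x in btorus L. (LINT h|btorus L. f (x + h) * f x) = 0"
      proof (rule AE_btorus)
        fix x :: "real^'n" assume x: "x \<in> cube L"
        have cx: "continuous_on UNIV (\<lambda>h. f (h + x))" by (intro continuous_on_compose2[OF cf[of UNIV]] continuous_intros) auto
        have "(LINT h|btorus L. f (h + x)) = (LINT h|torus L. f (h + x))"
          by (rule torus_integral_borel(1)[symmetric, OF borel_measurable_continuous_onI[OF cx]])
        also have "\<dots> = 0" using torus_integral_shift[OF fb per x] mean by simp
        finally show "(LINT h|btorus L. f (x + h) * f x) = 0" by (simp add: add.commute)
      qed
      show "(\<lambda>x. LINT h|btorus L. f (x + h) * f x) \<in> borel_measurable (btorus L)"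
        using P.integrable_snd[OF int] by simp
    qed auto
    finally show ?thesis by simp
  qed
  have main: "2 * S - 2 * (LINT x|btorus L. f (x + h) * f x) <= real CARD('n) * L\<^sup>2 * G" if h: "h \<in> cube L" for h
  proof -
    have ch: "continuous_on UNIV (\<lambda>x. f (x + h))" by (intro continuous_on_compose2[OF cf[of UNIV]] continuous_intros) auto
    have i: "integrable (torus L) (\<lambda>x. (f (x + h))\<^sup>2)" "integrable (torus L) (\<lambda>x. (f x)\<^sup>2)" "integrable (torus L) (\<lambda>x. f (x + h) * f x)"
      by (intro torus_continuous_integrable L continuous_intros ch cf)+
    have "(LINT x|torus L. (f (x + h))\<^sup>2) = S"
      unfolding S_def
      by (rule torus_integral_shift[of "\<lambda>x. (f x)\<^sup>2"]) (use fb per h in \<open>auto simp: torus_periodic_def\<close>)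
    moreover have "(LINT x|btorus L. f (x + h) * f x) = (LINT x|torus L. f (x + h) * f x)"
      by (rule torus_integral_borel(1)[symmetric]) (intro borel_measurable_continuous_onI continuous_intros ch cf)
    moreover have "(\<lambda>x. (f (x + h) - f x)\<^sup>2) = (\<lambda>x. ((f (x + h))\<^sup>2 + (f x)\<^sup>2) - 2 * (f (x + h) * f x))"
      by (auto simp: power2_eq_square algebra_simps)
    ultimately have "(LINT x|torus L. (f (x + h) - f x)\<^sup>2) = 2 * S - 2 * (LINT x|btorus L. f (x + h) * f x)"
      using i by (simp add: S_def)
    moreover have "(LINT x|torus L. (f (x + h) - f x)\<^sup>2) <= (norm h)\<^sup>2 * G"
      unfolding G_def by (rule square_increment_integral_le[OF L f h])
    moreover have "(norm h)\<^sup>2 * G <= (real CARD('n) * L\<^sup>2) * G"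
    proof (rule mult_right_mono[OF _ G0])
      have "(norm h)\<^sup>2 = (\<Sum>j\<in>UNIV. (h $ j)\<^sup>2)" by (simp add: norm_vec_def L2_set_def sum_nonneg)
      also have "\<dots> <= (\<Sum>j\<in>(UNIV::'n set). L\<^sup>2)"
        by (intro sum_mono power_mono) (use h in \<open>auto simp: cube_def less_imp_le\<close>)
      finally show "(norm h)\<^sup>2 <= real CARD('n) * L\<^sup>2" by simp
    qed
    ultimately show ?thesis by linarith
  qed
  define J where "J = (\<lambda>h. LINT x|btorus L. f (x + h) * f x)"
  have Ji: "integrable (btorus L) J" unfolding J_def using P.integrable_fst[OF int] by simp
  have "2 * S * V = (LINT h|(btorus L :: (real^'n) measure). 2 * S) - 2 * (LINT h|btorus L. J h)"
    unfolding const J_def prod0 by simp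
  also have "\<dots> = (LINT h|btorus L. 2 * S - 2 * J h)"
    using Ji by simp
  also have "\<dots> <= (LINT h|(btorus L :: (real^'n) measure). real CARD('n) * L\<^sup>2 * G)"
    by (rule integral_mono_AE) (use Ji in \<open>auto intro!: AE_btorus simp: J_def main\<close>)
  also have "\<dots> = real CARD('n) * L\<^sup>2 * G * V" by (rule const)
  finally have "2 * S <= real CARD('n) * L\<^sup>2 * G" using V by simp
  moreover have "0 <= S" by (simp add: S_def)
  ultimately have "S <= real CARD('n) * L\<^sup>2 * G" by linarith
  then show ?thesis by (simp add: S_def G_def)
qed

section \<open>Square integrable functions\<close>

lemma L2_real_iff: "f \<in> L2 M \<longleftrightarrow> f \<in> borel_measurable M \<and> integrable M (\<lambda>x. (f x)\<^sup>2)" for f :: "'a => real"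
  by (simp add: L2_def)

lemma L2_mult_integrable:
  fixes f g :: "'a => real"
  assumes "f \<in> L2 M" "g \<in> L2 M"
  shows "integrable M (\<lambda>x. f x * g x)"
proof (rule Bochner_Integration.integrable_bound)
  show "integrable M (\<lambda>x. (f x)\<^sup>2 + (g x)\<^sup>2)" using assms by (simp add: L2_real_iff)
  show "(\<lambda>x. f x * g x) \<in> borel_measurable M"
    using assms unfolding L2_real_iff by (intro borel_measurable_times) auto
  have "\<bar>a * b\<bar> <= a\<^sup>2 + b\<^sup>2" for a b :: real
  proof -
    have "0 <= \<bar>a\<bar> * \<bar>b\<bar>" by simp
    moreover have "2 * (\<bar>a\<bar> * \<bar>b\<bar>) <= a\<^sup>2 + b\<^sup>2" using sum_squares_bound[of "\<bar>a\<bar>" "\<bar>b\<bar>"] by (simp add: mult.assoc)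
    ultimately show ?thesis unfolding abs_mult by linarith
  qed
  then show "AE x in M. norm (f x * g x) <= norm ((f x)\<^sup>2 + (g x)\<^sup>2)" by simp
qed

lemma integrable_mult_bounded:
  fixes k g :: "'a => real"
  assumes k: "integrable M k" and g: "g \<in> borel_measurable M" and C: "AE x in M. \<bar>g x\<bar> <= C"
  shows "integrable M (\<lambda>x. k x * g x)"
proof (rule Bochner_Integration.integrable_bound)
  show "integrable M (\<lambda>x. C * k x)" using k by simp
  show "(\<lambda>x. k x * g x) \<in> borel_measurable M" using k g by measurable
  show "AE x in M. norm (k x * g x) <= norm (C * k x)"
    using C
  proof eventually_elim
    case (elim x)
    have "\<bar>k x\<bar> * \<bar>g x\<bar> <= \<bar>k x\<bar> * \<bar>C\<bar>" using elim by (intro mult_left_mono) auto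
    then show ?case by (simp add: abs_mult mult.commute)
  qed
qed

text \<open>Testing with the sign of \<open>f\<close> on the set \<open>{\<bar>f\<bar> > 1}\<close>.\<close>

lemma bounded_by_duality:
  fixes f :: "'a => real"
  assumes "finite_measure M" and f: "integrable M f"
    and dual: "\<And>g. g \<in> borel_measurable M ==> (\<And>x. \<bar>g x\<bar> <= 1) ==> (LINT x|M. f x * g x) <= (LINT x|M. \<bar>g x\<bar>)"
  shows "AE x in M. \<bar>f x\<bar> <= 1"
proof -
  interpret finite_measure M by fact
  have [measurable]: "f \<in> borel_measurable M" using f by simp
  define g where "g = (\<lambda>x. if 1 < \<bar>f x\<bar> then sgn (f x) else 0)"
  have gm [measurable]: "g \<in> borel_measurable M" unfolding g_def by measurable
  have g1: "\<bar>g x\<bar> <= 1" for x by (simp add: g_def sgn_if)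
  have i: "integrable M (\<lambda>x. f x * g x)" "integrable M (\<lambda>x. \<bar>g x\<bar>)"
    by (rule integrable_mult_bounded[OF f gm, of 1], simp add: g1) (rule integrable_const_bound[of _ 1], auto simp: g1)
  have nn: "AE x in M. 0 <= f x * g x - \<bar>g x\<bar>" by (rule AE_I2) (auto simp: g_def sgn_if)
  have "(LINT x|M. f x * g x - \<bar>g x\<bar>) = 0"
    using dual[OF gm g1] i integral_nonneg_AE[OF nn] by simp
  then have "AE x in M. f x * g x - \<bar>g x\<bar> = 0"
    using integral_nonneg_eq_0_iff_AE[OF _ nn] i by simp
  then show ?thesis by eventually_elim (auto simp: g_def sgn_if split: if_splits)
qed

lemma L2_add:
  fixes f g :: "'a => real"
  assumes "f \<in> L2 M" "g \<in> L2 M"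
  shows "(\<lambda>x. f x + g x) \<in> L2 M"
proof -
  have "(\<lambda>x. (f x + g x)\<^sup>2) = (\<lambda>x. (f x)\<^sup>2 + (g x)\<^sup>2 + 2 * (f x * g x))" by (auto simp: power2_eq_square algebra_simps)
  then show ?thesis using assms L2_mult_integrable[OF assms] by (auto simp: L2_real_iff intro!: borel_measurable_add)
qed

lemma L2_cmult: "f \<in> L2 M ==> (\<lambda>x. c * f x) \<in> L2 M" for f :: "'a => real"
  by (auto simp: L2_real_iff power_mult_distrib intro!: borel_measurable_times)

lemma L2_diff: "f \<in> L2 M ==> g \<in> L2 M ==> (\<lambda>x. f x - g x) \<in> L2 M" for f :: "'a => real"
  using L2_add[OF _ L2_cmult[of g M "- 1"], of f] by simp

text \<open>The linear case \<open>c = 0\<close> is the one in which a variational inequality becomes an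
  equation.\<close>

lemma quadratic_nonneg_discriminant:
  fixes a b c :: real
  assumes nn: "\<And>t. 0 <= a + 2 * t * b + t\<^sup>2 * c" and c: "0 <= c"
  shows "b\<^sup>2 <= a * c"
proof (cases "c = 0")
  case True
  have "b = 0"
  proof (rule ccontr)
    assume b: "b \<noteq> 0"
    have "0 <= a + 2 * (- (a + 1) / (2 * b)) * b" using nn[of "- (a + 1) / (2 * b)"] True by simp
    also have "\<dots> = - 1" using b by (simp add: field_simps)
    finally show False by simp
  qed
  then show ?thesis using True by simp
next
  case False
  then show ?thesis using c nn[of "- b / c"] by (simp add: field_simps power2_eq_square)
qed

lemma cauchy_schwarz_integral:
  fixes f g :: "'a => real"
  assumes f: "f \<in> L2 M" and g: "g \<in> L2 M"
  shows "(LINT x|M. f x * g x)\<^sup>2 <= (LINT x|M. (f x)\<^sup>2) * (LINT x|M. (g x)\<^sup>2)"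
proof (rule quadratic_nonneg_discriminant)
  fix t
  have "0 <= (LINT x|M. (f x + t * g x)\<^sup>2)" by simp
  also have "(\<lambda>x. (f x + t * g x)\<^sup>2) = (\<lambda>x. (f x)\<^sup>2 + 2 * t * (f x * g x) + t\<^sup>2 * (g x)\<^sup>2)"
    by (auto simp: power2_eq_square algebra_simps)
  also have "(LINT x|M. (f x)\<^sup>2 + 2 * t * (f x * g x) + t\<^sup>2 * (g x)\<^sup>2)
      = (LINT x|M. (f x)\<^sup>2) + 2 * t * (LINT x|M. f x * g x) + t\<^sup>2 * (LINT x|M. (g x)\<^sup>2)"
    using f g L2_mult_integrable[OF f g] by (simp add: L2_real_iff)
  finally show "0 <= (LINT x|M. (f x)\<^sup>2) + 2 * t * (LINT x|M. f x * g x) + t\<^sup>2 * (LINT x|M. (g x)\<^sup>2)" .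
qed simp

lemma cauchy_schwarz_sqrt:
  fixes f g :: "'a => real"
  assumes "f \<in> L2 M" "g \<in> L2 M"
  shows "\<bar>LINT x|M. f x * g x\<bar> <= sqrt (LINT x|M. (f x)\<^sup>2) * sqrt (LINT x|M. (g x)\<^sup>2)"
  using real_sqrt_le_mono[OF cauchy_schwarz_integral[OF assms]] by (simp add: real_sqrt_mult)

lemma L2_inner_tendsto:
  fixes f :: "nat => 'a => real"
  assumes f: "\<And>n. f n \<in> L2 M" and g: "g \<in> L2 M" and h: "h \<in> L2 M"
    and lim: "(\<lambda>n. LINT x|M. (f n x - g x)\<^sup>2) \<longlonglongrightarrow> 0"
  shows "(\<lambda>n. LINT x|M. f n x * h x) \<longlonglongrightarrow> (LINT x|M. g x * h x)"
proof -
  have "(\<lambda>n. (LINT x|M. f n x * h x) - (LINT x|M. g x * h x)) \<longlonglongrightarrow> 0"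
  proof (rule Lim_null_comparison)
    have "\<bar>(LINT x|M. f n x * h x) - (LINT x|M. g x * h x)\<bar> <= sqrt (LINT x|M. (f n x - g x)\<^sup>2) * sqrt (LINT x|M. (h x)\<^sup>2)" for n
    proof -
      have "(LINT x|M. f n x * h x) - (LINT x|M. g x * h x) = (LINT x|M. (f n x - g x) * h x)"
        using L2_mult_integrable[OF f h] L2_mult_integrable[OF g h] by (simp add: left_diff_distrib)
      then show ?thesis using cauchy_schwarz_sqrt[OF L2_diff[OF f g] h] by simp
    qed
    then show "\<forall>\<^sub>F n in sequentially. norm ((LINT x|M. f n x * h x) - (LINT x|M. g x * h x))
        <= sqrt (LINT x|M. (f n x - g x)\<^sup>2) * sqrt (LINT x|M. (h x)\<^sup>2)" by simp
    show "(\<lambda>n. sqrt (LINT x|M. (f n x - g x)\<^sup>2) * sqrt (LINT x|M. (h x)\<^sup>2)) \<longlonglongrightarrow> 0"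
      using tendsto_mult[OF tendsto_real_sqrt[OF lim] tendsto_const] by simp
  qed
  then show ?thesis by (simp add: LIM_zero_iff)
qed

text \<open>The Riesz-Fischer theorem: a subsequence with summable increments converges almost everywhere, and
  Fatou's lemma turns this into convergence in square mean.\<close>

lemma L2_complete:
  fixes f :: "nat => 'a => real"
  assumes fin: "finite_measure M" and f: "\<And>n. f n \<in> L2 M"
    and cau: "\<And>e. 0 < e ==> \<exists>N. \<forall>m\<ge>N. \<forall>n\<ge>N. (LINT x|M. (f m x - f n x)\<^sup>2) < e"
  obtains g where "g \<in> L2 M" "(\<lambda>n. LINT x|M. (f n x - g x)\<^sup>2) \<longlonglongrightarrow> 0"
proof -
  interpret finite_measure M by (rule fin)
  have fm [measurable]: "f n \<in> borel_measurable M" for n using f by (simp add: L2_real_iff)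
  have one: "(\<lambda>_. 1::real) \<in> L2 M" by (simp add: L2_real_iff)
  have "\<exists>N. \<forall>m\<ge>N. \<forall>n\<ge>N. (LINT x|M. (f m x - f n x)\<^sup>2) < (1/4) ^ k" for k :: nat by (rule cau) simp
  then obtain N where N: "\<And>k m n. m \<ge> N k ==> n \<ge> N k ==> (LINT x|M. (f m x - f n x)\<^sup>2) < (1/4) ^ k" by metis
  define r where "r = (\<lambda>k. k + (\<Sum>i\<le>k. N i))"
  have r: "N j <= r k" if "j <= k" for j k
    unfolding r_def using that by (intro trans_le_add2 member_le_sum) auto
  define d where "d = (\<lambda>k x. \<bar>f (r (Suc k)) x - f (r k) x\<bar>)"
  have d2: "d k \<in> L2 M" for k
    using L2_diff[OF f f, of "r (Suc k)" "r k"] by (simp add: L2_real_iff d_def)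
  have di: "integrable M (d k)" for k using L2_mult_integrable[OF d2 one] by simp
  define V where "V = sqrt (measure M (space M))"
  have dle: "(LINT x|M. d k x) <= V * (1/2) ^ k" for k
  proof -
    have "(LINT x|M. (d k x)\<^sup>2) <= (1/4) ^ k"
      using N[of k "r (Suc k)" "r k"] r[of k "Suc k"] r[of k k] by (simp add: d_def less_imp_le)
    then have "sqrt (LINT x|M. (d k x)\<^sup>2) <= sqrt ((1/4) ^ k)" by (rule real_sqrt_le_mono)
    also have "sqrt ((1/4) ^ k) = (1/2::real) ^ k"
    proof -
      have "(1/4::real) ^ k = ((1/2) ^ k)\<^sup>2" by (simp add: power_mult[symmetric] mult.commute[of _ 2]) (simp add: power_mult power2_eq_square)
      then show ?thesis by simp
    qed
    finally have "sqrt (LINT x|M. (d k x)\<^sup>2) * V <= (1/2) ^ k * V" by (intro mult_right_mono) (simp_all add: V_def)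
    moreover have "\<bar>LINT x|M. d k x * 1\<bar> <= sqrt (LINT x|M. (d k x)\<^sup>2) * V"
      using cauchy_schwarz_sqrt[OF d2 one] by (simp add: V_def)
    ultimately show ?thesis by (simp add: mult.commute)
  qed
  have "AE x in M. (\<Sum>k. ennreal (d k x)) \<noteq> \<infinity>"
  proof (rule nn_integral_noteq_infinite)
    have "(\<integral>\<^sup>+ x. (\<Sum>k. ennreal (d k x)) \<partial>M) = (\<Sum>k. \<integral>\<^sup>+ x. ennreal (d k x) \<partial>M)"
      by (rule nn_integral_suminf) (simp add: d_def)
    also have "\<dots> = (\<Sum>k. ennreal (LINT x|M. d k x))"
      by (rule suminf_cong, rule nn_integral_eq_integral[OF di]) (simp add: d_def)
    also have "\<dots> <= (\<Sum>k. ennreal (V * (1/2) ^ k))"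
      by (intro suminf_le summableI ennreal_leI dle)
    also have "\<dots> = ennreal (\<Sum>k. V * (1/2) ^ k)"
      by (rule suminf_ennreal2) (auto simp: V_def intro!: summable_mult summable_geometric)
    finally show "(\<integral>\<^sup>+ x. (\<Sum>k. ennreal (d k x)) \<partial>M) \<noteq> \<infinity>" by (auto simp: top_unique)
  qed (simp add: d_def)
  then have conv: "AE x in M. convergent (\<lambda>k. f (r k) x)"
  proof eventually_elim
    case (elim x)
    have "summable (\<lambda>k. d k x)" by (rule summable_suminf_not_top) (use elim in \<open>auto simp: d_def\<close>)
    then have "summable (\<lambda>k. f (r (Suc k)) x - f (r k) x)"
      unfolding d_def by (rule summable_rabs_cancel)
    then have "convergent (\<lambda>n. \<Sum>k<n. f (r (Suc k)) x - f (r k) x)" by (simp add: summable_iff_convergent)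
    then have "convergent (\<lambda>n. f (r n) x - f (r 0) x)"
      unfolding sum_lessThan_telescope[of "\<lambda>k. f (r k) x"] .
    then have "convergent (\<lambda>n. (f (r n) x - f (r 0) x) + f (r 0) x)" by (intro convergent_add convergent_const)
    then show ?case by simp
  qed
  define g where "g = (\<lambda>x. lim (\<lambda>k. f (r k) x))"
  have gm [measurable]: "g \<in> borel_measurable M" unfolding g_def by measurable
  have glim: "AE x in M. (\<lambda>k. f (r k) x) \<longlonglongrightarrow> g x"
    using conv by eventually_elim (simp add: g_def convergent_LIMSEQ_iff)
  have fatou: "(\<integral>\<^sup>+ x. ennreal ((f n x - g x)\<^sup>2) \<partial>M) <= ennreal e"
    if n: "\<And>m. m \<ge> K ==> (LINT x|M. (f n x - f m x)\<^sup>2) < e" for n K e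
  proof -
    have dn: "integrable M (\<lambda>x. (f n x - f m x)\<^sup>2)" for m using L2_diff[OF f f] by (simp add: L2_real_iff)
    have "(\<integral>\<^sup>+ x. ennreal ((f n x - g x)\<^sup>2) \<partial>M) = (\<integral>\<^sup>+ x. liminf (\<lambda>k. ennreal ((f n x - f (r k) x)\<^sup>2)) \<partial>M)"
    proof (rule nn_integral_cong_AE)
      show "AE x in M. ennreal ((f n x - g x)\<^sup>2) = liminf (\<lambda>k. ennreal ((f n x - f (r k) x)\<^sup>2))"
        using glim
      proof eventually_elim
        case (elim x)
        have "(\<lambda>k. ennreal ((f n x - f (r k) x)\<^sup>2)) \<longlonglongrightarrow> ennreal ((f n x - g x)\<^sup>2)"
          by (intro tendsto_intros elim tendsto_ennrealI)
        from lim_imp_Liminf[OF sequentially_bot this] show ?case by simp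
      qed
    qed
    also have "\<dots> <= liminf (\<lambda>k. \<integral>\<^sup>+ x. ennreal ((f n x - f (r k) x)\<^sup>2) \<partial>M)"
      by (rule nn_integral_liminf) simp
    also have "\<dots> <= liminf (\<lambda>k. ennreal e)"
    proof (rule Liminf_mono)
      have "(\<integral>\<^sup>+ x. ennreal ((f n x - f (r k) x)\<^sup>2) \<partial>M) <= ennreal e" if "K <= r k" for k
        using nn_integral_eq_integral[OF dn, of "r k"] n[OF that] by (simp add: ennreal_leI less_imp_le)
      moreover have "\<exists>k0. \<forall>k\<ge>k0. K <= r k" by (auto simp: r_def intro!: exI[of _ K])
      ultimately show "\<forall>\<^sub>F k in sequentially. (\<integral>\<^sup>+ x. ennreal ((f n x - f (r k) x)\<^sup>2) \<partial>M) <= ennreal e"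
        by (auto simp: eventually_sequentially)
    qed
    also have "\<dots> = ennreal e" by (simp add: Liminf_const)
    finally show ?thesis .
  qed
  have fin2: "integrable M (\<lambda>x. (f n x - g x)\<^sup>2) \<and> (LINT x|M. (f n x - g x)\<^sup>2) <= e"
    if n: "\<And>m. m \<ge> K ==> (LINT x|M. (f n x - f m x)\<^sup>2) < e" for n K e
  proof -
    have e: "0 <= e"
    proof -
      have "0 <= (LINT x|M. (f n x - f K x)\<^sup>2)" by simp
      then show ?thesis using n[of K] by linarith
    qed
    have "(\<integral>\<^sup>+ x. ennreal ((f n x - g x)\<^sup>2) \<partial>M) < \<infinity>"
      using le_less_trans[OF fatou[OF n] ennreal_less_top] by simp
    then have i: "integrable M (\<lambda>x. (f n x - g x)\<^sup>2)"
      by (intro integrableI_bounded) simp_all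
    have "ennreal (LINT x|M. (f n x - g x)\<^sup>2) <= ennreal e"
      using nn_integral_eq_integral[OF i] fatou[OF n] by simp
    then show ?thesis using i e by simp
  qed
  have "g \<in> L2 M"
  proof -
    obtain K where K: "\<And>m n. m \<ge> K ==> n \<ge> K ==> (LINT x|M. (f m x - f n x)\<^sup>2) < 1" using cau[of 1] by auto
    have "(\<lambda>x. f K x - g x) \<in> L2 M" using fin2[of K K 1] K by (simp add: L2_real_iff)
    from L2_diff[OF f[of K] this] show ?thesis by simp
  qed
  moreover have "(\<lambda>n. LINT x|M. (f n x - g x)\<^sup>2) \<longlonglongrightarrow> 0"
  proof (rule LIMSEQ_I)
    fix e :: real assume e: "0 < e"
    obtain K where K: "\<And>m n. m \<ge> K ==> n \<ge> K ==> (LINT x|M. (f m x - f n x)\<^sup>2) < e / 2" using cau[of "e/2"] e by auto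
    have "norm ((LINT x|M. (f n x - g x)\<^sup>2) - 0) < e" if "n \<ge> K" for n
      using fin2[of K n "e/2"] K that e by simp
    then show "\<exists>K. \<forall>n\<ge>K. norm ((LINT x|M. (f n x - g x)\<^sup>2) - 0) < e" by blast
  qed
  ultimately show ?thesis by (rule that)
qed

section \<open>The negative Sobolev norm\<close>

lemma torus_L2_bounded:
  fixes f :: "real^'n => real"
  assumes L: "0 < L" "f \<in> borel_measurable (torus L)" "AE x in torus L. \<bar>f x\<bar> <= C"
  shows "f \<in> L2 (torus L)"
proof -
  have "AE x in torus L. \<bar>(f x)\<^sup>2\<bar> <= C\<^sup>2"
    using assms(3) by eventually_elim (use abs_le_square_iff in fastforce)
  then show ?thesis using assms by (auto simp: L2_real_iff intro!: torus_integrable_bounded)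
qed

lemma torus_L2_continuous:
  fixes f :: "real^'n => real"
  assumes "0 < L" "continuous_on UNIV f"
  shows "f \<in> L2 (torus L)"
  using assms by (auto simp: L2_real_iff intro!: torus_continuous_integrable continuous_intros torus_measurableI borel_measurable_continuous_onI)

lemma torus_L2_smooth: "0 < L ==> f \<in> torus_smooth L ==> f \<in> L2 (torus L)" for f :: "real^'n => real"
  by (rule torus_L2_continuous) (auto intro: torus_smooth_continuous)

lemma torus_L2_integrable: "0 < L ==> f \<in> L2 (torus L) ==> integrable (torus L) f" for f :: "real^'n => real"
  using L2_mult_integrable[OF _ torus_L2_continuous[of L "\<lambda>_. 1"], of f] by simp

lemma trig_dense_ex:
  fixes g :: "'a::euclidean_space => real"
  assumes "0 < L" "g \<in> borel_measurable (lebesgue_on (cbox 0 (box_corner L)))" "\<And>x. \<bar>g x\<bar> <= C"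
  shows "\<exists>q N. negligible N \<and> (\<forall>n::nat. q n \<in> trig L)
    \<and> (\<forall>n. \<forall>x\<in>cbox 0 (box_corner L). \<bar>q n x\<bar> <= C + 1)
    \<and> (\<forall>x\<in>cbox 0 (box_corner L) - N. (\<lambda>n. q n x) \<longlonglongrightarrow> g x)"
  by (rule trig_dense[OF assms]) blast

text \<open>The sign of \<open>h\<close> is a bounded almost everywhere limit of trigonometric polynomials, so
  the integral of \<open>\<bar>h\<bar>\<close> is zero.\<close>

lemma trig_orthogonal_imp_zero:
  fixes h :: "real^'n => real"
  assumes L: "0 < L" and h: "integrable (torus L) h"
    and orth: "\<And>q. q \<in> trig L ==> (LINT x|torus L. h x * q x) = 0"
  shows "AE x in torus L. h x = 0"
proof -
  have hm [measurable]: "h \<in> borel_measurable (torus L)" using h by simp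
  define g where "g = (\<lambda>x. if x \<in> cube L then sgn (h x) else 0)"
  have "g \<in> borel_measurable lebesgue"
  proof -
    have "(\<lambda>x. sgn (h x)) \<in> borel_measurable (lebesgue_on (cube L))"
      using hm unfolding torus_def[symmetric] by measurable
    then show ?thesis unfolding g_def by (subst borel_measurable_if) auto
  qed
  then have gm: "g \<in> borel_measurable (lebesgue_on (cbox 0 (box_corner L)))" by (rule measurable_restrict_space1)
  have g1: "\<bar>g x\<bar> <= 1" for x by (auto simp: g_def sgn_if)
  obtain q N where N: "negligible N" and q: "\<And>n::nat. q n \<in> trig L"
    "\<And>n x. x \<in> cbox 0 (box_corner L) ==> \<bar>q n x\<bar> <= 1 + 1"
    "\<And>x. x \<in> cbox 0 (box_corner L) - N ==> (\<lambda>n. q n x) \<longlonglongrightarrow> g x"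
    using trig_dense_ex[OF L gm g1] by blast
  have qm: "q n \<in> borel_measurable (torus L)" for n by (rule torus_measurableI[OF trig_borel[OF q(1)]])
  have "(\<lambda>n. LINT x|torus L. h x * q n x) \<longlonglongrightarrow> (LINT x|torus L. \<bar>h x\<bar>)"
  proof (rule integral_dominated_convergence[where w = "\<lambda>x. 2 * \<bar>h x\<bar>"])
    show "AE x in torus L. (\<lambda>n. h x * q n x) \<longlonglongrightarrow> \<bar>h x\<bar>"
    proof (rule AE_torusI[OF N])
      fix x assume x: "x \<in> cube L" "x \<notin> N"
      then have "(\<lambda>n. h x * q n x) \<longlonglongrightarrow> h x * g x"
        using cube_subset_cbox by (intro tendsto_intros q(3)) auto
      then show "(\<lambda>n. h x * q n x) \<longlonglongrightarrow> \<bar>h x\<bar>" using x by (simp add: g_def abs_sgn)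
    qed
    show "AE x in torus L. norm (h x * q n x) <= 2 * \<bar>h x\<bar>" for n
    proof (rule AE_I2)
      fix x :: "real^'n" assume "x \<in> space (torus L)"
      then have "\<bar>q n x\<bar> <= 2" using q(2)[of x n] cube_subset_cbox by auto
      then show "norm (h x * q n x) <= 2 * \<bar>h x\<bar>"
        using mult_left_mono[of "\<bar>q n x\<bar>" 2 "\<bar>h x\<bar>"] by (simp add: abs_mult mult.commute)
    qed
  qed (use h qm in auto)
  then have "(LINT x|torus L. \<bar>h x\<bar>) = 0" using orth[OF q(1)] by (simp add: LIMSEQ_const_iff)
  then have "AE x in torus L. \<bar>h x\<bar> = 0"
    using h by (subst (asm) integral_nonneg_eq_0_iff_AE) auto
  then show ?thesis by simp
qed

lemma laplacian_add:
  assumes "f \<in> torus_smooth L" "g \<in> torus_smooth L"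
  shows "laplacian (\<lambda>x. f x + g x) x = laplacian f x + laplacian g x"
proof -
  have "partial i (partial i (\<lambda>x. f x + g x)) x = partial i (partial i f) x + partial i (partial i g) x" for i
  proof -
    have "partial i (\<lambda>x. f x + g x) = (\<lambda>x. partial i f x + partial i g x)" using partial_add[OF assms] by auto
    then show ?thesis using partial_add[OF torus_smooth_partial[OF assms(1)] torus_smooth_partial[OF assms(2)]] by simp
  qed
  then show ?thesis by (simp add: laplacian_def sum.distrib)
qed

lemma laplacian_cmult:
  assumes "f \<in> torus_smooth L"
  shows "laplacian (\<lambda>x. c * f x) x = c * laplacian f x"
proof -
  have "partial i (partial i (\<lambda>x. c * f x)) x = c * partial i (partial i f) x" for i
  proof -
    have "partial i (\<lambda>x. c * f x) = (\<lambda>x. c * partial i f x)" using partial_cmult[OF assms] by auto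
    then show ?thesis using partial_cmult[OF torus_smooth_partial[OF assms]] by simp
  qed
  then show ?thesis by (simp add: laplacian_def sum_distrib_left)
qed

lemma partial_cos: "partial i (\<lambda>x. cos (\<kappa> \<bullet> x)) x = - (\<kappa> $ i) * sin (\<kappa> \<bullet> x)"
  by (subst partial_eq[where f' = "\<lambda>h. - (\<kappa> \<bullet> h) * sin (\<kappa> \<bullet> x)"]) (auto intro!: derivative_eq_intros simp: inner_axis)

lemma partial_sin: "partial i (\<lambda>x. sin (\<kappa> \<bullet> x)) x = \<kappa> $ i * cos (\<kappa> \<bullet> x)"
  by (subst partial_eq[where f' = "\<lambda>h. (\<kappa> \<bullet> h) * cos (\<kappa> \<bullet> x)"]) (auto intro!: derivative_eq_intros simp: inner_axis)

lemma norm_vec_sq: "(norm (x::real^'n))\<^sup>2 = (\<Sum>i\<in>UNIV. (x $ i)\<^sup>2)"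
  by (simp add: norm_vec_def L2_set_def sum_nonneg)

lemma laplacian_cos_sin:
  fixes \<kappa> x :: "real^'n"
  assumes L: "0 < L" and \<kappa>: "\<kappa> \<in> lattice L"
  shows "laplacian (\<lambda>x. cos (\<kappa> \<bullet> x)) x = - (norm \<kappa>)\<^sup>2 * cos (\<kappa> \<bullet> x)"
    "laplacian (\<lambda>x. sin (\<kappa> \<bullet> x)) x = - (norm \<kappa>)\<^sup>2 * sin (\<kappa> \<bullet> x)"
proof -
  have s: "(\<lambda>x. sin (\<kappa> \<bullet> x)) \<in> torus_smooth L" and c: "(\<lambda>x. cos (\<kappa> \<bullet> x)) \<in> torus_smooth L"
    by (intro trig_torus_smooth trig.intros \<kappa> L)+
  have "partial j (\<lambda>x. cos (\<kappa> \<bullet> x)) = (\<lambda>x. - (\<kappa> $ j) * sin (\<kappa> \<bullet> x))" "partial j (\<lambda>x. sin (\<kappa> \<bullet> x)) = (\<lambda>x. \<kappa> $ j * cos (\<kappa> \<bullet> x))" for j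
    by (auto simp: partial_cos partial_sin)
  then show "laplacian (\<lambda>x. cos (\<kappa> \<bullet> x)) x = - (norm \<kappa>)\<^sup>2 * cos (\<kappa> \<bullet> x)" "laplacian (\<lambda>x. sin (\<kappa> \<bullet> x)) x = - (norm \<kappa>)\<^sup>2 * sin (\<kappa> \<bullet> x)"
    by (simp_all only: laplacian_def partial_cmult[OF s] partial_cmult[OF c] partial_sin partial_cos norm_vec_sq sum_distrib_right sum_negf[symmetric])
      (simp_all add: power2_eq_square mult.assoc)
qed

text \<open>The Laplace equation is solved wave by wave. The derivative has no constant Fourier mode, so a
  periodic solution exists.\<close>

lemma trig_partial_laplacian:
  fixes q :: "real^'n => real"
  assumes L: "0 < L" and "q \<in> trig L"
  shows "\<exists>\<xi>\<in>torus_smooth L. \<forall>x. partial i q x = laplacian \<xi> x"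
  using assms(2)
proof (induction)
  case (trig_cos \<kappa>)
  have s: "(\<lambda>x. sin (\<kappa> \<bullet> x)) \<in> torus_smooth L" by (intro trig_torus_smooth trig.trig_sin trig_cos L)
  have "partial i (\<lambda>x. cos (\<kappa> \<bullet> x)) x = laplacian (\<lambda>x. (\<kappa> $ i / (norm \<kappa>)\<^sup>2) * sin (\<kappa> \<bullet> x)) x" for x
    unfolding partial_cos laplacian_cmult[OF s] laplacian_cos_sin[OF L trig_cos] by (cases "\<kappa> = 0") auto
  then show ?case using torus_smooth_cmult[OF s] by blast
next
  case (trig_sin \<kappa>)
  have c: "(\<lambda>x. cos (\<kappa> \<bullet> x)) \<in> torus_smooth L" by (intro trig_torus_smooth trig.trig_cos trig_sin L)
  have "partial i (\<lambda>x. sin (\<kappa> \<bullet> x)) x = laplacian (\<lambda>x. (- (\<kappa> $ i) / (norm \<kappa>)\<^sup>2) * cos (\<kappa> \<bullet> x)) x" for x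
    unfolding partial_sin laplacian_cmult[OF c] laplacian_cos_sin[OF L trig_sin] by (cases "\<kappa> = 0") auto
  then show ?case using torus_smooth_cmult[OF c] by blast
next
  case (trig_add f g)
  then obtain \<xi> \<eta> where "\<xi> \<in> torus_smooth L" "\<eta> \<in> torus_smooth L"
    "\<And>x. partial i f x = laplacian \<xi> x" "\<And>x. partial i g x = laplacian \<eta> x" by blast
  then show ?case
    using partial_add[OF trig_torus_smooth[OF trig_add.hyps(1) L] trig_torus_smooth[OF trig_add.hyps(2) L]]
    by (intro bexI[of _ "\<lambda>x. \<xi> x + \<eta> x"]) (auto simp: laplacian_add torus_smooth_add)
next
  case (trig_cmult f c)
  then obtain \<xi> where "\<xi> \<in> torus_smooth L" "\<And>x. partial i f x = laplacian \<xi> x" by blast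
  then show ?case
    using partial_cmult[OF trig_torus_smooth[OF trig_cmult.hyps(1) L]]
    by (intro bexI[of _ "\<lambda>x. c * \<xi> x"]) (auto simp: laplacian_cmult torus_smooth_cmult)
qed

lemma L2_vec_component:
  fixes G :: "'a => real^'n"
  assumes "G \<in> L2 M"
  shows "(\<lambda>x. G x $ i) \<in> L2 M"
proof -
  have m: "(\<lambda>x. G x $ i) \<in> borel_measurable M"
    using assms measurable_compose[of G M borel "\<lambda>v. v $ i" borel]
    by (auto simp: L2_def intro!: borel_measurable_continuous_onI continuous_intros)
  have "integrable M (\<lambda>x. (G x $ i)\<^sup>2)"
  proof (rule Bochner_Integration.integrable_bound)
    show "integrable M (\<lambda>x. (norm (G x))\<^sup>2)" using assms by (simp add: L2_def)
    have "(G x $ i)\<^sup>2 <= (norm (G x))\<^sup>2" for x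
      using power_mono[OF component_le_norm_cart[of "G x" i] abs_ge_zero, of 2] by simp
    then show "AE x in M. norm ((G x $ i)\<^sup>2) <= norm ((norm (G x))\<^sup>2)" by simp
  qed (use m in simp)
  then show ?thesis using m by (simp add: L2_real_iff)
qed

lemma L2_vecI:
  fixes G :: "'a => real^'n"
  assumes "\<And>i. (\<lambda>x. G x $ i) \<in> L2 M"
  shows "G \<in> L2 M"
proof -
  have "G \<in> borel_measurable M"
  proof (subst borel_measurable_euclidean_space, intro ballI)
    fix b :: "real^'n" assume "b \<in> Basis"
    then obtain i where "b = axis i 1" by (auto simp: Basis_vec_def)
    then show "(\<lambda>x. G x \<bullet> b) \<in> borel_measurable M" using assms[of i] by (simp add: inner_axis L2_real_iff)
  qed
  then show ?thesis using assms by (simp add: L2_def norm_vec_sq)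
qed

text \<open>The relation between \<open>f\<close> and the pair of potential and gradient from which
  \<open>Hm1_norm\<close> selects its value.\<close>

definition H1_solution :: "real => (real^'n => real) => (real^'n => real) => (real^'n => real^'n) => bool" where
  "H1_solution L f \<phi> G \<longleftrightarrow> \<phi> \<in> L2 (torus L) \<and> G \<in> L2 (torus L) \<and> weak_laplacian L \<phi> f \<and> weak_gradient L \<phi> G"

text \<open>A weak gradient is tested with a trigonometric polynomial \<open>q\<close>; since
  \<open>\<partial>\<^sub>i q\<close> is the Laplacian of a smooth function, the value is determined by
  \<open>f\<close>.\<close>

lemma H1_solution_unique:
  fixes f :: "real^'n => real"
  assumes L: "0 < L" and 1: "H1_solution L f \<phi> G" and 2: "H1_solution L f \<psi> H"
  shows "AE x in torus L. G x = H x"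
proof -
  have "AE x in torus L. G x $ i - H x $ i = 0" for i
  proof (rule trig_orthogonal_imp_zero[OF L])
    have GH: "(\<lambda>x. G x $ i) \<in> L2 (torus L)" "(\<lambda>x. H x $ i) \<in> L2 (torus L)"
      using 1 2 by (auto simp: H1_solution_def intro: L2_vec_component)
    then show "integrable (torus L) (\<lambda>x. G x $ i - H x $ i)" by (intro torus_L2_integrable L L2_diff)
    fix q :: "real^'n => real" assume q: "q \<in> trig L"
    have qs: "q \<in> torus_smooth L" by (rule trig_torus_smooth[OF q L])
    obtain \<xi> where \<xi>: "\<xi> \<in> torus_smooth L" "\<And>x. partial i q x = laplacian \<xi> x"
      using trig_partial_laplacian[OF L q] by blast
    have key: "(LINT x|torus L. K x $ i * q x) = - (LINT x|torus L. f x * \<xi> x)" if "H1_solution L f \<eta> K" for \<eta> K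
    proof -
      have "(LINT x|torus L. \<eta> x * partial i q x) = - (LINT x|torus L. K x $ i * q x)"
        using that qs by (simp add: H1_solution_def weak_gradient_def)
      moreover have "(LINT x|torus L. \<eta> x * laplacian \<xi> x) = (LINT x|torus L. f x * \<xi> x)"
        using that \<xi>(1) by (simp add: H1_solution_def weak_laplacian_def)
      ultimately show ?thesis by (simp add: \<xi>(2))
    qed
    note key[OF 1] key[OF 2]
    moreover have "(LINT x|torus L. (G x $ i - H x $ i) * q x) = (LINT x|torus L. G x $ i * q x) - (LINT x|torus L. H x $ i * q x)"
      using L2_mult_integrable[OF GH(1) torus_L2_smooth[OF L qs]] L2_mult_integrable[OF GH(2) torus_L2_smooth[OF L qs]]
      by (simp add: left_diff_distrib)
    ultimately show "(LINT x|torus L. (G x $ i - H x $ i) * q x) = 0" by simp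
  qed
  then have "AE x in torus L. \<forall>i\<in>UNIV. G x $ i - H x $ i = 0" by (intro AE_finite_allI) auto
  then show ?thesis by eventually_elim (simp add: vec_eq_iff)
qed

lemma Hm1_norm_eq:
  fixes f :: "real^'n => real"
  assumes L: "0 < L" and s: "H1_solution L f \<phi> G"
  shows "Hm1_norm L f = L2_norm (torus L) G"
  unfolding Hm1_norm_def
proof (rule the_equality)
  show "\<exists>\<phi> Ga. \<phi> \<in> L2 (torus L) \<and> Ga \<in> L2 (torus L) \<and> weak_laplacian L \<phi> f \<and> weak_gradient L \<phi> Ga
      \<and> L2_norm (torus L) G = L2_norm (torus L) Ga"
    using s unfolding H1_solution_def by blast
  fix r assume "\<exists>\<phi> G. \<phi> \<in> L2 (torus L) \<and> G \<in> L2 (torus L) \<and> weak_laplacian L \<phi> f \<and> weak_gradient L \<phi> G \<and> r = L2_norm (torus L) G"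
  then obtain \<psi> H where 2: "H1_solution L f \<psi> H" "r = L2_norm (torus L) H" unfolding H1_solution_def by blast
  have "(LINT x|torus L. (norm (G x))\<^sup>2) = (LINT x|torus L. (norm (H x))\<^sup>2)"
  proof (rule integral_cong_AE)
    show "AE x in torus L. (norm (G x))\<^sup>2 = (norm (H x))\<^sup>2"
      using H1_solution_unique[OF L s 2(1)] by eventually_elim simp
  qed (use s 2 in \<open>auto simp: H1_solution_def L2_def\<close>)
  then show "r = L2_norm (torus L) G" by (simp add: 2 L2_norm_def)
qed

subsection \<open>Existence by the Dirichlet principle\<close>

text \<open>The bilinear form of the Dirichlet integral.\<close>

definition dirichlet :: "real => (real^'n => real) => (real^'n => real) => real" where
  "dirichlet L f g = (LINT x|torus L. grad f x \<bullet> grad g x)"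

lemma dirichlet_integrable:
  fixes f g :: "real^'n => real"
  assumes "0 < L" "f \<in> torus_smooth L" "g \<in> torus_smooth L"
  shows "integrable (torus L) (\<lambda>x. grad f x \<bullet> grad g x)"
  by (intro torus_continuous_integrable[OF assms(1)] continuous_on_inner grad_continuous[OF assms(2)] grad_continuous[OF assms(3)])

lemma grad_linear:
  assumes "f \<in> torus_smooth L" "g \<in> torus_smooth L"
  shows "grad (\<lambda>x. f x + c * g x) x = grad f x + c *\<^sub>R grad g x"
  using partial_add[OF assms(1) torus_smooth_cmult[OF assms(2)]] partial_cmult[OF assms(2)]
  by (simp add: grad_def vec_eq_iff)

lemma dirichlet_expand:
  fixes f g :: "real^'n => real"
  assumes "0 < L" "f \<in> torus_smooth L" "g \<in> torus_smooth L"
  shows "dirichlet L (\<lambda>x. f x + c * g x) (\<lambda>x. f x + c * g x) = dirichlet L f f + 2 * c * dirichlet L f g + c\<^sup>2 * dirichlet L g g"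
proof -
  have "(\<lambda>x. (grad f x + c *\<^sub>R grad g x) \<bullet> (grad f x + c *\<^sub>R grad g x))
      = (\<lambda>x. grad f x \<bullet> grad f x + 2 * c * (grad f x \<bullet> grad g x) + c\<^sup>2 * (grad g x \<bullet> grad g x))"
    by (auto simp: inner_add_left inner_add_right inner_commute power2_eq_square algebra_simps)
  then show ?thesis
    unfolding dirichlet_def grad_linear[OF assms(2,3)]
    using dirichlet_integrable[OF assms(1,2,2)] dirichlet_integrable[OF assms] dirichlet_integrable[OF assms(1,3,3)] by simp
qed

lemma dirichlet_nonneg: "0 <= dirichlet L f f"
  by (simp add: dirichlet_def)

lemma partial_sq_le_dirichlet:
  fixes f :: "real^'n => real"
  assumes "0 < L" "f \<in> torus_smooth L"
  shows "(LINT x|torus L. (partial i f x)\<^sup>2) <= dirichlet L f f"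
  unfolding dirichlet_def
proof (rule integral_mono)
  show "integrable (torus L) (\<lambda>x. (partial i f x)\<^sup>2)"
    by (intro torus_continuous_integrable continuous_intros assms torus_smooth_continuous[OF torus_smooth_partial[OF assms(2)]])
  show "integrable (torus L) (\<lambda>x. grad f x \<bullet> grad f x)" by (rule dirichlet_integrable[OF assms(1,2,2)])
  show "(partial i f x)\<^sup>2 <= grad f x \<bullet> grad f x" for x
  proof -
    have "(grad f x $ i)\<^sup>2 <= (\<Sum>j\<in>UNIV. (grad f x $ j)\<^sup>2)" by (rule member_le_sum) auto
    then show ?thesis by (simp add: inner_vec_def power2_eq_square) (simp add: grad_def)
  qed
qed

text \<open>The energy \<open>\<integral> \<bar>\<nabla>\<psi>\<bar>\<^sup>2 + 2 \<integral> f \<psi>\<close>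
  is bounded below on smooth functions of mean zero by the Poincare inequality. By the parallelogram identity
  the gradients of a minimising sequence form a Cauchy sequence, and by the Poincare inequality so do the
  functions. The limits satisfy the Euler-Lagrange equation, which is the weak Laplace equation; test
  functions that are not of mean zero are covered because \<open>f\<close> has mean zero.\<close>

theorem H1_solution_exists:
  fixes f :: "real^'n => real"
  assumes L: "0 < L" and f: "f \<in> L2 (torus L)" and mean: "(LINT x|torus L. f x) = 0"
  shows "\<exists>\<phi> G. H1_solution L f \<phi> G"
proof -
  define T where "T = {\<psi>::real^'n => real. \<psi> \<in> torus_smooth L \<and> (LINT x|torus L. \<psi> x) = 0}"
  define F where "F = (\<lambda>\<psi>. LINT x|torus L. f x * \<psi> x)"
  define E where "E = (\<lambda>\<psi>. dirichlet L \<psi> \<psi> + 2 * F \<psi>)"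
  define P where "P = real CARD('n) * L\<^sup>2"
  define Q where "Q = (LINT x|torus L. (f x)\<^sup>2)"
  have P0: "0 <= P" and Q0: "0 <= Q" by (simp_all add: P_def Q_def)
  have Ts: "\<psi> \<in> torus_smooth L" if "\<psi> \<in> T" for \<psi> using that by (simp add: T_def)
  have TL2: "\<psi> \<in> L2 (torus L)" if "\<psi> \<in> T" for \<psi> using torus_L2_smooth[OF L Ts[OF that]] .
  have Tlin: "(\<lambda>x. \<psi> x + c * \<xi> x) \<in> T" if "\<psi> \<in> T" "\<xi> \<in> T" for \<psi> \<xi> c
    using that torus_L2_integrable[OF L TL2[OF that(1)]] torus_L2_integrable[OF L TL2[OF that(2)]]
    by (auto simp: T_def intro!: torus_smooth_add torus_smooth_cmult)
  have Flin: "F (\<lambda>x. \<psi> x + c * \<xi> x) = F \<psi> + c * F \<xi>" if "\<psi> \<in> T" "\<xi> \<in> T" for \<psi> \<xi> c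
  proof -
    have "(\<lambda>x. f x * (\<psi> x + c * \<xi> x)) = (\<lambda>x. f x * \<psi> x + c * (f x * \<xi> x))" by (auto simp: algebra_simps)
    then show ?thesis unfolding F_def
      using L2_mult_integrable[OF f TL2[OF that(1)]] L2_mult_integrable[OF f TL2[OF that(2)]] by simp
  qed
  have Elin: "E (\<lambda>x. \<psi> x + c * \<xi> x) = E \<psi> + 2 * c * (dirichlet L \<psi> \<xi> + F \<xi>) + c\<^sup>2 * dirichlet L \<xi> \<xi>"
    if "\<psi> \<in> T" "\<xi> \<in> T" for \<psi> \<xi> c
    unfolding E_def Flin[OF that] dirichlet_expand[OF L Ts[OF that(1)] Ts[OF that(2)]] by (simp add: algebra_simps)
  have poin: "(LINT x|torus L. (\<psi> x)\<^sup>2) <= P * dirichlet L \<psi> \<psi>" if "\<psi> \<in> T" for \<psi>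
    using poincare[OF L, of \<psi>] that by (simp add: T_def P_def dirichlet_def power2_norm_eq_inner)
  have lower: "- (P * Q) <= E \<psi>" if "\<psi> \<in> T" for \<psi>
  proof -
    define D where "D = dirichlet L \<psi> \<psi>"
    have D0: "0 <= D" by (simp add: D_def dirichlet_nonneg)
    have "(F \<psi>)\<^sup>2 <= Q * (LINT x|torus L. (\<psi> x)\<^sup>2)"
      unfolding F_def Q_def by (rule cauchy_schwarz_integral[OF f TL2[OF that]])
    also have "\<dots> <= Q * (P * D)" unfolding D_def by (rule mult_left_mono[OF poin[OF that] Q0])
    finally have "(2 * F \<psi>)\<^sup>2 <= 4 * (P * Q) * D" by (simp add: power_mult_distrib mult.commute mult.left_commute)
    also have "\<dots> <= (D + P * Q)\<^sup>2"
      using zero_le_power2[of "D - P * Q"] by (simp add: power2_eq_square algebra_simps)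
    finally have "\<bar>2 * F \<psi>\<bar> <= D + P * Q"
      using D0 P0 Q0 by (intro power2_le_imp_le[of "\<bar>2 * F \<psi>\<bar>"]) auto
    then show ?thesis unfolding E_def D_def[symmetric] by linarith
  qed
  have zeroT: "(\<lambda>_. 0) \<in> T" using trig_torus_smooth[OF trig_const[of 0 L] L] by (simp add: T_def)
  define I where "I = Inf (E ` T)"
  have bdd: "bdd_below (E ` T)" using lower by (auto intro!: bdd_belowI2)
  have I: "I <= E \<psi>" if "\<psi> \<in> T" for \<psi> unfolding I_def by (rule cINF_lower[OF bdd that])
  have "\<exists>\<psi>\<in>T. E \<psi> < I + 1 / (real n + 1)" for n
    using cInf_lessD[of "E ` T" "I + 1 / (real n + 1)"] zeroT by (auto simp: I_def)
  then obtain \<psi> where \<psi>: "\<And>n. \<psi> n \<in> T" "\<And>n. E (\<psi> n) < I + 1 / (real n + 1)" by metis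
  have close: "dirichlet L (\<lambda>x. \<psi> m x + (-1) * \<psi> n x) (\<lambda>x. \<psi> m x + (-1) * \<psi> n x) <= 2 * (1 / (real m + 1) + 1 / (real n + 1))" for m n
  proof -
    define \<delta> where "\<delta> = (\<lambda>x. \<psi> m x + (-1) * \<psi> n x)"
    have dT: "\<delta> \<in> T" unfolding \<delta>_def by (intro Tlin \<psi>)
    have mid: "(\<lambda>x. \<psi> n x + (1/2) * \<delta> x) \<in> T" by (intro Tlin \<psi> dT)
    have e: "\<psi> m = (\<lambda>x. \<psi> n x + 1 * \<delta> x)" by (simp add: \<delta>_def)
    have "E (\<psi> m) = E (\<psi> n) + 2 * (dirichlet L (\<psi> n) \<delta> + F \<delta>) + dirichlet L \<delta> \<delta>"
      using Elin[OF \<psi>(1)[of n] dT, of 1] e by simp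
    moreover have "E (\<lambda>x. \<psi> n x + (1/2) * \<delta> x) = E (\<psi> n) + (dirichlet L (\<psi> n) \<delta> + F \<delta>) + dirichlet L \<delta> \<delta> / 4"
      using Elin[OF \<psi>(1)[of n] dT, of "1/2"] by (simp add: power2_eq_square)
    ultimately have "dirichlet L \<delta> \<delta> <= 2 * (1 / (real m + 1) + 1 / (real n + 1))"
      using I[OF mid] \<psi>(2)[of m] \<psi>(2)[of n] by simp
    then show ?thesis by (simp add: \<delta>_def)
  qed
  have cauchy: "\<exists>N. \<forall>m\<ge>N. \<forall>n\<ge>N. B * (2 * (1 / (real m + 1) + 1 / (real n + 1))) < e" if "0 < e" "0 <= B" for B e :: real
  proof -
    obtain N :: nat where N: "4 * B / e < real N" using reals_Archimedean2 by blast
    have "B * (2 * (1 / (real m + 1) + 1 / (real n + 1))) < e" if "m \<ge> N" "n \<ge> N" for m n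
    proof -
      have "1 / (real m + 1) <= 1 / (real N + 1)" "1 / (real n + 1) <= 1 / (real N + 1)"
        using that by (auto intro!: divide_left_mono)
      then have "B * (2 * (1 / (real m + 1) + 1 / (real n + 1))) <= B * (2 * (1 / (real N + 1) + 1 / (real N + 1)))"
        using \<open>0 <= B\<close> by (intro mult_left_mono) auto
      also have "\<dots> = 4 * B / (real N + 1)" by simp
      also have "\<dots> < e" using N \<open>0 < e\<close> by (simp add: field_simps)
      finally show ?thesis .
    qed
    then show ?thesis by blast
  qed
  have pL2: "partial i (\<psi> n) \<in> L2 (torus L)" for i n
    by (rule torus_L2_smooth[OF L torus_smooth_partial[OF Ts[OF \<psi>(1)]]])
  obtain \<phi> where \<phi>: "\<phi> \<in> L2 (torus L)" "(\<lambda>n. LINT x|torus L. (\<psi> n x - \<phi> x)\<^sup>2) \<longlonglongrightarrow> 0"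
  proof (rule L2_complete[OF finite_measure_torus[OF L], of \<psi>])
    show "\<psi> n \<in> L2 (torus L)" for n by (rule TL2[OF \<psi>(1)])
    fix e :: real assume "0 < e"
    from cauchy[OF this P0] obtain N where N: "\<And>m n. m \<ge> N ==> n \<ge> N ==> P * (2 * (1 / (real m + 1) + 1 / (real n + 1))) < e" by blast
    have "(LINT x|torus L. (\<psi> m x - \<psi> n x)\<^sup>2) < e" if "m \<ge> N" "n \<ge> N" for m n
      using poin[OF Tlin[OF \<psi>(1)[of m] \<psi>(1)[of n], of "-1"]] mult_left_mono[OF close[of m n] P0] N[OF that] by simp
    then show "\<exists>N. \<forall>m\<ge>N. \<forall>n\<ge>N. (LINT x|torus L. (\<psi> m x - \<psi> n x)\<^sup>2) < e" by blast
  qed blast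
  have ex: "\<exists>g. g \<in> L2 (torus L) \<and> (\<lambda>n. LINT x|torus L. (partial i (\<psi> n) x - g x)\<^sup>2) \<longlonglongrightarrow> 0" for i
  proof (rule L2_complete[OF finite_measure_torus[OF L], of "\<lambda>n. partial i (\<psi> n)"])
    show "partial i (\<psi> n) \<in> L2 (torus L)" for n by (rule pL2)
    fix e :: real assume "0 < e"
    from cauchy[OF this zero_le_one] obtain N where N: "\<And>m n. m \<ge> N ==> n \<ge> N ==> 1 * (2 * (1 / (real m + 1) + 1 / (real n + 1))) < e" by blast
    have "(LINT x|torus L. (partial i (\<psi> m) x - partial i (\<psi> n) x)\<^sup>2) < e" if "m \<ge> N" "n \<ge> N" for m n
    proof -
      have "partial i (\<lambda>x. \<psi> m x + (-1) * \<psi> n x) x = partial i (\<psi> m) x - partial i (\<psi> n) x" for x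
        using partial_add[OF Ts[OF \<psi>(1)] torus_smooth_cmult[OF Ts[OF \<psi>(1)]], of i m "-1" n x] partial_cmult[OF Ts[OF \<psi>(1)], of i "-1" n x] by simp
      then show ?thesis
        using partial_sq_le_dirichlet[OF L Ts[OF Tlin[OF \<psi>(1)[of m] \<psi>(1)[of n], of "-1"]], of i] close[of m n] N[OF that] by simp
    qed
    then show "\<exists>N. \<forall>m\<ge>N. \<forall>n\<ge>N. (LINT x|torus L. (partial i (\<psi> m) x - partial i (\<psi> n) x)\<^sup>2) < e" by blast
  qed blast
  define g where "g = (\<lambda>i. SOME g. g \<in> L2 (torus L) \<and> (\<lambda>n. LINT x|torus L. (partial i (\<psi> n) x - g x)\<^sup>2) \<longlonglongrightarrow> 0)"
  have g: "g i \<in> L2 (torus L)" "(\<lambda>n. LINT x|torus L. (partial i (\<psi> n) x - g i x)\<^sup>2) \<longlonglongrightarrow> 0" for i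
    using someI_ex[OF ex[of i]] unfolding g_def by simp_all
  define G where "G = (\<lambda>x. \<chi> i. g i x)"
  have Gi: "G x $ i = g i x" for x i by (simp add: G_def)
  have wg: "weak_gradient L \<phi> G"
    unfolding weak_gradient_def Gi
  proof (intro ballI allI)
    fix \<xi> :: "real^'n => real" and i assume \<xi>: "\<xi> \<in> torus_smooth L"
    have "(\<lambda>n. LINT x|torus L. \<psi> n x * partial i \<xi> x) \<longlonglongrightarrow> (LINT x|torus L. \<phi> x * partial i \<xi> x)"
      by (rule L2_inner_tendsto[OF TL2[OF \<psi>(1)] \<phi>(1) torus_L2_smooth[OF L torus_smooth_partial[OF \<xi>]] \<phi>(2)])
    moreover have "(\<lambda>n. - (LINT x|torus L. partial i (\<psi> n) x * \<xi> x)) \<longlonglongrightarrow> - (LINT x|torus L. g i x * \<xi> x)"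
      by (intro tendsto_minus L2_inner_tendsto[OF pL2 g(1) torus_L2_smooth[OF L \<xi>] g(2)])
    moreover have "(LINT x|torus L. \<psi> n x * partial i \<xi> x) = - (LINT x|torus L. partial i (\<psi> n) x * \<xi> x)" for n
      by (rule torus_integration_by_parts[OF L Ts[OF \<psi>(1)] \<xi>])
    ultimately show "(LINT x|torus L. \<phi> x * partial i \<xi> x) = - (LINT x|torus L. g i x * \<xi> x)"
      by (simp add: LIMSEQ_unique)
  qed
  have variation: "(\<Sum>i\<in>UNIV. LINT x|torus L. g i x * partial i \<xi> x) + F \<xi> = 0" if \<xi>: "\<xi> \<in> T" for \<xi>
  proof -
    define B where "B = (\<Sum>i\<in>UNIV. LINT x|torus L. g i x * partial i \<xi> x) + F \<xi>"
    have dlim: "(\<lambda>n. dirichlet L (\<psi> n) \<xi>) \<longlonglongrightarrow> (\<Sum>i\<in>UNIV. LINT x|torus L. g i x * partial i \<xi> x)"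
    proof -
      have "dirichlet L (\<psi> n) \<xi> = (\<Sum>i\<in>UNIV. LINT x|torus L. partial i (\<psi> n) x * partial i \<xi> x)" for n
        unfolding dirichlet_def inner_vec_def grad_def
        using L2_mult_integrable[OF pL2 torus_L2_smooth[OF L torus_smooth_partial[OF Ts[OF \<xi>]]]] by simp
      moreover have "(\<lambda>n. \<Sum>i\<in>UNIV. LINT x|torus L. partial i (\<psi> n) x * partial i \<xi> x)
          \<longlonglongrightarrow> (\<Sum>i\<in>UNIV. LINT x|torus L. g i x * partial i \<xi> x)"
        by (intro tendsto_sum L2_inner_tendsto[OF pL2 g(1) torus_L2_smooth[OF L torus_smooth_partial[OF Ts[OF \<xi>]]] g(2)])
      ultimately show ?thesis by simp
    qed
    have "0 <= 0 + 2 * t * B + t\<^sup>2 * dirichlet L \<xi> \<xi>" for t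
    proof -
      have q: "0 <= 1 / (real n + 1) + 2 * t * (dirichlet L (\<psi> n) \<xi> + F \<xi>) + t\<^sup>2 * dirichlet L \<xi> \<xi>" for n
        using I[OF Tlin[OF \<psi>(1)[of n] \<xi>, of t]] \<psi>(2)[of n] Elin[OF \<psi>(1)[of n] \<xi>, of t] by simp
      moreover have "(\<lambda>n. 1 / (real n + 1) + 2 * t * (dirichlet L (\<psi> n) \<xi> + F \<xi>) + t\<^sup>2 * dirichlet L \<xi> \<xi>)
          \<longlonglongrightarrow> 0 + 2 * t * B + t\<^sup>2 * dirichlet L \<xi> \<xi>"
        unfolding B_def using LIMSEQ_inverse_real_of_nat
        by (intro tendsto_intros dlim) (simp add: inverse_eq_divide add.commute)
      ultimately show ?thesis by (intro LIMSEQ_le_const) auto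
    qed
    from quadratic_nonneg_discriminant[OF this dirichlet_nonneg] show ?thesis by (simp add: B_def)
  qed
  have "weak_laplacian L \<phi> f"
    unfolding weak_laplacian_def
  proof
    fix \<xi> :: "real^'n => real" assume \<xi>: "\<xi> \<in> torus_smooth L"
    define c where "c = (LINT x|torus L. \<xi> x) / L ^ CARD('n)"
    have one: "(\<lambda>_. 1) \<in> torus_smooth L" by (rule trig_torus_smooth[OF trig_const L])
    have \<xi>i: "integrable (torus L) \<xi>" by (rule torus_L2_integrable[OF L torus_L2_smooth[OF L \<xi>]])
    have "(LINT x|(torus L :: (real^'n) measure). c) = L ^ CARD('n) * c"
      using measure_torus[OF L, where 'n = 'n] by simp
    then have "(LINT x|(torus L :: (real^'n) measure). c) = (LINT x|torus L. \<xi> x)" using L by (simp add: c_def)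
    then have "(LINT x|torus L. \<xi> x + (- c) * 1) = 0"
      using \<xi>i finite_measure.integrable_const[OF finite_measure_torus[OF L, where 'a = 'n], of c] by simp
    then have cT: "(\<lambda>x. \<xi> x + (- c) * 1) \<in> T"
      unfolding T_def using torus_smooth_add[OF \<xi> torus_smooth_cmult[OF one, of "- c"]] by blast
    have p: "partial i (\<lambda>x. \<xi> x + (- c) * 1) x = partial i \<xi> x" for i x
    proof -
      have "partial i (\<lambda>_. 1::real) x = 0" by (subst partial_eq[where f' = "\<lambda>_. 0"]) auto
      then show ?thesis
        using partial_add[OF \<xi> torus_smooth_cmult[OF one, of "- c"], of i x] partial_cmult[OF one, of i "- c" x] by simp
    qed
    have Fc: "F (\<lambda>x. \<xi> x + (- c) * 1) = F \<xi>"
    proof -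
      have "(\<lambda>x. f x * (\<xi> x + (- c) * 1)) = (\<lambda>x. f x * \<xi> x - c * f x)" by (auto simp: algebra_simps)
      then show ?thesis unfolding F_def
        using L2_mult_integrable[OF f torus_L2_smooth[OF L \<xi>]] torus_L2_integrable[OF L f] mean by simp
    qed
    have v: "(\<Sum>i\<in>UNIV. LINT x|torus L. g i x * partial i \<xi> x) + F \<xi> = 0"
      using variation[OF cT] unfolding p Fc .
    have "(LINT x|torus L. \<phi> x * laplacian \<xi> x) = (\<Sum>i\<in>UNIV. LINT x|torus L. \<phi> x * partial i (partial i \<xi>) x)"
      unfolding laplacian_def sum_distrib_left
      using L2_mult_integrable[OF \<phi>(1) torus_L2_smooth[OF L torus_smooth_partial[OF torus_smooth_partial[OF \<xi>]]]] by simp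
    also have "\<dots> = (\<Sum>i\<in>UNIV. - (LINT x|torus L. g i x * partial i \<xi> x))"
      using wg torus_smooth_partial[OF \<xi>] unfolding weak_gradient_def Gi by (intro sum.cong) auto
    finally show "(LINT x|torus L. \<phi> x * laplacian \<xi> x) = (LINT x|torus L. f x * \<xi> x)"
      using v by (simp add: sum_negf F_def)
  qed
  moreover have "G \<in> L2 (torus L)" by (rule L2_vecI) (simp add: Gi g)
  ultimately show ?thesis using \<phi>(1) wg unfolding H1_solution_def by blast
qed

section \<open>Reduction to one variable\<close>

lemma torus_lift_measurable: "g \<in> borel_measurable borel ==> (\<lambda>x::real^'n. g (x $ i)) \<in> borel_measurable (torus L)"
  for g :: "real => real"
  by (rule torus_measurableI, rule measurable_compose[OF coordinate_borel])

text \<open>The function \<open>m\<close> is the average of \<open>f\<close> over the other variables. It is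
  characterised by its integrals against functions of \<open>x\<^sub>i\<close>, which avoids iterated
  integrals over a variable number of coordinates.\<close>

definition is_marginal :: "real => 'n => (real^'n => real) => (real => real) => bool" where
  "is_marginal L i f m \<longleftrightarrow> m \<in> borel_measurable borel \<and> (\<forall>s. \<bar>m s\<bar> <= 1) \<and>
     (\<forall>g C. g \<in> borel_measurable borel \<longrightarrow> (\<forall>s\<in>{0..L}. \<bar>g s\<bar> <= C) \<longrightarrow>
        (LINT x|torus L. f x * g (x $ i)) = (LINT x|torus L. m (x $ i) * g (x $ i)))"

lemma cube_coordinate: "x \<in> cube L ==> x $ i \<in> {0..L}"
  by (auto simp: cube_def less_imp_le)

text \<open>The image of the measure \<open>1 + f\<close> under the coordinate is absolutely continuous with
  respect to the image of the volume, and its Radon-Nikodym density is \<open>1 + m\<close>. The bound on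
  \<open>m\<close> follows by duality from the one on \<open>f\<close>.\<close>

lemma marginal_exists:
  fixes f :: "real^'n => real"
  assumes L: "0 < L" and fm [measurable]: "f \<in> borel_measurable (torus L)" and f1: "AE x in torus L. \<bar>f x\<bar> <= 1"
  shows "\<exists>m. is_marginal L i f m"
proof -
  define p where "p = (\<lambda>x::real^'n. x $ i)"
  have pe: "x $ i = p x" for x by (simp add: p_def)
  interpret T: finite_measure "torus L :: (real^'n) measure" by (rule finite_measure_torus[OF L])
  have pm [measurable]: "p \<in> borel_measurable (torus L)" unfolding p_def by (rule torus_measurableI) measurable
  define \<mu> where "\<mu> = distr (torus L) borel p"
  define D where "D = density (torus L) (\<lambda>x. ennreal (1 + f x))"
  define \<nu> where "\<nu> = distr D borel p"
  have smu [measurable_cong]: "sets \<mu> = sets borel" and snu [measurable_cong]: "sets \<nu> = sets borel" by (simp_all add: \<mu>_def \<nu>_def)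
  have pD [measurable]: "p \<in> borel_measurable D" unfolding D_def by simp
  interpret U: finite_measure \<mu> unfolding \<mu>_def by (rule T.finite_measure_distr[OF pm])
  have f0: "AE x in torus L. 0 <= 1 + f x" using f1 by eventually_elim auto
  have fi: "integrable (torus L) f" by (rule torus_integrable_bounded[OF L fm f1])
  have finD: "emeasure \<nu> UNIV < (\<infinity>::ennreal)"
  proof -
    have "emeasure \<nu> UNIV = emeasure D (space (torus L))"
      unfolding \<nu>_def by (subst emeasure_distr[OF pD]) (auto simp: D_def)
    also have "\<dots> = (\<integral>\<^sup>+ x. ennreal (1 + f x) \<partial>torus L)"
      unfolding D_def by (subst emeasure_density[OF _ sets.top]) (auto intro!: nn_integral_cong)
    also have "\<dots> = ennreal (LINT x|torus L. 1 + f x)" by (rule nn_integral_eq_integral) (use fi f0 in auto)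
    finally show ?thesis by simp
  qed
  have "absolutely_continuous \<mu> \<nu>"
    unfolding absolutely_continuous_def
  proof
    fix A assume A: "A \<in> null_sets \<mu>"
    then have [measurable]: "A \<in> sets borel" using smu by auto
    have "emeasure \<mu> A = emeasure (torus L) (p -` A \<inter> space (torus L))" unfolding \<mu>_def by (rule emeasure_distr[OF pm]) simp
    moreover have "p -` A \<inter> space (torus L) \<in> sets (torus L)" by measurable
    ultimately have "p -` A \<inter> space (torus L) \<in> null_sets (torus L)" using A by (auto simp: null_sets_def)
    moreover have "absolutely_continuous (torus L) D" unfolding D_def by (rule absolutely_continuousI_density) measurable
    ultimately have "emeasure D (p -` A \<inter> space (torus L)) = 0" by (auto simp: absolutely_continuous_def)
    then have "emeasure \<nu> A = 0" unfolding \<nu>_def by (subst emeasure_distr[OF pD]) (auto simp: D_def)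
    then show "A \<in> null_sets \<nu>" using snu by (auto simp: null_sets_def)
  qed
  moreover have "sets \<nu> = sets \<mu>" using smu snu by simp
  ultimately have "\<exists>h\<in>borel_measurable \<mu>. density \<mu> h = \<nu>" by (rule U.Radon_Nikodym)
  then obtain h :: "real => ennreal" where h [measurable]: "h \<in> borel_measurable \<mu>" and dens: "density \<mu> h = \<nu>"
    by blast
  have hfin: "AE s in \<mu>. h s \<noteq> (\<infinity>::ennreal)"
  proof (rule nn_integral_noteq_infinite)
    have "(\<integral>\<^sup>+ s. h s \<partial>\<mu>) = emeasure (density \<mu> h) UNIV"
      by (subst emeasure_density) (auto simp: smu)
    then show "(\<integral>\<^sup>+ s. h s \<partial>\<mu>) \<noteq> (\<infinity>::ennreal)" using finD by (simp add: dens)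
  qed simp
  define m0 where "m0 = (\<lambda>s. enn2real (h s) - 1)"
  have m0m [measurable]: "m0 \<in> borel_measurable borel"
    unfolding m0_def using h measurable_cong_sets[OF smu refl] by measurable
  have dens': "density \<mu> (\<lambda>s. ennreal (1 + m0 s)) = \<nu>"
    unfolding dens[symmetric]
    by (rule density_cong) (use hfin in \<open>auto simp: m0_def elim!: eventually_mono simp: ennreal_enn2real less_top[symmetric]\<close>)
  have base: "(LINT x|torus L. (1 + f x) * g (p x)) = (LINT x|torus L. (1 + m0 (p x)) * g (p x))"
    if [measurable]: "g \<in> borel_measurable borel" for g :: "real => real"
  proof -
    have "(LINT x|torus L. (1 + f x) * g (p x)) = (LINT x|D. g (p x))"
      unfolding D_def by (subst integral_density) (use f0 in auto)
    also have "\<dots> = (LINT s|\<nu>. g s)" unfolding \<nu>_def by (rule integral_distr[symmetric]) auto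
    also have "\<dots> = (LINT s|\<mu>. (1 + m0 s) * g s)"
      unfolding dens'[symmetric] by (subst integral_density) (auto simp: m0_def smu)
    also have "\<dots> = (LINT x|torus L. (1 + m0 (p x)) * g (p x))" unfolding \<mu>_def by (rule integral_distr) auto
    finally show ?thesis .
  qed
  have m0i: "integrable (torus L) (\<lambda>x. 1 + m0 (p x))"
  proof (rule integrableI_bounded)
    have "(\<integral>\<^sup>+ x. ennreal (norm (1 + m0 (p x))) \<partial>torus L) = (\<integral>\<^sup>+ s. ennreal (1 + m0 s) \<partial>\<mu>)"
      unfolding \<mu>_def by (subst nn_integral_distr) (auto simp: m0_def)
    also have "\<dots> = emeasure (density \<mu> (\<lambda>s. ennreal (1 + m0 s))) UNIV"
      by (subst emeasure_density) (auto simp: smu)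
    finally show "(\<integral>\<^sup>+ x. ennreal (norm (1 + m0 (p x))) \<partial>torus L) < (\<infinity>::ennreal)" using finD by (simp add: dens')
  qed measurable
  have m0i': "integrable (torus L) (\<lambda>x. m0 (p x))"
    using Bochner_Integration.integrable_diff[OF m0i T.integrable_const[of 1]] by simp
  have eq: "(LINT x|torus L. f x * g (p x)) = (LINT x|torus L. m0 (p x) * g (p x))"
    if [measurable]: "g \<in> borel_measurable borel" and C: "\<And>s. \<bar>g s\<bar> <= C" for g :: "real => real" and C
  proof -
    have gi: "integrable (torus L) (\<lambda>x. g (p x))" by (rule T.integrable_const_bound[of _ C]) (use C in auto)
    have i: "integrable (torus L) (\<lambda>x. k x * g (p x))" if "integrable (torus L) k" for k
      by (rule integrable_mult_bounded[OF that, of _ C]) (use C in auto)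
    have "(LINT x|torus L. g (p x)) + (LINT x|torus L. f x * g (p x)) = (LINT x|torus L. g (p x)) + (LINT x|torus L. m0 (p x) * g (p x))"
      using base[of g] gi i[OF fi] i[OF m0i'] by (simp add: distrib_right)
    then show ?thesis by simp
  qed
  have "AE s in \<mu>. \<bar>m0 s\<bar> <= 1"
  proof (rule bounded_by_duality[OF U.finite_measure_axioms])
    show "integrable \<mu> m0" unfolding \<mu>_def by (subst integrable_distr_eq) (use m0i' in auto)
    fix g :: "real => real" assume "g \<in> borel_measurable \<mu>" and g1: "\<bar>g s\<bar> <= 1" for s
    then have g [measurable]: "g \<in> borel_measurable borel" using measurable_cong_sets[OF smu refl] by blast
    have gi: "integrable (torus L) (\<lambda>x. \<bar>g (p x)\<bar>)" by (rule T.integrable_const_bound[of _ 1]) (use g1 in auto)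
    have "(LINT s|\<mu>. m0 s * g s) = (LINT x|torus L. f x * g (p x))"
      unfolding eq[OF g g1] \<mu>_def by (rule integral_distr) auto
    also have "\<dots> <= (LINT x|torus L. \<bar>g (p x)\<bar>)"
    proof (rule integral_mono_AE[OF _ gi])
      show "integrable (torus L) (\<lambda>x. f x * g (p x))" by (rule integrable_mult_bounded[OF fi, of _ 1]) (use g1 in auto)
      show "AE x in torus L. f x * g (p x) <= \<bar>g (p x)\<bar>"
        using f1
      proof eventually_elim
        case (elim x)
        show ?case using mult_right_mono[OF elim, of "\<bar>g (p x)\<bar>"] abs_ge_self[of "f x * g (p x)"] by (simp add: abs_mult)
      qed
    qed
    also have "\<dots> = (LINT s|\<mu>. \<bar>g s\<bar>)" unfolding \<mu>_def by (rule integral_distr[symmetric]) auto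
    finally show "(LINT s|\<mu>. m0 s * g s) <= (LINT s|\<mu>. \<bar>g s\<bar>)" .
  qed
  then have bound: "AE x in torus L. \<bar>m0 (p x)\<bar> <= 1" unfolding \<mu>_def by (rule AE_distrD[OF pm])
  define m where "m = (\<lambda>s. max (- 1) (min 1 (m0 s)))"
  have mm: "m \<in> borel_measurable borel" unfolding m_def by measurable
  have meq: "AE x in torus L. m0 (p x) = m (p x)"
    using bound by eventually_elim (simp add: m_def)
  show ?thesis
    unfolding is_marginal_def pe
  proof (intro exI[of _ m] conjI allI impI)
    fix g :: "real => real" and C assume g [measurable]: "g \<in> borel_measurable borel" and C: "\<forall>s\<in>{0..L}. \<bar>g s\<bar> <= C"
    define g' where "g' = (\<lambda>s. if s \<in> {0..L} then g s else 0)"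
    have g'm [measurable]: "g' \<in> borel_measurable borel" unfolding g'_def by measurable
    have g'C: "\<bar>g' s\<bar> <= \<bar>C\<bar>" for s using C by (force simp: g'_def)
    have gg: "x \<in> space (torus L) ==> g' (p x) = g (p x)" for x by (auto simp: g'_def p_def cube_def less_imp_le)
    have "(LINT x|torus L. f x * g (p x)) = (LINT x|torus L. f x * g' (p x))"
      by (rule Bochner_Integration.integral_cong) (auto simp: gg simp del: space_torus)
    also have "\<dots> = (LINT x|torus L. m0 (p x) * g' (p x))" by (rule eq[OF g'm g'C])
    also have "\<dots> = (LINT x|torus L. m (p x) * g' (p x))"
    proof (rule integral_cong_AE)
      show "AE x in torus L. m0 (p x) * g' (p x) = m (p x) * g' (p x)" using meq by eventually_elim simp
      show "(\<lambda>x. m (p x) * g' (p x)) \<in> borel_measurable (torus L)" using mm by measurable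
    qed measurable
    also have "\<dots> = (LINT x|torus L. m (p x) * g (p x))"
      by (rule Bochner_Integration.integral_cong) (auto simp: gg simp del: space_torus)
    finally show "(LINT x|torus L. f x * g (p x)) = (LINT x|torus L. m (p x) * g (p x))" .
  qed (use mm in \<open>auto simp: m_def\<close>)
qed

subsection \<open>Smooth approximation of one-dimensional potentials\<close>

text \<open>The primitive of \<open>g\<close> of mean zero on \<open>[0,L]\<close>.\<close>

definition mean_free :: "real => (real => real) => real => real" where
  "mean_free L g s = prim g s - integral {0..L} (prim g) / L"

text \<open>Only the constant mode has no periodic antiderivative.\<close>

lemma trig_antiderivative:
  fixes q :: "real => real"
  assumes "q \<in> trig L"
  shows "\<exists>c. \<exists>P\<in>trig L. \<forall>s. (P has_real_derivative q s - c) (at s)"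
  using assms
proof (induction)
  case (trig_cos \<kappa>)
  show ?case
  proof (cases "\<kappa> = 0")
    case True
    then show ?thesis by (intro exI[of _ 1] bexI[OF _ trig_const[of 0]]) auto
  next
    case False
    have "((\<lambda>s. (1 / \<kappa>) * sin (\<kappa> \<bullet> s)) has_real_derivative cos (\<kappa> \<bullet> s) - 0) (at s)" for s
      using False by (auto intro!: derivative_eq_intros)
    then show ?thesis using trig.trig_cmult[OF trig.trig_sin[OF trig_cos], of "1 / \<kappa>"] by blast
  qed
next
  case (trig_sin \<kappa>)
  show ?case
  proof (cases "\<kappa> = 0")
    case True
    then show ?thesis by (intro exI[of _ 0] bexI[OF _ trig_const[of 0]]) auto
  next
    case False
    have "((\<lambda>s. (- 1 / \<kappa>) * cos (\<kappa> \<bullet> s)) has_real_derivative sin (\<kappa> \<bullet> s) - 0) (at s)" for s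
      using False by (auto intro!: derivative_eq_intros)
    then show ?thesis using trig.trig_cmult[OF trig.trig_cos[OF trig_sin], of "- 1 / \<kappa>"] by blast
  qed
next
  case (trig_add f g)
  then obtain c d P R where "P \<in> trig L" "R \<in> trig L" "\<And>s. (P has_real_derivative f s - c) (at s)" "\<And>s. (R has_real_derivative g s - d) (at s)"
    by blast
  moreover from this have "((\<lambda>s. P s + R s) has_real_derivative f s + g s - (c + d)) (at s)" for s
    using DERIV_add[of P "f s - c" s UNIV R "g s - d"] by (simp add: algebra_simps)
  ultimately show ?case using trig.trig_add by blast
next
  case (trig_cmult f a)
  then obtain c P where "P \<in> trig L" "\<And>s. (P has_real_derivative f s - c) (at s)" by blast
  moreover from this have "((\<lambda>s. a * P s) has_real_derivative a * f s - a * c) (at s)" for s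
    using DERIV_cmult[of P "f s - c" s UNIV a] by (simp add: algebra_simps)
  ultimately show ?case using trig.trig_cmult by blast
qed

lemma trig_integral_antiderivative:
  fixes P :: "real => real"
  assumes "\<And>s. (P has_real_derivative q s) (at s)" "a <= b"
  shows "integral {a..b} q = P b - P a"
  by (rule integral_unique, rule fundamental_theorem_of_calculus)
    (use assms in \<open>auto simp: has_real_derivative_iff_has_vector_derivative[symmetric] intro: has_field_derivative_at_within\<close>)

lemma box_corner_real: "cbox 0 (box_corner L) = {0..L::real}"
  by (simp add: box_corner_def)

text \<open>Trigonometric polynomials converging to \<open>m\<close> are integrated twice. The constants
  subtracted on the way tend to the right values, because the means of \<open>m\<close> and of its first
  primitive vanish. All integrations by parts for \<open>m\<close>, which is merely bounded, go through this
  sequence.\<close>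

theorem potential_approximation:
  fixes m :: "real => real"
  assumes L: "0 < L" and m: "m \<in> borel_measurable borel" "\<And>s. \<bar>m s\<bar> <= 1" and m0: "integral {0..L} m = 0"
  obtains p q r :: "nat => real => real" and N B where "negligible N"
    "\<And>n. p n \<in> trig L" "\<And>n. q n \<in> trig L" "\<And>n. r n \<in> trig L"
    "\<And>n s. (p n has_real_derivative q n s) (at s)" "\<And>n s. (q n has_real_derivative r n s) (at s)"
    "\<And>n s. s \<in> {0..L} ==> \<bar>p n s\<bar> <= B" "\<And>n s. s \<in> {0..L} ==> \<bar>q n s\<bar> <= B" "\<And>n s. s \<in> {0..L} ==> \<bar>r n s\<bar> <= B"
    "\<And>s. s \<in> {0..L} ==> (\<lambda>n. p n s) \<longlonglongrightarrow> prim (mean_free L m) s"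
    "\<And>s. s \<in> {0..L} ==> (\<lambda>n. q n s) \<longlonglongrightarrow> mean_free L m s"
    "\<And>s. s \<in> {0..L} - N ==> (\<lambda>n. r n s) \<longlonglongrightarrow> m s"
proof -
  have "m \<in> borel_measurable (lebesgue_on (cbox 0 (box_corner L)))" by (rule borel_measurable_lebesgue_onI[OF m(1)])
  from trig_dense_ex[OF L this m(2)] obtain t N where N: "negligible N" and t: "\<And>n::nat. t n \<in> trig L"
    "\<And>n s. s \<in> {0..L} ==> \<bar>t n s\<bar> <= 2" "\<And>s. s \<in> {0..L} - N ==> (\<lambda>n. t n s) \<longlonglongrightarrow> m s"
    unfolding box_corner_real one_add_one by blast
  have "\<forall>n. \<exists>c P. P \<in> trig L \<and> (\<forall>s. (P has_real_derivative t n s - c) (at s))"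
    using trig_antiderivative[OF t(1)] by blast
  then obtain c P where P: "\<And>n. P n \<in> trig L" "\<And>n s. (P n has_real_derivative t n s - c n) (at s)" by metis
  have "\<forall>n. \<exists>d R. R \<in> trig L \<and> (\<forall>s. (R has_real_derivative P n s - d) (at s))"
    using trig_antiderivative[OF P(1)] by blast
  then obtain d R where R: "\<And>n. R n \<in> trig L" "\<And>n s. (R n has_real_derivative P n s - d n) (at s)" by metis
  define r where "r = (\<lambda>n s. t n s - c n)"
  define q where "q = (\<lambda>n s. P n s - d n)"
  define p where "p = (\<lambda>n s. R n s - R n 0)"
  have trig: "p n \<in> trig L" "q n \<in> trig L" "r n \<in> trig L" for n
    unfolding p_def q_def r_def by (intro trig_diff trig_const t P R)+
  have dp: "(p n has_real_derivative q n s) (at s)" for n s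
    unfolding p_def q_def using DERIV_diff[OF R(2) DERIV_const] by simp
  have dq: "(q n has_real_derivative r n s) (at s)" for n s
    unfolding q_def r_def using DERIV_diff[OF P(2) DERIV_const] by simp

  have tb: "t n \<in> borel_measurable borel" and rb: "r n \<in> borel_measurable borel" and qb: "q n \<in> borel_measurable borel" for n
    using trig_borel[OF t(1)] trig_borel[OF trig(3)] trig_borel[OF trig(2)] by auto
  have per: "f L = f 0" if "f \<in> trig L" for f :: "real => real"
    using trig_periodic[OF that, of 1 0] L by simp
  have int_r: "integral {0..L} (r n) = 0" for n
    using trig_integral_antiderivative[OF dq, of 0 L] L per[OF trig(2)] by simp
  have int_q: "integral {0..L} (q n) = 0" for n
    using trig_integral_antiderivative[OF dp, of 0 L] L per[OF trig(1)] by simp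
  have c_eq: "c n = integral {0..L} (t n) / L" for n
  proof -
    have "integral {0..L} (r n) = integral {0..L} (t n) - L * c n"
      unfolding r_def using L by (subst integral_diff) (auto intro!: integrable_continuous_real trig_continuous[OF t(1)])
    then show ?thesis using int_r[of n] L by (simp add: field_simps)
  qed
  have c0: "c \<longlonglongrightarrow> 0"
  proof -
    have "(\<lambda>n. integral {0..L} (t n)) \<longlonglongrightarrow> integral {0..L} m"
      by (rule bounded_convergence_interval[OF tb m(1) t(2) N t(3)])
    from tendsto_divide[OF this tendsto_const[of L]] show ?thesis using L m0 by (simp add: c_eq[abs_def])
  qed
  have c2: "\<bar>c n\<bar> <= 2" for n
  proof -
    have "norm (integral {0..L} (t n)) <= integral {0..L} (\<lambda>_. 2)"
      by (rule integral_norm_bound_integral)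
        (use t(2) in \<open>auto intro!: integrable_continuous_real trig_continuous[OF t(1)]\<close>)
    then show ?thesis using L by (simp add: c_eq abs_divide divide_le_eq)
  qed
  have r4: "\<bar>r n s\<bar> <= 4" if "s \<in> {0..L}" for n s using t(2)[OF that, of n] c2[of n] unfolding r_def by linarith
  have rlim: "(\<lambda>n. r n s) \<longlonglongrightarrow> m s" if "s \<in> {0..L} - N" for s
    unfolding r_def using tendsto_diff[OF t(3)[OF that] c0] by simp
  have q_eq: "q n s = q n 0 + prim (r n) s" if "0 <= s" for n s
    using trig_integral_antiderivative[OF dq that] by (simp add: prim_def)
  have p_eq: "p n s = prim (q n) s" if "0 <= s" for n s
    using trig_integral_antiderivative[OF dp that] by (simp add: prim_def p_def)
  have pr_lim: "(\<lambda>n. prim (r n) s) \<longlonglongrightarrow> prim m s" if "s \<in> {0..L}" for s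
    unfolding prim_def
    by (rule bounded_convergence_interval[OF rb m(1) _ N, where C = 4]) (use r4 rlim that in auto)
  have pr_bd: "\<bar>prim (r n) s\<bar> <= 4 * L" if "s \<in> {0..L}" for n s
  proof -
    have "norm (integral {0..s} (r n)) <= integral {0..s} (\<lambda>_. 4)"
      by (rule integral_norm_bound_integral)
        (use r4 that in \<open>auto intro!: integrable_continuous_real trig_continuous[OF trig(3)]\<close>)
    then show ?thesis using that by (simp add: prim_def)
  qed
  have prb: "prim (r n) \<in> borel_measurable borel" for n
  proof -
    obtain C where "\<And>s. \<bar>r n s\<bar> <= C" using trig_bounded[OF trig(3)] by blast
    then show ?thesis by (rule borel_prim[OF rb])
  qed
  have mb: "prim m \<in> borel_measurable borel" by (rule borel_prim[OF m])
  have q0_eq: "q n 0 = - (integral {0..L} (prim (r n)) / L)" for n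
  proof -
    have "integral {0..L} (q n) = integral {0..L} (\<lambda>s. q n 0 + prim (r n) s)"
      by (rule Henstock_Kurzweil_Integration.integral_cong, rule q_eq) simp
    also have "\<dots> = L * q n 0 + integral {0..L} (prim (r n))"
      using L by (subst integral_add) (auto intro!: bounded_borel_integrable(2)[OF prb pr_bd])
    finally show ?thesis using int_q[of n] L by (simp add: field_simps)
  qed
  have q0_lim: "(\<lambda>n. q n 0) \<longlonglongrightarrow> - (integral {0..L} (prim m) / L)"
  proof -
    have "(\<lambda>n. integral {0..L} (prim (r n))) \<longlonglongrightarrow> integral {0..L} (prim m)"
      by (rule bounded_convergence_interval[OF prb mb pr_bd negligible_empty]) (use pr_lim in auto)
    then show ?thesis unfolding q0_eq using L by (intro tendsto_intros) auto
  qed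
  have q0_bd: "\<bar>q n 0\<bar> <= 4 * L" for n
  proof -
    have "norm (integral {0..L} (prim (r n))) <= integral {0..L} (\<lambda>_. 4 * L)"
      by (rule integral_norm_bound_integral) (use pr_bd in \<open>auto intro!: bounded_borel_integrable(2)[OF prb pr_bd]\<close>)
    then show ?thesis using L by (simp add: q0_eq abs_divide divide_le_eq power2_eq_square)
  qed
  have qlim: "(\<lambda>n. q n s) \<longlonglongrightarrow> mean_free L m s" if "s \<in> {0..L}" for s
    using tendsto_add[OF q0_lim pr_lim[OF that]] q_eq[of s] that by (simp add: mean_free_def algebra_simps)
  have q8: "\<bar>q n s\<bar> <= 8 * L" if "s \<in> {0..L}" for n s
    using q0_bd[of n] pr_bd[OF that, of n] q_eq[of s n] that by (simp add: abs_le_iff)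
  have mfb: "mean_free L m \<in> borel_measurable borel" unfolding mean_free_def[abs_def] using mb by measurable
  have plim: "(\<lambda>n. p n s) \<longlonglongrightarrow> prim (mean_free L m) s" if "s \<in> {0..L}" for s
  proof -
    have "(\<lambda>n. integral {0..s} (q n)) \<longlonglongrightarrow> integral {0..s} (mean_free L m)"
    by (rule bounded_convergence_interval[OF qb mfb _ negligible_empty, where C = "8 * L"]) (use q8 qlim that in auto)
    then show ?thesis using p_eq[of s] that by (simp add: prim_def)
  qed
  have p8: "\<bar>p n s\<bar> <= 8 * L * L" if "s \<in> {0..L}" for n s
  proof -
    have "norm (integral {0..s} (q n)) <= integral {0..s} (\<lambda>_. 8 * L)"
      by (rule integral_norm_bound_integral)
        (use q8 that in \<open>auto intro!: integrable_continuous_real trig_continuous[OF trig(2)]\<close>)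
    also have "\<dots> <= 8 * L * L" using that L by (simp add: mult_left_mono mult_right_mono)
    finally show ?thesis using p_eq[of s n] that by (simp add: prim_def)
  qed
  define B where "B = 4 + 8 * L + 8 * L * L"
  have B: "4 <= B" "8 * L <= B" "8 * L * L <= B" using L by (auto simp: B_def)
  have pB: "\<bar>p n s\<bar> <= B" and qB: "\<bar>q n s\<bar> <= B" and rB: "\<bar>r n s\<bar> <= B" if "s \<in> {0..L}" for n s
    using p8[OF that, of n] q8[OF that, of n] r4[OF that, of n] B by linarith+
  show ?thesis
    by (rule that[OF N trig dp dq pB qB rB plim qlim rlim])
qed

section \<open>Energies of one-dimensional densities\<close>

lemma trig_lift:
  fixes q :: "real => real"
  assumes "q \<in> trig L"
  shows "(\<lambda>x::real^'n. q (x $ i)) \<in> trig L"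
  using assms
proof induction
  have lat: "axis i \<kappa> \<in> (lattice L :: (real^'n) set)" if "\<kappa> \<in> lattice L" for \<kappa> :: real
  proof -
    have "\<forall>b\<in>Basis. \<exists>k::int. \<kappa> \<bullet> b = 2 * pi * k / L" using that unfolding lattice_def by blast
    then have "\<exists>k::int. \<kappa> \<bullet> 1 = 2 * pi * k / L" by (rule bspec) simp
    then obtain k :: int where k: "\<kappa> = 2 * pi * k / L" unfolding inner_real_def mult_1_right by blast
    show ?thesis unfolding lattice_def
    proof (intro CollectI ballI)
      fix b :: "real^'n" assume "b \<in> Basis"
      then obtain j where b: "b = axis j 1" by (auto simp: Basis_vec_def)
      show "\<exists>k::int. axis i \<kappa> \<bullet> b = 2 * pi * k / L"
        by (cases "j = i") (auto simp: b inner_axis_axis k intro: exI[of _ k] exI[of _ 0])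
    qed
  qed
  have inn: "axis i \<kappa> \<bullet> x = \<kappa> \<bullet> (x $ i)" for \<kappa> :: real and x :: "real^'n" by (simp add: inner_axis')
  {
    case (trig_cos \<kappa>)
    show ?case using trig.trig_cos[OF lat[OF trig_cos]] by (simp add: inn)
  next
    case (trig_sin \<kappa>)
    show ?case using trig.trig_sin[OF lat[OF trig_sin]] by (simp add: inn)
  }
qed (auto intro: trig.trig_add trig.trig_cmult)

lemma trig_lift_smooth: "f \<in> trig L ==> 0 < L ==> (\<lambda>x::real^'n. f (x $ i)) \<in> torus_smooth L"
  by (rule trig_torus_smooth[OF trig_lift])

lemma derivative_lift:
  fixes q :: "real => real"
  assumes "(q has_real_derivative d) (at (x $ i))"
  shows "((\<lambda>y::real^'n. q (y $ i)) has_derivative (\<lambda>h. d * h $ i)) (at x)"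
proof -
  have "((\<lambda>y::real^'n. y $ i) has_derivative (\<lambda>h. h $ i)) (at x)"
    by (rule bounded_linear_imp_has_derivative) (rule bounded_linear_vec_nth)
  from has_derivative_compose[OF this assms[unfolded has_field_derivative_def]] show ?thesis by (simp add: o_def)
qed

lemma partial_lift:
  fixes q :: "real => real"
  assumes "\<And>s. (q has_real_derivative q' s) (at s)"
  shows "partial j (\<lambda>y::real^'n. q (y $ i)) x = (if j = i then q' (x $ i) else 0)"
  unfolding partial_eq[OF derivative_lift[OF assms]] by (auto simp: axis_def)

lemma partial_lift_fun:
  fixes q :: "real => real"
  assumes "\<And>s. (q has_real_derivative q' s) (at s)"
  shows "partial j (\<lambda>y::real^'n. q (y $ i)) = (\<lambda>x. if j = i then q' (x $ i) else 0)"
  using partial_lift[OF assms] by blast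

lemma laplacian_lift:
  fixes q :: "real => real"
  assumes q: "\<And>s. (q has_real_derivative q' s) (at s)" and q': "\<And>s. (q' has_real_derivative q'' s) (at s)"
  shows "laplacian (\<lambda>y::real^'n. q (y $ i)) x = q'' (x $ i)"
proof -
  have z: "partial j (\<lambda>x::real^'n. 0) x = 0" for j
    by (rule partial_eq[of "\<lambda>_. 0" "\<lambda>_. 0", simplified])
  have "laplacian (\<lambda>y::real^'n. q (y $ i)) x = (\<Sum>j\<in>UNIV. if j = i then q'' (x $ i) else 0)"
    unfolding laplacian_def partial_lift_fun[OF q]
    by (rule sum.cong) (auto simp: partial_lift[OF q'] z)
  then show ?thesis by simp
qed

text \<open>Dominated convergence for functions of one coordinate against a fixed integrable function.\<close>

lemma torus_lift_limit:
  fixes h :: "real^'n => real" and a :: "nat => real => real"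
  assumes L: "0 < L" and h: "integrable (torus L) h" and N: "negligible N"
    and am: "\<And>n. a n \<in> borel_measurable borel" and bm: "b \<in> borel_measurable borel"
    and bd: "\<And>n s. s \<in> {0..L} ==> \<bar>a n s\<bar> <= B" and lim: "\<And>s. s \<in> {0..L} - N ==> (\<lambda>n. a n s) \<longlonglongrightarrow> b s"
  shows "(\<lambda>n. LINT x|torus L. h x * a n (x $ i)) \<longlonglongrightarrow> (LINT x|torus L. h x * b (x $ i))"
proof (rule integral_dominated_convergence)
  have hm [measurable]: "h \<in> borel_measurable (torus L)" using h by measurable
  have [measurable]: "(\<lambda>x. a n (x $ i)) \<in> borel_measurable (torus L)" for n by (rule torus_lift_measurable[OF am])
  have [measurable]: "(\<lambda>x. b (x $ i)) \<in> borel_measurable (torus L)" by (rule torus_lift_measurable[OF bm])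
  show "(\<lambda>x. h x * b (x $ i)) \<in> borel_measurable (torus L)" "\<And>n. (\<lambda>x. h x * a n (x $ i)) \<in> borel_measurable (torus L)"
    by measurable
  show "integrable (torus L) (\<lambda>x. B * \<bar>h x\<bar>)" using h by simp
  have "AE x in torus L. (\<lambda>n. a n ((x::real^'n) $ i)) \<longlonglongrightarrow> b (x $ i)"
    by (rule AE_torus_coordinate[OF L N]) (use lim in auto)
  then show "AE x in torus L. (\<lambda>n. h x * a n (x $ i)) \<longlonglongrightarrow> h x * b (x $ i)"
    by eventually_elim (intro tendsto_intros)
  show "AE x in torus L. norm (h x * a n (x $ i)) <= B * \<bar>h x\<bar>" for n
  proof (rule AE_I2)
    fix x :: "real^'n" assume "x \<in> space (torus L)"
    then have "\<bar>a n (x $ i)\<bar> <= B" by (intro bd cube_coordinate) simp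
    then show "norm (h x * a n (x $ i)) <= B * \<bar>h x\<bar>"
      using mult_right_mono[of "\<bar>a n (x $ i)\<bar>" B "\<bar>h x\<bar>"] by (simp add: abs_mult mult.commute)
  qed
qed

text \<open>The class of the averages of the densities.\<close>

definition profile :: "real => (real => real) => bool" where
  "profile L m \<longleftrightarrow> m \<in> borel_measurable borel \<and> (\<forall>s. \<bar>m s\<bar> <= 1) \<and> integral {0..L} m = 0"

text \<open>The conclusion of \<open>potential_approximation\<close> as a predicate, so that it can be passed
  between lemmas.\<close>

definition approximates :: "real => (nat => real => real) => (nat => real => real) => (nat => real => real) => real set => real => (real => real) => bool"
  where "approximates L p q r N B m \<longleftrightarrow> negligible N \<and> 0 <= B \<and>
    (\<forall>n. p n \<in> trig L \<and> q n \<in> trig L \<and> r n \<in> trig L) \<and>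
    (\<forall>n s. (p n has_real_derivative q n s) (at s) \<and> (q n has_real_derivative r n s) (at s)) \<and>
    (\<forall>n. \<forall>s\<in>{0..L}. \<bar>p n s\<bar> <= B \<and> \<bar>q n s\<bar> <= B \<and> \<bar>r n s\<bar> <= B) \<and>
    (\<forall>s\<in>{0..L}. (\<lambda>n. p n s) \<longlonglongrightarrow> prim (mean_free L m) s \<and> (\<lambda>n. q n s) \<longlonglongrightarrow> mean_free L m s) \<and>
    (\<forall>s\<in>{0..L} - N. (\<lambda>n. r n s) \<longlonglongrightarrow> m s)"

lemma approximates_exists:
  assumes L: "0 < L" and m: "profile L m"
  shows "\<exists>p q r N B. approximates L p q r N B m"
proof -
  have m': "m \<in> borel_measurable borel" "\<And>s. \<bar>m s\<bar> <= 1" "integral {0..L} m = 0" using m by (auto simp: profile_def)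
  show ?thesis
  proof (rule potential_approximation[OF L m'])
    fix p q r N B
    assume *: "negligible N"
    "\<And>n. p n \<in> trig L" "\<And>n. q n \<in> trig L" "\<And>n. r n \<in> trig L"
    "\<And>n s. (p n has_real_derivative q n s) (at s)" "\<And>n s. (q n has_real_derivative r n s) (at s)"
    "\<And>n s. s \<in> {0..L} ==> \<bar>p n s\<bar> <= B" "\<And>n s. s \<in> {0..L} ==> \<bar>q n s\<bar> <= B" "\<And>n s. s \<in> {0..L} ==> \<bar>r n s\<bar> <= B"
    "\<And>s. s \<in> {0..L} ==> (\<lambda>n. p n s) \<longlonglongrightarrow> prim (mean_free L m) s"
    "\<And>s. s \<in> {0..L} ==> (\<lambda>n. q n s) \<longlonglongrightarrow> mean_free L m s"
    "\<And>s. s \<in> {0..L} - N ==> (\<lambda>n. r n s) \<longlonglongrightarrow> m s"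
    have "0 <= \<bar>p 0 0\<bar>" by simp
    also have "\<dots> <= B" using *(7)[of 0 0] L by auto
    finally have "0 <= B" .
    with * have "approximates L p q r N B m" unfolding approximates_def by simp
    then show ?thesis by blast
  qed
qed

lemma approximatesD:
  assumes "approximates L p q r N B m"
  shows "negligible N" "0 <= B" "p n \<in> trig L" "q n \<in> trig L" "r n \<in> trig L"
    "(p n has_real_derivative q n s) (at s)" "(q n has_real_derivative r n s) (at s)"
    "s \<in> {0..L} ==> \<bar>p n s\<bar> <= B" "s \<in> {0..L} ==> \<bar>q n s\<bar> <= B" "s \<in> {0..L} ==> \<bar>r n s\<bar> <= B"
    "s \<in> {0..L} ==> (\<lambda>n. p n s) \<longlonglongrightarrow> prim (mean_free L m) s"
    "s \<in> {0..L} ==> (\<lambda>n. q n s) \<longlonglongrightarrow> mean_free L m s"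
    "s \<in> {0..L} - N ==> (\<lambda>n. r n s) \<longlonglongrightarrow> m s"
    "p n \<in> borel_measurable borel" "q n \<in> borel_measurable borel" "r n \<in> borel_measurable borel"
  using assms trig_borel[of "p n" L] trig_borel[of "q n" L] trig_borel[of "r n" L] unfolding approximates_def by auto

lemma profile_borel:
  assumes "profile L m"
  shows "m \<in> borel_measurable borel" "\<bar>m s\<bar> <= 1" "integral {0..L} m = 0"
    "mean_free L m \<in> borel_measurable borel"
  using assms borel_prim[of m 1] by (auto simp: profile_def mean_free_def[abs_def])

lemma mean_free_bound:
  assumes "profile L m"
  shows "\<exists>C. \<forall>s\<in>{0..L}. \<bar>mean_free L m s\<bar> <= C"
proof (intro exI ballI)
  fix s assume "s \<in> {0..L}"
  then show "\<bar>mean_free L m s\<bar> <= 1 * L + \<bar>integral {0..L} (prim m) / L\<bar>"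
    using prim_bound[OF profile_borel(1,2)[OF assms], of s L] unfolding mean_free_def by linarith
qed

text \<open>On \<open>[0,L]\<close> the second primitive coincides with the primitive of a bounded Borel
  function. Outside, where only the cube is ever evaluated, it may grow.\<close>

lemma potential_borel:
  assumes m: "profile L m" and L: "0 < L"
  shows "\<exists>F B. F \<in> borel_measurable borel \<and> (\<forall>s\<in>{0..L}. F s = prim (mean_free L m) s \<and> \<bar>F s\<bar> <= B)"
proof -
  obtain C where C: "\<And>s. s \<in> {0..L} ==> \<bar>mean_free L m s\<bar> <= C" using mean_free_bound[OF m] by blast
  have C0: "0 <= C" using C[of 0] L by auto
  define w where "w = (\<lambda>s. if s \<in> {0..L} then mean_free L m s else 0)"
  have w: "w \<in> borel_measurable borel" using profile_borel(4)[OF m] unfolding w_def by measurable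
  have wC: "\<bar>w s\<bar> <= C" for s using C[of s] C0 unfolding w_def by auto
  have "prim w s = prim (mean_free L m) s" if "s \<in> {0..L}" for s
    unfolding prim_def by (rule Henstock_Kurzweil_Integration.integral_cong) (use that in \<open>auto simp: w_def\<close>)
  then show ?thesis using borel_prim[OF w wC] prim_bound[OF w wC, of _ L] by (intro exI[of _ "prim w"] exI[of _ "C * L"]) auto
qed

lemma potential_limit:
  fixes h :: "real^'n => real"
  assumes L: "0 < L" and m: "profile L m" and ap: "approximates L p q r N B m" and h: "integrable (torus L) h"
  shows "(\<lambda>n. LINT x|torus L. h x * p n (x $ i)) \<longlonglongrightarrow> (LINT x|torus L. h x * prim (mean_free L m) (x $ i))"
    "(\<lambda>n. LINT x|torus L. h x * q n (x $ i)) \<longlonglongrightarrow> (LINT x|torus L. h x * mean_free L m (x $ i))"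
    "(\<lambda>n. LINT x|torus L. h x * r n (x $ i)) \<longlonglongrightarrow> (LINT x|torus L. h x * m (x $ i))"
proof -
  obtain F where F: "F \<in> borel_measurable borel" "\<And>s. s \<in> {0..L} ==> F s = prim (mean_free L m) s"
    using potential_borel[OF m L] by blast
  have "(LINT x|torus L. h x * prim (mean_free L m) (x $ i)) = (LINT x|torus L. h x * F (x $ i))"
    by (rule Bochner_Integration.integral_cong) (simp_all add: F(2)[OF cube_coordinate])
  moreover have "(\<lambda>n. LINT x|torus L. h x * p n (x $ i)) \<longlonglongrightarrow> (LINT x|torus L. h x * F (x $ i))"
    by (rule torus_lift_limit[OF L h approximatesD(1)[OF ap] approximatesD(14)[OF ap] F(1) approximatesD(8)[OF ap]])
      (use approximatesD(11)[OF ap] F(2) in auto)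
  ultimately show "(\<lambda>n. LINT x|torus L. h x * p n (x $ i)) \<longlonglongrightarrow> (LINT x|torus L. h x * prim (mean_free L m) (x $ i))" by simp
  show "(\<lambda>n. LINT x|torus L. h x * q n (x $ i)) \<longlonglongrightarrow> (LINT x|torus L. h x * mean_free L m (x $ i))"
    by (rule torus_lift_limit[OF L h approximatesD(1)[OF ap] approximatesD(15)[OF ap] profile_borel(4)[OF m] approximatesD(9)[OF ap]])
      (use approximatesD(12)[OF ap] in auto)
  show "(\<lambda>n. LINT x|torus L. h x * r n (x $ i)) \<longlonglongrightarrow> (LINT x|torus L. h x * m (x $ i))"
    by (rule torus_lift_limit[OF L h approximatesD(1)[OF ap] approximatesD(16)[OF ap] profile_borel(1)[OF m] approximatesD(10)[OF ap] approximatesD(13)[OF ap]])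
qed

lemma torus_lift_L2:
  fixes g :: "real => real"
  assumes L: "0 < L" and g: "g \<in> borel_measurable borel" "\<And>s. s \<in> {0..L} ==> \<bar>g s\<bar> <= C"
  shows "(\<lambda>x::real^'n. g (x $ i)) \<in> L2 (torus L)" "integrable (torus L) (\<lambda>x::real^'n. g (x $ i))"
proof -
  have "AE x in (torus L :: (real^'n) measure). \<bar>g (x $ i)\<bar> <= C"
    by (rule AE_I2) (use g(2) cube_coordinate in auto)
  with torus_lift_measurable[OF g(1)] show "(\<lambda>x::real^'n. g (x $ i)) \<in> L2 (torus L)" "integrable (torus L) (\<lambda>x::real^'n. g (x $ i))"
    by (auto intro: torus_L2_bounded[OF L] torus_integrable_bounded[OF L])
qed

lemma potential_lift_L2:
  assumes L: "0 < L" and m: "profile L m"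
  shows "(\<lambda>x::real^'n. mean_free L m (x $ i)) \<in> L2 (torus L)" "(\<lambda>x::real^'n. m (x $ i)) \<in> L2 (torus L)"
    "(\<lambda>x::real^'n. prim (mean_free L m) (x $ i)) \<in> L2 (torus L)"
proof -
  obtain C where C: "\<And>s. s \<in> {0..L} ==> \<bar>mean_free L m s\<bar> <= C" using mean_free_bound[OF m] by blast
  show "(\<lambda>x::real^'n. mean_free L m (x $ i)) \<in> L2 (torus L)" by (rule torus_lift_L2(1)[OF L profile_borel(4)[OF m] C])
  show "(\<lambda>x::real^'n. m (x $ i)) \<in> L2 (torus L)" by (rule torus_lift_L2(1)[OF L profile_borel(1,2)[OF m]])
  obtain F B where F: "F \<in> borel_measurable borel" "\<And>s. s \<in> {0..L} ==> F s = prim (mean_free L m) s" "\<And>s. s \<in> {0..L} ==> \<bar>F s\<bar> <= B"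
    using potential_borel[OF m L] by blast
  have eq: "x \<in> space (torus L) ==> prim (mean_free L m) (x $ i) = F (x $ i)" for x :: "real^'n"
    by (simp add: F(2)[OF cube_coordinate])
  have "(\<lambda>x::real^'n. F (x $ i)) \<in> L2 (torus L)" by (rule torus_lift_L2(1)[OF L F(1,3)])
  moreover have "(\<lambda>x::real^'n. F (x $ i)) \<in> L2 (torus L) \<longleftrightarrow> (\<lambda>x::real^'n. prim (mean_free L m) (x $ i)) \<in> L2 (torus L)"
    unfolding L2_real_iff
    by (intro arg_cong2[where f = "(\<and>)"] measurable_cong Bochner_Integration.integrable_cong) (simp_all only: eq)
  ultimately show "(\<lambda>x::real^'n. prim (mean_free L m) (x $ i)) \<in> L2 (torus L)" by simp
qed

text \<open>Integration by parts, \<open>\<integral> w' F = - \<integral> w F'\<close>.\<close>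

lemma potential_parts:
  fixes i :: "'n::finite"
  assumes L: "0 < L" and m: "profile L m" and k: "profile L k"
  shows "(LINT x|torus L. m ((x::real^'n) $ i) * prim (mean_free L k) (x $ i)) = - (LINT x|torus L. mean_free L m ((x::real^'n) $ i) * mean_free L k (x $ i))"
proof -
  obtain p q r N B where a: "approximates L p q r N B m" using approximates_exists[OF L m] by blast
  obtain p' q' r' N' B' where b: "approximates L p' q' r' N' B' k" using approximates_exists[OF L k] by blast
  have sm: "(\<lambda>x::real^'n. f (x $ i)) \<in> torus_smooth L" if "f \<in> trig L" for f by (rule trig_lift_smooth[OF that L])
  have ibp: "(LINT x|torus L. p' l ((x::real^'n) $ i) * r n (x $ i)) = - (LINT x|torus L. q' l ((x::real^'n) $ i) * q n (x $ i))" for l n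
    using torus_integration_by_parts[OF L sm[OF approximatesD(3)[OF b]] sm[OF approximatesD(4)[OF a]], where i = i]
    unfolding partial_lift_fun[OF approximatesD(6)[OF b]] partial_lift_fun[OF approximatesD(7)[OF a]] by simp
  have int: "integrable (torus L) (\<lambda>x::real^'n. f (x $ i))" if "f \<in> trig L" for f
    by (rule torus_L2_integrable[OF L torus_L2_smooth[OF L sm[OF that]]])
  \<comment> \<open>first the limit in the approximation of \<open>m\<close>, then the one of \<open>k\<close>\<close>
  have one: "(LINT x|torus L. p' l ((x::real^'n) $ i) * m (x $ i)) = - (LINT x|torus L. q' l ((x::real^'n) $ i) * mean_free L m (x $ i))" for l
  proof (rule LIMSEQ_unique)
    show "(\<lambda>n. LINT x|torus L. p' l ((x::real^'n) $ i) * r n (x $ i)) \<longlonglongrightarrow> (LINT x|torus L. p' l ((x::real^'n) $ i) * m (x $ i))"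
      by (rule potential_limit(3)[OF L m a int[OF approximatesD(3)[OF b]]])
    show "(\<lambda>n. LINT x|torus L. p' l ((x::real^'n) $ i) * r n (x $ i)) \<longlonglongrightarrow> - (LINT x|torus L. q' l ((x::real^'n) $ i) * mean_free L m (x $ i))"
      unfolding ibp by (intro tendsto_minus potential_limit(2)[OF L m a int[OF approximatesD(4)[OF b]]])
  qed
  have mi: "integrable (torus L) (\<lambda>x::real^'n. m (x $ i))" "integrable (torus L) (\<lambda>x::real^'n. mean_free L m (x $ i))"
    using torus_L2_integrable[OF L potential_lift_L2(2)[OF L m]] torus_L2_integrable[OF L potential_lift_L2(1)[OF L m]] by auto
  show ?thesis
  proof (rule LIMSEQ_unique)
    show "(\<lambda>n. LINT x|torus L. m ((x::real^'n) $ i) * p' n (x $ i)) \<longlonglongrightarrow> (LINT x|torus L. m ((x::real^'n) $ i) * prim (mean_free L k) (x $ i))"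
      by (rule potential_limit(1)[OF L k b mi(1)])
    have "(LINT x|torus L. m ((x::real^'n) $ i) * p' n (x $ i)) = - (LINT x|torus L. mean_free L m ((x::real^'n) $ i) * q' n (x $ i))" for n
      using one[of n] by (simp add: mult.commute)
    then show "(\<lambda>n. LINT x|torus L. m ((x::real^'n) $ i) * p' n (x $ i)) \<longlonglongrightarrow> - (LINT x|torus L. mean_free L m ((x::real^'n) $ i) * mean_free L k (x $ i))"
      by (simp only:) (intro tendsto_minus potential_limit(2)[OF L k b mi(2)])
  qed
qed

text \<open>The integrand \<open>w w'\<close> is the derivative of \<open>w\<^sup>2 / 2\<close>.\<close>

lemma potential_orthogonal:
  fixes i :: "'n::finite"
  assumes L: "0 < L" and m: "profile L m"
  shows "(LINT x|torus L. mean_free L m ((x::real^'n) $ i) * m (x $ i)) = 0"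
proof -
  obtain p q r N B where a: "approximates L p q r N B m" using approximates_exists[OF L m] by blast
  have sm: "(\<lambda>x::real^'n. q n (x $ i)) \<in> torus_smooth L" for n by (rule trig_torus_smooth[OF trig_lift[OF approximatesD(4)[OF a]] L])
  have z: "(LINT x|torus L. 1 * (q n ((x::real^'n) $ i) * r n (x $ i))) = 0" for n
  proof -
    have "(LINT x|torus L. q n ((x::real^'n) $ i) * r n (x $ i)) = - (LINT x|torus L. r n ((x::real^'n) $ i) * q n (x $ i))"
      using torus_integration_by_parts[OF L sm[of n] sm[of n], where i = i]
      unfolding partial_lift_fun[OF approximatesD(7)[OF a]] by simp
    also have "(LINT x|torus L. r n ((x::real^'n) $ i) * q n (x $ i)) = (LINT x|torus L. q n ((x::real^'n) $ i) * r n (x $ i))"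
      by (simp only: mult.commute)
    finally show ?thesis by simp
  qed
  have bd: "\<bar>q n s * r n s\<bar> <= B * B" if "s \<in> {0..L}" for n s
    unfolding abs_mult by (intro mult_mono approximatesD[OF a] that) auto
  have meas: "(\<lambda>s. q n s * r n s) \<in> borel_measurable borel" for n
    using approximatesD(15,16)[OF a, of n] by measurable
  have meas': "(\<lambda>s. mean_free L m s * m s) \<in> borel_measurable borel"
    using profile_borel(1,4)[OF m] by measurable
  have one: "integrable (torus L) (\<lambda>x::real^'n. 1 :: real)" by (rule torus_continuous_integrable[OF L]) auto
  have lim: "(\<lambda>n. q n s * r n s) \<longlonglongrightarrow> mean_free L m s * m s" if "s \<in> {0..L} - N" for s
    using that by (intro tendsto_mult approximatesD(12,13)[OF a]) auto
  have "(\<lambda>n. LINT x|torus L. 1 * (q n ((x::real^'n) $ i) * r n (x $ i))) \<longlonglongrightarrow> (LINT x|torus L. 1 * (mean_free L m ((x::real^'n) $ i) * m (x $ i)))"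
    by (rule torus_lift_limit[OF L one approximatesD(1)[OF a] meas meas' bd lim])
  then show ?thesis unfolding z by (simp add: LIMSEQ_const_iff)
qed

lemma marginal_profile:
  fixes f :: "real^'n => real"
  assumes L: "0 < L" and m: "is_marginal L i f m" and f0: "(LINT x|torus L. f x) = 0"
  shows "profile L m"
proof -
  have mm: "m \<in> borel_measurable borel" "\<And>s. \<bar>m s\<bar> <= 1"
    and int: "\<And>g C. g \<in> borel_measurable borel ==> \<forall>s\<in>{0..L}. \<bar>g s\<bar> <= C ==>
        (LINT x|torus L. f x * g (x $ i)) = (LINT x|torus L. m (x $ i) * g (x $ i))"
    using m unfolding is_marginal_def by blast+
  have "(LINT x|torus L. m ((x::real^'n) $ i)) = 0"
    using int[of "\<lambda>_. 1" 1] f0 by simp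
  moreover have "(LINT x|torus L. m ((x::real^'n) $ i)) = L ^ (CARD('n) - 1) * integral {0..L} m"
    by (rule torus_integral_coordinate[OF L mm])
  ultimately show ?thesis using mm L by (simp add: profile_def)
qed

lemma marginal_potential:
  fixes f :: "real^'n => real"
  assumes L: "0 < L" and m: "is_marginal L i f m" and k: "profile L k"
  shows "(LINT x|torus L. f x * prim (mean_free L k) (x $ i)) = (LINT x|torus L. m ((x::real^'n) $ i) * prim (mean_free L k) (x $ i))"
proof -
  obtain F B where F: "F \<in> borel_measurable borel" "\<And>s. s \<in> {0..L} ==> F s = prim (mean_free L k) s" "\<forall>s\<in>{0..L}. \<bar>F s\<bar> <= B"
    using potential_borel[OF k L] by blast
  have "(LINT x|torus L. h x * prim (mean_free L k) (x $ i)) = (LINT x|torus L. h x * F (x $ i))" for h :: "real^'n => real"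
    by (rule Bochner_Integration.integral_cong) (simp_all add: F(2)[OF cube_coordinate])
  moreover have "(LINT x|torus L. f x * F (x $ i)) = (LINT x|torus L. m (x $ i) * F (x $ i))"
    using m F(1,3) unfolding is_marginal_def by blast
  ultimately show ?thesis by simp
qed

text \<open>Testing the equation for the potential of \<open>f\<close> with the second primitive of
  \<open>m\<close> shows that \<open>w\<close> is tested by the \<open>i\<close>-th component of the gradient
  exactly as by itself; hence \<open>w\<close> is an orthogonal projection of that component.\<close>

theorem Hm1_norm_ge_marginal:
  fixes f :: "real^'n => real"
  assumes L: "0 < L" and f: "f \<in> L2 (torus L)" and f0: "(LINT x|torus L. f x) = 0" and m: "is_marginal L i f m"
  shows "(LINT x|torus L. (mean_free L m ((x::real^'n) $ i))\<^sup>2) <= (Hm1_norm L f)\<^sup>2"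
proof -
  have pm: "profile L m" by (rule marginal_profile[OF L m f0])
  obtain \<phi> G where s: "H1_solution L f \<phi> G" using H1_solution_exists[OF L f f0] by blast
  have \<phi>: "\<phi> \<in> L2 (torus L)" and G: "G \<in> L2 (torus L)" and wl: "weak_laplacian L \<phi> f" and wg: "weak_gradient L \<phi> G"
    using s by (auto simp: H1_solution_def)
  obtain p q r N B where a: "approximates L p q r N B m" using approximates_exists[OF L pm] by blast
  have sm: "(\<lambda>x::real^'n. f (x $ i)) \<in> torus_smooth L" if "f \<in> trig L" for f by (rule trig_lift_smooth[OF that L])
  have Gi: "(\<lambda>x. G x $ i) \<in> L2 (torus L)" by (rule L2_vec_component[OF G])
  have eq: "(LINT x|torus L. f x * p n (x $ i)) = - (LINT x|torus L. G x $ i * q n (x $ i))" for n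
  proof -
    have "(LINT x|torus L. \<phi> x * r n (x $ i)) = (LINT x|torus L. f x * p n (x $ i))"
      using wl[unfolded weak_laplacian_def, rule_format, OF sm[OF approximatesD(3)[OF a, of n]]]
      unfolding laplacian_lift[OF approximatesD(6)[OF a] approximatesD(7)[OF a]] .
    moreover have "(LINT x|torus L. \<phi> x * r n (x $ i)) = - (LINT x|torus L. G x $ i * q n (x $ i))"
      using wg[unfolded weak_gradient_def, rule_format, OF sm[OF approximatesD(4)[OF a, of n]], of i]
      unfolding partial_lift[OF approximatesD(7)[OF a]] by simp
    ultimately show ?thesis by simp
  qed
  have fint: "integrable (torus L) f" by (rule torus_L2_integrable[OF L f])
  have Gint: "integrable (torus L) (\<lambda>x. G x $ i)" by (rule torus_L2_integrable[OF L Gi])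
  have "(LINT x|torus L. f x * prim (mean_free L m) (x $ i)) = - (LINT x|torus L. G x $ i * mean_free L m (x $ i))"
  proof (rule LIMSEQ_unique[OF potential_limit(1)[OF L pm a fint]])
    show "(\<lambda>n. LINT x|torus L. f x * p n (x $ i)) \<longlonglongrightarrow> - (LINT x|torus L. G x $ i * mean_free L m (x $ i))"
      unfolding eq by (intro tendsto_minus potential_limit(2)[OF L pm a Gint])
  qed
  moreover have "(LINT x|torus L. f x * prim (mean_free L m) (x $ i)) = - (LINT x|torus L. (mean_free L m ((x::real^'n) $ i))\<^sup>2)"
    unfolding marginal_potential[OF L m pm] potential_parts[OF L pm pm] power2_eq_square ..
  ultimately have e: "(LINT x|torus L. (mean_free L m ((x::real^'n) $ i))\<^sup>2) = (LINT x|torus L. G x $ i * mean_free L m (x $ i))" by simp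
  define A where "A = (LINT x|torus L. (mean_free L m ((x::real^'n) $ i))\<^sup>2)"
  have A0: "0 <= A" unfolding A_def by simp
  have "A\<^sup>2 <= (LINT x|torus L. (G x $ i)\<^sup>2) * A"
    using cauchy_schwarz_integral[OF Gi potential_lift_L2(1)[OF L pm, of i]] unfolding e[symmetric] A_def .
  then have "A <= (LINT x|torus L. (G x $ i)\<^sup>2)"
    using A0 by (cases "A = 0") (auto simp: power2_eq_square)
  also have "\<dots> <= (LINT x|torus L. (norm (G x))\<^sup>2)"
  proof (rule integral_mono)
    show "integrable (torus L) (\<lambda>x. (G x $ i)\<^sup>2)" using Gi by (simp add: L2_real_iff)
    show "integrable (torus L) (\<lambda>x. (norm (G x))\<^sup>2)" using G by (simp add: L2_def)
    show "(G x $ i)\<^sup>2 <= (norm (G x))\<^sup>2" for x using component_le_norm_cart[of "G x" i] by (simp add: abs_le_square_iff[symmetric])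
  qed
  also have "\<dots> = (Hm1_norm L f)\<^sup>2" unfolding Hm1_norm_eq[OF L s] L2_norm_def by simp
  finally show ?thesis unfolding A_def .
qed

text \<open>The second primitive of \<open>m\<close>, as a function of \<open>x\<^sub>i\<close>, solves the
  Laplace equation, and its gradient is \<open>w(x\<^sub>i)\<close> in direction \<open>i\<close>.\<close>

theorem Hm1_norm_one_variable:
  fixes f :: "real^'n => real"
  assumes L: "0 < L" and m: "profile L m" and eq: "AE x in torus L. f x = m (x $ i)" and fm: "f \<in> borel_measurable (torus L)"
  shows "(Hm1_norm L f)\<^sup>2 = (LINT x|torus L. (mean_free L m ((x::real^'n) $ i))\<^sup>2)"
proof -
  obtain p q r N B where a: "approximates L p q r N B m" using approximates_exists[OF L m] by blast
  have sm: "(\<lambda>x::real^'n. f (x $ i)) \<in> torus_smooth L" if "f \<in> trig L" for f by (rule trig_lift_smooth[OF that L])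
  define G where "G = (\<lambda>x::real^'n. axis i (mean_free L m (x $ i)))"
  define \<phi> where "\<phi> = (\<lambda>x::real^'n. prim (mean_free L m) (x $ i))"
  have Gj: "G x $ j = (if j = i then mean_free L m (x $ i) else 0)" for x j unfolding G_def by (simp add: axis_def)
  have GL: "G \<in> L2 (torus L)"
  proof (rule L2_vecI)
    fix j show "(\<lambda>x. G x $ j) \<in> L2 (torus L)"
      by (cases "j = i") (auto simp: Gj potential_lift_L2[OF L m] intro: torus_L2_continuous[OF L])
  qed
  have int: "integrable (torus L) \<psi>" if "\<psi> \<in> torus_smooth L" for \<psi> :: "real^'n => real"
    by (rule torus_L2_integrable[OF L torus_L2_smooth[OF L that]])
  have grad: "(LINT x|torus L. \<phi> x * partial j \<psi> x) = - (LINT x|torus L. G x $ j * \<psi> x)" if \<psi>: "\<psi> \<in> torus_smooth L" for \<psi> j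
  proof (rule LIMSEQ_unique)
    show "(\<lambda>n. LINT x|torus L. partial j \<psi> x * p n (x $ i)) \<longlonglongrightarrow> (LINT x|torus L. \<phi> x * partial j \<psi> x)"
      using potential_limit(1)[OF L m a int[OF torus_smooth_partial[OF \<psi>]]] by (simp add: \<phi>_def mult.commute)
    have ibp: "(LINT x|torus L. partial j \<psi> x * p n (x $ i)) = - (LINT x|torus L. \<psi> x * (if j = i then q n (x $ i) else 0))" for n
      using torus_integration_by_parts[OF L \<psi> sm[OF approximatesD(3)[OF a, of n]], of j]
      unfolding partial_lift_fun[OF approximatesD(6)[OF a]] by simp
    show "(\<lambda>n. LINT x|torus L. partial j \<psi> x * p n (x $ i)) \<longlonglongrightarrow> - (LINT x|torus L. G x $ j * \<psi> x)"
      unfolding ibp Gj using potential_limit(2)[OF L m a int[OF \<psi>]] by (cases "j = i") (auto intro!: tendsto_minus simp: mult.commute)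
  qed
  have lap: "(LINT x|torus L. \<phi> x * laplacian \<psi> x) = (LINT x|torus L. f x * \<psi> x)" if \<psi>: "\<psi> \<in> torus_smooth L" for \<psi>
  proof -
    have \<phi>L: "\<phi> \<in> L2 (torus L)" unfolding \<phi>_def by (rule potential_lift_L2(3)[OF L m])
    have "(LINT x|torus L. \<phi> x * laplacian \<psi> x) = (\<Sum>j\<in>UNIV. LINT x|torus L. \<phi> x * partial j (partial j \<psi>) x)"
      unfolding laplacian_def sum_distrib_left
      by (rule Bochner_Integration.integral_sum) (intro L2_mult_integrable \<phi>L torus_L2_smooth[OF L] torus_smooth_partial \<psi>)
    also have "\<dots> = (\<Sum>j\<in>UNIV. if j = i then - (LINT x|torus L. mean_free L m (x $ i) * partial i \<psi> x) else 0)"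
      unfolding grad[OF torus_smooth_partial[OF \<psi>]] Gj by (rule sum.cong) auto
    also have "\<dots> = - (LINT x|torus L. mean_free L m (x $ i) * partial i \<psi> x)" by simp
    also have "\<dots> = (LINT x|torus L. \<psi> x * m (x $ i))"
    proof (rule LIMSEQ_unique)
      show "(\<lambda>n. - (LINT x|torus L. partial i \<psi> x * q n (x $ i))) \<longlonglongrightarrow> - (LINT x|torus L. mean_free L m (x $ i) * partial i \<psi> x)"
        using tendsto_minus[OF potential_limit(2)[OF L m a int[OF torus_smooth_partial[OF \<psi>]]]] by (simp add: mult.commute)
      have ibp: "- (LINT x|torus L. partial i \<psi> x * q n (x $ i)) = (LINT x|torus L. \<psi> x * r n (x $ i))" for n
        using torus_integration_by_parts[OF L \<psi> sm[OF approximatesD(4)[OF a, of n]], of i]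
        unfolding partial_lift_fun[OF approximatesD(7)[OF a]] by simp
      show "(\<lambda>n. - (LINT x|torus L. partial i \<psi> x * q n (x $ i))) \<longlonglongrightarrow> (LINT x|torus L. \<psi> x * m (x $ i))"
        unfolding ibp by (rule potential_limit(3)[OF L m a int[OF \<psi>]])
    qed
    also have "\<dots> = (LINT x|torus L. f x * \<psi> x)"
    proof (rule integral_cong_AE)
      have [measurable]: "\<psi> \<in> borel_measurable (torus L)" using int[OF \<psi>] by measurable
      show "(\<lambda>x. f x * \<psi> x) \<in> borel_measurable (torus L)" using fm by measurable
      show "(\<lambda>x. \<psi> x * m (x $ i)) \<in> borel_measurable (torus L)"
        using torus_lift_measurable[OF profile_borel(1)[OF m], of i L] by measurable
      show "AE x in torus L. \<psi> x * m (x $ i) = f x * \<psi> x" using eq by eventually_elim simp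
    qed
    finally show ?thesis .
  qed
  have sol: "H1_solution L f \<phi> G"
    using GL potential_lift_L2(3)[OF L m, of i] grad lap
    unfolding H1_solution_def weak_laplacian_def weak_gradient_def \<phi>_def by auto
  have nG: "(norm (G x))\<^sup>2 = (mean_free L m (x $ i))\<^sup>2" for x
    unfolding G_def power2_norm_eq_inner inner_axis_axis by (simp add: power2_eq_square)
  show ?thesis unfolding Hm1_norm_eq[OF L sol] L2_norm_def nG by simp
qed

section \<open>Lebesgue measurable functions of time and space\<close>

lemma AE_lebesgue_on_iff:
  fixes S :: "'a::euclidean_space set"
  assumes "S \<in> sets lebesgue"
  shows "(AE x in lebesgue_on S. P x) \<longleftrightarrow> (AE x in lborel. x \<in> S \<longrightarrow> P x)"
  using assms by (subst AE_restrict_space_iff) (auto simp: AE_completion_iff)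

lemma lebesgue_on_borel_representative:
  fixes f :: "'a::euclidean_space => real"
  assumes S: "S \<in> sets lebesgue" and f: "f \<in> borel_measurable (lebesgue_on S)"
  shows "\<exists>f'. f' \<in> borel_measurable borel \<and> (AE x in lebesgue_on S. f x = f' x)"
proof -
  have "(\<lambda>x. if x \<in> S then f x else 0) \<in> borel_measurable lebesgue"
    using borel_measurable_if[OF S] f by blast
  from completion_ex_borel_measurable_real[OF this] obtain f' where f': "f' \<in> borel_measurable lborel"
    "AE x in lborel. (if x \<in> S then f x else 0) = f' x" by blast
  from f'(2) have "AE x in lborel. x \<in> S \<longrightarrow> f x = f' x" by eventually_elim auto
  then show ?thesis using f'(1) S by (auto simp: AE_lebesgue_on_iff)
qed

lemma complete_lebesgue_on:
  fixes S :: "'a::euclidean_space set"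
  assumes S: "S \<in> sets lebesgue"
  shows "complete_measure (lebesgue_on S)"
proof
  fix A B assume A: "B \<subseteq> A" "A \<in> null_sets (lebesgue_on S)"
  then have "A \<in> null_sets lebesgue" using S null_sets_restrict_space[OF S] by auto
  then have "B \<in> null_sets lebesgue" by (rule completion.complete2[OF A(1)])
  moreover have "B \<subseteq> S" using A null_setsD2[OF A(2)] sets.sets_into_space[of A "lebesgue_on S"] by auto
  ultimately show "B \<in> sets (lebesgue_on S)" using S by (auto simp: sets_restrict_space_iff)
qed

text \<open>Lebesgue measure restricted to a measurable set is complete, so changing a function on a null set
  preserves measurability. The inner integrals of the weak formulation are identified only for almost every
  time.\<close>

lemma lebesgue_on_measurable_AE:
  fixes f g :: "'a::euclidean_space => real"
  assumes S: "S \<in> sets lebesgue" and g: "g \<in> borel_measurable (lebesgue_on S)" and eq: "AE x in lebesgue_on S. f x = g x"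
  shows "f \<in> borel_measurable (lebesgue_on S)"
proof (rule measurableI)
  interpret complete_measure "lebesgue_on S" by (rule complete_lebesgue_on[OF S])
  fix A :: "real set" assume A: "A \<in> sets borel"
  show "f -` A \<inter> space (lebesgue_on S) \<in> sets (lebesgue_on S)"
  proof (rule in_sets_AE)
    show "AE x in lebesgue_on S. (x \<in> g -` A \<inter> space (lebesgue_on S)) = (x \<in> f -` A \<inter> space (lebesgue_on S))"
      using eq by eventually_elim simp
    show "g -` A \<inter> space (lebesgue_on S) \<in> sets (lebesgue_on S)" by (rule measurable_sets[OF g A])
  qed auto
qed simp

lemma AE_torus_iff: "(AE x in torus L. P x) \<longleftrightarrow> (AE x in btorus L. P x)"
  unfolding torus_def btorus_def
  by (subst AE_density) (auto simp: AE_lebesgue_on_iff split: split_indicator)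

lemma slab_borel: "{0<..<T::real} \<times> (cube L :: (real^'n) set) \<in> sets borel"
proof -
  have "{0<..<T::real} \<times> (cube L :: (real^'n) set) \<in> sets (borel \<Otimes>\<^sub>M borel)" by (intro pair_measureI) auto
  then show ?thesis unfolding borel_prod .
qed

lemma slab_lebesgue: "{0<..<T::real} \<times> (cube L :: (real^'n) set) \<in> sets lebesgue"
  using slab_borel[of T L] by (metis sets_completionI_sets sets_lborel)

lemma interval_lebesgue: "{0<..<T::real} \<in> sets lebesgue" by simp

text \<open>Fubini for null sets, applied to the uncompleted product measure.\<close>

lemma AE_time_slices:
  assumes "AE p in (time_torus T L :: (real \<times> (real^'n)) measure). P p"
  shows "AE t in lebesgue_on {0<..<T}. AE x in torus L. P (t, x)"
proof -
  have "AE p in lborel \<Otimes>\<^sub>M (lborel :: (real^'n) measure). p \<in> {0<..<T} \<times> cube L \<longrightarrow> P p"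
    using assms unfolding time_torus_def AE_lebesgue_on_iff[OF slab_lebesgue] lborel_prod .
  from lborel_pair.AE_pair[OF this] have "AE t in lborel. t \<in> {0<..<T} \<longrightarrow> (AE x in lborel. x \<in> (cube L :: (real^'n) set) \<longrightarrow> P (t, x))"
    by eventually_elim (auto elim: eventually_mono)
  then show ?thesis unfolding torus_def by (simp add: AE_lebesgue_on_iff)
qed

text \<open>A Borel representative has measurable slices and measurable slice integrals, and it agrees with
  \<open>u\<close> on almost every slice.\<close>

lemma time_slice_measurable:
  fixes u :: "real => real^'n => real"
  assumes u: "(\<lambda>(t, x). u t x) \<in> borel_measurable (time_torus T L)"
  shows "AE t in lebesgue_on {0<..<T}. u t \<in> borel_measurable (torus L)"
    "(\<lambda>t. LINT x|torus L. u t x) \<in> borel_measurable (lebesgue_on {0<..<T})"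
proof -
  obtain u' where u': "u' \<in> borel_measurable borel" "AE p in time_torus T L. (case p of (t, x) => u t x) = u' p"
    using lebesgue_on_borel_representative[OF slab_lebesgue u[unfolded time_torus_def]] unfolding time_torus_def by blast
  have ae: "AE t in lebesgue_on {0<..<T}. AE x in torus L. u t x = u' (t, x)"
    using AE_time_slices[OF u'(2)] by simp
  have u'm [measurable]: "u' \<in> borel_measurable (borel \<Otimes>\<^sub>M borel)" using u'(1) by (simp add: borel_prod)
  have sl: "(\<lambda>x. u' (t, x)) \<in> borel_measurable (torus L)" for t by (rule torus_measurableI) measurable
  show "AE t in lebesgue_on {0<..<T}. u t \<in> borel_measurable (torus L)"
    using ae
  proof eventually_elim
    case (elim t)
    then show ?case using sl[of t] unfolding torus_def
        by (rule lebesgue_on_measurable_AE[OF cube_lebesgue, rotated, of _ "\<lambda>x. u' (t, x)"])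
  qed
  have K: "(\<lambda>t. LINT x|lborel. indicator (cube L) x * u' (t, x)) \<in> borel_measurable borel"
    by (rule lborel.borel_measurable_lebesgue_integral) (simp add: split_def)
  have eqK: "(LINT x|torus L. u' (t, x)) = (LINT x|lborel. indicator (cube L) x * u' (t, x))" for t
  proof -
    have m: "(\<lambda>x. u' (t, x)) \<in> borel_measurable borel" by measurable
    have b: "btorus L = density lborel (\<lambda>x::real^'n. ennreal (indicator (cube L) x))"
      by (simp add: btorus_def ennreal_indicator)
    show ?thesis unfolding torus_integral_borel(1)[OF m] b
      by (subst integral_density) (use m in auto)
  qed
  show "(\<lambda>t. LINT x|torus L. u t x) \<in> borel_measurable (lebesgue_on {0<..<T})"
  proof (rule lebesgue_on_measurable_AE[OF interval_lebesgue])
    show "(\<lambda>t. LINT x|lborel. indicator (cube L) x * u' (t, x)) \<in> borel_measurable (lebesgue_on {0<..<T})"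
      by (rule borel_measurable_lebesgue_onI[OF K])
    show "AE t in lebesgue_on {0<..<T}. (LINT x|torus L. u t x) = (LINT x|lborel. indicator (cube L) x * u' (t, x))"
      using ae
    proof eventually_elim
      case (elim t)
      have "u t \<in> borel_measurable (torus L)"
        using elim sl[of t] unfolding torus_def
        by (rule lebesgue_on_measurable_AE[OF cube_lebesgue, rotated, of _ "\<lambda>x. u' (t, x)"])
      then have "(LINT x|torus L. u t x) = (LINT x|torus L. u' (t, x))" by (intro integral_cong_AE sl elim)
      then show ?case by (simp add: eqK)
    qed
  qed
qed

lemma lift_time_measurable:
  fixes g :: "real => real"
  assumes "g \<in> borel_measurable borel"
  shows "(\<lambda>(t, x::real^'n). g (x $ i)) \<in> borel_measurable (time_torus T L)"
proof -
  have [measurable]: "g \<in> borel_measurable borel" by fact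
  have "(\<lambda>p::real \<times> (real^'n). g (snd p $ i)) \<in> borel_measurable (borel \<Otimes>\<^sub>M borel)" by measurable
  then show ?thesis unfolding time_torus_def split_def by (intro borel_measurable_lebesgue_onI) (simp add: borel_prod)
qed

lemma finite_measure_interval: "finite_measure (lebesgue_on {0<..<T::real})"
  by (rule finite_measureI, cases "0 <= T") (auto simp: emeasure_restrict_space)

text \<open>The initial segments are stable under intersection and generate the Borel sets, so all integrals
  over Borel sets vanish.\<close>

lemma AE_zero_if_initial_integrals_zero:
  fixes f :: "real => real"
  assumes f: "integrable (lebesgue_on {0<..<T}) f"
    and z: "\<And>\<tau>. (LINT t|lebesgue_on {0<..<T}. indicator {..<\<tau>} t * f t) = 0"
  shows "AE t in lebesgue_on {0<..<T}. f t = 0"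
proof -
  let ?M = "lebesgue_on {0<..<T}"
  have fm: "f \<in> borel_measurable ?M" using f by measurable
  obtain g where g [measurable]: "g \<in> borel_measurable borel" and fg: "AE t in ?M. f t = g t"
    using lebesgue_on_borel_representative[OF interval_lebesgue fm] by blast
  have gm [measurable]: "g \<in> borel_measurable ?M" by (rule borel_measurable_lebesgue_onI[OF g])
  define G where "G = (\<lambda>t. indicator {0<..<T} t *\<^sub>R g t)"
  have Gm [measurable]: "G \<in> borel_measurable borel" unfolding G_def by measurable
  have "integrable ?M g" using f fg by (subst integrable_cong_AE[OF gm fm]) auto
  then have Gi: "integrable lborel G"
    unfolding G_def by (subst (asm) integrable_restrict_space) (auto simp: integrable_completion)
  have eq: "(LINT t:A|lborel. G t) = (LINT t|?M. indicator A t * f t)" if [measurable]: "A \<in> sets borel" for A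
  proof -
    have Am: "(indicator A :: real => real) \<in> borel_measurable ?M" by (rule borel_measurable_lebesgue_onI) measurable
    have "(LINT t|?M. indicator A t * f t) = (LINT t|?M. indicator A t * g t)"
      by (rule integral_cong_AE) (use Am fm fg in \<open>auto elim!: eventually_mono\<close>)
    also have "\<dots> = (LINT t|lebesgue. indicator {0<..<T} t *\<^sub>R (indicator A t * g t))"
      by (rule integral_restrict_space) simp
    also have "\<dots> = (LINT t|lborel. indicator {0<..<T} t *\<^sub>R (indicator A t * g t))"
      by (rule integral_completion) simp
    finally show ?thesis by (simp add: set_lebesgue_integral_def G_def mult.left_commute)
  qed
  have "AE t in lborel. G t = 0"
  proof (rule density_unique_real[OF Gi])
    fix A :: "real set" assume "A \<in> sets lborel"
    then have A: "A \<in> sigma_sets UNIV (range lessThan)" by (simp add: borel_Iio)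
    have "{..<a} \<inter> {..<b} = {..<min a b}" for a b :: real by auto
    then have "Int_stable (range lessThan :: real set set)" by (auto simp: Int_stable_def)
    moreover have "range lessThan \<subseteq> Pow (UNIV :: real set)" by simp
    ultimately have "(LINT t:A|lborel. G t) = 0" using A
    proof (induction rule: sigma_sets_induct_disjoint)
      case (basic A)
      then show ?case using z by (auto simp: eq)
    next
      case (compl A)
      have [measurable]: "A \<in> sets borel" using compl(1) by (simp add: borel_Iio)
      have i: "integrable lborel (\<lambda>t. indicator A t *\<^sub>R G t)" by (rule integrable_mult_indicator[OF _ Gi]) simp
      have "(LINT t:UNIV - A|lborel. G t) = (LINT t|lborel. G t - indicator A t *\<^sub>R G t)"
        unfolding set_lebesgue_integral_def by (rule Bochner_Integration.integral_cong) (auto simp: indicator_def)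
      also have "\<dots> = (LINT t|lborel. G t) - (LINT t:A|lborel. G t)"
        unfolding set_lebesgue_integral_def by (rule Bochner_Integration.integral_diff[OF Gi i])
      finally have "(LINT t:UNIV - A|lborel. G t) = (LINT t|lborel. G t) - (LINT t:A|lborel. G t)" .
      moreover have "(LINT t|lborel. G t) = (LINT t:{..<T}|lborel. G t)"
        unfolding set_lebesgue_integral_def by (rule Bochner_Integration.integral_cong) (auto simp: G_def indicator_def)
      ultimately show ?case using compl(2) z by (simp add: eq)
    next
      case (union A)
      have A: "A i \<in> sets lborel" for i using union(2) by (auto simp: borel_Iio)
      have "set_integrable lborel (\<Union>i. A i) G"
        unfolding set_integrable_def by (rule integrable_mult_indicator[OF _ Gi]) (use A in auto)
      from lebesgue_integral_countable_add[OF A _ this] union(1,3) show ?case by (simp add: disjoint_family_on_def)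
    qed (auto simp: set_lebesgue_integral_def)
    then show "(LINT t:A|lborel. G t) = (LINT t:A|lborel. 0)" by (simp add: set_lebesgue_integral_def)
  qed simp
  then have "AE t in ?M. g t = 0" unfolding AE_lebesgue_on_iff[OF interval_lebesgue] by eventually_elim (auto simp: G_def)
  with fg show ?thesis by eventually_elim simp
qed

subsection \<open>Functions of a single variable\<close>

text \<open>If translation in direction \<open>j\<close> leaves \<open>h\<close> fixed and reverses the sign
  of \<open>\<phi>\<close>, the integral equals its own negative. The function \<open>\<gamma>\<close> may
  fail to be measurable, so the invariance is transported as an almost everywhere statement.\<close>

lemma one_variable_orthogonal:
  fixes h \<phi> :: "real^'n => real"
  assumes hm [measurable]: "h \<in> borel_measurable borel" and h: "AE x in btorus L. h x = \<gamma> (x $ i)"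
    and \<phi>m [measurable]: "\<phi> \<in> borel_measurable borel" and d: "0 <= d" "d < L" and ij: "j \<noteq> i"
    and \<phi>: "\<And>x. \<phi> (wrap L j d x) = - \<phi> x"
  shows "(LINT x|btorus L. h x * \<phi> x) = 0"
proof -
  let ?S = "wrap L j d :: real^'n => real^'n"
  have S: "?S \<in> measurable (btorus L) borel" using wrap_borel by (simp add: measurable_cong_sets[OF sets_btorus refl])
  have Si: "?S x $ i = x $ i" for x using ij by (simp add: wrap_def axis_def)
  have "AE x in distr (btorus L) borel ?S. h x = \<gamma> (x $ i)" unfolding distr_wrap[OF d] by (rule h)
  then have "AE x in btorus L. h (?S x) = \<gamma> (?S x $ i)"
    by (rule AE_distrD[OF S])
  with h have ae: "AE x in btorus L. h (?S x) = h x" by eventually_elim (simp add: Si)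
  have "(LINT x|btorus L. h x * \<phi> x) = (LINT x|distr (btorus L) borel ?S. h x * \<phi> x)" by (simp add: distr_wrap[OF d])
  also have "\<dots> = (LINT x|btorus L. h (?S x) * \<phi> (?S x))" by (rule integral_distr[OF S]) measurable
  also have "\<dots> = (LINT x|btorus L. - (h x * \<phi> x))"
  proof (rule integral_cong_AE)
    show "AE x in btorus L. h (?S x) * \<phi> (?S x) = - (h x * \<phi> x)" using ae by eventually_elim (simp add: \<phi>)
    show "(\<lambda>x. h (?S x) * \<phi> (?S x)) \<in> borel_measurable (btorus L)"
      using measurable_compose[OF S hm] measurable_compose[OF S \<phi>m] by measurable
  qed measurable
  finally show ?thesis by simp
qed

text \<open>The difference \<open>f - m(x\<^sub>i)\<close> depends only on \<open>x\<^sub>i\<close>. It is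
  orthogonal to waves in direction \<open>i\<close> by the definition of the marginal, and to all others
  because half a period in another direction reverses their sign.\<close>

theorem one_variable_marginal:
  fixes f :: "real^'n => real"
  assumes L: "0 < L" and fm: "f \<in> borel_measurable (torus L)" and f1: "AE x in torus L. \<bar>f x\<bar> <= 1"
    and fg: "AE x in torus L. f x = g (x $ i)" and m: "is_marginal L i f m"
  shows "AE x in torus L. f x = m (x $ i)"
proof -
  have mm: "m \<in> borel_measurable borel" "\<And>s. \<bar>m s\<bar> <= 1"
    and int: "\<And>g C. g \<in> borel_measurable borel ==> \<forall>s\<in>{0..L}. \<bar>g s\<bar> <= C ==>
        (LINT x|torus L. f x * g (x $ i)) = (LINT x|torus L. m (x $ i) * g (x $ i))"
    using m unfolding is_marginal_def by blast+
  have mlift: "(\<lambda>x::real^'n. m (x $ i)) \<in> borel_measurable (torus L)" by (rule torus_lift_measurable[OF mm(1)])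
  define h where "h = (\<lambda>x. f x - m (x $ i))"
  have hm: "h \<in> borel_measurable (torus L)" unfolding h_def using fm mlift by measurable
  have fi: "integrable (torus L) f" by (rule torus_integrable_bounded[OF L fm f1])
  have mi: "integrable (torus L) (\<lambda>x::real^'n. m (x $ i))" by (rule torus_lift_L2(2)[OF L mm])
  have hi: "integrable (torus L) h" unfolding h_def using fi mi by simp
  obtain h' where h' [measurable]: "h' \<in> borel_measurable borel" and hh: "AE x in torus L. h x = h' x"
    using lebesgue_on_borel_representative[OF cube_lebesgue hm[unfolded torus_def]] unfolding torus_def by blast
  have h'g: "AE x in btorus L. h' x = g (x $ i) - m (x $ i)"
    unfolding AE_torus_iff[symmetric] using hh fg by eventually_elim (simp add: h_def)
  have tr: "(LINT x|torus L. h x * \<phi> x) = (LINT x|btorus L. h' x * \<phi> x)" if [measurable]: "\<phi> \<in> borel_measurable borel" for \<phi>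
  proof -
    have "(LINT x|torus L. h x * \<phi> x) = (LINT x|torus L. h' x * \<phi> x)"
    proof (rule integral_cong_AE)
      show "AE x in torus L. h x * \<phi> x = h' x * \<phi> x" using hh by eventually_elim simp
      show "(\<lambda>x. h x * \<phi> x) \<in> borel_measurable (torus L)" using hm torus_measurableI[OF that] by measurable
      show "(\<lambda>x. h' x * \<phi> x) \<in> borel_measurable (torus L)" by (rule torus_measurableI) measurable
    qed
    also have "\<dots> = (LINT x|btorus L. h' x * \<phi> x)" by (rule torus_integral_borel(1)) measurable
    finally show ?thesis .
  qed
  have wave: "(LINT x|torus L. h x * \<theta> (\<kappa> \<bullet> x)) = 0"
    if \<kappa>: "\<kappa> \<in> lattice L" and \<theta>m [measurable]: "\<theta> \<in> borel_measurable borel" and \<theta>1: "\<And>s. \<bar>\<theta> s\<bar> <= 1"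
      and anti: "\<And>s. \<theta> (s + pi) = - \<theta> s" "\<And>s. \<theta> (s - pi) = - \<theta> s"
      and per: "torus_periodic L (\<lambda>x. \<theta> (\<kappa> \<bullet> x))" for \<kappa> and \<theta> :: "real => real"
  proof (cases "\<exists>j. j \<noteq> i \<and> \<kappa> $ j \<noteq> 0")
    case False
    then have "\<kappa> = axis i (\<kappa> $ i)" by (auto simp: vec_eq_iff axis_def)
    then have e: "\<kappa> \<bullet> x = \<kappa> $ i * x $ i" for x by (metis inner_axis' inner_real_def)
    have "(\<lambda>s. \<theta> (\<kappa> $ i * s)) \<in> borel_measurable borel" by measurable
    from int[OF this, of 1] have i: "(LINT x|torus L. f x * \<theta> (\<kappa> $ i * x $ i)) = (LINT x|torus L. m (x $ i) * \<theta> (\<kappa> $ i * x $ i))"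
      using \<theta>1 by simp
    have [measurable]: "(\<lambda>x::real^'n. \<theta> (\<kappa> $ i * x $ i)) \<in> borel_measurable (torus L)" by (rule torus_measurableI) measurable
    have bi: "integrable (torus L) (\<lambda>x. k x * \<theta> (\<kappa> $ i * x $ i))" if "integrable (torus L) k" for k
      by (rule integrable_mult_bounded[OF that, of _ 1]) (use \<theta>1 in auto)
    show ?thesis unfolding e h_def left_diff_distrib
      by (subst Bochner_Integration.integral_diff[OF bi[OF fi] bi[OF mi]]) (simp add: i)
  next
    case True
    then obtain j where j: "j \<noteq> i" "\<kappa> $ j \<noteq> 0" by blast
    have "axis j (1::real) \<in> Basis" by simp
    then have "\<exists>k::int. \<kappa> \<bullet> axis j 1 = 2 * pi * k / L" using \<kappa> unfolding lattice_def by blast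
    then obtain k :: int where k: "\<kappa> $ j = 2 * pi * k / L" by (auto simp: inner_axis)
    have k1: "1 <= \<bar>k\<bar>" using j(2) k by auto
    \<comment> \<open>half a period of the wave in direction \<open>j\<close>\<close>
    define d where "d = L / (2 * \<bar>real_of_int k\<bar>)"
    have kr: "1 <= \<bar>real_of_int k\<bar>" using k1 by linarith
    have d: "0 <= d" "d < L" using L kr mult_left_mono[OF kr, of L] by (auto simp: d_def divide_less_eq)
    have "\<kappa> $ j * d = pi \<or> \<kappa> $ j * d = - pi"
      using L kr by (auto simp: k d_def field_simps abs_if split: if_splits)
    then have an: "\<theta> (\<kappa> \<bullet> (x + axis j d)) = - \<theta> (\<kappa> \<bullet> x)" for x
      using anti[of "\<kappa> \<bullet> x"] by (auto simp: inner_add_right inner_axis)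
    have "(LINT x|btorus L. h' x * \<theta> (\<kappa> \<bullet> x)) = 0"
    proof (rule one_variable_orthogonal[OF h' h'g _ d j(1)])
      show "\<theta> (\<kappa> \<bullet> wrap L j d x) = - \<theta> (\<kappa> \<bullet> x)" for x using wrap_periodic[OF per, of j d x] an by simp
    qed measurable
    then show ?thesis by (subst tr) auto
  qed
  have "AE x in torus L. h x = 0"
  proof (rule trig_orthogonal_imp_zero[OF L hi])
    fix q :: "real^'n => real" assume "q \<in> trig L"
    then show "(LINT x|torus L. h x * q x) = 0"
    proof induction
      case (trig_cos \<kappa>)
      show ?case by (rule wave[OF trig_cos]) (auto intro: trig_basis_periodic[OF trig.trig_cos[OF trig_cos] L])
    next
      case (trig_sin \<kappa>)
      show ?case by (rule wave[OF trig_sin]) (auto intro: trig_basis_periodic[OF trig.trig_sin[OF trig_sin] L])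
    next
      case (trig_add p q)
      have i: "integrable (torus L) (\<lambda>x. h x * p x)" if p: "p \<in> trig L" for p :: "real^'n => real"
      proof -
        obtain C where C: "\<And>x. \<bar>p x\<bar> <= C" using trig_bounded[OF p] by blast
        have [measurable]: "p \<in> borel_measurable (torus L)" by (rule torus_measurableI[OF trig_borel[OF p]])
        show ?thesis by (rule integrable_mult_bounded[OF hi, of _ C]) (use C in auto)
      qed
      show ?case unfolding distrib_left
        by (subst Bochner_Integration.integral_add[OF i[OF trig_add(1)] i[OF trig_add(2)]]) (simp add: trig_add)
    next
      case (trig_cmult q c)
      have "(LINT x|torus L. h x * (c * q x)) = c * (LINT x|torus L. h x * q x)" by (simp add: mult.left_commute)
      then show ?case using trig_cmult by simp
    qed
  qed
  then show ?thesis by eventually_elim (simp add: h_def)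
qed

section \<open>Consequences of the weak formulation\<close>

lemma continuous_integrable_interval:
  fixes f :: "real => real"
  assumes "continuous_on UNIV f"
  shows "integrable (lebesgue_on {0<..<T}) f"
proof -
  interpret finite_measure "lebesgue_on {0<..<T}" by (rule finite_measure_interval)
  have "compact (f ` {0..T})" by (rule compact_continuous_image) (auto intro: continuous_on_subset[OF assms])
  then obtain C where C: "\<And>t. t \<in> {0..T} ==> norm (f t) <= C" using compact_imp_bounded bounded_iff by (metis imageI)
  show ?thesis
    by (rule integrable_const_bound[of _ C]) (use C in \<open>auto intro!: AE_I2 borel_measurable_lebesgue_onI borel_measurable_continuous_onI assms\<close>)
qed

lemma cutoff_continuous: "0 < c ==> continuous_on S (cutoff c \<tau> k)"
  by (intro continuous_at_imp_continuous_on ballI DERIV_isCont[OF cutoff_deriv])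

lemma cutoff_0_range: "0 < c ==> 0 <= cutoff c \<tau> 0 t \<and> cutoff c \<tau> 0 t <= 1"
  by (auto simp: cutoff_def)

lemma cutoff_0_limit: "(\<lambda>n. cutoff (1 / Suc n) \<tau> 0 t) \<longlonglongrightarrow> indicator {..<\<tau>} t"
proof (cases "t < \<tau>")
  case True
  have "(\<lambda>n. exp (- (1 / Suc n) / (\<tau> - t))) \<longlonglongrightarrow> exp (- 0 / (\<tau> - t))"
    by (intro tendsto_intros LIMSEQ_Suc[OF lim_1_over_n, unfolded o_def]) (use True in auto)
  then show ?thesis using True by (simp add: cutoff_def)
qed (simp add: cutoff_def)

lemma cutoff_integral:
  assumes c: "0 < c" and \<tau>: "0 < \<tau>" "\<tau> < T"
  shows "(LINT t|lebesgue_on {0<..<T}. c * cutoff c \<tau> 2 t) = cutoff c \<tau> 0 0"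
proof -
  have d: "((\<lambda>t. - cutoff c \<tau> 0 t) has_real_derivative c * cutoff c \<tau> 2 t) (at t)" for t
    using DERIV_minus[OF cutoff_deriv[OF c, of \<tau> 0 t]] by (simp add: numeral_2_eq_2)
  have "(LINT t|lebesgue_on {0<..<T}. c * cutoff c \<tau> 2 t) = integral {0<..<T} (\<lambda>t. c * cutoff c \<tau> 2 t)"
    by (intro lebesgue_integral_eq_integral continuous_integrable_interval continuous_intros cutoff_continuous[OF c]) simp
  also have "\<dots> = integral {0..T} (\<lambda>t. c * cutoff c \<tau> 2 t)" by (rule integral_open_interval_real[symmetric])
  also have "\<dots> = - cutoff c \<tau> 0 T - - cutoff c \<tau> 0 0"
    by (rule trig_integral_antiderivative[OF d]) (use \<tau> in simp)
  also have "\<dots> = cutoff c \<tau> 0 0" using \<tau> by (simp add: cutoff_def)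
  finally show ?thesis .
qed

lemma cutoff_moment:
  assumes T: "0 < T"
  shows "(\<lambda>n. LINT t|lebesgue_on {0<..<T}. 1 / Suc n * cutoff (1 / Suc n) \<tau> 2 t * max 0 (\<tau> - t)) \<longlonglongrightarrow> 0"
proof -
  interpret finite_measure "lebesgue_on {0<..<T}" by (rule finite_measure_interval)
  have e: "1 / Suc n * cutoff (1 / Suc n) \<tau> 2 t * max 0 (\<tau> - t) = 1 / Suc n / (\<tau> - t) * exp (- (1 / Suc n / (\<tau> - t)))" if "t < \<tau>" for n t
    using that by (simp add: cutoff_def power2_eq_square divide_simps)
  have z: "1 / Suc n * cutoff (1 / Suc n) \<tau> 2 t * max 0 (\<tau> - t) = 0" if "\<not> t < \<tau>" for n t
    using that by (simp add: cutoff_def)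
  have bd: "\<bar>1 / Suc n * cutoff (1 / Suc n) \<tau> 2 t * max 0 (\<tau> - t)\<bar> <= 1" for n t
  proof (cases "t < \<tau>")
    case True
    define y where "y = 1 / Suc n / (\<tau> - t)"
    have y: "0 <= y" using True by (simp add: y_def)
    have "y <= exp y" using exp_ge_add_one_self[of y] by linarith
    then have "y * exp (- y) <= 1" by (simp add: exp_minus field_simps)
    then show ?thesis unfolding e[OF True] y_def[symmetric] using y by simp
  next
    case False
    show ?thesis unfolding z[OF False] by simp
  qed
  have "(\<lambda>n. LINT t|lebesgue_on {0<..<T}. 1 / Suc n * cutoff (1 / Suc n) \<tau> 2 t * max 0 (\<tau> - t)) \<longlonglongrightarrow> (LINT t|lebesgue_on {0<..<T}. 0)"
  proof (rule integral_dominated_convergence[where w = "\<lambda>_. 1"])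
    show "AE t in lebesgue_on {0<..<T}. (\<lambda>n. 1 / Suc n * cutoff (1 / Suc n) \<tau> 2 t * max 0 (\<tau> - t)) \<longlonglongrightarrow> 0"
    proof (rule AE_I2)
      fix t
      show "(\<lambda>n. 1 / Suc n * cutoff (1 / Suc n) \<tau> 2 t * max 0 (\<tau> - t)) \<longlonglongrightarrow> 0"
      proof (cases "t < \<tau>")
        case True
        have "(\<lambda>n. 1 / Suc n / (\<tau> - t) * exp (- (1 / Suc n / (\<tau> - t)))) \<longlonglongrightarrow> 0 / (\<tau> - t) * exp (- (0 / (\<tau> - t)))"
          by (intro tendsto_intros LIMSEQ_Suc[OF lim_1_over_n, unfolded o_def]) (use True in auto)
        then show ?thesis unfolding e[OF True] by simp
      next
        case False
        show ?thesis unfolding z[OF False] by simp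
      qed
    qed
    show "(\<lambda>t. 1 / Suc n * cutoff (1 / Suc n) \<tau> 2 t * max 0 (\<tau> - t)) \<in> borel_measurable (lebesgue_on {0<..<T})" for n
      by (intro borel_measurable_lebesgue_onI borel_measurable_continuous_onI continuous_intros cutoff_continuous) simp
    show "AE t in lebesgue_on {0<..<T}. norm (1 / Suc n * cutoff (1 / Suc n) \<tau> 2 t * max 0 (\<tau> - t)) <= 1" for n
      by (rule AE_I2) (use bd in simp)
  qed auto
  then show ?thesis by simp
qed

text \<open>The weights have total mass tending to one and first moment \<open>\<integral> (\<tau> -
  t)\<close> tending to zero. Continuity of \<open>R\<close> on \<open>[0,\<tau>]\<close> gives \<open>\<bar>R
  t - R \<tau>\<bar> <= \<epsilon> + M (\<tau> - t)\<close>, and the weighted average of the right-hand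
  side tends to \<open>\<epsilon>\<close>.\<close>

theorem cutoff_approximate_identity:
  assumes \<tau>: "0 < \<tau>" "\<tau> < T" and R: "continuous_on {0..\<tau>} R"
    and Rm: "R \<in> borel_measurable (lebesgue_on {0<..<T})" and K: "\<And>t. t \<in> {0<..<T} ==> \<bar>R t\<bar> <= K"
  shows "(\<lambda>n. LINT t|lebesgue_on {0<..<T}. 1 / Suc n * cutoff (1 / Suc n) \<tau> 2 t * R t) \<longlonglongrightarrow> R \<tau>"
proof -
  let ?M = "lebesgue_on {0<..<T}"
  define c where "c = (\<lambda>n. 1 / real (Suc n))"
  define e where "e = (\<lambda>n t. c n * cutoff (c n) \<tau> 2 t)"
  have c: "0 < c n" for n by (simp add: c_def)
  have e0: "0 <= e n t" for n t using c[of n] by (auto simp: e_def cutoff_def)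
  have ez: "e n t = 0" if "\<tau> <= t" for n t using that by (simp add: e_def cutoff_def)
  have ec: "continuous_on UNIV (e n)" for n unfolding e_def by (intro continuous_intros cutoff_continuous[OF c])
  have ei: "integrable ?M (e n)" for n by (rule continuous_integrable_interval[OF ec])
  have mass: "(LINT t|?M. e n t) = cutoff (c n) \<tau> 0 0" for n unfolding e_def by (rule cutoff_integral[OF c \<tau>])
  have mlim: "(\<lambda>n. LINT t|?M. e n t) \<longlonglongrightarrow> 1"
    unfolding mass c_def using cutoff_0_limit[of \<tau> 0] \<tau> by simp
  have mle: "(LINT t|?M. e n t) <= 1" for n unfolding mass using cutoff_0_range[OF c] by blast
  define k where "k = (\<lambda>n t. e n t * max 0 (\<tau> - t))"
  have ki: "integrable ?M (k n)" for n unfolding k_def by (intro continuous_integrable_interval continuous_intros ec)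
  have klim: "(\<lambda>n. LINT t|?M. k n t) \<longlonglongrightarrow> 0"
    unfolding k_def e_def c_def using cutoff_moment[of T \<tau>] \<tau> by simp
  have T: "0 < T" using \<tau> by simp
  have K0: "0 <= K" using K[of "T/2"] T by (auto intro: order_trans[OF abs_ge_zero])
  have eRi: "integrable ?M (\<lambda>t. e n t * R t)" for n
    by (rule integrable_mult_bounded[OF ei Rm, where C = K]) (use K in auto)
  have diff: "(\<lambda>n. (LINT t|?M. e n t * R t) - R \<tau> * (LINT t|?M. e n t)) \<longlonglongrightarrow> 0"
  proof (rule LIMSEQ_I)
    fix \<epsilon> :: real assume \<epsilon>: "0 < \<epsilon>"
    from R \<tau> \<epsilon> obtain \<eta> where \<eta>: "0 < \<eta>" "\<And>t. t \<in> {0..\<tau>} ==> dist t \<tau> < \<eta> ==> dist (R t) (R \<tau>) < \<epsilon> / 2"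
      unfolding continuous_on_iff by (metis atLeastAtMost_iff half_gt_zero less_eq_real_def)
    define M where "M = 2 * K / \<eta>"
    have M0: "0 <= M" using K0 \<eta> by (simp add: M_def)
    have pt: "\<bar>e n t * R t - R \<tau> * e n t\<bar> <= \<epsilon> / 2 * e n t + M * k n t" if t: "t \<in> {0<..<T}" for n t
    proof (cases "t < \<tau>")
      case True
      have "\<bar>R t - R \<tau>\<bar> <= \<epsilon> / 2 + M * (\<tau> - t)"
      proof (cases "\<tau> - t < \<eta>")
        case near: True
        have "\<bar>R t - R \<tau>\<bar> < \<epsilon> / 2" using \<eta>(2)[of t] near True t by (auto simp: dist_real_def)
        moreover have "0 <= M * (\<tau> - t)" using M0 True by simp
        ultimately show ?thesis by linarith
      next
        case False
        have "\<bar>R t - R \<tau>\<bar> <= 2 * K" using K[OF t] K[of \<tau>] \<tau> by auto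
        also have "\<dots> = M * \<eta>" using \<eta> by (simp add: M_def)
        also have "\<dots> <= M * (\<tau> - t)" using False M0 by (intro mult_left_mono) auto
        finally show ?thesis using \<epsilon> by simp
      qed
      then have "e n t * \<bar>R t - R \<tau>\<bar> <= e n t * (\<epsilon> / 2 + M * (\<tau> - t))" by (rule mult_left_mono[OF _ e0])
      moreover have "\<bar>e n t * R t - R \<tau> * e n t\<bar> = e n t * \<bar>R t - R \<tau>\<bar>"
      proof -
        have "e n t * R t - R \<tau> * e n t = e n t * (R t - R \<tau>)" by (simp add: algebra_simps)
        then show ?thesis using e0[of n t] by (simp add: abs_mult)
      qed
      moreover have "e n t * (\<epsilon> / 2 + M * (\<tau> - t)) = \<epsilon> / 2 * e n t + M * k n t" using True by (simp add: k_def algebra_simps)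
      ultimately show ?thesis by simp
    qed (simp add: ez k_def)
    have le: "\<bar>(LINT t|?M. e n t * R t) - R \<tau> * (LINT t|?M. e n t)\<bar> <= \<epsilon> / 2 + M * (LINT t|?M. k n t)" for n
    proof -
      have "(LINT t|?M. e n t * R t) - R \<tau> * (LINT t|?M. e n t) = (LINT t|?M. e n t * R t - R \<tau> * e n t)"
        using eRi ei by simp
      also have "\<bar>\<dots>\<bar> <= (LINT t|?M. \<epsilon> / 2 * e n t + M * k n t)"
      proof (rule integral_abs_bound_integral)
        show "integrable ?M (\<lambda>t. e n t * R t - R \<tau> * e n t)" "integrable ?M (\<lambda>t. \<epsilon> / 2 * e n t + M * k n t)"
          using eRi ei ki by auto
      qed (use pt in simp)
      also have "\<dots> = \<epsilon> / 2 * (LINT t|?M. e n t) + M * (LINT t|?M. k n t)" using ei ki by simp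
      also have "\<dots> <= \<epsilon> / 2 + M * (LINT t|?M. k n t)"
        using mult_left_mono[OF mle[of n], of "\<epsilon> / 2"] \<epsilon> by simp
      finally show ?thesis .
    qed
    have "(\<lambda>n. \<epsilon> / 2 + M * (LINT t|?M. k n t)) \<longlonglongrightarrow> \<epsilon> / 2 + M * 0" by (intro tendsto_intros klim)
    then have "\<forall>\<^sub>F n in sequentially. \<epsilon> / 2 + M * (LINT t|?M. k n t) < \<epsilon>"
      by (rule order_tendstoD) (use \<epsilon> in simp)
    then obtain N where "\<And>n. n \<ge> N ==> \<epsilon> / 2 + M * (LINT t|?M. k n t) < \<epsilon>" unfolding eventually_sequentially by blast
    then show "\<exists>N. \<forall>n\<ge>N. norm ((LINT t|?M. e n t * R t) - R \<tau> * (LINT t|?M. e n t) - 0) < \<epsilon>"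
      unfolding diff_0_right real_norm_def using le_less_trans[OF le] by blast
  qed
  have "(\<lambda>n. (LINT t|?M. e n t * R t) - R \<tau> * (LINT t|?M. e n t) + R \<tau> * (LINT t|?M. e n t)) \<longlonglongrightarrow> 0 + R \<tau> * 1"
    by (intro tendsto_add diff tendsto_mult mlim tendsto_const)
  then show ?thesis by (simp add: e_def c_def)
qed

lemma cutoff_pairing_limit:
  assumes T: "0 < T" and Nm: "N \<in> borel_measurable (lebesgue_on {0<..<T})" and C: "AE t in lebesgue_on {0<..<T}. \<bar>N t\<bar> <= C"
  shows "(\<lambda>n. LINT t|lebesgue_on {0<..<T}. cutoff (1 / Suc n) \<tau> 0 t * N t) \<longlonglongrightarrow> (LINT t|lebesgue_on {0<..<T}. indicator {..<\<tau>} t * N t)"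
    "integrable (lebesgue_on {0<..<T}) N"
proof -
  let ?M = "lebesgue_on {0<..<T}"
  interpret finite_measure ?M by (rule finite_measure_interval)
  show i: "integrable ?M N" by (rule integrable_const_bound[of _ C]) (use Nm C in auto)
  have cm: "cutoff (1 / Suc n) \<tau> 0 \<in> borel_measurable ?M" for n
    by (intro borel_measurable_lebesgue_onI borel_measurable_continuous_onI cutoff_continuous) simp
  have im: "(indicator {..<\<tau>} :: real => real) \<in> borel_measurable ?M"
    by (rule borel_measurable_lebesgue_onI) measurable
  show "(\<lambda>n. LINT t|?M. cutoff (1 / Suc n) \<tau> 0 t * N t) \<longlonglongrightarrow> (LINT t|?M. indicator {..<\<tau>} t * N t)"
  proof (rule integral_dominated_convergence[where w = "\<lambda>t. \<bar>N t\<bar>"])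
    show "(\<lambda>t. indicator {..<\<tau>} t * N t) \<in> borel_measurable ?M" using im Nm by measurable
    show "(\<lambda>t. cutoff (1 / Suc n) \<tau> 0 t * N t) \<in> borel_measurable ?M" for n using cm Nm by measurable
    show "AE t in ?M. (\<lambda>n. cutoff (1 / Suc n) \<tau> 0 t * N t) \<longlonglongrightarrow> indicator {..<\<tau>} t * N t"
      by (intro AE_I2 tendsto_mult cutoff_0_limit tendsto_const)
    show "AE t in ?M. norm (cutoff (1 / Suc n) \<tau> 0 t * N t) <= \<bar>N t\<bar>" for n
    proof (rule AE_I2)
      fix t
      have "\<bar>cutoff (1 / Suc n) \<tau> 0 t\<bar> <= 1" using cutoff_0_range[of "1 / Suc n" \<tau> t] by auto
      from mult_right_mono[OF this, of "\<bar>N t\<bar>"] show "norm (cutoff (1 / Suc n) \<tau> 0 t * N t) <= \<bar>N t\<bar>" by (simp add: abs_mult)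
    qed
  qed (use i in simp)
qed

subsection \<open>Pairing a flux with functions of one variable\<close>

text \<open>Measurable in time and space, with square norms bounded by \<open>E\<close> at almost every time.
  Both \<open>v\<^sub>i\<close> and \<open>\<rho> v\<^sub>i\<close> are of this kind.\<close>

definition flux :: "real => real => real => (real => real^'n => real) => bool" where
  "flux T L E u \<longleftrightarrow> (\<lambda>(t, x). u t x) \<in> borel_measurable (time_torus T L) \<and>
    (AE t in lebesgue_on {0<..<T}. u t \<in> L2 (torus L) \<and> (LINT x|torus L. (u t x)\<^sup>2) <= E)"

lemma flux_pairing_measurable:
  fixes u :: "real => real^'n => real"
  assumes u: "flux T L E u" and g: "g \<in> borel_measurable borel"
  shows "(\<lambda>t. LINT x|torus L. u t x * g (x $ i)) \<in> borel_measurable (lebesgue_on {0<..<T})"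
proof (rule time_slice_measurable(2))
  have "(\<lambda>(t, x). u t x) \<in> borel_measurable (time_torus T L)" using u by (simp add: flux_def)
  from borel_measurable_times[OF this lift_time_measurable[OF g, of i]]
  show "(\<lambda>(t, x). u t x * g (x $ i)) \<in> borel_measurable (time_torus T L)" by (simp add: split_def)
qed

lemma lift_square_bound:
  fixes g :: "real => real" and i :: "'n::finite"
  assumes L: "0 < L" and g: "g \<in> borel_measurable borel" "\<And>s. s \<in> {0..L} ==> \<bar>g s\<bar> <= B"
  shows "(LINT x|torus L. (g ((x::real^'n) $ i))\<^sup>2) <= B\<^sup>2 * L ^ CARD('n)"
proof -
  interpret finite_measure "torus L :: (real^'n) measure" by (rule finite_measure_torus[OF L])
  have "(LINT x|torus L. (g ((x::real^'n) $ i))\<^sup>2) <= (LINT x|(torus L :: (real^'n) measure). B\<^sup>2)"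
  proof (rule integral_mono)
    show "integrable (torus L) (\<lambda>x::real^'n. (g (x $ i))\<^sup>2)" using torus_lift_L2(1)[OF L g, of i] by (simp add: L2_real_iff)
    show "(g (x $ i))\<^sup>2 <= B\<^sup>2" if "x \<in> space (torus L)" for x :: "real^'n"
    proof -
      have "\<bar>g (x $ i)\<bar> <= \<bar>B\<bar>" using g(2)[OF cube_coordinate, of x i] that by simp
      then show ?thesis by (simp only: abs_le_square_iff)
    qed
  qed simp
  then show ?thesis using measure_torus[OF L, where 'n = 'n] by (simp add: mult.commute)
qed

lemma L2_pairing_bound:
  fixes u :: "real^'n => real"
  assumes L: "0 < L" and u: "u \<in> L2 (torus L)" "(LINT x|torus L. (u x)\<^sup>2) <= E"
    and g: "(\<lambda>x::real^'n. g (x $ i)) \<in> L2 (torus L)"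
  shows "\<bar>LINT x|torus L. u x * g (x $ i)\<bar> <= sqrt E * sqrt (LINT x|torus L. (g ((x::real^'n) $ i))\<^sup>2)"
  by (rule order_trans[OF cauchy_schwarz_sqrt[OF u(1) g]]) (intro mult_right_mono, use u(2) in auto)

lemma flux_pairing_bounded:
  fixes u :: "real => real^'n => real"
  assumes L: "0 < L" and u: "flux T L E u" and E: "0 <= E"
    and g: "g \<in> borel_measurable borel" "\<And>s. s \<in> {0..L} ==> \<bar>g s\<bar> <= B"
  shows "AE t in lebesgue_on {0<..<T}. \<bar>LINT x|torus L. u t x * g (x $ i)\<bar> <= sqrt E * sqrt (B\<^sup>2 * L ^ CARD('n))"
proof -
  have "AE t in lebesgue_on {0<..<T}. u t \<in> L2 (torus L) \<and> (LINT x|torus L. (u t x)\<^sup>2) <= E" using u by (simp add: flux_def)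
  then show ?thesis
  proof eventually_elim
    case (elim t)
    from L2_pairing_bound[OF L elim[THEN conjunct1] elim[THEN conjunct2] torus_lift_L2(1)[OF L g]]
    have "\<bar>LINT x|torus L. u t x * g (x $ i)\<bar> <= sqrt E * sqrt (LINT x|torus L. (g ((x::real^'n) $ i))\<^sup>2)" .
    also have "\<dots> <= sqrt E * sqrt (B\<^sup>2 * L ^ CARD('n))"
      using E by (intro mult_left_mono real_sqrt_le_mono lift_square_bound[OF L g]) auto
    finally show ?case .
  qed
qed

lemma flux_pairing_limit:
  fixes u :: "real => real^'n => real"
  assumes L: "0 < L" and u: "flux T L E u" and E: "0 <= E" and A: "A \<in> sets borel"
    and am: "\<And>n. a n \<in> borel_measurable borel" and bm: "b \<in> borel_measurable borel"
    and bd: "\<And>n s. s \<in> {0..L} ==> \<bar>a n s\<bar> <= B" and lim: "\<And>s. s \<in> {0..L} ==> (\<lambda>n. a n s) \<longlonglongrightarrow> b s"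
  shows "(\<lambda>n. LINT t|lebesgue_on {0<..<T}. indicator A t * (LINT x|torus L. u t x * a n (x $ i)))
    \<longlonglongrightarrow> (LINT t|lebesgue_on {0<..<T}. indicator A t * (LINT x|torus L. u t x * b (x $ i)))"
proof -
  let ?M = "lebesgue_on {0<..<T}"
  interpret finite_measure ?M by (rule finite_measure_interval)
  have im: "(indicator A :: real => real) \<in> borel_measurable ?M"
    by (rule borel_measurable_lebesgue_onI) (use A in measurable)
  let ?C = "sqrt E * sqrt (B\<^sup>2 * L ^ CARD('n))"
  show ?thesis
  proof (rule integral_dominated_convergence[where w = "\<lambda>_. ?C"])
    show "(\<lambda>t. indicator A t * (LINT x|torus L. u t x * b (x $ i))) \<in> borel_measurable ?M"
      using im flux_pairing_measurable[OF u bm, of i] by measurable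
    show "(\<lambda>t. indicator A t * (LINT x|torus L. u t x * a n (x $ i))) \<in> borel_measurable ?M" for n
      using im flux_pairing_measurable[OF u am[of n], of i] by measurable
    have "AE t in ?M. u t \<in> L2 (torus L)" using u by (auto simp: flux_def elim: eventually_mono)
    then show "AE t in ?M. (\<lambda>n. indicator A t * (LINT x|torus L. u t x * a n (x $ i))) \<longlonglongrightarrow> indicator A t * (LINT x|torus L. u t x * b (x $ i))"
    proof eventually_elim
      case (elim t)
      have "(\<lambda>n. LINT x|torus L. u t x * a n (x $ i)) \<longlonglongrightarrow> (LINT x|torus L. u t x * b (x $ i))"
        by (rule torus_lift_limit[OF L torus_L2_integrable[OF L elim] negligible_empty am bm bd]) (use lim in auto)
      then show ?case by (intro tendsto_mult tendsto_const)
    qed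
    show "AE t in ?M. norm (indicator A t * (LINT x|torus L. u t x * a n (x $ i))) <= ?C" for n
    proof -
      have "AE t in ?M. \<bar>LINT x|torus L. u t x * a n (x $ i)\<bar> <= ?C" by (rule flux_pairing_bounded[OF L u E am bd])
      then show ?thesis
      proof eventually_elim
        case (elim t)
        have "0 <= ?C" using E L by simp
        then show ?case using elim by (auto simp: indicator_def)
      qed
    qed
  qed simp
qed

subsection \<open>The continuity equation in one variable\<close>

text \<open>The set where the bound fails is open, and a nonempty open set is not negligible.\<close>

lemma continuous_le_if_AE_le:
  fixes h :: "real => real"
  assumes h: "continuous_on {0<..<T} h" and ae: "AE s in lebesgue_on {0<..<T}. h s <= C" and t: "t \<in> {0<..<T}"
  shows "h t <= C"
proof (rule ccontr)
  assume "\<not> h t <= C"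
  define A where "A = {0<..<T} \<inter> h -` {C<..}"
  have opA: "open A" unfolding A_def by (rule continuous_open_preimage[OF h]) auto
  have "AE s in lborel. s \<notin> A"
    using ae unfolding A_def by (auto simp: AE_lebesgue_on_iff elim!: eventually_mono)
  moreover have "{s \<in> space lborel. \<not> s \<notin> A} = A" by auto
  ultimately have "A \<in> null_sets lborel"
    using AE_iff_null_sets[of A lborel] opA by auto
  then have "negligible A" by (simp add: negligible_iff_null_sets null_sets_completionI)
  moreover have "t \<in> A" using t \<open>\<not> h t <= C\<close> by (simp add: A_def)
  ultimately show False using opA open_not_negligible by auto
qed

text \<open>The bound holds at almost every time by Fubini. Tested against a fixed function it passes to every
  time by continuity, and duality recovers the pointwise bound.\<close>

lemma weakly_continuous_bound:
  fixes \<rho> :: "real => real^'n => real"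
  assumes L: "0 < L" and wc: "\<rho> \<in> weakly_continuous_L2 T L"
    and ae: "AE t in lebesgue_on {0<..<T}. AE x in torus L. \<bar>\<rho> t x\<bar> <= 1" and t: "t \<in> {0<..<T}"
  shows "AE x in torus L. \<bar>\<rho> t x\<bar> <= 1"
proof -
  have \<rho>L: "\<rho> s \<in> L2 (torus L)" if "s \<in> {0<..<T}" for s using wc that by (simp add: weakly_continuous_L2_def)
  show ?thesis
  proof (rule bounded_by_duality)
    show "finite_measure (torus L :: (real^'n) measure)" by (rule finite_measure_torus[OF L])
    show "integrable (torus L) (\<rho> t)" by (rule torus_L2_integrable[OF L \<rho>L[OF t]])
    fix g :: "real^'n => real" assume gm: "g \<in> borel_measurable (torus L)" and g1: "\<bar>g x\<bar> <= 1" for x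
    have gL: "g \<in> L2 (torus L)" by (rule torus_L2_bounded[OF L gm]) (use g1 in auto)
    have gi: "integrable (torus L) (\<lambda>x. \<bar>g x\<bar>)" using torus_L2_integrable[OF L gL] by simp
    show "(LINT x|torus L. \<rho> t x * g x) <= (LINT x|torus L. \<bar>g x\<bar>)"
    proof (rule continuous_le_if_AE_le[OF _ _ t])
      have "continuous_on {0..<T} (\<lambda>t. LINT x|torus L. \<rho> t x * g x)" using wc gL by (simp add: weakly_continuous_L2_def)
      then show "continuous_on {0<..<T} (\<lambda>t. LINT x|torus L. \<rho> t x * g x)" by (rule continuous_on_subset) auto
      show "AE s in lebesgue_on {0<..<T}. (LINT x|torus L. \<rho> s x * g x) <= (LINT x|torus L. \<bar>g x\<bar>)"
        using ae AE_space
      proof eventually_elim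
        case (elim s)
        show ?case
        proof (rule integral_mono_AE[OF _ gi])
          show "integrable (torus L) (\<lambda>x. \<rho> s x * g x)" by (rule L2_mult_integrable[OF \<rho>L gL]) (use elim in simp)
          show "AE x in torus L. \<rho> s x * g x <= \<bar>g x\<bar>"
            using elim(1)
          proof eventually_elim
            case (elim x)
            show ?case using mult_right_mono[OF elim, of "\<bar>g x\<bar>"] abs_ge_self[of "\<rho> s x * g x"] by (simp add: abs_mult)
          qed
        qed
      qed
    qed
  qed
qed

lemma grad_lift:
  fixes q :: "real => real" and y :: "real^'n"
  assumes q: "\<And>s. (q has_real_derivative q' s) (at s)"
  shows "y \<bullet> grad (\<lambda>x. k * q (x $ i)) x = k * (y $ i * q' (x $ i))"
proof -
  have "((\<lambda>s. k * q s) has_real_derivative k * q' s) (at s)" for s using q by (rule DERIV_cmult)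
  note p = partial_lift[OF this]
  have "grad (\<lambda>x. k * q (x $ i)) x = axis i (k * q' (x $ i))"
    unfolding grad_def p by (simp add: vec_eq_iff axis_def)
  then show ?thesis by (simp add: inner_axis mult.left_commute)
qed

text \<open>The test functions are products of a cutoff at \<open>\<tau>\<close> and
  \<open>q(x\<^sub>i)\<close>. As the cutoffs approach the indicator of \<open>{..<\<tau>}\<close>, minus
  their time derivative concentrates at \<open>\<tau>\<close> and picks out the value of the weakly continuous
  representative there.\<close>

theorem continuity_one_variable:
  fixes \<rho> :: "real => real^'n => real"
  assumes L: "0 < L" and ce: "solves_continuity T L \<rho>0 \<rho> v" and wc: "\<rho> \<in> weakly_continuous_L2 T L"
    and \<rho>1: "\<And>t. t \<in> {0<..<T} ==> AE x in torus L. \<bar>\<rho> t x\<bar> <= 1"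
    and u: "flux T L E (\<lambda>t x. \<rho> t x * v t x $ i)" and E: "0 <= E"
    and q: "q \<in> trig L" and q': "q' \<in> trig L" and d: "\<And>s. (q has_real_derivative q' s) (at s)" and \<tau>: "\<tau> \<in> {0<..<T}"
  shows "(LINT x|torus L. \<rho> \<tau> x * q (x $ i)) = (LINT x|torus L. \<rho>0 x * q (x $ i)) +
    (LINT t|lebesgue_on {0<..<T}. indicator {..<\<tau>} t * (LINT x|torus L. \<rho> t x * v t x $ i * q' (x $ i)))"
proof -
  let ?M = "lebesgue_on {0<..<T}"
  define R where "R = (\<lambda>t. LINT x|torus L. \<rho> t x * q (x $ i))"
  define N where "N = (\<lambda>t. LINT x|torus L. \<rho> t x * v t x $ i * q' (x $ i))"
  define R0 where "R0 = (LINT x|torus L. \<rho>0 x * q (x $ i))"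
  have T: "0 < T" using \<tau> by auto
  obtain B where B: "\<And>s. \<bar>q s\<bar> <= B" using trig_bounded[OF q] by blast
  obtain B' where B': "\<And>s. \<bar>q' s\<bar> <= B'" using trig_bounded[OF q'] by blast
  have ql: "(\<lambda>x::real^'n. q (x $ i)) \<in> L2 (torus L)" by (rule torus_lift_L2(1)[OF L trig_borel[OF q] B])
  have q'l: "(\<lambda>x::real^'n. q' (x $ i)) \<in> L2 (torus L)" by (rule torus_lift_L2(1)[OF L trig_borel[OF q'] B'])
  have \<rho>L: "\<rho> s \<in> L2 (torus L)" if "s \<in> {0<..<T}" for s using wc that by (simp add: weakly_continuous_L2_def)
  have Rc: "continuous_on {0..<T} R" unfolding R_def using wc ql by (simp add: weakly_continuous_L2_def)
  have Rm: "R \<in> borel_measurable ?M"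
    by (rule continuous_imp_measurable_on_sets_lebesgue) (auto intro: continuous_on_subset[OF Rc])
  have RK: "\<bar>R t\<bar> <= (LINT x|torus L. \<bar>q ((x::real^'n) $ i)\<bar>)" if t: "t \<in> {0<..<T}" for t
    unfolding R_def
  proof (rule order_trans[OF integral_abs_bound], rule integral_mono_AE)
    show "integrable (torus L) (\<lambda>x. \<bar>\<rho> t x * q (x $ i)\<bar>)" using L2_mult_integrable[OF \<rho>L[OF t] ql] by simp
    show "integrable (torus L) (\<lambda>x::real^'n. \<bar>q (x $ i)\<bar>)" using torus_L2_integrable[OF L ql] by simp
    show "AE x in torus L. \<bar>\<rho> t x * q (x $ i)\<bar> <= \<bar>q (x $ i)\<bar>"
      using \<rho>1[OF t]
    proof eventually_elim
      case (elim x)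
      show ?case using mult_right_mono[OF elim, of "\<bar>q (x $ i)\<bar>"] by (simp add: abs_mult)
    qed
  qed
  have Nm: "N \<in> borel_measurable ?M" unfolding N_def by (rule flux_pairing_measurable[OF u trig_borel[OF q']])
  have Nb: "AE t in ?M. \<bar>N t\<bar> <= sqrt E * sqrt (B'\<^sup>2 * L ^ CARD('n))"
    unfolding N_def by (rule flux_pairing_bounded[OF L u E trig_borel[OF q'] B'])
  have test: "(LINT t|?M. cutoff c \<tau> 0 t * N t) - (LINT t|?M. c * cutoff c \<tau> 2 t * R t) + cutoff c \<tau> 0 0 * R0 = 0" if c: "0 < c" for c
  proof -
    define \<psi> where "\<psi> = (\<lambda>t (x::real^'n). cutoff c \<tau> 0 t * q (x $ i))"
    have "\<psi> \<in> time_smooth_compact T L"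
      unfolding \<psi>_def by (rule cutoff_trig_time_smooth_compact[OF trig_lift[OF q] L c]) (use \<tau> in simp)
    then have eq: "(LINT t|?M. LINT x|torus L. \<rho> t x * deriv (\<lambda>s. \<psi> s x) t + \<rho> t x * (v t x \<bullet> grad (\<psi> t) x))
      + (LINT x|torus L. \<rho>0 x * \<psi> 0 x) = 0" using ce by (simp add: solves_continuity_def)
    have dt: "deriv (\<lambda>s. \<psi> s x) t = - (c * cutoff c \<tau> 2 t) * q (x $ i)" for t x
    proof (rule DERIV_imp_deriv)
      have "(cutoff c \<tau> 0 has_real_derivative - (c * cutoff c \<tau> 2 t)) (at t)"
        using cutoff_deriv[OF c, of \<tau> 0 t] by (simp add: numeral_2_eq_2)
      from DERIV_cmult_right[OF this, of "q (x $ i)"]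
      show "((\<lambda>s. \<psi> s x) has_real_derivative - (c * cutoff c \<tau> 2 t) * q (x $ i)) (at t)" unfolding \<psi>_def by simp
    qed
    have gr: "v t x \<bullet> grad (\<psi> t) x = cutoff c \<tau> 0 t * (v t x $ i * q' (x $ i))" for t x
      unfolding \<psi>_def by (rule grad_lift[OF d])
    have uL: "AE t in ?M. (\<lambda>x. \<rho> t x * v t x $ i) \<in> L2 (torus L)" using u by (auto simp: flux_def elim: eventually_mono)
    have inner: "AE t in ?M. (LINT x|torus L. \<rho> t x * deriv (\<lambda>s. \<psi> s x) t + \<rho> t x * (v t x \<bullet> grad (\<psi> t) x))
        = cutoff c \<tau> 0 t * N t - c * cutoff c \<tau> 2 t * R t"
      using uL AE_space
    proof eventually_elim
      case (elim t)
      have i1: "integrable (torus L) (\<lambda>x. \<rho> t x * q (x $ i))" by (rule L2_mult_integrable[OF \<rho>L ql]) (use elim in simp)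
      have i2: "integrable (torus L) (\<lambda>x. \<rho> t x * v t x $ i * q' (x $ i))" by (rule L2_mult_integrable[OF elim(1) q'l])
      have "(LINT x|torus L. \<rho> t x * deriv (\<lambda>s. \<psi> s x) t + \<rho> t x * (v t x \<bullet> grad (\<psi> t) x))
        = (LINT x|torus L. - (c * cutoff c \<tau> 2 t) * (\<rho> t x * q (x $ i)) + cutoff c \<tau> 0 t * (\<rho> t x * v t x $ i * q' (x $ i)))"
        by (rule Bochner_Integration.integral_cong) (auto simp: dt gr algebra_simps)
      also have "\<dots> = - (c * cutoff c \<tau> 2 t) * R t + cutoff c \<tau> 0 t * N t"
        unfolding R_def N_def using i1 i2 by (subst Bochner_Integration.integral_add) auto
      finally show ?case by simp
    qed
    have cm: "cutoff c \<tau> k \<in> borel_measurable ?M" for k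
      by (intro borel_measurable_lebesgue_onI borel_measurable_continuous_onI cutoff_continuous[OF c])
    have rm: "(\<lambda>t. cutoff c \<tau> 0 t * N t - c * cutoff c \<tau> 2 t * R t) \<in> borel_measurable ?M"
      using cm Nm Rm by measurable
    have "(LINT t|?M. LINT x|torus L. \<rho> t x * deriv (\<lambda>s. \<psi> s x) t + \<rho> t x * (v t x \<bullet> grad (\<psi> t) x))
      = (LINT t|?M. cutoff c \<tau> 0 t * N t - c * cutoff c \<tau> 2 t * R t)"
      by (rule integral_cong_AE[OF lebesgue_on_measurable_AE[OF interval_lebesgue rm inner] rm inner])
    also have "\<dots> = (LINT t|?M. cutoff c \<tau> 0 t * N t) - (LINT t|?M. c * cutoff c \<tau> 2 t * R t)"
    proof (rule Bochner_Integration.integral_diff)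
      have ci: "integrable ?M (cutoff c \<tau> 0)" "integrable ?M (\<lambda>t. c * cutoff c \<tau> 2 t)"
        by (intro continuous_integrable_interval continuous_intros cutoff_continuous[OF c])+
      show "integrable ?M (\<lambda>t. cutoff c \<tau> 0 t * N t)" by (rule integrable_mult_bounded[OF ci(1) Nm Nb])
      show "integrable ?M (\<lambda>t. c * cutoff c \<tau> 2 t * R t)"
        by (rule integrable_mult_bounded[OF ci(2) Rm AE_I2]) (use RK in auto)
    qed
    finally have "(LINT t|?M. LINT x|torus L. \<rho> t x * deriv (\<lambda>s. \<psi> s x) t + \<rho> t x * (v t x \<bullet> grad (\<psi> t) x))
      = (LINT t|?M. cutoff c \<tau> 0 t * N t) - (LINT t|?M. c * cutoff c \<tau> 2 t * R t)" .
    moreover have "(LINT x|torus L. \<rho>0 x * \<psi> 0 x) = cutoff c \<tau> 0 0 * R0"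
      unfolding \<psi>_def R0_def integral_mult_right_zero[symmetric]
      by (rule Bochner_Integration.integral_cong) (auto simp: mult_ac)
    ultimately show ?thesis using eq by simp
  qed
  have \<tau>': "0 < \<tau>" "\<tau> < T" using \<tau> by auto
  have "(\<lambda>n. (LINT t|?M. cutoff (1 / Suc n) \<tau> 0 t * N t) - (LINT t|?M. 1 / Suc n * cutoff (1 / Suc n) \<tau> 2 t * R t) + cutoff (1 / Suc n) \<tau> 0 0 * R0)
    \<longlonglongrightarrow> (LINT t|?M. indicator {..<\<tau>} t * N t) - R \<tau> + indicator {..<\<tau>} 0 * R0"
  proof (intro tendsto_add tendsto_diff tendsto_mult tendsto_const cutoff_0_limit cutoff_pairing_limit(1)[OF T Nm Nb])
    show "(\<lambda>n. LINT t|?M. 1 / Suc n * cutoff (1 / Suc n) \<tau> 2 t * R t) \<longlonglongrightarrow> R \<tau>"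
    proof (rule cutoff_approximate_identity[OF \<tau>' _ Rm RK])
      show "continuous_on {0..\<tau>} R" by (rule continuous_on_subset[OF Rc]) (use \<tau>' in auto)
    qed
  qed
  then have "(\<lambda>n. 0) \<longlonglongrightarrow> (LINT t|?M. indicator {..<\<tau>} t * N t) - R \<tau> + indicator {..<\<tau>} 0 * R0"
    using test[of "1 / Suc n" for n] by (simp only: zero_less_divide_1_iff of_nat_0_less_iff zero_less_Suc simp_thms)
  then have "(LINT t|?M. indicator {..<\<tau>} t * N t) - R \<tau> + indicator {..<\<tau>} 0 * R0 = 0"
    by (simp add: LIMSEQ_const_iff)
  then show ?thesis using \<tau>' unfolding R_def N_def R0_def by simp
qed

text \<open>The same cutoffs, this time at every \<open>\<tau>\<close>, show that all initial integrals
  vanish.\<close>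

theorem divergence_free_one_variable:
  fixes v :: "real => real^'n => real^'n"
  assumes L: "0 < L" and T: "0 < T" and df: "solves_div_free T L v" and u: "flux T L E (\<lambda>t x. v t x $ i)" and E: "0 <= E"
    and q: "q \<in> trig L" and q': "q' \<in> trig L" and d: "\<And>s. (q has_real_derivative q' s) (at s)"
  shows "AE t in lebesgue_on {0<..<T}. (LINT x|torus L. v t x $ i * q' (x $ i)) = 0"
proof -
  let ?M = "lebesgue_on {0<..<T}"
  define N where "N = (\<lambda>t. LINT x|torus L. v t x $ i * q' (x $ i))"
  obtain B' where B': "\<And>s. \<bar>q' s\<bar> <= B'" using trig_bounded[OF q'] by blast
  have Nm: "N \<in> borel_measurable ?M" unfolding N_def by (rule flux_pairing_measurable[OF u trig_borel[OF q']])
  have Nb: "AE t in ?M. \<bar>N t\<bar> <= sqrt E * sqrt (B'\<^sup>2 * L ^ CARD('n))"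
    unfolding N_def by (rule flux_pairing_bounded[OF L u E trig_borel[OF q'] B'])
  have test: "(LINT t|?M. cutoff c \<tau> 0 t * N t) = 0" if c: "0 < c" for c \<tau>
  proof -
    define \<psi> where "\<psi> = (\<lambda>t (x::real^'n). cutoff c \<tau> 0 t * q (x $ i))"
    have "\<psi> \<in> time_smooth L"
      unfolding \<psi>_def by (rule cutoff_trig_time_smooth[OF trig_lift[OF q] L c])
    then have "(LINT t|?M. LINT x|torus L. v t x \<bullet> grad (\<psi> t) x) = 0" using df by (simp add: solves_div_free_def)
    moreover have "v t x \<bullet> grad (\<psi> t) x = cutoff c \<tau> 0 t * (v t x $ i * q' (x $ i))" for t x
      unfolding \<psi>_def by (rule grad_lift[OF d])
    ultimately show ?thesis unfolding N_def by simp
  qed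
  have "AE t in ?M. N t = 0"
  proof (rule AE_zero_if_initial_integrals_zero[OF cutoff_pairing_limit(2)[OF T Nm Nb]])
    fix \<tau>
    have "(\<lambda>n. LINT t|?M. cutoff (1 / Suc n) \<tau> 0 t * N t) \<longlonglongrightarrow> (LINT t|?M. indicator {..<\<tau>} t * N t)"
      by (rule cutoff_pairing_limit(1)[OF T Nm Nb])
    then have "(\<lambda>n. 0) \<longlonglongrightarrow> (LINT t|?M. indicator {..<\<tau>} t * N t)" using test by simp
    then show "(LINT t|?M. indicator {..<\<tau>} t * N t) = 0" by (simp add: LIMSEQ_const_iff)
  qed
  then show ?thesis by (simp add: N_def)
qed

text \<open>One null set has to serve all \<open>g\<close>, because \<open>g\<close> will depend on the time.
  The countably many waves of the lattice determine the integrals against all trigonometric polynomials, and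
  these approximate every profile.\<close>

theorem divergence_free_profile:
  fixes v :: "real => real^'n => real^'n"
  assumes L: "0 < L" and T: "0 < T" and df: "solves_div_free T L v" and u: "flux T L E (\<lambda>t x. v t x $ i)" and E: "0 <= E"
  shows "AE t in lebesgue_on {0<..<T}. \<forall>g. profile L g \<longrightarrow> (LINT x|torus L. v t x $ i * g (x $ i)) = 0"
proof -
  let ?M = "lebesgue_on {0<..<T}"
  define \<kappa> where "\<kappa> = (\<lambda>k::int. 2 * pi * k / L)"
  define wave where "wave = (\<lambda>b k s. if b then cos (\<kappa> k * s) else sin (\<kappa> k * s))"
  have latE: "\<exists>k. a = \<kappa> k" if "a \<in> lattice L" for a
  proof -
    have "\<forall>b\<in>Basis. \<exists>k::int. a \<bullet> b = 2 * pi * k / L" using that unfolding lattice_def by blast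
    then have "\<exists>k::int. a \<bullet> 1 = 2 * pi * k / L" by (rule bspec) simp
    then show ?thesis unfolding inner_real_def mult_1_right \<kappa>_def .
  qed
  have "\<kappa> k \<in> lattice L" for k by (auto simp: \<kappa>_def lattice_def)
  then have wt: "wave b k \<in> trig L" for b k
    using trig.trig_cos[of "\<kappa> k" L] trig.trig_sin[of "\<kappa> k" L] by (cases b) (simp_all add: wave_def)
  have per: "integral {0..L} q' = 0" if "\<And>s. (q has_real_derivative q' s) (at s)" "q \<in> trig L" for q q' :: "real => real"
    using trig_integral_antiderivative[OF that(1), of 0 L] trig_periodic[OF that(2), of 1 0] L by simp
  have q0: "q integrable_on {0..L}" if "q \<in> trig L" for q :: "real => real"
    by (rule integrable_continuous_real[OF trig_continuous[OF that]])
  have "AE t in ?M. (LINT x|torus L. v t x $ i * (wave b k (x $ i) - integral {0..L} (wave b k) / L)) = 0" for b k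
  proof -
    obtain c P where P: "P \<in> trig L" "\<And>s. (P has_real_derivative wave b k s - c) (at s)" using trig_antiderivative[OF wt] by blast
    have "integral {0..L} (\<lambda>s. wave b k s - c) = integral {0..L} (wave b k) - c * L"
      using L by (subst integral_diff) (auto intro: q0 wt)
    then have "c = integral {0..L} (wave b k) / L" using per[OF P(2,1)] L by (simp add: field_simps)
    with divergence_free_one_variable[OF L T df u E P(1) trig_diff[OF wt trig_const] P(2)] show ?thesis by simp
  qed
  then have "AE t in ?M. \<forall>b k. (LINT x|torus L. v t x $ i * (wave b k (x $ i) - integral {0..L} (wave b k) / L)) = 0"
    by (simp add: AE_all_countable)
  moreover have "AE t in ?M. (\<lambda>x. v t x $ i) \<in> L2 (torus L)" using u by (auto simp: flux_def elim: eventually_mono)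
  ultimately show ?thesis
  proof eventually_elim
    case (elim t)
    define h where "h = (\<lambda>x. v t x $ i)"
    have hL: "h \<in> L2 (torus L)" using elim(2) by (simp add: h_def)
    have hi: "integrable (torus L) h" by (rule torus_L2_integrable[OF L hL])
    have qi: "integrable (torus L) (\<lambda>x. h x * q (x $ i))" if q: "q \<in> trig L" for q
    proof -
      obtain B where "\<And>s. \<bar>q s\<bar> <= B" using trig_bounded[OF q] by blast
      from torus_lift_L2(1)[OF L trig_borel[OF q] this] show ?thesis by (rule L2_mult_integrable[OF hL])
    qed
    have base: "(LINT x|torus L. h x * wave b k (x $ i)) = integral {0..L} (wave b k) / L * (LINT x|torus L. h x)" for b k
    proof -
      have "(LINT x|torus L. h x * (wave b k (x $ i) - integral {0..L} (wave b k) / L))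
        = (LINT x|torus L. h x * wave b k (x $ i)) - (LINT x|torus L. h x * (integral {0..L} (wave b k) / L))"
        unfolding right_diff_distrib by (rule Bochner_Integration.integral_diff[OF qi[OF wt]]) (use hi in simp)
      then show ?thesis using elim(1) by (simp add: h_def mult.commute)
    qed
    have mean: "(LINT x|torus L. h x * q (x $ i)) = integral {0..L} q / L * (LINT x|torus L. h x)" if "q \<in> trig L" for q
      using that
    proof induction
      case (trig_cos a)
      then obtain k where W: "(\<lambda>s. cos (a \<bullet> s)) = wave True k" using latE by (auto simp: wave_def)
      then show ?case using base[of True k] unfolding W[symmetric] by simp
    next
      case (trig_sin a)
      then obtain k where W: "(\<lambda>s. sin (a \<bullet> s)) = wave False k" using latE by (auto simp: wave_def)
      then show ?case using base[of False k] unfolding W[symmetric] by simp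
    next
      case (trig_add p q)
      have "(LINT x|torus L. h x * (p (x $ i) + q (x $ i))) = (LINT x|torus L. h x * p (x $ i)) + (LINT x|torus L. h x * q (x $ i))"
        unfolding distrib_left by (rule Bochner_Integration.integral_add[OF qi[OF trig_add(1)] qi[OF trig_add(2)]])
      moreover have "integral {0..L} (\<lambda>s. p s + q s) = integral {0..L} p + integral {0..L} q"
        by (rule Henstock_Kurzweil_Integration.integral_add[OF q0[OF trig_add(1)] q0[OF trig_add(2)]])
      ultimately show ?case using trig_add by (simp add: add_divide_distrib distrib_right)
    next
      case (trig_cmult q c)
      have "(LINT x|torus L. h x * (c * q (x $ i))) = c * (LINT x|torus L. h x * q (x $ i))" by (simp add: mult.left_commute)
      then show ?case using trig_cmult by simp
    qed
    show ?case
    proof (intro allI impI)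
      fix g assume g: "profile L g"
      obtain p q r N B where a: "approximates L p q r N B g" using approximates_exists[OF L g] by blast
      have z: "(LINT x|torus L. h x * r n (x $ i)) = 0" for n
        using mean[OF approximatesD(5)[OF a]] per[OF approximatesD(7)[OF a] approximatesD(4)[OF a]] by simp
      have "(\<lambda>n. LINT x|torus L. h x * r n (x $ i)) \<longlonglongrightarrow> (LINT x|torus L. h x * g (x $ i))"
        by (rule potential_limit(3)[OF L g a hi])
      then show "(LINT x|torus L. v t x $ i * g (x $ i)) = 0" unfolding z by (simp add: LIMSEQ_const_iff h_def)
    qed
  qed
qed

section \<open>The rate at which the energy changes\<close>

text \<open>The one-dimensional data of the flow: \<open>m t\<close> is the average of the density \<open>f
  t\<close> over the variables other than \<open>x\<^sub>i\<close>, and \<open>V t\<close> is the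
  \<open>i\<close>-th component of the velocity.\<close>

locale marginal_flow =
  fixes L T E :: real and i :: "'n::finite" and f V :: "real => real^'n => real" and m :: "real => real => real"
  assumes L: "0 < L" and T: "0 < T" and E: "0 <= E"
    and density_measurable: "\<And>t. t \<in> {0..<T} ==> f t \<in> borel_measurable (torus L)"
    and density_bound: "\<And>t. t \<in> {0..<T} ==> AE x in torus L. \<bar>f t x\<bar> <= 1"
    and density_mean: "\<And>t. t \<in> {0..<T} ==> (LINT x|torus L. f t x) = 0"
    and marginal: "\<And>t. t \<in> {0..<T} ==> is_marginal L i (f t) (m t)"
    and flux_density: "flux T L E (\<lambda>t x. f t x * V t x)"
    and flux_velocity: "flux T L E V"
    and evolution: "\<And>q q' \<tau>. q \<in> trig L ==> q' \<in> trig L ==> (\<And>s. (q has_real_derivative q' s) (at s)) ==> \<tau> \<in> {0..<T} ==>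
      (LINT x|torus L. f \<tau> x * q (x $ i)) = (LINT x|torus L. f 0 x * q (x $ i)) +
      (LINT t|lebesgue_on {0<..<T}. indicator {..<\<tau>} t * (LINT x|torus L. f t x * V t x * q' (x $ i)))"
    and incompressible: "AE t in lebesgue_on {0<..<T}. \<forall>g. profile L g \<longrightarrow> (LINT x|torus L. V t x * g (x $ i)) = 0"
begin

abbreviation w :: "real => real^'n => real" where "w t \<equiv> \<lambda>x. mean_free L (m t) (x $ i)"

definition energy :: "real => real" where "energy t = (LINT x|torus L. (w t x)\<^sup>2)"

text \<open>The integral of \<open>w\<^sup>2 (1 - m\<^sup>2)\<close>, a measure of how much the averaged
  density differs from a function with values \<open>1\<close> and \<open>-1\<close>.\<close>

definition defect :: "real => real" where
  "defect t = (LINT x|torus L. (w t x)\<^sup>2) - (LINT x|torus L. (w t x)\<^sup>2 * (m t (x $ i))\<^sup>2)"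

text \<open>The rate at which the flux at time \<open>r\<close> changes the pairing of the density with the
  potential whose derivative is \<open>w t\<close>.\<close>

definition transported :: "real => real => real" where
  "transported t r = (LINT x|torus L. f r x * V r x * w t x)"

abbreviation time :: "real measure" where "time \<equiv> lebesgue_on {0<..<T}"

lemma profile_m: "t \<in> {0..<T} ==> profile L (m t)"
  using marginal_profile[OF L marginal density_mean] .

lemma w_L2: "t \<in> {0..<T} ==> w t \<in> L2 (torus L)"
  by (rule potential_lift_L2(1)[OF L profile_m])

lemma transported_measurable: "t \<in> {0..<T} ==> transported t \<in> borel_measurable time"
  unfolding transported_def[abs_def]
  by (rule flux_pairing_measurable[OF flux_density profile_borel(4)[OF profile_m]])

lemma flux_slices: "AE r in time. (\<lambda>x. f r x * V r x) \<in> L2 (torus L) \<and> (LINT x|torus L. (f r x * V r x)\<^sup>2) <= E"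
  using flux_density by (simp add: flux_def)

lemma transported_combination:
  assumes "s \<in> {0..<T}" "t \<in> {0..<T}" and r: "(\<lambda>x. f r x * V r x) \<in> L2 (torus L) \<and> (LINT x|torus L. (f r x * V r x)\<^sup>2) <= E"
  shows "\<bar>transported t r - transported s r\<bar> <= sqrt E * sqrt (LINT x|torus L. (w t x - w s x)\<^sup>2)"
proof -
  have "transported t r - transported s r = (LINT x|torus L. f r x * V r x * w t x - f r x * V r x * w s x)"
    unfolding transported_def
    by (rule Bochner_Integration.integral_diff[symmetric]) (intro L2_mult_integrable r[THEN conjunct1] w_L2 assms)+
  also have "\<dots> = (LINT x|torus L. f r x * V r x * (\<lambda>s'. mean_free L (m t) s' - mean_free L (m s) s') (x $ i))"
    by (simp add: right_diff_distrib)
  finally show ?thesis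
    using L2_pairing_bound[OF L r[THEN conjunct1] r[THEN conjunct2] L2_diff[OF w_L2[OF assms(2)] w_L2[OF assms(1)]]] by simp
qed

lemma transported_integrable:
  assumes t: "t \<in> {0..<T}" and A: "A \<in> sets borel"
  shows "integrable time (\<lambda>r. indicator A r * transported t r)"
proof -
  interpret finite_measure time by (rule finite_measure_interval)
  obtain C where C: "\<And>s. s \<in> {0..L} ==> \<bar>mean_free L (m t) s\<bar> <= C" using mean_free_bound[OF profile_m[OF t]] by blast
  have "AE r in time. \<bar>transported t r\<bar> <= sqrt E * sqrt (C\<^sup>2 * L ^ CARD('n))"
    unfolding transported_def by (rule flux_pairing_bounded[OF L flux_density E profile_borel(4)[OF profile_m[OF t]] C])
  then have i: "integrable time (transported t)"
    by (intro integrable_const_bound transported_measurable t) simp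
  have im: "(indicator A :: real => real) \<in> borel_measurable time"
    by (rule borel_measurable_lebesgue_onI) (use A in measurable)
  show ?thesis
  proof (rule Bochner_Integration.integrable_bound[OF i])
    show "(\<lambda>r. indicator A r * transported t r) \<in> borel_measurable time" using im transported_measurable[OF t] by measurable
  qed (auto simp: indicator_def)
qed

text \<open>The evolution equation, tested with the second primitive of \<open>m k\<close>; pairing a density
  with that primitive is minus the inner product of the two potentials \<open>w\<close>.\<close>

lemma evolution_potential:
  assumes t: "t \<in> {0..<T}" and k: "k \<in> {0..<T}"
  shows "(LINT x|torus L. w t x * w k x) = (LINT x|torus L. w 0 x * w k x) - (LINT r|time. indicator {..<t} r * transported k r)"
proof -
  note pk = profile_m[OF k]
  have fi: "integrable (torus L) (f s)" if "s \<in> {0..<T}" for s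
    by (rule torus_integrable_bounded[OF L density_measurable[OF that] density_bound[OF that]])
  have pot: "(LINT x|torus L. f s x * prim (mean_free L (m k)) (x $ i)) = - (LINT x|torus L. w s x * w k x)" if "s \<in> {0..<T}" for s
    unfolding marginal_potential[OF L marginal[OF that] pk] by (rule potential_parts[OF L profile_m[OF that] pk])
  obtain p q r N B where a: "approximates L p q r N B (m k)" using approximates_exists[OF L pk] by blast
  have T0: "0 \<in> {0..<T}" using T by simp
  have "(LINT x|torus L. f t x * prim (mean_free L (m k)) (x $ i)) = (LINT x|torus L. f 0 x * prim (mean_free L (m k)) (x $ i))
     + (LINT r|time. indicator {..<t} r * transported k r)"
  proof (rule LIMSEQ_unique[OF potential_limit(1)[OF L pk a fi[OF t]]])
    have e: "(LINT x|torus L. f t x * p n (x $ i)) = (LINT x|torus L. f 0 x * p n (x $ i)) +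
      (LINT r|time. indicator {..<t} r * (LINT x|torus L. f r x * V r x * q n (x $ i)))" for n
      by (rule evolution[OF approximatesD(3)[OF a] approximatesD(4)[OF a] approximatesD(6)[OF a] t])
    show "(\<lambda>n. LINT x|torus L. f t x * p n (x $ i)) \<longlonglongrightarrow> (LINT x|torus L. f 0 x * prim (mean_free L (m k)) (x $ i))
     + (LINT r|time. indicator {..<t} r * transported k r)"
      unfolding e transported_def
      by (intro tendsto_add potential_limit(1)[OF L pk a fi[OF T0]]
        flux_pairing_limit[OF L flux_density E _ approximatesD(15)[OF a] profile_borel(4)[OF pk] approximatesD(9)[OF a] approximatesD(12)[OF a]]) auto
  qed
  then show ?thesis unfolding pot[OF t] pot[OF T0] by simp
qed

lemma evolution_between:
  assumes s: "s \<in> {0..<T}" and t: "t \<in> {0..<T}" and k: "k \<in> {0..<T}" and st: "s <= t"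
  shows "(LINT x|torus L. w t x * w k x) - (LINT x|torus L. w s x * w k x) = - (LINT r|time. indicator {s..<t} r * transported k r)"
proof -
  have "(LINT r|time. indicator {s..<t} r * transported k r) = (LINT r|time. indicator {..<t} r * transported k r - indicator {..<s} r * transported k r)"
    by (rule Bochner_Integration.integral_cong) (use st in \<open>auto simp: indicator_def\<close>)
  also have "\<dots> = (LINT r|time. indicator {..<t} r * transported k r) - (LINT r|time. indicator {..<s} r * transported k r)"
    by (intro Bochner_Integration.integral_diff transported_integrable k) auto
  finally show ?thesis using evolution_potential[OF t k] evolution_potential[OF s k] by simp
qed

lemma time_integral_bound:
  fixes h :: "real => real"
  assumes st: "0 <= s" "s <= t" "t <= T" and h: "integrable time (\<lambda>r. indicator {s..<t} r * h r)"
    and b: "AE r in time. r \<in> {s..<t} \<longrightarrow> \<bar>h r\<bar> <= b"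
  shows "\<bar>LINT r|time. indicator {s..<t} r * h r\<bar> <= (t - s) * b"
proof -
  have one: "(LINT r|time. indicator {s..<t} r) = t - s"
  proof -
    have "(LINT r|time. indicator {s..<t} r) = measure time ({s..<t} \<inter> space time)"
      by (simp add: Int_commute)
    also have "\<dots> = measure lebesgue ({0<..<T} \<inter> {s..<t})"
      by (subst measure_restrict_space) (auto simp: Int_commute Int_left_commute)
    also have "\<dots> = t - s"
    proof (cases "s = 0")
      case True
      then have "{0<..<T} \<inter> {s..<t} = {0<..<t}" using st by auto
      then show ?thesis using st True by simp
    next
      case False
      then have "{0<..<T} \<inter> {s..<t} = {s..<t}" using st by auto
      then show ?thesis using st by simp
    qed
    finally show ?thesis .
  qed
  interpret finite_measure time by (rule finite_measure_interval)
  have im: "(indicator {s..<t} :: real => real) \<in> borel_measurable time"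
    by (rule borel_measurable_lebesgue_onI) measurable
  have ii: "integrable time (indicator {s..<t} :: real => real)"
    by (rule integrable_const_bound[of _ 1]) (use im in \<open>auto simp: indicator_def\<close>)
  have "\<bar>LINT r|time. indicator {s..<t} r * h r\<bar> <= (LINT r|time. \<bar>indicator {s..<t} r * h r\<bar>)" by (rule integral_abs_bound)
  also have "\<dots> <= (LINT r|time. indicator {s..<t} r * b)"
  proof (rule integral_mono_AE)
    show "AE r in time. \<bar>indicator {s..<t} r * h r\<bar> <= indicator {s..<t} r * b"
      using b by eventually_elim (auto simp: indicator_def)
  qed (use h ii in auto)
  also have "\<dots> = (t - s) * b" using one by simp
  finally show ?thesis .
qed

text \<open>The square norm of \<open>w t - w s\<close> is an integral of the flux paired with \<open>w t - w
  s\<close> itself; the Cauchy-Schwarz inequality cancels one factor.\<close>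

lemma potential_lipschitz:
  assumes s: "s \<in> {0..<T}" and t: "t \<in> {0..<T}" and st: "s <= t"
  shows "sqrt (LINT x|torus L. (w t x - w s x)\<^sup>2) <= sqrt E * (t - s)"
proof -
  define X where "X = sqrt (LINT x|torus L. (w t x - w s x)\<^sup>2)"
  have X0: "0 <= X" by (simp add: X_def)
  note i = L2_mult_integrable[OF w_L2 w_L2]
  have "X\<^sup>2 = (LINT x|torus L. (w t x - w s x)\<^sup>2)" by (simp add: X_def)
  also have "\<dots> = (LINT x|torus L. (w t x * w t x - w s x * w t x) - (w t x * w s x - w s x * w s x))"
    by (rule Bochner_Integration.integral_cong) (auto simp: power2_eq_square algebra_simps)
  also have "\<dots> = ((LINT x|torus L. w t x * w t x) - (LINT x|torus L. w s x * w t x)) - ((LINT x|torus L. w t x * w s x) - (LINT x|torus L. w s x * w s x))"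
    by (simp only: Bochner_Integration.integral_diff Bochner_Integration.integrable_diff i[OF t t] i[OF s t] i[OF t s] i[OF s s])
  also have "\<dots> = - ((LINT r|time. indicator {s..<t} r * transported t r) - (LINT r|time. indicator {s..<t} r * transported s r))"
    unfolding evolution_between[OF s t t st] evolution_between[OF s t s st] by simp
  also have "(LINT r|time. indicator {s..<t} r * transported t r) - (LINT r|time. indicator {s..<t} r * transported s r)
    = (LINT r|time. indicator {s..<t} r * (transported t r - transported s r))"
    unfolding right_diff_distrib
    by (intro Bochner_Integration.integral_diff[symmetric] transported_integrable s t) auto
  also have "- \<dots> <= \<bar>\<dots>\<bar>" by simp
  also have "\<dots> <= (t - s) * (sqrt E * X)"
  proof (rule time_integral_bound)
    show "integrable time (\<lambda>r. indicator {s..<t} r * (transported t r - transported s r))"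
      unfolding right_diff_distrib by (intro Bochner_Integration.integrable_diff transported_integrable s t) auto
    show "AE r in time. r \<in> {s..<t} \<longrightarrow> \<bar>transported t r - transported s r\<bar> <= sqrt E * X"
      using flux_slices by eventually_elim (use transported_combination[OF s t] in \<open>auto simp: X_def\<close>)
  qed (use s t st in auto)
  finally have "X * X <= (sqrt E * (t - s)) * X" by (simp add: power2_eq_square mult_ac)
  then have "X <= sqrt E * (t - s)" using X0 E st by (cases "X = 0") auto
  then show ?thesis by (simp add: X_def)
qed

text \<open>The function \<open>m w\<close> has mean zero, so incompressibility allows \<open>f\<close> to be
  replaced by \<open>f - m\<close>. Expanding the square, the marginal property evaluates the mixed term, and
  \<open>f\<^sup>2 <= 1\<close> leaves the defect.\<close>

lemma transported_defect:
  "AE r in time. \<bar>transported r r\<bar> <= sqrt E * sqrt (defect r)"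
proof -
  have "AE r in time. V r \<in> L2 (torus L) \<and> (LINT x|torus L. (V r x)\<^sup>2) <= E" using flux_velocity by (simp add: flux_def)
  then show ?thesis
    using flux_slices incompressible AE_space
  proof eventually_elim
    case (elim r)
    then have r: "r \<in> {0..<T}" by simp
    note pr = profile_m[OF r]
    have mb [measurable]: "m r \<in> borel_measurable borel" and wb [measurable]: "mean_free L (m r) \<in> borel_measurable borel"
      using profile_borel(1,4)[OF pr] by auto
    obtain C0 where C0: "\<And>s. s \<in> {0..L} ==> \<bar>mean_free L (m r) s\<bar> <= C0" using mean_free_bound[OF pr] by blast
    define C where "C = max 1 C0"
    have C1: "1 <= C" and C: "\<bar>mean_free L (m r) s\<bar> <= C" if "s \<in> {0..L}" for s
      using C0[OF that] by (auto simp: C_def)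
    have C1: "1 <= C" by (simp add: C_def)
    have wm: "\<bar>mean_free L (m r) s * m r s\<bar> <= C" if "s \<in> {0..L}" for s
      using mult_mono[OF C[OF that] profile_borel(2)[OF pr], of s] C1 by (simp add: abs_mult)
    define g where "g = (\<lambda>s. if s \<in> {0..L} then mean_free L (m r) s * m r s / C else 0)"
    have gb [measurable]: "g \<in> borel_measurable borel" unfolding g_def by measurable
    have g1: "\<bar>g s\<bar> <= 1" for s using wm[of s] C1 by (auto simp: g_def)
    have gw: "C * g (x $ i) = w r x * m r (x $ i)" if "x \<in> space (torus L)" for x
      using that C1 cube_coordinate[of x L i] by (simp add: g_def)
    have "(LINT x|torus L. C * g ((x::real^'n) $ i)) = (LINT x|torus L. w r x * m r (x $ i))"
      by (rule Bochner_Integration.integral_cong) (use gw in auto)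
    then have "(LINT x|torus L. g ((x::real^'n) $ i)) = 0"
      using potential_orthogonal[OF L pr, of i] C1 by simp
    then have "integral {0..L} g = 0"
      using torus_integral_coordinate[OF L gb g1, of i] L by simp
    then have pg: "profile L g" using gb g1 by (simp add: profile_def)
    have "(LINT x|torus L. V r x * g (x $ i)) = 0" using elim pg by blast
    moreover have "(LINT x|torus L. V r x * (w r x * m r (x $ i))) = (LINT x|torus L. C * (V r x * g (x $ i)))"
      by (rule Bochner_Integration.integral_cong) (use gw in \<open>auto simp: mult.left_commute\<close>)
    ultimately have orth: "(LINT x|torus L. V r x * (w r x * m r (x $ i))) = 0" by simp
    have VL: "V r \<in> L2 (torus L)" using elim by simp
    have wmL: "(\<lambda>x. w r x * m r (x $ i)) \<in> L2 (torus L)"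
    proof (rule torus_lift_L2(1)[OF L, of "\<lambda>s. mean_free L (m r) s * m r s"])
      show "(\<lambda>s. mean_free L (m r) s * m r s) \<in> borel_measurable borel" by measurable
    qed (rule wm)
    have fm [measurable]: "f r \<in> borel_measurable (torus L)" by (rule density_measurable[OF r])
    have wlm [measurable]: "w r \<in> borel_measurable (torus L)" by (rule torus_lift_measurable[OF wb])
    have mlm [measurable]: "(\<lambda>x::real^'n. m r (x $ i)) \<in> borel_measurable (torus L)" by (rule torus_lift_measurable[OF mb])
    have fwL: "(\<lambda>x. f r x * w r x) \<in> L2 (torus L)"
    proof (rule torus_L2_bounded[OF L])
      show "AE x in torus L. \<bar>f r x * w r x\<bar> <= C"
        using density_bound[OF r] AE_space
      proof eventually_elim
        case (elim x)
        then have "\<bar>w r x\<bar> <= C" by (intro C cube_coordinate) simp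
        from mult_mono[OF elim(1) this] show ?case by (simp add: abs_mult)
      qed
    qed measurable
    define h where "h = (\<lambda>x. f r x * w r x - w r x * m r (x $ i))"
    have hL: "h \<in> L2 (torus L)" unfolding h_def by (rule L2_diff[OF fwL wmL])
    have "transported r r = (LINT x|torus L. V r x * (f r x * w r x)) - (LINT x|torus L. V r x * (w r x * m r (x $ i)))"
      unfolding transported_def orth by (simp add: mult_ac)
    also have "\<dots> = (LINT x|torus L. V r x * h x)"
      unfolding h_def right_diff_distrib
      by (rule Bochner_Integration.integral_diff[symmetric]) (intro L2_mult_integrable VL fwL wmL)+
    finally have "\<bar>transported r r\<bar> <= sqrt (LINT x|torus L. (V r x)\<^sup>2) * sqrt (LINT x|torus L. (h x)\<^sup>2)"
      using cauchy_schwarz_sqrt[OF VL hL] by simp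
    also have "\<dots> <= sqrt E * sqrt (defect r)"
    proof (intro mult_mono real_sqrt_le_mono)
      have i1: "integrable (torus L) (\<lambda>x. (w r x)\<^sup>2)" using w_L2[OF r] by (simp add: L2_real_iff)
      have i2: "integrable (torus L) (\<lambda>x. (w r x)\<^sup>2 * (m r (x $ i))\<^sup>2)" using wmL by (simp add: L2_real_iff power_mult_distrib)
      have i3: "integrable (torus L) (\<lambda>x. f r x * ((w r x)\<^sup>2 * m r (x $ i)))"
        using L2_mult_integrable[OF fwL wmL] by (simp add: power2_eq_square mult_ac)
      have "(LINT x|torus L. (h x)\<^sup>2) <= (LINT x|torus L. (w r x)\<^sup>2 - 2 * (f r x * ((w r x)\<^sup>2 * m r (x $ i))) + (w r x)\<^sup>2 * (m r (x $ i))\<^sup>2)"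
      proof (rule integral_mono_AE)
        show "integrable (torus L) (\<lambda>x. (h x)\<^sup>2)" using hL by (simp add: L2_real_iff)
        show "AE x in torus L. (h x)\<^sup>2 <= (w r x)\<^sup>2 - 2 * (f r x * ((w r x)\<^sup>2 * m r (x $ i))) + (w r x)\<^sup>2 * (m r (x $ i))\<^sup>2"
          using density_bound[OF r]
        proof eventually_elim
          case (elim x)
          have "(f r x)\<^sup>2 <= 1" using elim by (simp add: abs_square_le_1)
          from mult_left_mono[OF this, of "(w r x)\<^sup>2"] show ?case by (simp add: h_def power2_eq_square algebra_simps)
        qed
      qed (use i1 i2 i3 in auto)
      also have "\<dots> = (LINT x|torus L. (w r x)\<^sup>2) - 2 * (LINT x|torus L. f r x * ((w r x)\<^sup>2 * m r (x $ i))) + (LINT x|torus L. (w r x)\<^sup>2 * (m r (x $ i))\<^sup>2)"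
        using i1 i2 i3 by simp
      also have "(LINT x|torus L. f r x * ((w r x)\<^sup>2 * m r (x $ i))) = (LINT x|torus L. m r (x $ i) * ((w r x)\<^sup>2 * m r (x $ i)))"
      proof -
        have g: "(\<lambda>s. (mean_free L (m r) s)\<^sup>2 * m r s) \<in> borel_measurable borel" by measurable
        have "\<bar>(mean_free L (m r) s)\<^sup>2 * m r s\<bar> <= C * C" if "s \<in> {0..L}" for s
          using mult_mono[OF C[OF that] wm[OF that]] C1 by (simp add: abs_mult power2_eq_square mult.assoc)
        then show ?thesis using marginal[OF r] g unfolding is_marginal_def by blast
      qed
      also have "(LINT x|torus L. m r (x $ i) * ((w r x)\<^sup>2 * m r (x $ i))) = (LINT x|torus L. (w r x)\<^sup>2 * (m r (x $ i))\<^sup>2)"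
        by (rule Bochner_Integration.integral_cong) (auto simp: power2_eq_square mult_ac)
      finally show "(LINT x|torus L. (h x)\<^sup>2) <= defect r" by (simp add: defect_def)
    qed (use elim E in auto)
    finally show ?case .
  qed
qed

text \<open>The difference of two squares is the product of sum and difference, so only the flux paired with
  \<open>w t + w s\<close> occurs. At time \<open>r\<close> both are replaced by \<open>w r\<close> at a cost
  that is of second order in \<open>t - s\<close>.\<close>

theorem energy_rate:
  assumes s: "s \<in> {0..<T}" and t: "t \<in> {0..<T}" and st: "s <= t"
    and b: "\<And>r. r \<in> {s..<t} ==> sqrt (defect r) <= b"
  shows "\<bar>energy t - energy s\<bar> <= (t - s) * (2 * sqrt E * b + 2 * E * (t - s))"
proof -
  have e: "energy k = (LINT x|torus L. w k x * w k x)" for k by (simp add: energy_def power2_eq_square)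
  have c: "(LINT x|torus L. w t x * w s x) = (LINT x|torus L. w s x * w t x)" by (simp add: mult.commute)
  have "energy t - energy s = - (LINT r|time. indicator {s..<t} r * transported t r) - (LINT r|time. indicator {s..<t} r * transported s r)"
    using evolution_between[OF s t t st] evolution_between[OF s t s st] unfolding e c by simp
  also have "\<dots> = - (LINT r|time. indicator {s..<t} r * (transported t r + transported s r))"
    unfolding distrib_left
    by (subst Bochner_Integration.integral_add) (auto intro!: transported_integrable s t)
  also have "\<bar>\<dots>\<bar> <= (t - s) * (2 * sqrt E * b + 2 * E * (t - s))"
    unfolding abs_minus_cancel
  proof (rule time_integral_bound)
    show "integrable time (\<lambda>r. indicator {s..<t} r * (transported t r + transported s r))"
      unfolding distrib_left by (intro Bochner_Integration.integrable_add transported_integrable s t) auto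
    show "AE r in time. r \<in> {s..<t} \<longrightarrow> \<bar>transported t r + transported s r\<bar> <= 2 * sqrt E * b + 2 * E * (t - s)"
      using flux_slices transported_defect AE_space
    proof eventually_elim
      case (elim r)
      show ?case
      proof
        assume rs: "r \<in> {s..<t}"
        have r: "r \<in> {0..<T}" using elim by simp
        have E2: "sqrt E * (sqrt E * x) = E * x" for x using E by (simp add: mult.assoc[symmetric])
        have "\<bar>transported t r - transported r r\<bar> <= sqrt E * (sqrt E * (t - r))"
          using rs by (intro order_trans[OF transported_combination[OF r t elim(1)]] mult_left_mono potential_lipschitz r t) (use E in auto)
        moreover have "\<bar>transported r r - transported s r\<bar> <= sqrt E * (sqrt E * (r - s))"
          using rs by (intro order_trans[OF transported_combination[OF s r elim(1)]] mult_left_mono potential_lipschitz r s) (use E in auto)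
        moreover have "\<bar>transported r r\<bar> <= sqrt E * b"
          using rs E by (intro order_trans[OF elim(2)] mult_left_mono b) auto
        moreover have "E * (t - r) + E * (r - s) = E * (t - s)" by (simp add: algebra_simps)
        moreover have "0 <= E * (t - s)" using E st by simp
        ultimately show "\<bar>transported t r + transported s r\<bar> <= 2 * sqrt E * b + 2 * E * (t - s)"
          unfolding E2 by (simp add: abs_le_iff)
      qed
    qed
  qed (use s t st in auto)
  finally show ?thesis .
qed

end

section \<open>The differential inequality\<close>

text \<open>The largest time up to which the bound with slope \<open>C + \<epsilon>\<close> holds cannot be
  smaller than \<open>b\<close>.\<close>

lemma dini_lower_bound:
  fixes F :: "real => real"
  assumes ab: "a <= b" and F: "continuous_on {a..b} F"
    and rate: "\<And>t \<epsilon>. a <= t ==> t < b ==> 0 < \<epsilon> ==> \<exists>\<delta>>0. \<forall>h. 0 < h \<and> h < \<delta> \<and> t + h <= b \<longrightarrow> F t - (C + \<epsilon>) * h <= F (t + h)"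
  shows "F a - C * (b - a) <= F b"
proof (rule field_le_epsilon)
  fix e :: real assume e: "0 < e"
  define \<epsilon> where "\<epsilon> = e / (b - a + 1)"
  have \<epsilon>: "0 < \<epsilon>" using e ab by (simp add: \<epsilon>_def)
  define S where "S = {t \<in> {a..b}. F a - (C + \<epsilon>) * (t - a) <= F t}"
  have "closed S" unfolding S_def
    by (rule continuous_on_closed_Collect_le) (auto intro!: continuous_intros F)
  have S: "a \<in> S" "S \<subseteq> {a..b}" using ab by (auto simp: S_def)
  have bdd: "bdd_above S" using S(2) by (meson bdd_above_Icc bdd_above_mono)
  define c where "c = Sup S"
  have cS: "c \<in> S" unfolding c_def by (rule closed_contains_Sup[OF _ bdd \<open>closed S\<close>]) (use S in auto)
  have "c = b"
  proof (rule ccontr)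
    assume "c \<noteq> b"
    then have c: "a <= c" "c < b" using cS S(2) by auto
    from rate[OF c \<epsilon>] obtain \<delta> where \<delta>: "0 < \<delta>" "\<And>h. 0 < h ==> h < \<delta> ==> c + h <= b ==> F c - (C + \<epsilon>) * h <= F (c + h)" by blast
    define h where "h = min (\<delta> / 2) (b - c)"
    have h: "0 < h" "h < \<delta>" "c + h <= b" using \<delta>(1) c by (auto simp: h_def min_def)
    have "F c - (C + \<epsilon>) * h <= F (c + h)" by (rule \<delta>(2)[OF h])
    moreover have "F a - (C + \<epsilon>) * (c - a) <= F c" using cS by (simp add: S_def)
    ultimately have "c + h \<in> S" using h c by (simp add: S_def algebra_simps)
    then have "c + h <= c" unfolding c_def by (rule cSup_upper[OF _ bdd])
    then show False using h by simp
  qed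
  then have "F a - (C + \<epsilon>) * (b - a) <= F b" using cS by (simp add: S_def)
  moreover have "\<epsilon> * (b - a) <= e" using e ab by (simp add: \<epsilon>_def divide_simps mult_left_mono)
  ultimately show "F a - C * (b - a) <= F b + e" by (simp add: algebra_simps)
qed

text \<open>The solution \<open>z\<close> in \<open>[0,1]\<close> of \<open>x = M z (2 - z)\<close>.\<close>

definition layer :: "real => real => real" where
  "layer M x = 1 - sqrt (1 - x / M)"

text \<open>Up to scaling, the time needed to bring the energy from \<open>x\<close> down to zero at maximal
  rate.\<close>

definition travel :: "real => real => real" where
  "travel M x = sqrt 2 * S_fun (sqrt (layer M x))"

text \<open>The bound for the square root of the defect at energy \<open>x\<close>, by
  \<open>defect_speed\<close>.\<close>

definition speed :: "real => real => real" where
  "speed M x = sqrt (2 * M * layer M x * (1 - layer M x))"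

lemma layer_range:
  assumes "0 < M" "0 <= x" "x <= M"
  shows "0 <= layer M x" "layer M x <= 1" "x = M * layer M x * (2 - layer M x)"
proof -
  have r: "0 <= 1 - x / M" "1 - x / M <= 1" using assms by auto
  show "0 <= layer M x" "layer M x <= 1" using r by (auto simp: layer_def)
  have "layer M x * (2 - layer M x) = 1 - (sqrt (1 - x / M))\<^sup>2" by (simp add: layer_def power2_eq_square algebra_simps)
  also have "\<dots> = x / M" using r by simp
  finally show "x = M * layer M x * (2 - layer M x)" using assms by (simp add: mult.assoc)
qed

lemma layer_continuous: "0 < M ==> continuous_on S (layer M)"
  unfolding layer_def[abs_def] by (intro continuous_intros) auto

lemma speed_continuous: "0 < M ==> continuous_on S (speed M)"
  unfolding speed_def[abs_def] by (intro continuous_intros layer_continuous)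

lemma travel_continuous:
  assumes "0 < M"
  shows "continuous_on {0..M} (travel M)"
proof -
  have "-1 <= sqrt (layer M x)" "sqrt (layer M x) <= 1" if "x \<in> {0..M}" for x
    using layer_range(1,2)[OF assms, of x] that by (auto intro: order_trans[of _ 0])
  then show ?thesis unfolding travel_def[abs_def] S_fun_def
    by (intro continuous_intros layer_continuous[OF assms]) auto
qed

lemma travel_0: "travel M 0 = 0" by (simp add: travel_def layer_def S_fun_def)

lemma S_fun_deriv:
  assumes "\<bar>a\<bar> < 1"
  shows "(S_fun has_real_derivative sqrt (1 - a\<^sup>2)) (at a)"
proof -
  have p: "0 < 1 - a\<^sup>2" using assms by (simp add: abs_square_less_1)
  have s: "sqrt (1 - a\<^sup>2) * sqrt (1 - a\<^sup>2) = 1 - a\<^sup>2" using p by simp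
  have s0: "0 < sqrt (1 - a\<^sup>2)" using p by simp
  have "((\<lambda>a. (arcsin a + a * sqrt (1 - a\<^sup>2)) / 2) has_real_derivative
    (inverse (sqrt (1 - a\<^sup>2)) + (1 * sqrt (1 - a\<^sup>2) + a * ((0 - 2 * a) * (inverse (sqrt (1 - a\<^sup>2)) / 2)))) / 2) (at a)"
    using assms p by (auto intro!: derivative_eq_intros simp: abs_less_iff)
  moreover have "(inverse (sqrt (1 - a\<^sup>2)) + (1 * sqrt (1 - a\<^sup>2) + a * ((0 - 2 * a) * (inverse (sqrt (1 - a\<^sup>2)) / 2)))) / 2 = sqrt (1 - a\<^sup>2)"
    using s s0 by (simp add: field_simps power2_eq_square)
  ultimately show ?thesis unfolding S_fun_def[abs_def] by (rule DERIV_cong)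
qed

text \<open>The constants of \<open>travel\<close> are chosen to make this product one.\<close>

lemma travel_deriv:
  assumes M: "0 < M" and x: "0 < x" "x < M"
  shows "\<exists>D. (travel M has_real_derivative D) (at x) \<and> 0 <= D \<and> D * speed M x * 2 * sqrt M = 1"
proof -
  define s where "s = sqrt (1 - x / M)"
  have r: "0 < 1 - x / M" "1 - x / M < 1" using M x by auto
  have s: "0 < s" "s < 1" using r by (auto simp: s_def)
  have z: "layer M x = 1 - s" by (simp add: layer_def s_def)
  define \<alpha> where "\<alpha> = sqrt (1 - s)"
  have \<alpha>: "0 < \<alpha>" "\<alpha> < 1" using s by (auto simp: \<alpha>_def)
  have \<alpha>2: "\<alpha>\<^sup>2 = 1 - s" using s by (simp add: \<alpha>_def)
  have dl: "(layer M has_real_derivative inverse s / 2 / M) (at x)"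
  proof -
    have "((\<lambda>x. 1 - sqrt (1 - x / M)) has_real_derivative 0 - (0 - 1 / M) * (inverse (sqrt (1 - x / M)) / 2)) (at x)"
      using r M by (auto intro!: derivative_eq_intros)
    then show ?thesis unfolding layer_def[abs_def] s_def by (simp add: mult_ac)
  qed
  have da: "((\<lambda>x. sqrt (layer M x)) has_real_derivative (inverse \<alpha> / 2) * (inverse s / 2 / M)) (at x)"
    using DERIV_chain2[OF DERIV_real_sqrt dl] s unfolding z \<alpha>_def by simp
  have S: "(S_fun has_real_derivative sqrt (1 - \<alpha>\<^sup>2)) (at (sqrt (layer M x)))"
    using S_fun_deriv[of \<alpha>] \<alpha> unfolding z \<alpha>_def by simp
  define D where "D = sqrt 2 * (sqrt (1 - \<alpha>\<^sup>2) * ((inverse \<alpha> / 2) * (inverse s / 2 / M)))"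
  have d: "(travel M has_real_derivative D) (at x)"
    unfolding travel_def[abs_def] D_def by (intro DERIV_cmult DERIV_chain2[OF S da])
  have D0: "0 <= D" using \<alpha> s M unfolding D_def \<alpha>2 by simp
  have sp: "speed M x = sqrt 2 * sqrt M * \<alpha> * sqrt s" unfolding speed_def z \<alpha>_def by (simp add: real_sqrt_mult)
  have "D * speed M x * 2 * sqrt M = (sqrt 2 * sqrt 2) * (sqrt M * sqrt M) * (sqrt s * sqrt s) * (inverse \<alpha> * \<alpha>) * inverse s * 2 / 4 / M"
    unfolding D_def \<alpha>2 sp by simp
  also have "\<dots> = 1" using \<alpha> s M by simp
  finally show ?thesis using d D0 by blast
qed

lemma clip_lipschitz: "\<bar>max a (min b x) - max a (min b y)\<bar> <= \<bar>x - y\<bar>" for a b x y :: real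
  by (auto simp: max_def min_def)

text \<open>The function \<open>travel\<close> is differentiable only inside \<open>(0,M)\<close>, so the
  energy is clipped to a window \<open>[\<epsilon>,A1]\<close>. Inside the window the chain rule holds for
  difference quotients, as clipping does not increase distances. Finally the window is enlarged.\<close>

theorem travel_time:
  fixes A :: "real => real"
  assumes M: "0 < M" and e: "0 < e" and T: "0 < T"
    and range: "\<And>t. t \<in> {0..<T} ==> 0 <= A t \<and> A t <= M"
    and rate: "\<And>s t b. s \<in> {0..<T} ==> t \<in> {0..<T} ==> s <= t ==> (\<And>r. r \<in> {s..<t} ==> speed M (A r) <= b) ==>
      \<bar>A t - A s\<bar> <= (t - s) * (2 * e * b + 2 * e\<^sup>2 * (t - s))"
    and lim: "\<And>\<eta>. 0 < \<eta> ==> \<exists>t\<in>{0..<T}. A t < \<eta>"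
  shows "travel M (A 0) <= e / sqrt M * T"
proof -
  have spb: "\<exists>B. \<forall>x\<in>{0..M}. speed M x <= B"
  proof -
    have "compact (speed M ` {0..M})" by (intro compact_continuous_image speed_continuous M) simp
    then obtain B where "\<forall>y\<in>speed M ` {0..M}. norm y <= B" using compact_imp_bounded bounded_iff by metis
    then show ?thesis by (intro exI[of _ B]) force
  qed
  then obtain B where B: "\<And>x. x \<in> {0..M} ==> speed M x <= B" by blast
  have AB: "speed M (A r) <= B" if "r \<in> {0..<T}" for r using range[OF that] by (intro B) simp
  define K where "K = 2 * e * B + 2 * e\<^sup>2 * T"
  have lip: "\<bar>A t - A s\<bar> <= K * (t - s)" if "s \<in> {0..<T}" "t \<in> {0..<T}" "s <= t" for s t
  proof -
    have "\<bar>A t - A s\<bar> <= (t - s) * (2 * e * B + 2 * e\<^sup>2 * (t - s))" by (rule rate[OF that]) (use AB that in auto)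
    also have "\<dots> <= (t - s) * K" unfolding K_def using that e by (intro mult_left_mono add_left_mono) auto
    finally show ?thesis by (simp add: mult.commute)
  qed
  have Ac: "continuous_on {0..<T} A"
  proof (rule lipschitz_on_continuous_on[of "\<bar>K\<bar>"], rule lipschitz_onI)
    fix s t assume st: "s \<in> {0..<T}" "t \<in> {0..<T}"
    have "dist (A s) (A t) <= K * \<bar>s - t\<bar>"
      using lip[of s t] lip[of t s] st by (cases "s <= t") (auto simp: dist_real_def abs_minus_commute)
    also have "\<dots> <= \<bar>K\<bar> * dist s t" by (simp add: dist_real_def mult_right_mono)
    finally show "dist (A s) (A t) <= \<bar>K\<bar> * dist s t" .
  qed simp
  define C where "C = e / sqrt M"
  have main: "travel M A1 - travel M \<epsilon> <= C * T" if \<epsilon>: "0 < \<epsilon>" "\<epsilon> < A1" and A1: "A1 < A 0" for \<epsilon> A1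
  proof -
    from lim[OF \<epsilon>(1)] obtain b where b: "b \<in> {0..<T}" "A b < \<epsilon>" by blast
    have A1M: "A1 < M" using A1 range[of 0] T by auto
    define cl where "cl = (\<lambda>x. max \<epsilon> (min A1 x))"
    define F where "F = (\<lambda>t. travel M (cl (A t)))"
    have clr: "cl x \<in> {0..M}" for x using \<epsilon> A1M by (auto simp: cl_def)
    have sub: "{0..b} \<subseteq> {0..<T}" using b by auto
    have clc: "continuous_on {0..b} (\<lambda>t. cl (A t))"
      unfolding cl_def by (intro continuous_intros continuous_on_subset[OF Ac sub])
    have Fc: "continuous_on {0..b} F" unfolding F_def
      by (rule continuous_on_compose2[OF travel_continuous[OF M] clc]) (use clr in auto)
    have "F 0 - C * (b - 0) <= F b"
    proof (rule dini_lower_bound[OF _ Fc])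
      show "0 <= b" using b by simp
      fix t \<eta> :: real assume t: "0 <= t" "t < b" and \<eta>: "0 < \<eta>"
      have tT: "t \<in> {0..<T}" using t b by auto
      have near: "\<exists>\<delta>>0. \<forall>h. 0 <= h \<and> h < \<delta> \<and> t + h <= b \<longrightarrow> \<bar>g (A (t + h)) - g (A t)\<bar> < \<kappa>"
        if g: "continuous_on UNIV g" and \<kappa>: "0 < \<kappa>" for g :: "real => real" and \<kappa> :: real
      proof -
        have "continuous_on {0..b} (\<lambda>t. g (A t))"
          by (rule continuous_on_compose2[OF g continuous_on_subset[OF Ac sub]]) auto
        then obtain \<delta> where "\<delta> > 0" "\<And>t'. t' \<in> {0..b} ==> dist t' t < \<delta> ==> dist (g (A t')) (g (A t)) < \<kappa>"
          using \<kappa> t unfolding continuous_on_iff by (metis atLeastAtMost_iff less_imp_le)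
        then show ?thesis using t by (intro exI[of _ \<delta>]) (auto simp: dist_real_def)
      qed
      show "\<exists>\<delta>>0. \<forall>h. 0 < h \<and> h < \<delta> \<and> t + h <= b \<longrightarrow> F t - (C + \<eta>) * h <= F (t + h)"
      proof (cases "A t < \<epsilon> \<or> A1 < A t")
        case True
        \<comment> \<open>outside of the window the clipped energy is locally constant\<close>
        define \<kappa> where "\<kappa> = (if A t < \<epsilon> then \<epsilon> - A t else A t - A1)"
        have "0 < \<kappa>" using True by (auto simp: \<kappa>_def)
        from near[OF continuous_on_id this] obtain \<delta> where \<delta>: "\<delta> > 0" "\<And>h. 0 <= h ==> h < \<delta> ==> t + h <= b ==> \<bar>A (t + h) - A t\<bar> < \<kappa>"
          by auto
        have "F (t + h) = F t" if "0 < h" "h < \<delta>" "t + h <= b" for h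
        proof -
          have "cl (A (t + h)) = cl (A t)"
            using \<delta>(2)[of h] that True \<epsilon> by (auto simp: cl_def \<kappa>_def max_def min_def split: if_splits)
          then show ?thesis by (simp add: F_def)
        qed
        moreover have "0 <= (C + \<eta>) * h" if "0 < h" for h using that \<eta> e M by (simp add: C_def)
        ultimately show ?thesis using \<delta>(1) by (intro exI[of _ \<delta>]) auto
      next
        case False
        define x where "x = A t"
        have x: "\<epsilon> <= x" "x <= A1" using False by (auto simp: x_def)
        have clx: "cl (A t) = x" using x by (simp add: cl_def x_def)
        obtain D where D: "(travel M has_real_derivative D) (at x)" "0 <= D" "D * speed M x * 2 * sqrt M = 1"
          using travel_deriv[OF M, of x] x \<epsilon> A1M by auto
        \<comment> \<open>the slope obtained when derivative, speed and step are all off by \<open>\<kappa>\<close>\<close>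
        define P where "P = (\<lambda>\<kappa>. (D + \<kappa>) * (2 * e * (speed M x + \<kappa>) + 2 * e\<^sup>2 * \<kappa>))"
        have P0: "P 0 = C"
        proof -
          have sM: "sqrt M \<noteq> 0" using M by simp
          have "P 0 * sqrt M = e * (D * speed M x * 2 * sqrt M)" by (simp add: P_def mult_ac)
          also have "\<dots> = e" by (simp only: D(3) mult_1_right)
          finally show ?thesis using sM by (simp add: C_def eq_divide_eq)
        qed
        have "continuous_on UNIV P" unfolding P_def by (intro continuous_intros)
        then have "\<exists>d>0. \<forall>\<kappa>. dist \<kappa> 0 < d \<longrightarrow> dist (P \<kappa>) (P 0) < \<eta>"
          using \<eta> unfolding continuous_on_iff by (metis UNIV_I)
        then obtain d where d: "0 < d" "\<And>\<kappa>. dist \<kappa> 0 < d ==> dist (P \<kappa>) (P 0) < \<eta>" by blast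
        define \<kappa> where "\<kappa> = d / 2"
        have \<kappa>: "0 < \<kappa>" using d by (simp add: \<kappa>_def)
        have P\<kappa>: "P \<kappa> <= C + \<eta>" using d(2)[of \<kappa>] d(1) unfolding P0 by (auto simp: \<kappa>_def dist_real_def)
        have "(travel M has_derivative (*) D) (at x)" using D(1) by (simp add: has_field_derivative_def)
        then obtain d1 where d1: "0 < d1" "\<And>y. norm (y - x) < d1 ==> norm (travel M y - travel M x - D * (y - x)) <= \<kappa> * norm (y - x)"
          using \<kappa> unfolding has_derivative_at_alt by blast
        from near[OF continuous_on_id d1(1)] obtain \<delta>1 where \<delta>1: "\<delta>1 > 0"
          "\<And>h. 0 <= h ==> h < \<delta>1 ==> t + h <= b ==> \<bar>A (t + h) - x\<bar> < d1" by (auto simp: x_def)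
        from near[OF speed_continuous[OF M] \<kappa>] obtain \<delta>2 where \<delta>2: "\<delta>2 > 0"
          "\<And>h. 0 <= h ==> h < \<delta>2 ==> t + h <= b ==> \<bar>speed M (A (t + h)) - speed M x\<bar> < \<kappa>" by (auto simp: x_def)
        define \<delta> where "\<delta> = min \<kappa> (min \<delta>1 \<delta>2)"
        have \<delta>: "0 < \<delta>" using \<kappa> \<delta>1 \<delta>2 by (simp add: \<delta>_def)
        have "F t - (C + \<eta>) * h <= F (t + h)" if h: "0 < h" "h < \<delta>" "t + h <= b" for h
        proof -
          define y where "y = cl (A (t + h))"
          have th: "t + h \<in> {0..<T}" using h t b by auto
          have "\<bar>A (t + h) - A t\<bar> <= (t + h - t) * (2 * e * (speed M x + \<kappa>) + 2 * e\<^sup>2 * (t + h - t))"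
          proof (rule rate[OF tT th])
            show "speed M (A r) <= speed M x + \<kappa>" if "r \<in> {t..<t + h}" for r
              using \<delta>2(2)[of "r - t"] that h by (auto simp: \<delta>_def)
          qed (use h in simp)
          also have "\<dots> <= h * (2 * e * (speed M x + \<kappa>) + 2 * e\<^sup>2 * \<kappa>)"
            using h by (auto intro!: mult_left_mono simp: \<delta>_def)
          finally have Ah: "\<bar>A (t + h) - A t\<bar> <= h * (2 * e * (speed M x + \<kappa>) + 2 * e\<^sup>2 * \<kappa>)" .
          have yx: "\<bar>y - x\<bar> <= \<bar>A (t + h) - A t\<bar>" using clip_lipschitz[of \<epsilon> A1 "A (t + h)" "A t"] clx by (simp add: y_def cl_def)
          have "\<bar>y - x\<bar> < d1" using yx \<delta>1(2)[of h] h by (simp add: \<delta>_def x_def)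
          then have "\<bar>travel M y - travel M x - D * (y - x)\<bar> <= \<kappa> * \<bar>y - x\<bar>" using d1(2)[of y] by simp
          moreover have "\<bar>D * (y - x)\<bar> = D * \<bar>y - x\<bar>" using D(2) by (simp add: abs_mult)
          ultimately have "\<bar>travel M y - travel M x\<bar> <= (D + \<kappa>) * \<bar>y - x\<bar>" by (simp add: distrib_right abs_le_iff) linarith
          also have "\<dots> <= (D + \<kappa>) * (h * (2 * e * (speed M x + \<kappa>) + 2 * e\<^sup>2 * \<kappa>))"
            using D(2) \<kappa> yx Ah by (intro mult_left_mono) auto
          also have "\<dots> = P \<kappa> * h" by (simp add: P_def mult_ac)
          also have "\<dots> <= (C + \<eta>) * h" using P\<kappa> h by (intro mult_right_mono) auto
          finally show ?thesis by (simp add: F_def clx y_def[symmetric] abs_le_iff)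
        qed
        then show ?thesis using \<delta> by blast
      qed
    qed
    moreover have "F 0 = travel M A1" "F b = travel M \<epsilon>" using A1 \<epsilon> b by (auto simp: F_def cl_def max_def min_def)
    moreover have "C * b <= C * T" using b e M by (intro mult_left_mono) (auto simp: C_def)
    ultimately show ?thesis by simp
  qed
  show ?thesis
  proof (cases "A 0 = 0")
    case True
    then show ?thesis using e M T by (simp add: travel_0)
  next
    case False
    define a where "a = A 0"
    have a: "0 < a" "a <= M" using False range[of 0] T by (auto simp: a_def)
    have inv: "(\<lambda>n. 1 / real (n + 3)) \<longlonglongrightarrow> 0" using LIMSEQ_ignore_initial_segment[OF lim_1_over_n, of 3] by simp
    have fr: "0 < 1 / real (n + 3)" "1 / real (n + 3) < 1 / 2" for n by (auto simp: divide_simps)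
    have lm: "travel M (a * (1 - 1 / real (n + 3))) - travel M (a * (1 / real (n + 3))) <= C * T" for n
    proof (rule main)
      show "0 < a * (1 / real (n + 3))" using a fr by simp
      show "a * (1 / real (n + 3)) < a * (1 - 1 / real (n + 3))"
        by (rule mult_strict_left_mono) (use a fr[of n] in linarith)+
      have "a * (1 - 1 / real (n + 3)) < a * 1" by (rule mult_strict_left_mono) (use a fr[of n] in linarith)+
      then show "a * (1 - 1 / real (n + 3)) < A 0" by (simp add: a_def)
    qed
    have cont: "(\<lambda>n. travel M (y n)) \<longlonglongrightarrow> travel M z" if "y \<longlonglongrightarrow> z" "\<And>n. y n \<in> {0..M}" "z \<in> {0..M}" for y z
      using travel_continuous[OF M] that unfolding continuous_on_sequentially by (auto simp: o_def)
    have le: "a * c \<in> {0..M}" if "0 <= c" "c <= 1" for c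
      using mult_mono[OF a(2) that(2)] a that M by simp
    have "(\<lambda>n. travel M (a * (1 - 1 / real (n + 3))) - travel M (a * (1 / real (n + 3)))) \<longlonglongrightarrow> travel M (a * (1 - 0)) - travel M (a * 0)"
      by (intro tendsto_diff cont tendsto_mult tendsto_const inv le) (auto simp: divide_simps)
    then have "travel M (a * (1 - 0)) - travel M (a * 0) <= C * T"
      by (rule LIMSEQ_le_const2) (use lm in blast)
    then show ?thesis by (simp add: travel_0 a_def C_def)
  qed
qed

section \<open>The lower bound for the mixing time\<close>

context marginal_flow
begin

text \<open>The square of \<open>H_max\<close>.\<close>

definition max_energy :: real where "max_energy = L ^ (CARD('n) - 1) * (L ^ 3 / 48)"

lemma max_energy_pos: "0 < max_energy" using L by (simp add: max_energy_def)

text \<open>The one-dimensional inequality, integrated over the remaining coordinates.\<close>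

lemma energy_inequality:
  assumes t: "t \<in> {0..<T}" and z: "0 <= z" "z <= 1"
  shows "z * energy t - (1 - z) * (energy t - defect t) <= max_energy * z\<^sup>2"
proof -
  note p = profile_m[OF t]
  have mb [measurable]: "m t \<in> borel_measurable borel" and wb [measurable]: "mean_free L (m t) \<in> borel_measurable borel"
    using profile_borel(1,4)[OF p] by auto
  obtain B where B: "\<And>s. s \<in> {0..L} ==> \<bar>mean_free L (m t) s\<bar> <= B" using mean_free_bound[OF p] by blast
  define c where "c = - (integral {0..L} (prim (m t)) / L)"
  have w: "c + prim (m t) s = mean_free L (m t) s" for s by (simp add: mean_free_def c_def)
  have pi: "prim (m t) integrable_on {0..L}"
    by (rule integrable_continuous_real[OF prim_continuous[OF profile_borel(1,2)[OF p]]])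
  have "integral {0..L} (\<lambda>s. c + prim (m t) s) = integral {0..L} (\<lambda>s. c) + integral {0..L} (prim (m t))"
    by (rule Henstock_Kurzweil_Integration.integral_add[OF integrable_const_ivl pi])
  then have w0: "integral {0..L} (\<lambda>s. c + prim (m t) s) = 0" using L by (simp add: c_def)
  note ti = transport_inequality[OF z L profile_borel(1,2,3)[OF p] w0, unfolded w]
  have e1: "(LINT x|torus L. (w t x)\<^sup>2) = L ^ (CARD('n) - 1) * integral {0..L} (\<lambda>s. (mean_free L (m t) s)\<^sup>2)"
  proof (rule torus_integral_coordinate[OF L])
    show "\<bar>(mean_free L (m t) s)\<^sup>2\<bar> <= B\<^sup>2" if "s \<in> {0..L}" for s using sq_mult_bound[OF B[OF that], of 1] by simp
  qed measurable
  have e2: "(LINT x|torus L. (w t x)\<^sup>2 * (m t (x $ i))\<^sup>2) = L ^ (CARD('n) - 1) * integral {0..L} (\<lambda>s. (mean_free L (m t) s)\<^sup>2 * (m t s)\<^sup>2)"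
  proof (rule torus_integral_coordinate[OF L])
    show "\<bar>(mean_free L (m t) s)\<^sup>2 * (m t s)\<^sup>2\<bar> <= B\<^sup>2" if "s \<in> {0..L}" for s
      by (rule sq_mult_bound[OF B[OF that] profile_borel(2)[OF p]])
  qed measurable
  have "z * energy t - (1 - z) * (energy t - defect t) = L ^ (CARD('n) - 1) *
    (z * integral {0..L} (\<lambda>s. (mean_free L (m t) s)\<^sup>2) - (1 - z) * integral {0..L} (\<lambda>s. (mean_free L (m t) s)\<^sup>2 * (m t s)\<^sup>2))"
    unfolding energy_def defect_def e1 e2 by (simp add: algebra_simps)
  also have "\<dots> <= L ^ (CARD('n) - 1) * (L ^ 3 / 48 * z\<^sup>2)"
    using ti L by (intro mult_left_mono) auto
  finally show ?thesis by (simp add: max_energy_def mult.assoc)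
qed

lemma energy_range: "t \<in> {0..<T} ==> 0 <= energy t \<and> energy t <= max_energy"
  using energy_inequality[of t 1] by (simp add: energy_def)

text \<open>For \<open>z < 1\<close> the inequality for this very \<open>z\<close> is solved for the defect.
  At the maximal energy \<open>z = 1\<close> it degenerates, and nearby values \<open>1 - y\<close> show that
  the defect is not positive.\<close>

lemma defect_speed:
  assumes t: "t \<in> {0..<T}"
  shows "sqrt (defect t) <= speed max_energy (energy t)"
proof -
  define z where "z = layer max_energy (energy t)"
  have z: "0 <= z" "z <= 1" "energy t = max_energy * z * (2 - z)"
    using layer_range[OF max_energy_pos] energy_range[OF t] unfolding z_def by blast+
  have M: "0 < max_energy" by (rule max_energy_pos)
  have "defect t <= 2 * max_energy * z * (1 - z)"
  proof (cases "z = 1")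
    case False
    then have z1: "0 < 1 - z" using z by simp
    have "(1 - z) * defect t <= max_energy * z\<^sup>2 + (1 - 2 * z) * energy t"
      using energy_inequality[OF t z(1,2)] by (simp add: algebra_simps)
    also have "\<dots> = (1 - z) * (2 * max_energy * z * (1 - z))" unfolding z(3) by (simp add: power2_eq_square algebra_simps)
    finally show ?thesis using z1 by simp
  next
    case True
    have "defect t <= 0 + \<epsilon>" if \<epsilon>: "0 < \<epsilon>" for \<epsilon>
    proof -
      define y where "y = min 1 (\<epsilon> / max_energy)"
      have y: "0 < y" "y <= 1" using \<epsilon> M by (auto simp: y_def)
      have "energy t = max_energy" using z(3) True by simp
      then have "y * defect t <= max_energy * (1 - y)\<^sup>2 + (2 * y - 1) * max_energy"
        using energy_inequality[OF t, of "1 - y"] y by (simp add: algebra_simps)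
      also have "\<dots> = y * (max_energy * y)" by (simp add: power2_eq_square algebra_simps)
      finally have "defect t <= max_energy * y" using y by simp
      also have "\<dots> <= max_energy * (\<epsilon> / max_energy)" using M by (intro mult_left_mono) (auto simp: y_def)
      finally show ?thesis using M by simp
    qed
    then have "defect t <= 0" by (rule field_le_epsilon)
    then show ?thesis using True by simp
  qed
  then show ?thesis unfolding speed_def z_def[symmetric] by (rule real_sqrt_le_mono)
qed

theorem mixing_time:
  assumes E0: "0 < E" and lim: "\<And>\<eta>. 0 < \<eta> ==> \<exists>t\<in>{0..<T}. energy t < \<eta>"
  shows "travel max_energy (energy 0) <= sqrt E / sqrt max_energy * T"
proof (rule travel_time[OF max_energy_pos _ T energy_range _ lim])
  show "0 < sqrt E" using E0 by simp
  fix s t b assume st: "s \<in> {0..<T}" "t \<in> {0..<T}" "s <= t" and b: "\<And>r. r \<in> {s..<t} ==> speed max_energy (energy r) <= b"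
  have "\<bar>energy t - energy s\<bar> <= (t - s) * (2 * sqrt E * b + 2 * E * (t - s))"
  proof (rule energy_rate[OF st])
    fix r assume r: "r \<in> {s..<t}"
    then have "r \<in> {0..<T}" using st by auto
    from order_trans[OF defect_speed[OF this] b[OF r]] show "sqrt (defect r) <= b" .
  qed
  then show "\<bar>energy t - energy s\<bar> <= (t - s) * (2 * sqrt E * b + 2 * (sqrt E)\<^sup>2 * (t - s))" using E by simp
qed

end

lemma Linf_norm_le_AE:
  fixes f :: "'a => 'b::euclidean_space"
  assumes "Linf_norm M f <= ennreal c" "0 <= c"
  shows "AE x in M. norm (f x) <= c"
proof -
  have "AE x in M. ennreal (norm (f x)) <= Linf_norm M f" unfolding Linf_norm_def by (rule esssup_AE)
  then show ?thesis
  proof eventually_elim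
    case (elim x)
    from order_trans[OF elim assms(1)] show ?case using assms(2) by simp
  qed
qed

lemma H_max_square:
  assumes "0 < L" "0 < d"
  shows "(H_max L d)\<^sup>2 = L ^ (d - 1) * (L ^ 3 / 48)" "0 < H_max L d"
proof -
  have "(L powr ((real d + 2) / 2))\<^sup>2 = L powr (real d + 2)"
    using assms by (simp add: power2_eq_square powr_add[symmetric])
  also have "\<dots> = L ^ (d + 2)" using powr_realpow[OF assms(1), of "d + 2"] by (simp add: add.commute)
  also have "\<dots> = L ^ ((d - 1) + 3)" using assms by (simp add: numeral_3_eq_3 numeral_2_eq_2)
  finally have "(L powr ((real d + 2) / 2))\<^sup>2 = L ^ (d - 1) * L ^ 3" by (simp only: power_add)
  then show "(H_max L d)\<^sup>2 = L ^ (d - 1) * (L ^ 3 / 48)" by (simp add: H_max_def power_divide)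
  show "0 < H_max L d" using assms by (simp add: H_max_def)
qed

lemma velocity_component_flux:
  fixes v :: "real => real^'n => real^'n"
  assumes v: "v \<in> LinfL2 T L" and vE: "LinfL2_norm T L v <= ennreal (sqrt E)" and E: "0 <= E"
  shows "flux T L E (\<lambda>t x. v t x $ i)"
  unfolding flux_def
proof
  have vm: "(\<lambda>(t, x). v t x) \<in> borel_measurable (time_torus T L)" and vL: "AE t in lebesgue_on {0<..<T}. v t \<in> L2 (torus L)"
    using v by (auto simp: LinfL2_def)
  from measurable_compose[OF vm coordinate_borel[of i]]
  show "(\<lambda>(t, x). v t x $ i) \<in> borel_measurable (time_torus T L)" by (simp add: split_def)
  have "AE t in lebesgue_on {0<..<T}. ennreal (L2_norm (torus L) (v t)) <= LinfL2_norm T L v"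
    unfolding LinfL2_norm_def by (rule esssup_AE)
  with vL show "AE t in lebesgue_on {0<..<T}. (\<lambda>x. v t x $ i) \<in> L2 (torus L) \<and> (LINT x|torus L. (v t x $ i)\<^sup>2) <= E"
  proof eventually_elim
    case (elim t)
    have c: "(\<lambda>x. v t x $ i) \<in> L2 (torus L)" by (rule L2_vec_component[OF elim(1)])
    have "ennreal (L2_norm (torus L) (v t)) <= ennreal (sqrt E)" using elim(2) vE by (rule order_trans)
    then have "L2_norm (torus L) (v t) <= sqrt E" using E by simp
    then have e: "(LINT x|torus L. (norm (v t x))\<^sup>2) <= E" by (simp add: L2_norm_def)
    have "(LINT x|torus L. (v t x $ i)\<^sup>2) <= (LINT x|torus L. (norm (v t x))\<^sup>2)"
    proof (rule integral_mono)
      show "integrable (torus L) (\<lambda>x. (v t x $ i)\<^sup>2)" using c by (simp add: L2_real_iff)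
      show "integrable (torus L) (\<lambda>x. (norm (v t x))\<^sup>2)" using elim(1) by (simp add: L2_def)
      show "(v t x $ i)\<^sup>2 <= (norm (v t x))\<^sup>2" for x
        using component_le_norm_cart[of "v t x" i] by (simp add: abs_le_square_iff[symmetric])
    qed
    with e c show ?case by auto
  qed
qed

lemma flux_times_density:
  fixes V \<rho> :: "real => real^'n => real"
  assumes V: "flux T L E V" and \<rho>m: "(\<lambda>(t, x). \<rho> t x) \<in> borel_measurable (time_torus T L)"
    and \<rho>t: "\<And>t. t \<in> {0<..<T} ==> \<rho> t \<in> borel_measurable (torus L)" and \<rho>1: "\<And>t. t \<in> {0<..<T} ==> AE x in torus L. \<bar>\<rho> t x\<bar> <= 1"
  shows "flux T L E (\<lambda>t x. \<rho> t x * V t x)"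
  unfolding flux_def
proof
  have Vm: "(\<lambda>(t, x). V t x) \<in> borel_measurable (time_torus T L)" using V by (simp add: flux_def)
  from borel_measurable_times[OF \<rho>m Vm] show "(\<lambda>(t, x). \<rho> t x * V t x) \<in> borel_measurable (time_torus T L)"
    by (simp add: split_def)
  have "AE t in lebesgue_on {0<..<T}. V t \<in> L2 (torus L) \<and> (LINT x|torus L. (V t x)\<^sup>2) <= E" using V by (simp add: flux_def)
  then show "AE t in lebesgue_on {0<..<T}. (\<lambda>x. \<rho> t x * V t x) \<in> L2 (torus L) \<and> (LINT x|torus L. (\<rho> t x * V t x)\<^sup>2) <= E"
    using AE_space
  proof eventually_elim
    case (elim t)
    then have t: "t \<in> {0<..<T}" by simp
    have [measurable]: "\<rho> t \<in> borel_measurable (torus L)" "V t \<in> borel_measurable (torus L)"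
      and Vi: "integrable (torus L) (\<lambda>x. (V t x)\<^sup>2)" using \<rho>t[OF t] elim by (auto simp: L2_real_iff)
    have le: "AE x in torus L. (\<rho> t x * V t x)\<^sup>2 <= (V t x)\<^sup>2"
      using \<rho>1[OF t]
    proof eventually_elim
      case (elim x)
      have "(\<rho> t x)\<^sup>2 <= 1" using elim by (simp add: abs_square_le_1)
      from mult_right_mono[OF this, of "(V t x)\<^sup>2"] show ?case by (simp add: power_mult_distrib)
    qed
    have i: "integrable (torus L) (\<lambda>x. (\<rho> t x * V t x)\<^sup>2)"
      by (rule Bochner_Integration.integrable_bound[OF Vi]) (use le in auto)
    have "(LINT x|torus L. (\<rho> t x * V t x)\<^sup>2) <= (LINT x|torus L. (V t x)\<^sup>2)" by (rule integral_mono_AE[OF i Vi le])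
    with i elim show ?case by (simp add: L2_real_iff)
  qed
qed

theorem theorem1p5:
  fixes L E T :: real
    and \<rho>0 :: "real^'n \<Rightarrow> real"
    and \<rho> :: "real \<Rightarrow> real^'n \<Rightarrow> real"
    and v :: "real \<Rightarrow> real^'n \<Rightarrow> real^'n"
  assumes "CARD('n) \<ge> 2" and "L > 0" and "E > 0"
    and "\<rho>0 \<in> Linf (torus L)"
    and "(LINT x|torus L. \<rho>0 x) = 0"
    and "Linf_norm (torus L) \<rho>0 = 1"
    and "depends_on_one_variable L \<rho>0"
    and "T > 0"
    and "(\<lambda>(t, x). \<rho> t x) \<in> Linf (time_torus T L)"
    and "v \<in> LinfL2 T L"
    and "LinfL2_norm T L v \<le> ennreal (sqrt E)"
    and "Linf_norm (time_torus T L) (\<lambda>(t, x). \<rho> t x) \<le> 1"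
    and "solves_continuity T L \<rho>0 \<rho> v"
    and "solves_div_free T L v"
    and "\<rho> \<in> weakly_continuous_L2 T L"
    and "((\<lambda>t. Hm1_norm L (\<rho> t)) \<longlongrightarrow> 0) (at_left T)"
  shows "let r0 = Hm1_norm L \<rho>0 / H_max L CARD('n)
         in r0 \<in> {0..1} \<and>
            T \<ge> E powr (- 1 / 2) * H_max L CARD('n) * sqrt 2 * S_fun (alpha_fun r0)"
proof -
  note L = \<open>L > 0\<close> and Epos = \<open>E > 0\<close> and T = \<open>T > 0\<close> and mean0 = \<open>(LINT x|torus L. \<rho>0 x) = 0\<close>
    and ce = \<open>solves_continuity T L \<rho>0 \<rho> v\<close> and df = \<open>solves_div_free T L v\<close> and wc = \<open>\<rho> \<in> weakly_continuous_L2 T L\<close>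
  have E0: "0 \<le> E" using Epos by simp
  have \<rho>0m: "\<rho>0 \<in> borel_measurable (torus L)" using \<open>\<rho>0 \<in> Linf (torus L)\<close> by (simp add: Linf_def)
  have \<rho>0b: "AE x in torus L. \<bar>\<rho>0 x\<bar> \<le> 1"
    using Linf_norm_le_AE[of "torus L" \<rho>0 1] \<open>Linf_norm (torus L) \<rho>0 = 1\<close> by simp
  obtain i g where g: "AE x in torus L. \<rho>0 x = g (x $ i)"
    using \<open>depends_on_one_variable L \<rho>0\<close> unfolding depends_on_one_variable_def by blast
  have \<rho>m: "(\<lambda>(t, x). \<rho> t x) \<in> borel_measurable (time_torus T L)"
    using \<open>(\<lambda>(t, x). \<rho> t x) \<in> Linf (time_torus T L)\<close> by (simp add: Linf_def)
  have \<rho>L: "\<rho> t \<in> L2 (torus L)" if "t \<in> {0<..<T}" for t using wc that by (simp add: weakly_continuous_L2_def)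
  have \<rho>tm: "\<rho> t \<in> borel_measurable (torus L)" if "t \<in> {0<..<T}" for t using \<rho>L[OF that] by (simp add: L2_real_iff)
  have "AE p in time_torus T L. norm (case p of (t, x) \<Rightarrow> \<rho> t x) \<le> 1"
    by (rule Linf_norm_le_AE) (use \<open>Linf_norm (time_torus T L) (\<lambda>(t, x). \<rho> t x) \<le> 1\<close> in auto)
  from AE_time_slices[OF this] have "AE t in lebesgue_on {0<..<T}. AE x in torus L. \<bar>\<rho> t x\<bar> \<le> 1" by simp
  from weakly_continuous_bound[OF L wc this] have \<rho>b: "AE x in torus L. \<bar>\<rho> t x\<bar> \<le> 1" if "t \<in> {0<..<T}" for t using that by blast
  define V where "V = (\<lambda>t x. v t x $ i)"
  have fV: "flux T L E V" unfolding V_def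
    by (rule velocity_component_flux[OF \<open>v \<in> LinfL2 T L\<close> \<open>LinfL2_norm T L v \<le> ennreal (sqrt E)\<close> E0])
  have f\<rho>V: "flux T L E (\<lambda>t x. \<rho> t x * V t x)" by (rule flux_times_density[OF fV \<rho>m \<rho>tm \<rho>b])
  have ev: "(LINT x|torus L. \<rho> \<tau> x * q (x $ i)) = (LINT x|torus L. \<rho>0 x * q (x $ i)) +
      (LINT t|lebesgue_on {0<..<T}. indicator {..<\<tau>} t * (LINT x|torus L. \<rho> t x * V t x * q' (x $ i)))"
    if "q \<in> trig L" "q' \<in> trig L" "\<And>s. (q has_real_derivative q' s) (at s)" "\<tau> \<in> {0<..<T}" for q q' \<tau>
    using continuity_one_variable[OF L ce wc \<rho>b f\<rho>V[unfolded V_def] E0 that] unfolding V_def by simp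
  have mean: "(LINT x|torus L. \<rho> t x) = 0" if t: "t \<in> {0<..<T}" for t
    using ev[OF trig_const[of 1] trig_const[of 0] DERIV_const t] mean0 by simp
  \<comment> \<open>the initial datum replaces the slice at time zero\<close>
  define f where "f = (\<lambda>t. if t = 0 then \<rho>0 else \<rho> t)"
  have f0: "f 0 = \<rho>0" and ft: "\<And>t. t \<in> {0<..<T} \<Longrightarrow> f t = \<rho> t" by (auto simp: f_def)
  have cases: "t = 0 \<or> t \<in> {0<..<T}" if "t \<in> {0..<T}" for t using that by auto
  have fm: "f t \<in> borel_measurable (torus L)" if "t \<in> {0..<T}" for t
    using cases[OF that] \<rho>0m \<rho>tm[of t] by (auto simp: f0 ft)
  have fb: "AE x in torus L. \<bar>f t x\<bar> \<le> 1" if "t \<in> {0..<T}" for t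
    using cases[OF that] \<rho>0b \<rho>b[of t] by (auto simp: f0 ft)
  have fmean: "(LINT x|torus L. f t x) = 0" if "t \<in> {0..<T}" for t
    using cases[OF that] mean0 mean[of t] by (auto simp: f0 ft)
  define m where "m = (\<lambda>t. SOME m. is_marginal L i (f t) m)"
  have marg: "is_marginal L i (f t) (m t)" if "t \<in> {0..<T}" for t
    unfolding m_def by (rule someI_ex[OF marginal_exists[OF L fm[OF that] fb[OF that]]])
  have f\<rho>: "(LINT t|lebesgue_on {0<..<T}. indicator A t * (LINT x|torus L. f t x * V t x * q (x $ i)))
     = (LINT t|lebesgue_on {0<..<T}. indicator A t * (LINT x|torus L. \<rho> t x * V t x * q (x $ i)))" for A and q :: "real \<Rightarrow> real"
    by (rule Bochner_Integration.integral_cong) (auto simp: ft)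
  interpret marginal_flow L T E i f V m
  proof
    show "flux T L E (\<lambda>t x. f t x * V t x)"
      unfolding flux_def
    proof
      have "(\<lambda>(t, x). \<rho> t x * V t x) \<in> borel_measurable (time_torus T L)" using f\<rho>V by (simp add: flux_def)
      then show "(\<lambda>(t, x). f t x * V t x) \<in> borel_measurable (time_torus T L)"
        by (rule measurable_cong[THEN iffD1, rotated]) (auto simp: time_torus_def ft)
      have "AE t in lebesgue_on {0<..<T}. (\<lambda>x. \<rho> t x * V t x) \<in> L2 (torus L) \<and> (LINT x|torus L. (\<rho> t x * V t x)\<^sup>2) \<le> E"
        using f\<rho>V by (simp add: flux_def)
      then show "AE t in lebesgue_on {0<..<T}. (\<lambda>x. f t x * V t x) \<in> L2 (torus L) \<and> (LINT x|torus L. (f t x * V t x)\<^sup>2) \<le> E"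
        using AE_space by eventually_elim (simp add: ft)
    qed
    show "AE t in lebesgue_on {0<..<T}. \<forall>g. profile L g \<longrightarrow> (LINT x|torus L. V t x * g (x $ i)) = 0"
      using divergence_free_profile[OF L T df fV[unfolded V_def] E0] by (simp add: V_def)
    fix q q' :: "real \<Rightarrow> real" and \<tau>
    assume q: "q \<in> trig L" "q' \<in> trig L" "\<And>s. (q has_real_derivative q' s) (at s)" and \<tau>: "\<tau> \<in> {0..<T}"
    show "(LINT x|torus L. f \<tau> x * q (x $ i)) = (LINT x|torus L. f 0 x * q (x $ i)) +
      (LINT t|lebesgue_on {0<..<T}. indicator {..<\<tau>} t * (LINT x|torus L. f t x * V t x * q' (x $ i)))"
    proof (cases "\<tau> = 0")
      case True
      have "(LINT t|lebesgue_on {0<..<T}. indicator {..<\<tau>} t * (LINT x|torus L. f t x * V t x * q' (x $ i))) = (LINT t|lebesgue_on {0<..<T}. 0)"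
        by (rule Bochner_Integration.integral_cong) (auto simp: True)
      then show ?thesis using True by simp
    next
      case False
      then have "\<tau> \<in> {0<..<T}" using \<tau> by auto
      from ev[OF q this] show ?thesis unfolding f\<rho> f0 ft[OF \<open>\<tau> \<in> {0<..<T}\<close>] .
    qed
  qed (use L T E0 fm fb fmean marg fV in auto)
  have T0: "0 \<in> {0..<T}" using T by simp
  have start: "(Hm1_norm L \<rho>0)\<^sup>2 = energy 0"
    unfolding energy_def
    by (rule Hm1_norm_one_variable[OF L profile_m[OF T0] one_variable_marginal[OF L \<rho>0m \<rho>0b g marg[OF T0, unfolded f0]] \<rho>0m])
  have "travel max_energy (energy 0) \<le> sqrt E / sqrt max_energy * T"
  proof (rule mixing_time[OF Epos])
    fix \<eta> :: real assume \<eta>: "0 < \<eta>"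
    have "\<forall>\<^sub>F t in at_left T. dist (Hm1_norm L (\<rho> t)) 0 < sqrt \<eta>"
      by (rule tendstoD[OF \<open>((\<lambda>t. Hm1_norm L (\<rho> t)) \<longlongrightarrow> 0) (at_left T)\<close>]) (use \<eta> in simp)
    then obtain b where b: "b < T" "\<And>t. b < t \<Longrightarrow> t < T \<Longrightarrow> \<bar>Hm1_norm L (\<rho> t)\<bar> < sqrt \<eta>"
      unfolding eventually_at_left_field by (auto simp: dist_real_def)
    define t where "t = (max b 0 + T) / 2"
    have t: "b < t" "t < T" "t \<in> {0<..<T}" using b(1) T by (auto simp: t_def max_def)
    have t': "t \<in> {0..<T}" using t by auto
    have "energy t \<le> (Hm1_norm L (\<rho> t))\<^sup>2"
      unfolding energy_def by (rule Hm1_norm_ge_marginal[OF L \<rho>L[OF t(3)] mean[OF t(3)] marg[OF t', unfolded ft[OF t(3)]]])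
    also have "\<dots> < (sqrt \<eta>)\<^sup>2"
      using b(2)[OF t(1,2)] power_strict_mono[of "\<bar>Hm1_norm L (\<rho> t)\<bar>" "sqrt \<eta>" 2] by simp
    finally show "\<exists>t\<in>{0..<T}. energy t < \<eta>" using t' \<eta> by auto
  qed
  moreover define r0 where "r0 = Hm1_norm L \<rho>0 / H_max L CARD('n)"
  define H where "H = H_max L CARD('n)"
  have H: "H\<^sup>2 = max_energy" "0 < H"
    using H_max_square[OF L, of "CARD('n)"] by (simp_all add: H_def max_energy_def)
  have sH: "sqrt max_energy = H" using H by (metis less_imp_le real_sqrt_unique)
  have r0sq: "r0\<^sup>2 = energy 0 / max_energy" unfolding r0_def H_def[symmetric] power_divide start H(1) ..
  have "0 \<le> Hm1_norm L \<rho>0"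
  proof -
    have "\<rho>0 \<in> L2 (torus L)" by (rule torus_L2_bounded[OF L \<rho>0m \<rho>0b])
    from H1_solution_exists[OF L this mean0] obtain \<phi> G where s: "H1_solution L \<rho>0 \<phi> G" by blast
    show ?thesis unfolding Hm1_norm_eq[OF L s] L2_norm_def by simp
  qed
  then have r00: "0 \<le> r0" using H by (simp add: r0_def H_def[symmetric])
  have "r0\<^sup>2 \<le> 1" unfolding r0sq using energy_range[OF T0] max_energy_pos by simp
  then have r01: "r0 \<le> 1" using r00 by (simp add: abs_square_le_1)
  have "travel max_energy (energy 0) = sqrt 2 * S_fun (alpha_fun r0)"
    unfolding travel_def layer_def alpha_fun_def r0sq ..
  ultimately have "sqrt 2 * S_fun (alpha_fun r0) \<le> sqrt E / H * T" unfolding sH by simp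
  then have "sqrt 2 * S_fun (alpha_fun r0) * (H / sqrt E) \<le> sqrt E / H * T * (H / sqrt E)"
    using H Epos by (intro mult_right_mono) auto
  also have "\<dots> = T" using H Epos by simp
  finally have "sqrt 2 * S_fun (alpha_fun r0) * (H / sqrt E) \<le> T" .
  moreover have "E powr (- 1 / 2) = 1 / sqrt E"
    using Epos by (simp add: powr_minus_divide powr_half_sqrt)
  ultimately have "E powr (- 1 / 2) * H * sqrt 2 * S_fun (alpha_fun r0) \<le> T" by (simp add: mult_ac)
  then show ?thesis using r00 r01 unfolding r0_def H_def Let_def by auto
qed

end
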